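(* Let $\alpha>-1/2$ and $\alpha\ge\beta>-1$, and let $p=\frac{4(\alpha+1)}{2\alpha+1}$ or $p=\frac{4(\alpha+1)}{2\alpha+3}$. Then there exists $C>0$ such that $\Vert S_n\chi_E\Vert_{L^{p,\infty}(d\nu)}\le C\Vert\chi_E\Vert_{L^p(d\nu)}$ for every measurable set $E\subseteq[-1,1]$ and every $n\ge0$.
   Context: $d\nu=(1-x)^\alpha(1+x)^\beta dx+\sum_{i=1}^kM_i\delta_{a_i}$ on $[-1,1]$, with $a_1,\dots,a_k\in[-1,1]$ distinct and $M_i>0$. $(P_n)$ are the orthonormal polynomials for $\nu$ (positive leading coefficients), $L_n(x,y)=\sum_{j=0}^nP_j(x)P_j(y)$, $S_nf(x)=\int L_n(x,y)f(y)\,d\nu(y)$. $\chi_E$ is the indicator of $E$. $L^{p,\infty}(d\nu)$ is the weak $L^p$ space with quasinorm $\sup_{t>0}t^{1/p}f^*(t)$, $f^*$ the nonincreasing rearrangement with respect to $\nu$. *)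

theory Defs
  imports "HOL-Analysis.Analysis" "HOL-Computational_Algebra.Polynomial"
begin

definition jacobi_nu ::
  "real \<Rightarrow> real \<Rightarrow> nat \<Rightarrow> (nat \<Rightarrow> real) \<Rightarrow> (nat \<Rightarrow> real) \<Rightarrow> real measure" where
  "jacobi_nu \<alpha> \<beta> k a M = measure_of UNIV (sets borel)
     (\<lambda>A. (\<integral>\<^sup>+ x. ennreal (indicator ({-1..1} \<inter> A) x * (1 - x) powr \<alpha> * (1 + x) powr \<beta>) \<partial>lborel)
          + (\<Sum>i<k. ennreal (M i) * indicator A (a i)))"

definition orthonormal_polys :: "real measure \<Rightarrow> (nat \<Rightarrow> real poly) \<Rightarrow> bool" where
  "orthonormal_polys nu P \<longleftrightarrow>
     (\<forall>n. degree (P n) = n \<and> lead_coeff (P n) > 0) \<and>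
     (\<forall>m n. (\<integral>x. poly (P m) x * poly (P n) x \<partial>nu) = (if m = n then 1 else 0))"

definition kernel_L :: "(nat \<Rightarrow> real poly) \<Rightarrow> nat \<Rightarrow> real \<Rightarrow> real \<Rightarrow> real" where
  "kernel_L P n x y = (\<Sum>j\<le>n. poly (P j) x * poly (P j) y)"

definition partial_sum_op ::
  "real measure \<Rightarrow> (nat \<Rightarrow> real poly) \<Rightarrow> nat \<Rightarrow> (real \<Rightarrow> real) \<Rightarrow> real \<Rightarrow> real" where
  "partial_sum_op nu P n f x = (\<integral>y. kernel_L P n x y * f y \<partial>nu)"

definition rearrangement :: "'a measure \<Rightarrow> ('a \<Rightarrow> real) \<Rightarrow> real \<Rightarrow> ennreal" where
  "rearrangement nu f t =
     Inf {s::ennreal. emeasure nu {x \<in> space nu. s < ennreal \<bar>f x\<bar>} \<le> ennreal t}"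

definition weak_Lp_norm :: "'a measure \<Rightarrow> real \<Rightarrow> ('a \<Rightarrow> real) \<Rightarrow> ennreal" where
  "weak_Lp_norm nu p f = (SUP t\<in>{0<..}. ennreal (t powr (1 / p)) * rearrangement nu f t)"

definition Lp_norm :: "'a measure \<Rightarrow> real \<Rightarrow> ('a \<Rightarrow> real) \<Rightarrow> ennreal" where
  "Lp_norm nu p f = (if (\<integral>\<^sup>+ x. ennreal (\<bar>f x\<bar> powr p) \<partial>nu) = \<infinity> then \<infinity>
      else ennreal ((enn2real (\<integral>\<^sup>+ x. ennreal (\<bar>f x\<bar> powr p) \<partial>nu)) powr (1 / p)))"

end

theory Submission
  imports Defs "HOL-Complex_Analysis.Complex_Analysis"
begin

text \<open>
  Both exponents are \<open>1 / \<theta>\<close> and \<open>1 / (1 - \<theta>)\<close> with \<open>\<theta> = (2\<alpha> + 1) / (4(\<alpha> + 1)) \<le> 1/2\<close>. Since \<open>L\<^sub>n\<close> is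
  symmetric, testing \<open>S\<^sub>n \<chi>\<^sub>E\<close> on its upper and lower level sets reduces both cases to the single bound
  \<open>|\<integral>\<^sub>F \<integral>\<^sub>E L\<^sub>n d\<nu> d\<nu>| \<le> C \<nu>(E)\<^sup>\<theta> \<nu>(F)\<^sup>1\<^sup>-\<^sup>\<theta>\<close>.

  Without masses, a Christoffel--Darboux formula writes the kernel through \<open>p\<^sub>n\<close> and \<open>(1 - x\<^sup>2) p\<^sub>n'\<close>, which are
  bounded by an energy argument for the Jacobi differential equation. Away from the diagonal the kernel is
  dominated by a product of two powers of the distance to the end points. Near the diagonal, on dyadic blocks
  towards the end points, the weight is essentially constant and the kernel is a bounded multiple of the
  Hilbert kernel; there the restricted bound follows from Cauchy's theorem applied to \<open>cosh (\<Phi> / 4) - 1\<close>,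
  \<open>\<Phi>\<close> a Cauchy transform, and the blocks are summed by Hoelder's inequality.

  A mass \<open>M\<close> at \<open>c\<close> replaces \<open>K(x, y)\<close> by \<open>K(x, y) - M K(x, c) K(c, y) / (1 + M K(c, c))\<close>. The masses are added one
  at a time; upper bounds for \<open>K(\<cdot>, c)\<close> and the lower bound for \<open>K(c, c)\<close> control the correction. The finitely many
  small \<open>n\<close> are trivial.
\<close>

section \<open>Restricted bounds for conjugate Poisson integrals\<close>

text \<open>The exponent enters through one identity, \<theta> (\<alpha> + 1) = \<alpha>/2 + 1/4.
  The right side is the rate at which P_n may grow as a power of 1/(1 - x), so the power that
  dominates P_n misses L^(1/\<theta>) by a logarithm and lies only in the weak space. Its integral
  over a set is still controlled by a power of the measure of the set, and a bound for indicators
  asks for no more. The hypothesis \<beta> \<le> \<alpha> makes the other end point no worse: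
  \<beta>/2 + 1/4 \<le> \<theta> (\<beta> + 1).

  No asymptotic formula for Jacobi polynomials enters. The energy compares every point with the
  origin, and the energy at the origin is found from the integral of the energy, which is exactly
  2n(n + \<alpha> + \<beta> + 1).

  The delicate point about a mass at c is that the correction must not lose a power of n. Integrals
  of K(x, c) over sets do grow with n, at one rate for the exponent \<theta> and at another for 1 -
  \<theta>; the two rates add up to exactly what the division by K(c, c) gives back.\<close>

lemma integrable_bounded_mult:
  fixes k :: "'a \<Rightarrow> 'b::{banach,second_countable_topology}"
  assumes "integrable M f" "k \<in> borel_measurable M" "\<And>y. norm (k y) \<le> B"
  shows "integrable M (\<lambda>y. (f y :: real) *\<^sub>R k y)"
proof (rule Bochner_Integration.integrable_bound)
  show "integrable M (\<lambda>y. B * f y)" using assms(1) by simp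
  show "(\<lambda>y. f y *\<^sub>R k y) \<in> borel_measurable M" using assms by measurable
  have "norm (f y *\<^sub>R k y) \<le> norm (B * f y)" for y
    using mult_left_mono[OF order_trans[OF assms(3)[of y] abs_ge_self], of "\<bar>f y\<bar>"]
    by (simp add: abs_mult mult.commute)
  then show "AE y in M. norm (f y *\<^sub>R k y) \<le> norm (B * f y)" by simp
qed

text \<open>The segment is closed by the upper half circle, whose length is of order R, so decay of
  order R^(-2) suffices. Holomorphy slightly below the axis puts the closed contour inside a convex
  open set, where Cauchy's theorem applies.\<close>

lemma integral_upper_half_plane_bound:
  fixes G :: "complex \<Rightarrow> complex"
  assumes eps: "\<epsilon> > 0" and hol: "G holomorphic_on {z. Im z > -\<epsilon>}" and "K \<ge> 0"
    and bnd: "\<And>z. Im z \<ge> 0 \<Longrightarrow> norm z = R \<Longrightarrow> norm (G z) \<le> K / R^2" and R: "R > 0"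
  shows "(\<lambda>x. G (of_real x)) integrable_on {-R..R}"
    and "norm (integral {-R..R} (\<lambda>x. G (of_real x))) \<le> K * pi / R"
proof -
  let ?S = "{z. Im z > -\<epsilon>}"
  let ?c = "part_circlepath 0 R 0 pi"
  let ?l = "linepath (of_real (-R)) (of_real R) :: real \<Rightarrow> complex"
  have cont: "continuous_on ?S G" using hol holomorphic_on_imp_continuous_on by blast
  have convS: "convex ?S" using convex_halfspace_Im_gt by blast
  have openS: "open ?S" by (simp add: open_halfspace_Im_gt)
  have Im_c: "Im z \<ge> 0" if z: "z \<in> path_image ?c" for z
  proof -
    from z obtain x where "x \<in> {0..pi}" "z = of_real R * cis x"
      by (auto simp: path_image_part_circlepath' closed_segment_eq_real_ivl)
    then show ?thesis using R by (auto simp: sin_ge_zero)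
  qed
  have cS: "path_image ?c \<subseteq> ?S" using Im_c eps by fastforce
  have lS: "path_image ?l \<subseteq> ?S"
    using eps convS by (simp add: closed_segment_subset)
  have ends: "pathfinish ?l = pathstart ?c" "pathfinish ?c = pathstart ?l" by simp_all
  have 1: "(G has_contour_integral 0) (?c +++ ?l)"
    by (rule Cauchy_theorem_convex_simple[OF hol convS])
       (use cS lS ends in \<open>auto simp: path_image_join\<close>)
  have ic: "G contour_integrable_on ?c"
    by (rule contour_integrable_holomorphic_simple[OF hol openS _ cS]) simp
  have il: "G contour_integrable_on ?l"
    by (rule contour_integrable_holomorphic_simple[OF hol openS _ lS]) simp
  have "contour_integral ?c G + contour_integral ?l G = 0"
    using 1 contour_integral_join[OF ic il] contour_integral_unique[OF 1] by simp
  then have eq: "contour_integral ?l G = - contour_integral ?c G"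
    by (simp add: add_eq_0_iff)
  have "norm (contour_integral ?c G) \<le> K / R^2 * R * (pi - 0)"
    by (rule has_contour_integral_bound_part_circlepath[OF has_contour_integral_integral[OF ic]])
       (use assms Im_c in_path_image_part_circlepath[of _ 0 R 0 pi] in \<open>auto intro!: bnd\<close>)
  also have "\<dots> = K * pi / R" using R by (simp add: power2_eq_square)
  finally have "norm (contour_integral ?l G) \<le> K * pi / R" unfolding eq by simp
  moreover have "contour_integral ?l G = integral {-R..R} (\<lambda>x. G (of_real x))"
    by (subst contour_integral_linepath_Reals_eq) (use R in auto)
  ultimately show "norm (integral {-R..R} (\<lambda>x. G (of_real x))) \<le> K * pi / R" by simp
  show "(\<lambda>x. G (of_real x)) integrable_on {-R..R}"
    using il contour_integrable_linepath_Reals_iff[of "of_real (-R)" "of_real R" G] R by simp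
qed

section \<open>The Cauchy transform of an integrable density\<close>

definition cauchy_transform :: "(real \<Rightarrow> real) \<Rightarrow> complex \<Rightarrow> complex" where
  "cauchy_transform f z = (\<integral>y. f y *\<^sub>R inverse (z - of_real y) \<partial>lborel)"

text \<open>A regularised Hilbert transform: as \<epsilon> tends to 0 the kernel tends to 1/(x - y).
  It is the real part of \<open>cauchy_transform\<close> at height \<epsilon>.\<close>

definition conj_poisson :: "real \<Rightarrow> (real \<Rightarrow> real) \<Rightarrow> real \<Rightarrow> real" where
  "conj_poisson \<epsilon> f x = (\<integral>y. f y * ((x - y) / ((x - y)^2 + \<epsilon>^2)) \<partial>lborel)"

text \<open>The exact remainder of the first order expansion of the inverse at v. It is quadratic in
  u - v, which is what differentiation under the integral needs.\<close>

lemma second_order_inverse: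
  fixes u v :: "'a::field"
  assumes "u \<noteq> 0" "v \<noteq> 0"
  shows "inverse u - inverse v - (u - v) * (- ((inverse v)^2)) = (u - v)^2 * inverse u * (inverse v)^2"
  using assms by (simp add: field_simps power2_eq_square)

lemma norm_inverse_le_Im: "Im z > 0 \<Longrightarrow> norm (inverse (z - of_real y)) \<le> 1 / Im z"
  using abs_Im_le_cmod[of "z - of_real y"] by (auto simp: norm_inverse norm_divide inverse_eq_divide intro!: frac_le)

lemma cauchy_transform_integrable:
  assumes "integrable lborel f" "Im z > 0"
  shows "integrable lborel (\<lambda>y. f y *\<^sub>R inverse (z - of_real y))"
  by (rule integrable_bounded_mult[OF assms(1) _ norm_inverse_le_Im[OF assms(2)]]) measurable

text \<open>Differentiation under the integral sign with a quantitative remainder: at heights of at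
  least \<open>\<delta>\<close> the error of the linear approximation is at most \<open>B\<close>
  times the square of the increment.\<close>

lemma cauchy_transform_holomorphic:
  assumes f: "integrable lborel f"
  shows "cauchy_transform f holomorphic_on {z. Im z > 0}"
proof -
  have "\<exists>D. (cauchy_transform f has_field_derivative D) (at z)" if z: "Im z > 0" for z
  proof -
    \<comment> \<open>Half the height of z: every point within \<open>\<delta>\<close> of z still
      has height at least \<open>\<delta>\<close>.\<close>
    define \<delta> where "\<delta> = Im z / 2"
    have \<delta>: "\<delta> > 0" "Im z \<ge> \<delta>" using z by (auto simp: \<delta>_def)
    define B where "B = (\<integral>y. \<bar>f y\<bar> \<partial>lborel) / \<delta>^3"
    define D where "D = (\<integral>y. f y *\<^sub>R (- ((inverse (z - of_real y))^2)) \<partial>lborel)"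
    have iD: "integrable lborel (\<lambda>y. f y *\<^sub>R (- ((inverse (z - of_real y))^2)))"
      by (rule integrable_bounded_mult[OF f, where B="(1 / Im z)^2"])
         (use z in \<open>auto simp: norm_power intro!: power_mono norm_inverse_le_Im\<close>)
    have key: "norm (cauchy_transform f w - cauchy_transform f z - (w - z) * D) \<le> B * norm (w - z)^2"
      if w: "Im w \<ge> \<delta>" for w
    proof -
      have w0: "Im w > 0" using w \<delta> by linarith
      have pt: "inverse (w - of_real y) - inverse (z - of_real y) - (w - z) * (- ((inverse (z - of_real y))^2))
        = (w - z)^2 * inverse (w - of_real y) * (inverse (z - of_real y))^2" for y
      proof -
        have "w - of_real y \<noteq> 0" "z - of_real y \<noteq> 0" using w0 z by (auto simp: complex_eq_iff)
        from second_order_inverse[OF this] show ?thesis by simp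
      qed
      have eq: "cauchy_transform f w - cauchy_transform f z - (w - z) * D =
          (\<integral>y. f y *\<^sub>R ((w - z)^2 * inverse (w - of_real y) * (inverse (z - of_real y))^2) \<partial>lborel)"
      proof -
        have "(w - z) * D = (\<integral>y. (w - z) * (f y *\<^sub>R (- ((inverse (z - of_real y))^2))) \<partial>lborel)"
          unfolding D_def using iD by (intro integral_mult_right_zero[symmetric])
        then have "cauchy_transform f w - cauchy_transform f z - (w - z) * D =
          (\<integral>y. (f y *\<^sub>R inverse (w - of_real y) - f y *\<^sub>R inverse (z - of_real y))
             - (w - z) * (f y *\<^sub>R (- ((inverse (z - of_real y))^2))) \<partial>lborel)"
          unfolding cauchy_transform_def
          using cauchy_transform_integrable[OF f w0] cauchy_transform_integrable[OF f z]
            integrable_mult_right[OF iD, of "w - z"]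
          by (simp only: Bochner_Integration.integral_diff Bochner_Integration.integrable_diff)
        also have "\<dots> = (\<integral>y. f y *\<^sub>R ((w - z)^2 * inverse (w - of_real y) * (inverse (z - of_real y))^2) \<partial>lborel)"
          unfolding pt[symmetric] by (intro Bochner_Integration.integral_cong) (auto simp: algebra_simps)
        finally show ?thesis .
      qed
      have bb: "norm ((w - z)^2 * inverse (w - of_real y) * (inverse (z - of_real y))^2) \<le> norm (w-z)^2 / \<delta>^3" for y
      proof -
        have a: "norm (inverse (w - of_real y)) \<le> 1/\<delta>"
          using order_trans[OF norm_inverse_le_Im[OF w0]] w \<delta> by (simp add: frac_le)
        have b: "norm (inverse (z - of_real y)) \<le> 1/\<delta>"
          using order_trans[OF norm_inverse_le_Im[OF z]] \<delta> by (simp add: frac_le)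
        have "norm (inverse (w - of_real y)) * norm (inverse (z - of_real y))^2 \<le> (1/\<delta>) * (1/\<delta>)^2"
          using \<delta> by (intro mult_mono a power_mono b) auto
        also have "\<dots> = 1/\<delta>^3" by (simp add: power3_eq_cube power2_eq_square)
        finally have "norm (w-z)^2 * (norm (inverse (w - of_real y)) * norm (inverse (z - of_real y))^2)
            \<le> norm (w-z)^2 * (1/\<delta>^3)"
          by (rule mult_left_mono) simp
        then show ?thesis by (simp only: norm_mult norm_power mult.assoc) simp
      qed
      have "norm (cauchy_transform f w - cauchy_transform f z - (w - z) * D) \<le>
         (\<integral>y. \<bar>f y\<bar> * (norm (w - z)^2 / \<delta>^3) \<partial>lborel)"
        unfolding eq
      proof (rule Bochner_Integration.integral_norm_bound_integral)
        show "integrable lborel (\<lambda>y. f y *\<^sub>R ((w - z)^2 * inverse (w - of_real y) * (inverse (z - of_real y))^2))"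
          by (rule integrable_bounded_mult[OF f _ bb]) measurable
        show "integrable lborel (\<lambda>y. \<bar>f y\<bar> * (norm (w - z)^2 / \<delta>^3))" using f by simp
        show "norm (f y *\<^sub>R ((w - z)^2 * inverse (w - of_real y) * (inverse (z - of_real y))^2)) \<le>
            \<bar>f y\<bar> * (norm (w - z)^2 / \<delta>^3)" for y
          unfolding norm_scaleR real_norm_def by (rule mult_left_mono[OF bb]) simp
      qed
      then show ?thesis by (simp add: B_def mult_ac)
    qed
    have "B \<ge> 0" using \<delta> by (auto simp: B_def)
    have "(cauchy_transform f has_field_derivative D) (at z)"
      unfolding has_field_derivative_def has_derivative_at
    proof (intro conjI)
      show "bounded_linear ((*) D)" by (rule bounded_linear_mult_right)
      have ev: "eventually (\<lambda>h. norm (cauchy_transform f (z + h) - cauchy_transform f z - D * h) / norm h \<le> B * norm h) (at 0)"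
        unfolding eventually_at
      proof (intro exI[of _ \<delta>] conjI \<delta> ballI impI)
        fix h :: complex assume h: "h \<noteq> 0 \<and> dist h 0 < \<delta>"
        have "Im (z+h) \<ge> \<delta>" using h abs_Im_le_cmod[of h] by (auto simp: \<delta>_def)
        from key[OF this] show "norm (cauchy_transform f (z + h) - cauchy_transform f z - D * h) / norm h \<le> B * norm h"
          using h by (simp add: divide_simps power2_eq_square mult_ac)
      qed
      have li: "((\<lambda>h::complex. B * norm h) \<longlongrightarrow> 0) (at 0)"
        by (auto intro!: tendsto_eq_intros)
      show "(\<lambda>h. norm (cauchy_transform f (z + h) - cauchy_transform f z - D * h) / norm h) \<midarrow>0\<rightarrow> 0"
        by (rule tendsto_sandwich[OF _ ev tendsto_const li]) simp
    qed
    then show ?thesis by blast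
  qed
  then show ?thesis
    unfolding holomorphic_on_def field_differentiable_def
    using has_field_derivative_at_within by blast
qed

section \<open>Poisson integrals and their conjugates\<close>

definition poisson :: "real \<Rightarrow> (real \<Rightarrow> real) \<Rightarrow> real \<Rightarrow> real" where
  "poisson \<epsilon> f x = (\<integral>y. f y * (\<epsilon> / ((x - y)^2 + \<epsilon>^2)) \<partial>lborel)"

lemma cauchy_transform_eq_Complex:
  assumes f: "integrable lborel f" and "\<epsilon> > 0"
  shows "cauchy_transform f (Complex x \<epsilon>) = Complex (conj_poisson \<epsilon> f x) (- poisson \<epsilon> f x)"
proof -
  have i: "integrable lborel (\<lambda>y. f y *\<^sub>R inverse (Complex x \<epsilon> - of_real y))"
    by (rule cauchy_transform_integrable[OF f]) (use assms in simp)
  have "Re (inverse (Complex x \<epsilon> - of_real y)) = (x - y) / ((x - y)^2 + \<epsilon>^2)"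
       "Im (inverse (Complex x \<epsilon> - of_real y)) = - (\<epsilon> / ((x - y)^2 + \<epsilon>^2))" for y
    by (simp_all add: power2_eq_square)
  then show ?thesis
    using integral_Re[OF i] integral_Im[OF i]
    by (simp add: complex_eq_iff cauchy_transform_def conj_poisson_def poisson_def)
qed

lemma has_integral_poisson_kernel:
  assumes "\<epsilon> > 0" "a \<le> b"
  shows "((\<lambda>y. \<epsilon> / ((x - y)^2 + \<epsilon>^2)) has_integral (arctan ((b - x)/\<epsilon>) - arctan ((a - x)/\<epsilon>))) {a..b}"
proof (rule fundamental_theorem_of_calculus)
  fix y
  have "((\<lambda>y. arctan ((y - x)/\<epsilon>)) has_real_derivative (inverse (1 + ((y-x)/\<epsilon>)^2) * (1/\<epsilon>))) (at y within {a..b})"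
    using assms by (auto intro!: derivative_eq_intros)
  moreover have "inverse (1 + ((y-x)/\<epsilon>)^2) * (1/\<epsilon>) = \<epsilon> / ((x - y)^2 + \<epsilon>^2)"
  proof -
    have "1 + ((y-x)/\<epsilon>)^2 = ((x-y)^2 + \<epsilon>^2)/\<epsilon>^2"
      using assms by (simp add: power_divide field_simps power2_commute)
    then show ?thesis using assms by (simp add: power2_eq_square)
  qed
  ultimately show "((\<lambda>y. arctan ((y - x)/\<epsilon>)) has_vector_derivative (\<epsilon> / ((x - y)^2 + \<epsilon>^2))) (at y within {a..b})"
    by (simp add: has_real_derivative_iff_has_vector_derivative)
qed (use assms in simp)

lemma poisson_kernel_nn_integral_le:
  assumes "\<epsilon> > 0"
  shows "(\<integral>\<^sup>+y\<in>{a..b}. ennreal (\<epsilon> / ((x - y)^2 + \<epsilon>^2)) \<partial>lborel) \<le> ennreal pi"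
proof (cases "a \<le> b")
  case True
  have "(\<integral>\<^sup>+y\<in>{a..b}. ennreal (\<epsilon> / ((x - y)^2 + \<epsilon>^2)) \<partial>lborel) = ennreal (arctan ((b - x)/\<epsilon>) - arctan ((a - x)/\<epsilon>))"
    by (rule nn_integral_has_integral_lebesgue'[OF _ has_integral_poisson_kernel])
       (use assms True in auto)
  also have "\<dots> \<le> ennreal pi"
    using arctan_bounded[of "(b-x)/\<epsilon>"] arctan_bounded[of "(a-x)/\<epsilon>"] by (intro ennreal_leI) linarith
  finally show ?thesis .
qed simp

lemma integrable_unit_bounded:
  fixes f :: "real \<Rightarrow> real"
  assumes "f \<in> borel_measurable borel" "\<And>y. \<bar>f y\<bar> \<le> indicator {-1..1} y"
  shows "integrable lborel f"
  by (rule Bochner_Integration.integrable_bound[where f="indicator {-1..1::real} :: real \<Rightarrow> real"])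
     (use assms in auto)

lemma poisson_integrable:
  fixes \<epsilon> x :: real
  assumes f: "integrable lborel f" and "\<epsilon> > 0"
  shows "integrable lborel (\<lambda>y. f y * (\<epsilon> / ((x - y)^2 + \<epsilon>^2)))"
proof -
  have "norm (\<epsilon> / ((x - y)^2 + \<epsilon>^2)) \<le> \<epsilon> / \<epsilon>^2" for y
  proof -
    have "\<epsilon> / ((x - y)^2 + \<epsilon>^2) \<le> \<epsilon> / \<epsilon>^2"
      using assms by (intro divide_left_mono mult_pos_pos add_nonneg_pos) auto
    then show ?thesis using assms by simp
  qed
  from integrable_bounded_mult[OF f _ this] show ?thesis by simp
qed

lemma conj_poisson_integrable:
  fixes \<epsilon> x :: real
  assumes f: "integrable lborel f" and "\<epsilon> > 0"
  shows "integrable lborel (\<lambda>y. f y * ((x - y) / ((x - y)^2 + \<epsilon>^2)))"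
proof -
  have "norm ((x - y) / ((x - y)^2 + \<epsilon>^2)) \<le> 1 / \<epsilon>" for y
  proof -
    have "0 \<le> (\<bar>x - y\<bar> - \<epsilon>)^2" "0 \<le> \<bar>x - y\<bar> * \<epsilon>" using assms by simp_all
    then have "\<bar>x - y\<bar> * \<epsilon> \<le> (x - y)^2 + \<epsilon>^2"
      unfolding power2_diff power2_abs by (simp add: power2_diff)
    moreover have "(x - y)^2 + \<epsilon>^2 > 0" using assms by (simp add: add_nonneg_pos)
    ultimately show ?thesis using assms by (simp add: abs_divide divide_simps)
  qed
  from integrable_bounded_mult[OF f _ this] show ?thesis by simp
qed

section \<open>Exponential integrability of the conjugate Poisson integral\<close>

context
  fixes f :: "real \<Rightarrow> real" and \<epsilon> :: real
  assumes f_meas [measurable]: "f \<in> borel_measurable borel"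
    and f_nonneg: "\<And>y. 0 \<le> f y" and f_le: "\<And>y. f y \<le> indicator {-1..1} y" and eps: "\<epsilon> > 0"
begin

lemma f_integrable: "integrable lborel f"
  by (rule integrable_unit_bounded) (use f_nonneg f_le in auto)

lemma ennreal_poisson:
  "ennreal (poisson \<epsilon> f x) = (\<integral>\<^sup>+y. ennreal (f y * (\<epsilon> / ((x - y)^2 + \<epsilon>^2))) \<partial>lborel)"
  unfolding poisson_def
  by (rule nn_integral_eq_integral[OF poisson_integrable[OF f_integrable eps], symmetric])
     (use f_nonneg eps in auto)

lemma poisson_nonneg: "poisson \<epsilon> f x \<ge> 0"
  unfolding poisson_def using f_nonneg eps by (intro integral_nonneg_AE) auto

text \<open>The value of the constant matters: a quarter of the Poisson integral stays below pi/3,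
  where the cosine is at least 1/2.\<close>

lemma poisson_le_pi: "poisson \<epsilon> f x \<le> pi"
proof -
  have "ennreal (poisson \<epsilon> f x) \<le> (\<integral>\<^sup>+y\<in>{-1..1}. ennreal (\<epsilon> / ((x - y)^2 + \<epsilon>^2)) \<partial>lborel)"
    unfolding ennreal_poisson
  proof (rule nn_integral_mono)
    fix y
    have "f y * (\<epsilon> / ((x - y)^2 + \<epsilon>^2)) \<le> indicator {-1..1} y * (\<epsilon> / ((x - y)^2 + \<epsilon>^2))"
      using f_le eps by (intro mult_right_mono) auto
    then show "ennreal (f y * (\<epsilon> / ((x - y)^2 + \<epsilon>^2))) \<le> ennreal (\<epsilon> / ((x - y)^2 + \<epsilon>^2)) * indicator {-1..1} y"
      by (auto simp: indicator_def intro!: ennreal_leI ennreal_neg split: if_splits)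
  qed
  also have "\<dots> \<le> ennreal pi" by (rule poisson_kernel_nn_integral_le[OF eps])
  finally show ?thesis by simp
qed

lemma poisson_nn_integral_le:
  "(\<integral>\<^sup>+x\<in>{-R..R}. ennreal (poisson \<epsilon> f x) \<partial>lborel) \<le> ennreal (pi * (\<integral>y. f y \<partial>lborel))"
proof -
  have "(\<integral>\<^sup>+x\<in>{-R..R}. ennreal (poisson \<epsilon> f x) \<partial>lborel) =
     (\<integral>\<^sup>+x. \<integral>\<^sup>+y. ennreal (f y * (\<epsilon> / ((x - y)^2 + \<epsilon>^2))) * indicator {-R..R} x \<partial>lborel \<partial>lborel)"
    unfolding ennreal_poisson by (intro nn_integral_cong nn_integral_multc[symmetric]) measurable
  also have "\<dots> = (\<integral>\<^sup>+y. \<integral>\<^sup>+x. ennreal (f y * (\<epsilon> / ((x - y)^2 + \<epsilon>^2))) * indicator {-R..R} x \<partial>lborel \<partial>lborel)"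
    by (rule lborel_pair.Fubini') measurable
  also have "\<dots> = (\<integral>\<^sup>+y. ennreal (f y) * (\<integral>\<^sup>+x\<in>{-R..R}. ennreal (\<epsilon> / ((y - x)^2 + \<epsilon>^2)) \<partial>lborel) \<partial>lborel)"
  proof (intro nn_integral_cong)
    fix y
    have "ennreal (f y * (\<epsilon> / ((x - y)^2 + \<epsilon>^2))) * indicator {-R..R} x =
        ennreal (f y) * (ennreal (\<epsilon> / ((y - x)^2 + \<epsilon>^2)) * indicator {-R..R} x)" for x
      using f_nonneg[of y] eps
      by (subst ennreal_mult) (auto simp: power2_commute[of x y] mult.assoc)
    then show "(\<integral>\<^sup>+x. ennreal (f y * (\<epsilon> / ((x - y)^2 + \<epsilon>^2))) * indicator {-R..R} x \<partial>lborel) =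
        ennreal (f y) * (\<integral>\<^sup>+x\<in>{-R..R}. ennreal (\<epsilon> / ((y - x)^2 + \<epsilon>^2)) \<partial>lborel)"
      by (simp add: nn_integral_cmult)
  qed
  also have "\<dots> \<le> (\<integral>\<^sup>+y. ennreal (f y) * ennreal pi \<partial>lborel)"
    by (intro nn_integral_mono mult_left_mono poisson_kernel_nn_integral_le[OF eps]) auto
  also have "\<dots> = (\<integral>\<^sup>+y. ennreal (f y) \<partial>lborel) * ennreal pi" by (rule nn_integral_multc) measurable
  also have "(\<integral>\<^sup>+y. ennreal (f y) \<partial>lborel) = ennreal (\<integral>y. f y \<partial>lborel)"
    by (rule nn_integral_eq_integral[OF f_integrable]) (use f_nonneg in auto)
  also have "ennreal (\<integral>y. f y \<partial>lborel) * ennreal pi = ennreal (pi * (\<integral>y. f y \<partial>lborel))"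
    using f_nonneg by (subst ennreal_mult[symmetric]) (auto simp: mult.commute)
  finally show ?thesis .
qed

text \<open>The support in [-1, 1] gives the decay that makes the half circle in Cauchy's theorem
  negligible.\<close>

lemma cauchy_transform_norm_le:
  assumes z: "Im z \<ge> 0" "norm z \<ge> 2"
  shows "norm (cauchy_transform f (z + \<i> * of_real \<epsilon>)) \<le> 4 / norm z"
proof -
  have z0: "z \<noteq> 0" using z by auto
  have nz: "norm (z + \<i> * of_real \<epsilon>) \<ge> norm z"
    using z eps by (auto simp: cmod_def intro!: add_mono power_mono)
  have b: "norm (f y *\<^sub>R inverse (z + \<i> * of_real \<epsilon> - of_real y)) \<le> 2 / norm z * indicator {-1..1} y" for y
  proof (cases "y \<in> {-1..1}")
    case True
    have "norm (z + \<i> * of_real \<epsilon> - of_real y) \<ge> norm z - 1"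
      using norm_triangle_ineq2[of "z + \<i> * of_real \<epsilon>" "of_real y"] nz True by auto
    then have "norm (z + \<i> * of_real \<epsilon> - of_real y) \<ge> norm z / 2" using z by linarith
    then have "norm (inverse (z + \<i> * of_real \<epsilon> - of_real y)) \<le> 2 / norm z"
      using frac_le[of 1 1 "norm z / 2" "norm (z + \<i> * of_real \<epsilon> - of_real y)"] z
      by (simp add: inverse_eq_divide norm_divide z0)
    moreover have "\<bar>f y\<bar> \<le> 1" using f_le[of y] f_nonneg[of y] True by simp
    ultimately have "\<bar>f y\<bar> * norm (inverse (z + \<i> * of_real \<epsilon> - of_real y)) \<le> 1 * (2 / norm z)"
      by (intro mult_mono) auto
    then show ?thesis using True by simp
  next
    case False
    then have "f y = 0" using f_le[of y] f_nonneg[of y] by simp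
    then show ?thesis using False by simp
  qed
  have i: "integrable lborel (\<lambda>y. f y *\<^sub>R inverse (z + \<i> * of_real \<epsilon> - of_real y))"
    using z eps by (intro cauchy_transform_integrable f_integrable) auto
  have "norm (cauchy_transform f (z + \<i> * of_real \<epsilon>))
      \<le> (\<integral>y. norm (f y *\<^sub>R inverse (z + \<i> * of_real \<epsilon> - of_real y)) \<partial>lborel)"
    unfolding cauchy_transform_def by (rule integral_norm_bound)
  also have "\<dots> \<le> (\<integral>y. 2 / norm z * indicator {-1..1} (y::real) \<partial>lborel)"
    by (rule integral_mono[OF integrable_norm[OF i] _ b]) simp
  finally have "norm (cauchy_transform f (z + \<i> * of_real \<epsilon>)) \<le> (\<integral>y. 2 / norm z * indicator {-1..1} (y::real) \<partial>lborel)" .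
  then show ?thesis by simp
qed

lemma continuous_conj_poisson: "continuous_on UNIV (conj_poisson \<epsilon> f)"
  and continuous_poisson: "continuous_on UNIV (poisson \<epsilon> f)"
proof -
  have "continuous_on UNIV (\<lambda>x. cauchy_transform f (Complex x \<epsilon>))"
    by (rule continuous_on_compose2[OF holomorphic_on_imp_continuous_on[OF cauchy_transform_holomorphic[OF f_integrable]]])
       (use eps in \<open>auto simp: Complex_eq intro!: continuous_intros\<close>)
  then have c: "continuous_on UNIV (\<lambda>x. Complex (conj_poisson \<epsilon> f x) (- poisson \<epsilon> f x))"
    by (simp add: cauchy_transform_eq_Complex[OF f_integrable eps])
  from continuous_on_Re[OF c] show "continuous_on UNIV (conj_poisson \<epsilon> f)" by simp
  from continuous_on_minus[OF continuous_on_Im[OF c]] show "continuous_on UNIV (poisson \<epsilon> f)" by simp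
qed

text \<open>Let w be a quarter of the Cauchy transform, shifted up by \<epsilon>. The function exp w
  + exp (-w) - 2 is holomorphic and decays quadratically, so its integrals over [-R, R] tend to 0.
  On the axis its real part is 2 cosh (h/4) cos (u/4) - 2, with h the conjugate and u the Poisson
  integral. Since cos (u/4) is at least 1/2, this dominates cosh (h/4) - 1 up to an error u/4, and
  the integral of u is at most pi times that of f.\<close>

lemma cosh_conj_poisson_integral_le:
  "integral {-1..1} (\<lambda>x. cosh (conj_poisson \<epsilon> f x / 4) - 1) \<le> (\<integral>y. f y \<partial>lborel)"
proof -
  let ?h = "conj_poisson \<epsilon> f" and ?u = "poisson \<epsilon> f"
  let ?m = "\<integral>y. f y \<partial>lborel"
  define w where "w z = cauchy_transform f (z + \<i> * of_real \<epsilon>) / 4" for z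
  \<comment> \<open>Adding exp (- w) cancels the term linear in w; exp w - 1 alone would decay only
    like 1/|z|.\<close>
  define G where "G z = exp (w z) + exp (- w z) - 2" for z
  have w_hol: "w holomorphic_on {z. Im z > -\<epsilon>}"
    unfolding w_def
    by (intro holomorphic_intros holomorphic_on_compose_gen[OF _ cauchy_transform_holomorphic[OF f_integrable], unfolded comp_def]) auto
  have G_hol: "G holomorphic_on {z. Im z > -\<epsilon>}"
    unfolding G_def by (intro holomorphic_intros w_hol)
  have Taylor2: "norm (exp v - 1 - v) \<le> exp 1 * norm v ^ 2" if "norm v \<le> 1" for v :: complex
  proof -
    have "norm (exp v - 1 - v) \<le> exp \<bar>Re v\<bar> * norm v ^ 2"
      using Taylor_exp[of v 1] by (simp add: power2_eq_square algebra_simps)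
    also have "\<dots> \<le> exp 1 * norm v ^ 2"
      using abs_Re_le_cmod[of v] that by (intro mult_right_mono) auto
    finally show ?thesis .
  qed
  have G_bound: "norm (G z) \<le> 2 * exp 1 / (norm z)^2" if "Im z \<ge> 0" "norm z \<ge> 2" for z
  proof -
    have nw: "norm (w z) \<le> 1 / norm z"
      using cauchy_transform_norm_le[OF that] by (simp add: w_def norm_divide)
    also have "\<dots> \<le> 1" using that by (simp add: divide_simps)
    finally have nw1: "norm (w z) \<le> 1" .
    have "G z = (exp (w z) - 1 - w z) + (exp (- w z) - 1 - (- w z))" by (simp add: G_def)
    then have "norm (G z) \<le> exp 1 * norm (w z) ^ 2 + exp 1 * norm (- w z) ^ 2"
      using norm_triangle_mono[OF Taylor2[of "w z"] Taylor2[of "- w z"]] nw1 by simp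
    also have "\<dots> = 2 * exp 1 * norm (w z) ^ 2" by simp
    also have "\<dots> \<le> 2 * exp 1 * (1 / norm z) ^ 2"
      by (intro mult_left_mono power_mono nw) auto
    finally show ?thesis by (simp add: power_divide)
  qed
  have ReG: "Re (G (of_real x)) = 2 * cosh (?h x / 4) * cos (?u x / 4) - 2" for x
  proof -
    have "of_real x + \<i> * of_real \<epsilon> = Complex x \<epsilon>" by (simp add: complex_eq_iff)
    then have "w (of_real x) = cauchy_transform f (Complex x \<epsilon>) / 4" by (simp only: w_def)
    then have "w (of_real x) = Complex (?h x / 4) (- ?u x / 4)"
      by (simp add: cauchy_transform_eq_Complex[OF f_integrable eps] complex_eq_iff)
    then show ?thesis by (simp add: G_def Re_exp cosh_def algebra_simps)
  qed
  have pw: "cosh (?h x / 4) - 1 \<le> Re (G (of_real x)) + ?u x / 4" for x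
  proof -
    have u: "0 \<le> ?u x / 4" "?u x / 4 \<le> pi / 3"
      using poisson_nonneg[of x] poisson_le_pi[of x] pi_gt_zero by auto
    have "cos (?u x / 4) \<ge> cos (pi/3)" using u by (intro cos_monotone_0_pi_le) auto
    then have c: "cos (?u x / 4) \<ge> 1/2" by (simp add: cos_60)
    have "1 - cos (?u x / 4) \<le> (?u x / 4)^2 / 2"
      using cos_double_sin[of "?u x / 8"] abs_sin_x_le_abs_x[of "?u x / 8"]
        power_mono[of "\<bar>sin (?u x / 8)\<bar>" "\<bar>?u x / 8\<bar>" 2] by (simp add: power_divide)
    then have "2 * (1 - cos (?u x / 4)) \<le> ?u x * ?u x / 16" by (simp add: power2_eq_square)
    \<comment> \<open>One factor u is traded for the constant 4, since only the integral of u itself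
      is under control.\<close>
    also have "\<dots> \<le> ?u x * 4 / 16"
      using poisson_nonneg[of x] poisson_le_pi[of x] pi_less_4
      by (intro divide_right_mono mult_left_mono) auto
    finally have d: "2 * (1 - cos (?u x / 4)) \<le> ?u x / 4" by simp
    have "(cosh (?h x / 4) - 1) * 1 \<le> (cosh (?h x / 4) - 1) * (2 * cos (?u x / 4))"
      using c cosh_real_ge_1[of "?h x / 4"] by (intro mult_left_mono) auto
    then show ?thesis using d by (simp add: ReG algebra_simps)
  qed
  have cont: "continuous_on S (\<lambda>x. cosh (?h x / 4) - 1)" "continuous_on S ?u" for S
    using continuous_on_subset[OF continuous_conj_poisson] continuous_on_subset[OF continuous_poisson]
    by (auto intro!: continuous_intros)
  have u_int: "integral {-R..R} ?u \<le> pi * ?m" if "R > 0" for R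
  proof -
    have hi: "(?u has_integral integral {-R..R} ?u) {-R..R}"
      by (intro integrable_integral integrable_continuous_interval cont)
    have "ennreal (integral {-R..R} ?u) = (\<integral>\<^sup>+x\<in>{-R..R}. ennreal (?u x) \<partial>lborel)"
      by (rule nn_integral_has_integral_lebesgue'[OF _ hi, symmetric]) (use poisson_nonneg in auto)
    also have "\<dots> \<le> ennreal (pi * ?m)" by (rule poisson_nn_integral_le)
    finally show ?thesis
      using f_nonneg by (subst (asm) ennreal_le_iff) (auto intro!: mult_nonneg_nonneg integral_nonneg_AE)
  qed
  have main: "integral {-1..1} (\<lambda>x. cosh (?h x / 4) - 1) \<le> ?m + 2 * exp 1 * pi / R" if R: "R \<ge> 2" for R
  proof -
    note GR = integral_upper_half_plane_bound[OF eps G_hol, of "2 * exp 1" R]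
    have Gi: "(\<lambda>x. G (of_real x)) integrable_on {-R..R}"
      and Gb: "norm (integral {-R..R} (\<lambda>x. G (of_real x))) \<le> 2 * exp 1 * pi / R"
      using GR G_bound R by auto
    have Rei: "((\<lambda>x. Re (G (of_real x))) has_integral Re (integral {-R..R} (\<lambda>x. G (of_real x)))) {-R..R}"
      using has_integral_linear[OF integrable_integral[OF Gi] bounded_linear_Re] by (simp add: comp_def)
    have ui: "((\<lambda>x. ?u x / 4) has_integral integral {-R..R} ?u / 4) {-R..R}"
      using has_integral_divide[OF integrable_integral[OF integrable_continuous_interval[OF cont(2)]]] .
    have "integral {-1..1} (\<lambda>x. cosh (?h x / 4) - 1) \<le> integral {-R..R} (\<lambda>x. cosh (?h x / 4) - 1)"
      using R by (intro integral_subset_le integrable_continuous_interval cont) (auto simp: cosh_real_ge_1)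
    also have "\<dots> \<le> Re (integral {-R..R} (\<lambda>x. G (of_real x))) + integral {-R..R} ?u / 4"
      by (rule has_integral_le[OF integrable_integral[OF integrable_continuous_interval[OF cont(1)]] has_integral_add[OF Rei ui]])
         (use pw in auto)
    also have "\<dots> \<le> 2 * exp 1 * pi / R + pi * ?m / 4"
      using Gb complex_Re_le_cmod[of "integral {-R..R} (\<lambda>x. G (of_real x))"] u_int[of R] R by linarith
    also have "pi * ?m / 4 \<le> 4 * ?m / 4"
      using pi_less_4 f_nonneg by (intro divide_right_mono mult_right_mono) (auto intro!: integral_nonneg_AE)
    finally show ?thesis by simp
  qed
  have "((\<lambda>R. ?m + 2 * exp 1 * pi / R) \<longlongrightarrow> ?m + 0) at_top"
    by (intro tendsto_intros tendsto_divide_0[OF tendsto_const] filterlim_at_top_imp_at_infinity filterlim_ident)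
  then have lim: "((\<lambda>R. ?m + 2 * exp 1 * pi / R) \<longlongrightarrow> ?m) at_top" by simp
  show ?thesis
    by (rule tendsto_lowerbound[OF lim])
       (auto intro!: eventually_mono[OF eventually_ge_at_top[of 2]] main)
qed

end

text \<open>Two terms of the power series of cosh suffice: the quadratic one for |x| \<le> 1, where
  p \<ge> 2 is used, and one of even order at least p for |x| > 1.\<close>

lemma powr_le_cosh:
  assumes "p \<ge> 2"
  shows "\<exists>C>0. \<forall>x::real. \<bar>x\<bar> powr p \<le> C * (cosh (x / 4) - 1)"
proof -
  obtain m :: nat where m: "p \<le> real (2 * m)" "m \<ge> 1"
  proof
    show "p \<le> real (2 * nat \<lceil>p\<rceil>)" "nat \<lceil>p\<rceil> \<ge> 1" using assms by linarith+
  qed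
  have ge: "y ^ (2*k) / fact (2*k) \<le> cosh y - 1" if "k \<ge> 1" for y :: real and k :: nat
  proof -
    let ?a = "\<lambda>n. if even n then y ^ n /\<^sub>R fact n else 0"
    have "sum ?a {0, 2*k} \<le> suminf ?a"
      by (rule sum_le_suminf) (use sums_summable[OF cosh_converges[of y]] in \<open>auto simp: zero_le_even_power\<close>)
    then show ?thesis using sums_unique[OF cosh_converges[of y]] that by (simp add: divide_inverse mult.commute)
  qed
  define C :: real where "C = 16 * fact 2 + 4 ^ (2*m) * fact (2*m)"
  have "\<bar>x\<bar> powr p \<le> C * (cosh (x / 4) - 1)" for x
  proof -
    have "\<bar>x\<bar> powr p \<le> x ^ (2*1) + x ^ (2*m)"
    proof (cases "\<bar>x\<bar> \<le> 1")
      case True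
      then have "\<bar>x\<bar> powr p \<le> \<bar>x\<bar> powr 2" using assms by (intro powr_mono') auto
      also have "\<dots> = x ^ (2*1)" by (cases "x = 0") (simp_all add: powr_numeral)
      finally show ?thesis by (smt (verit) zero_le_even_power even_mult_iff even_numeral)
    next
      case False
      then have "\<bar>x\<bar> powr p \<le> \<bar>x\<bar> powr real (2*m)" using m by (intro powr_mono) auto
      also have "\<dots> = x ^ (2*m)" using False by (subst powr_realpow) (auto simp: power_even_abs)
      finally show ?thesis by (smt (verit) zero_le_even_power even_mult_iff even_numeral)
    qed
    also have "x ^ (2*1) = 16 * fact 2 * ((x/4) ^ (2*1) / fact (2*1))" by (simp add: power_divide)
    also have "\<dots> \<le> 16 * fact 2 * (cosh (x/4) - 1)" by (intro mult_left_mono ge) auto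
    also have "x ^ (2*m) = 4 ^ (2*m) * fact (2*m) * ((x/4) ^ (2*m) / fact (2*m))" by (simp add: power_divide)
    also have "\<dots> \<le> 4 ^ (2*m) * fact (2*m) * (cosh (x/4) - 1)" by (intro mult_left_mono ge m) auto
    finally show ?thesis by (simp add: C_def algebra_simps)
  qed
  moreover have "C > 0" unfolding C_def by (intro add_pos_pos mult_pos_pos) auto
  ultimately show ?thesis by blast
qed

text \<open>For every t > 0 one has |h| \<le> t + t powr (1 - p) |h| powr p, and the integral of |h|
  powr p over [-1, 1] is at most a multiple of that of f by the exponential bound. Optimising t
  gives the product of powers.\<close>

lemma conj_poisson_integral_le:
  assumes "p \<ge> 2"
  shows "\<exists>C>0. \<forall>f \<epsilon> F. f \<in> borel_measurable borel \<longrightarrow> (\<forall>y. 0 \<le> f y) \<longrightarrow>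
     (\<forall>y. f y \<le> indicator {-1..1} y) \<longrightarrow> \<epsilon> > 0 \<longrightarrow> F \<in> sets borel \<longrightarrow> F \<subseteq> {-1..1} \<longrightarrow>
     (\<integral>x. indicator F x * \<bar>conj_poisson \<epsilon> f x\<bar> \<partial>lborel)
       \<le> C * (\<integral>y. f y \<partial>lborel) powr (1/p) * measure lborel F powr (1 - 1/p)"
proof -
  obtain C where C: "C > 0" "\<And>x::real. \<bar>x\<bar> powr p \<le> C * (cosh (x / 4) - 1)"
    using powr_le_cosh[OF assms] by blast
  have "(\<integral>x. indicator F x * \<bar>conj_poisson \<epsilon> f x\<bar> \<partial>lborel)
       \<le> (1 + C) * (\<integral>y. f y \<partial>lborel) powr (1/p) * measure lborel F powr (1 - 1/p)"
    if f: "f \<in> borel_measurable borel" "\<And>y. 0 \<le> f y" "\<And>y. f y \<le> indicator {-1..1} y"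
      and eps: "\<epsilon> > 0" and F [measurable]: "F \<in> sets borel" and F1: "F \<subseteq> {-1..1}" for f \<epsilon> F
  proof -
    let ?h = "conj_poisson \<epsilon> f" and ?m = "\<integral>y. f y \<partial>lborel" and ?F = "measure lborel F"
    note cont = continuous_conj_poisson[OF f eps]
    have hm [measurable]: "?h \<in> borel_measurable borel"
      using cont by (simp add: borel_measurable_continuous_onI)
    have m0: "?m \<ge> 0" using f by (auto intro!: integral_nonneg_AE)
    have fF: "emeasure lborel F < \<infinity>"
      by (rule emeasure_bounded_finite[OF bounded_subset[OF compact_imp_bounded[OF compact_Icc] F1]])
    have ic: "integrable lborel (\<lambda>x. indicator {-1..1} x * k x)" if "continuous_on UNIV k" for k :: "real \<Rightarrow> real"
      using borel_integrable_atLeastAtMost'[of "-1" 1 k] continuous_on_subset[OF that]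
      by (auto simp: set_integrable_def)
    have iF: "integrable lborel (\<lambda>x. indicator F x * k x)" if "continuous_on UNIV k" for k :: "real \<Rightarrow> real"
    proof (rule Bochner_Integration.integrable_bound[OF ic[OF that]])
      show "(\<lambda>x. indicator F x * k x) \<in> borel_measurable lborel"
        using borel_measurable_continuous_onI[OF that] by measurable
    qed (use F1 in \<open>auto simp: indicator_def intro!: AE_I2\<close>)
    have key: "(\<integral>x. indicator F x * \<bar>?h x\<bar> \<partial>lborel) \<le> t * ?F + C * t powr (1 - p) * ?m" if t: "t > 0" for t
    proof -
      have pt: "\<bar>v\<bar> \<le> t + t powr (1 - p) * (C * (cosh (v / 4) - 1))" for v
      proof (cases "\<bar>v\<bar> \<le> t")
        case True then show ?thesis
          using C(1) cosh_real_ge_1[of "v/4"] by (auto intro!: add_increasing2 mult_nonneg_nonneg)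
      next
        case False
        have "\<bar>v\<bar> = \<bar>v\<bar> powr (1 - p) * \<bar>v\<bar> powr p" using False t by (simp flip: powr_add)
        also have "\<dots> \<le> t powr (1 - p) * (C * (cosh (v / 4) - 1))"
          using False t assms by (intro mult_mono C powr_mono2') auto
        finally show ?thesis using t by linarith
      qed
      have c1: "continuous_on UNIV (\<lambda>x. cosh (?h x / 4) - 1)" by (intro continuous_intros cont) auto
      have "(\<integral>x. indicator F x * \<bar>?h x\<bar> \<partial>lborel) \<le>
         (\<integral>x. t * indicator F x + t powr (1 - p) * C * (indicator {-1..1} x * (cosh (?h x / 4) - 1)) \<partial>lborel)"
      proof (rule integral_mono)
        show "integrable lborel (\<lambda>x. indicator F x * \<bar>?h x\<bar>)"
          by (intro iF continuous_intros cont)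
        show "integrable lborel (\<lambda>x. t * indicator F x + t powr (1 - p) * C * (indicator {-1..1} x * (cosh (?h x / 4) - 1)))"
          using fF by (intro Bochner_Integration.integrable_add integrable_mult_right ic c1) auto
        show "indicator F x * \<bar>?h x\<bar> \<le>
           t * indicator F x + t powr (1 - p) * C * (indicator {-1..1} x * (cosh (?h x / 4) - 1))" for x
        proof (cases "x \<in> F")
          case True then show ?thesis using pt[of "?h x"] F1 by (auto simp: mult.assoc)
        next
          case False then show ?thesis using C(1) cosh_real_ge_1[of "?h x/4"] by (auto intro!: mult_nonneg_nonneg)
        qed
      qed
      also have "\<dots> = t * ?F + t powr (1 - p) * C * (\<integral>x. indicator {-1..1} x * (cosh (?h x / 4) - 1) \<partial>lborel)"
        using fF ic[OF c1] by (subst Bochner_Integration.integral_add) auto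
      also have "(\<integral>x. indicator {-1..1} x * (cosh (?h x / 4) - 1) \<partial>lborel) = integral {-1..1} (\<lambda>x. cosh (?h x / 4) - 1)"
        using set_borel_integral_eq_integral(2)[of "{-1..1}" "\<lambda>x. cosh (?h x / 4) - 1"] ic[OF c1]
        by (simp add: set_integrable_def set_lebesgue_integral_def)
      finally have "(\<integral>x. indicator F x * \<bar>?h x\<bar> \<partial>lborel)
          \<le> t * ?F + t powr (1 - p) * C * integral {-1..1} (\<lambda>x. cosh (?h x / 4) - 1)" .
      also have "t powr (1 - p) * C * integral {-1..1} (\<lambda>x. cosh (?h x / 4) - 1) \<le> t powr (1 - p) * C * ?m"
        using C(1) by (intro mult_left_mono cosh_conj_poisson_integral_le[OF f eps]) auto
      finally show ?thesis by (simp add: mult_ac)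
    qed
    consider "?F = 0" | "?F > 0" "?m = 0" | "?F > 0" "?m > 0" using m0 measure_nonneg[of lborel F] by linarith
    then show ?thesis
    proof cases
      case 1
      then have "emeasure lborel F = 0" using fF by (simp add: emeasure_eq_ennreal_measure)
      then have "AE x in lborel. x \<notin> F" by (intro AE_not_in) auto
      then have "(\<integral>x. indicator F x * \<bar>?h x\<bar> \<partial>lborel) = (\<integral>x. 0 \<partial>(lborel::real measure))"
        by (intro integral_cong_AE) (auto elim!: eventually_mono)
      then show ?thesis using 1 by simp
    next
      case 2
      \<comment> \<open>The second term of \<open>key\<close> vanishes here, so t may be taken
        arbitrarily small.\<close>
      then have "(\<integral>x. indicator F x * \<bar>?h x\<bar> \<partial>lborel) \<le> 0 + e" if "e > 0" for e
        using key[of "e / ?F"] that by simp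
      then have "(\<integral>x. indicator F x * \<bar>?h x\<bar> \<partial>lborel) \<le> 0" by (rule field_le_epsilon)
      then show ?thesis using 2 by simp
    next
      case 3
      \<comment> \<open>The value at which the two terms of \<open>key\<close> are equal up to the
        factor \<open>C\<close>.\<close>
      define t where "t = (?m / ?F) powr (1/p)"
      have t: "t > 0" using 3 by (simp add: t_def)
      have e1: "t * ?F = ?m powr (1/p) * ?F powr (1 - 1/p)"
        using 3 by (simp add: t_def powr_divide powr_diff)
      have "t powr (1 - p) = (?m / ?F) powr (1/p - 1)"
        using assms by (simp add: t_def powr_powr field_simps)
      then have e2: "t powr (1 - p) * ?m = ?m powr (1/p) * ?F powr (1 - 1/p)"
        using 3 by (simp add: powr_divide powr_diff)
      show ?thesis using key[OF t] e1 e2 by (simp add: algebra_simps)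
    qed
  qed
  with C(1) show ?thesis by (intro exI[of _ "1 + C"]) auto
qed

text \<open>Sign changes are allowed by treating positive and negative parts separately. A function
  dominated by the indicator of E, rather than the indicator itself, leaves room for the weight and
  for one factor of the Jacobi kernel.\<close>

lemma restricted_conj_poisson:
  assumes "p \<ge> 2"
  shows "\<exists>C>0. \<forall>f E F \<epsilon>. f \<in> borel_measurable borel \<longrightarrow> E \<in> sets borel \<longrightarrow> F \<in> sets borel \<longrightarrow>
     E \<subseteq> {-1..1} \<longrightarrow> F \<subseteq> {-1..1} \<longrightarrow> (\<forall>y. \<bar>f y\<bar> \<le> indicator E y) \<longrightarrow> \<epsilon> > 0 \<longrightarrow>
     integrable lborel (\<lambda>x. indicator F x * \<bar>conj_poisson \<epsilon> f x\<bar>) \<and> conj_poisson \<epsilon> f \<in> borel_measurable borel \<and>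
     (\<integral>x. indicator F x * \<bar>conj_poisson \<epsilon> f x\<bar> \<partial>lborel)
       \<le> C * measure lborel E powr (1/p) * measure lborel F powr (1 - 1/p)"
proof -
  obtain C where C: "C > 0" and H: "\<And>f \<epsilon> F. f \<in> borel_measurable borel \<Longrightarrow> (\<And>y. 0 \<le> f y) \<Longrightarrow>
     (\<And>y. f y \<le> indicator {-1..1} y) \<Longrightarrow> \<epsilon> > 0 \<Longrightarrow> F \<in> sets borel \<Longrightarrow> F \<subseteq> {-1..1} \<Longrightarrow>
     (\<integral>x. indicator F x * \<bar>conj_poisson \<epsilon> f x\<bar> \<partial>lborel)
       \<le> C * (\<integral>y. f y \<partial>lborel) powr (1/p) * measure lborel F powr (1 - 1/p)"
    using conj_poisson_integral_le[OF assms] by blast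
  have "integrable lborel (\<lambda>x. indicator F x * \<bar>conj_poisson \<epsilon> f x\<bar>) \<and> conj_poisson \<epsilon> f \<in> borel_measurable borel \<and>
     (\<integral>x. indicator F x * \<bar>conj_poisson \<epsilon> f x\<bar> \<partial>lborel)
       \<le> 2 * C * measure lborel E powr (1/p) * measure lborel F powr (1 - 1/p)"
    if fm [measurable]: "f \<in> borel_measurable borel" and E [measurable]: "E \<in> sets borel"
      and F [measurable]: "F \<in> sets borel" and E1: "E \<subseteq> {-1..1}" and F1: "F \<subseteq> {-1..1}"
      and f: "\<And>y. \<bar>f y\<bar> \<le> indicator E y" and eps: "\<epsilon> > 0" for f E F \<epsilon>
  proof -
    have EI: "indicator E y \<le> (indicator {-1..1} y :: real)" for y using E1 by (auto simp: indicator_def)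
    define f1 where "f1 y = max 0 (f y)" for y
    define f2 where "f2 y = max 0 (- f y)" for y
    have f1: "f1 \<in> borel_measurable borel" "\<And>y. 0 \<le> f1 y" "\<And>y. f1 y \<le> indicator E y"
      and f2: "f2 \<in> borel_measurable borel" "\<And>y. 0 \<le> f2 y" "\<And>y. f2 y \<le> indicator E y"
    proof -
      have "f y \<le> indicator E y" "- f y \<le> indicator E y" for y using f[of y] by (simp_all add: abs_le_iff)
      then show "\<And>y. f1 y \<le> indicator E y" "\<And>y. f2 y \<le> indicator E y" by (simp_all add: f1_def f2_def)
      show "f1 \<in> borel_measurable borel" "f2 \<in> borel_measurable borel" unfolding f1_def f2_def by measurable
    qed (simp_all add: f1_def f2_def)
    note f1' = f1(1,2) order_trans[OF f1(3) EI] and f2' = f2(1,2) order_trans[OF f2(3) EI]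
    note i1 = f_integrable[OF f1' eps] and i2 = f_integrable[OF f2' eps]
    have eq: "conj_poisson \<epsilon> f = (\<lambda>x. conj_poisson \<epsilon> f1 x - conj_poisson \<epsilon> f2 x)"
    proof
      fix x
      have "f y = f1 y - f2 y" for y by (auto simp: f1_def f2_def)
      then show "conj_poisson \<epsilon> f x = conj_poisson \<epsilon> f1 x - conj_poisson \<epsilon> f2 x"
        unfolding conj_poisson_def
        using conj_poisson_integrable[OF i1 eps, of x] conj_poisson_integrable[OF i2 eps, of x]
        by (simp add: left_diff_distrib diff_divide_distrib flip: Bochner_Integration.integral_diff)
    qed
    have cont: "continuous_on UNIV (conj_poisson \<epsilon> f1)" "continuous_on UNIV (conj_poisson \<epsilon> f2)"
      by (rule continuous_conj_poisson[OF f1' eps] continuous_conj_poisson[OF f2' eps])+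
    have iF: "integrable lborel (\<lambda>x. indicator F x * \<bar>k x\<bar>)" if k: "continuous_on UNIV k" for k :: "real \<Rightarrow> real"
    proof (rule Bochner_Integration.integrable_bound)
      show "integrable lborel (\<lambda>x. indicator {-1..1} x *\<^sub>R k x)"
        using borel_integrable_atLeastAtMost'[of "-1" 1 k] continuous_on_subset[OF k]
        by (auto simp: set_integrable_def)
      show "(\<lambda>x. indicator F x * \<bar>k x\<bar>) \<in> borel_measurable lborel"
        using borel_measurable_continuous_onI[OF k] by measurable
    qed (use F1 in \<open>auto simp: indicator_def intro!: AE_I2\<close>)
    have mE: "(\<integral>y. g y \<partial>lborel) powr (1/p) \<le> measure lborel E powr (1/p)"
      if "integrable lborel g" "\<And>y. 0 \<le> g y" "\<And>y. g y \<le> indicator E y" for g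
    proof (rule powr_mono2)
      have "emeasure lborel E < \<infinity>"
        by (rule emeasure_bounded_finite[OF bounded_subset[OF compact_imp_bounded[OF compact_Icc] E1]])
      then have "(\<integral>y. g y \<partial>lborel) \<le> (\<integral>y. indicator E y \<partial>lborel)"
        using that by (intro integral_mono) auto
      then show "(\<integral>y. g y \<partial>lborel) \<le> measure lborel E" by simp
    qed (use assms that in \<open>auto intro!: integral_nonneg_AE\<close>)
    have b: "(\<integral>x. indicator F x * \<bar>conj_poisson \<epsilon> g x\<bar> \<partial>lborel)
       \<le> C * measure lborel E powr (1/p) * measure lborel F powr (1 - 1/p)"
      if "g \<in> borel_measurable borel" "\<And>y. 0 \<le> g y" "\<And>y. g y \<le> indicator E y" for g
    proof -
      note g' = that(1,2) order_trans[OF that(3) EI]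
      have "(\<integral>x. indicator F x * \<bar>conj_poisson \<epsilon> g x\<bar> \<partial>lborel)
       \<le> C * (\<integral>y. g y \<partial>lborel) powr (1/p) * measure lborel F powr (1 - 1/p)"
        by (rule H[OF g' eps F F1])
      also have "\<dots> \<le> C * measure lborel E powr (1/p) * measure lborel F powr (1 - 1/p)"
        using C by (intro mult_right_mono mult_left_mono mE f_integrable[OF g' eps] that) auto
      finally show ?thesis .
    qed
    have 1: "integrable lborel (\<lambda>x. indicator F x * \<bar>conj_poisson \<epsilon> f x\<bar>)"
      unfolding eq by (intro iF continuous_intros cont)
    have 2: "conj_poisson \<epsilon> f \<in> borel_measurable borel"
      unfolding eq by (intro borel_measurable_continuous_onI continuous_intros cont)
    have "(\<integral>x. indicator F x * \<bar>conj_poisson \<epsilon> f x\<bar> \<partial>lborel) \<le>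
       (\<integral>x. indicator F x * \<bar>conj_poisson \<epsilon> f1 x\<bar> + indicator F x * \<bar>conj_poisson \<epsilon> f2 x\<bar> \<partial>lborel)"
      using 1 iF cont by (intro integral_mono) (auto simp: eq indicator_def)
    also have "\<dots> = (\<integral>x. indicator F x * \<bar>conj_poisson \<epsilon> f1 x\<bar> \<partial>lborel) + (\<integral>x. indicator F x * \<bar>conj_poisson \<epsilon> f2 x\<bar> \<partial>lborel)"
      by (intro Bochner_Integration.integral_add iF cont)
    also have "\<dots> \<le> 2 * C * measure lborel E powr (1/p) * measure lborel F powr (1 - 1/p)"
      using b[OF f1] b[OF f2] by simp
    finally show ?thesis using 1 2 by blast
  qed
  with C show ?thesis by (intro exI[of _ "2 * C"]) (auto 0 0)
qed

section \<open>Energy estimates for the Jacobi equation\<close>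

lemma powr_comparable:
  fixes a b r :: real
  assumes "a > 0" "b > 0" "r \<ge> 1" "b \<le> r * a" "a \<le> r * b"
  shows "b powr k \<le> r powr \<bar>k\<bar> * a powr k"
proof (cases "k \<ge> 0")
  case True
  then have "b powr k \<le> (r * a) powr k" using assms by (intro powr_mono2) auto
  then show ?thesis using assms True by (simp add: powr_mult)
next
  case False
  then have "b powr k \<le> (a / r) powr k"
    using assms by (intro powr_mono2') (auto simp: field_simps)
  also have "\<dots> = r powr \<bar>k\<bar> * a powr k"
    using assms False by (simp add: powr_divide powr_minus_divide)
  finally show ?thesis .
qed

text \<open>The estimates concern the half [0, 1] next to the singular point 1. Reflection exchanges
  \<open>\<alpha>\<close> and \<open>\<beta>\<close> and so covers the other half.\<close>

locale jacobi_ode =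
  fixes \<alpha> \<beta> \<Lambda> :: real and p p1 p2 :: "real \<Rightarrow> real"
  assumes alpha: "\<alpha> > -1" and beta: "\<beta> > -1" and lam: "\<Lambda> > 0"
    and d0: "\<And>x. (p has_real_derivative p1 x) (at x)"
    and d1: "\<And>x. (p1 has_real_derivative p2 x) (at x)"
    and ode: "\<And>x. (1 - x^2) * p2 x + (\<beta> - \<alpha> - (\<alpha> + \<beta> + 2) * x) * p1 x + \<Lambda> * p x = 0"
begin

definition g where "g x = \<beta> - \<alpha> - (\<alpha> + \<beta> + 1) * x"
definition G where "G = \<bar>\<beta> - \<alpha>\<bar> + \<bar>\<alpha> + \<beta> + 1\<bar>"
text \<open>The energy of the equation: by \<open>En_deriv\<close> its derivative is - 2 g p1^2,
  with no mixed term.\<close>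

definition En where "En x = \<Lambda> * (p x)^2 + (1 - x^2) * (p1 x)^2"
text \<open>Chosen so that W' = W g / (1 - x^2). Where the solution oscillates fast, (1 - x^2) p1^2
  is half of \<open>En\<close> on average, which makes \<open>W * En\<close> nearly
  constant.\<close>

definition W where "W x = (1 - x) powr (\<alpha> + 1/2) * (1 + x) powr (\<beta> + 1/2)"
text \<open>The cross term removes the leading oscillation from the derivative of
  \<open>W * En\<close>; see \<open>E2_deriv\<close>.\<close>

definition E2 where "E2 x = W x * (En x + g x * (p x * p1 x))"

lemma G_ge_0: "G \<ge> 0" by (simp add: G_def)

lemma g_le: "\<bar>x\<bar> \<le> 1 \<Longrightarrow> \<bar>g x\<bar> \<le> G"
proof -
  assume "\<bar>x\<bar> \<le> 1"
  then have "\<bar>(\<alpha> + \<beta> + 1) * x\<bar> \<le> \<bar>\<alpha> + \<beta> + 1\<bar> * 1" unfolding abs_mult by (intro mult_left_mono) auto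
  then show ?thesis using abs_triangle_ineq4[of "\<beta> - \<alpha>" "(\<alpha> + \<beta> + 1) * x"] by (simp add: g_def G_def)
qed

lemma g2_le: "\<bar>x\<bar> \<le> 1 \<Longrightarrow> \<bar>(\<beta> - \<alpha>) * x - (\<alpha> + \<beta> + 1)\<bar> \<le> G"
proof -
  assume "\<bar>x\<bar> \<le> 1"
  then have "\<bar>(\<beta> - \<alpha>) * x\<bar> \<le> \<bar>\<beta> - \<alpha>\<bar> * 1" unfolding abs_mult by (intro mult_left_mono) auto
  then show ?thesis using abs_triangle_ineq4[of "(\<beta> - \<alpha>) * x" "\<alpha> + \<beta> + 1"] by (simp add: G_def)
qed

lemma p2_eq: "(1 - x^2) * p2 x = - (g x - x) * p1 x - \<Lambda> * p x"
  using ode[of x] by (simp add: g_def algebra_simps)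

lemma En_nonneg: "\<bar>x\<bar> \<le> 1 \<Longrightarrow> En x \<ge> 0"
  using lam by (auto simp: En_def abs_square_le_1 intro!: add_nonneg_nonneg)

lemma En_deriv: "(En has_real_derivative (- 2 * g x * (p1 x)^2)) (at x)"
proof -
  have "(En has_real_derivative (\<Lambda> * (2 * p x * p1 x) + ((- 2 * x) * (p1 x)^2 + (1 - x^2) * (2 * p1 x * p2 x)))) (at x)"
    unfolding En_def by (auto intro!: derivative_eq_intros d0 d1)
  moreover have "\<Lambda> * (2 * p x * p1 x) + ((- 2 * x) * (p1 x)^2 + (1 - x^2) * (2 * p1 x * p2 x))
     = 2 * p1 x * (\<Lambda> * p x + (1 - x^2) * p2 x) - 2 * x * (p1 x)^2"
    by (simp add: algebra_simps power2_eq_square)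
  moreover have "\<dots> = - 2 * g x * (p1 x)^2"
    unfolding p2_eq by (simp add: algebra_simps power2_eq_square)
  ultimately show ?thesis by simp
qed

lemma W_deriv:
  assumes "\<bar>x\<bar> < 1"
  shows "(W has_real_derivative (W x * g x / (1 - x^2))) (at x)"
proof -
  have x: "1 - x > 0" "1 + x > 0" using assms by auto
  have "(W has_real_derivative
     (((\<alpha> + 1/2) * (1 - x) powr (\<alpha> + 1/2 - 1) * (- 1)) * (1 + x) powr (\<beta> + 1/2)
      + (1 - x) powr (\<alpha> + 1/2) * ((\<beta> + 1/2) * (1 + x) powr (\<beta> + 1/2 - 1)))) (at x)"
    unfolding W_def using x by (auto intro!: derivative_eq_intros)
  moreover have "((\<alpha> + 1/2) * (1 - x) powr (\<alpha> + 1/2 - 1) * (- 1)) * (1 + x) powr (\<beta> + 1/2)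
      + (1 - x) powr (\<alpha> + 1/2) * ((\<beta> + 1/2) * (1 + x) powr (\<beta> + 1/2 - 1))
      = W x * (- (\<alpha> + 1/2) / (1 - x) + (\<beta> + 1/2) / (1 + x))"
  proof -
    have gen: "(A * (u / s) * (- 1)) * v + u * (B * (v / t)) = u * v * (- A / s + B / t)" for A B u v s t :: real
      by (simp add: divide_inverse algebra_simps)
    have e: "(1 - x) powr (\<alpha> + 1/2 - 1) = (1 - x) powr (\<alpha> + 1/2) / (1 - x)"
      "(1 + x) powr (\<beta> + 1/2 - 1) = (1 + x) powr (\<beta> + 1/2) / (1 + x)"
      using x powr_diff[of "1 - x" "\<alpha> + 1/2" 1] powr_diff[of "1 + x" "\<beta> + 1/2" 1] by simp_all
    show ?thesis unfolding e W_def by (rule gen)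
  qed
  moreover have "- (\<alpha> + 1/2) / (1 - x) + (\<beta> + 1/2) / (1 + x) = g x / (1 - x^2)"
  proof -
    have e: "1 - x^2 = (1 - x) * (1 + x)" by (simp add: power2_eq_square algebra_simps)
    show ?thesis unfolding e g_def using x by (simp add: divide_simps) (simp add: algebra_simps)
  qed
  ultimately show ?thesis by simp
qed

text \<open>All terms in p^2 and p1^2 cancel. The remaining product p p1 is smaller than the energy
  by a factor of order 1 / sqrt (\<Lambda> (1 - x^2)), by \<open>cross_le\<close>.\<close>

lemma E2_deriv:
  assumes "\<bar>x\<bar> < 1"
  shows "(E2 has_real_derivative (W x * (p x * p1 x) * ((\<beta> - \<alpha>) * x - (\<alpha> + \<beta> + 1)) / (1 - x^2))) (at x)"
proof -
  have nz: "1 - x^2 \<noteq> 0" using assms abs_square_less_1[of x] by linarith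
  have gd: "(g has_real_derivative (- (\<alpha> + \<beta> + 1))) (at x)"
    unfolding g_def by (auto intro!: derivative_eq_intros)
  have "(E2 has_real_derivative (W x * g x / (1 - x^2)) * (En x + g x * (p x * p1 x)) +
     W x * (- 2 * g x * (p1 x)^2 + (- (\<alpha> + \<beta> + 1) * (p x * p1 x) + g x * (p1 x * p1 x + p x * p2 x)))) (at x)"
    unfolding E2_def
    by (auto intro!: derivative_eq_intros W_deriv[OF assms] En_deriv gd d0 d1 simp: algebra_simps add_divide_distrib)
  moreover have "(W x * g x / (1 - x^2)) * (En x + g x * (p x * p1 x)) +
     W x * (- 2 * g x * (p1 x)^2 + (- (\<alpha> + \<beta> + 1) * (p x * p1 x) + g x * (p1 x * p1 x + p x * p2 x)))
     = W x * (p x * p1 x) * ((\<beta> - \<alpha>) * x - (\<alpha> + \<beta> + 1)) / (1 - x^2)"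
  proof -
    have gen: "c * ((w * u / c) * y + w * z) = w * (u * y + c * z)" if "c \<noteq> 0" for c w u y z :: real
      using that by (simp add: field_simps)
    have "(1 - x^2) * ((W x * g x / (1 - x^2)) * (En x + g x * (p x * p1 x)) +
     W x * (- 2 * g x * (p1 x)^2 + (- (\<alpha> + \<beta> + 1) * (p x * p1 x) + g x * (p1 x * p1 x + p x * p2 x))))
     = W x * (g x * (En x + g x * (p x * p1 x)) + (1 - x^2) * (- 2 * g x * (p1 x)^2
       + (- (\<alpha> + \<beta> + 1) * (p x * p1 x) + g x * (p1 x * p1 x + p x * p2 x))))"
      by (rule gen[OF nz])
    also have "\<dots> = W x * (p x * p1 x) * (g x * x - (\<alpha> + \<beta> + 1) * (1 - x^2))"
      unfolding En_def using p2_eq[of x] by algebra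
    also have "g x * x - (\<alpha> + \<beta> + 1) * (1 - x^2) = (\<beta> - \<alpha>) * x - (\<alpha> + \<beta> + 1)"
      unfolding g_def by algebra
    finally show ?thesis using nz by (simp add: eq_divide_eq mult.commute)
  qed
  ultimately show ?thesis by simp
qed

lemma cross_le:
  assumes "\<bar>x\<bar> < 1"
  shows "\<bar>p x * p1 x\<bar> \<le> En x / (2 * (sqrt \<Lambda> * sqrt (1 - x^2)))"
proof -
  have pos: "1 - x^2 > 0" using assms abs_square_less_1[of x] by linarith
  have "0 \<le> (sqrt \<Lambda> * \<bar>p x\<bar> - sqrt (1 - x^2) * \<bar>p1 x\<bar>)^2" by simp
  also have "\<dots> = En x - 2 * (sqrt \<Lambda> * sqrt (1 - x^2)) * \<bar>p x * p1 x\<bar>"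
    using pos lam by (simp add: power2_diff power_mult_distrib En_def abs_mult)
  finally show ?thesis using pos lam by (simp add: field_simps)
qed

lemma W_0: "W 0 = 1" by (simp add: W_def)
lemma W_pos: "\<bar>x\<bar> < 1 \<Longrightarrow> W x > 0" by (auto simp: W_def)

text \<open>By the inequality of the means the cross term in \<open>E2\<close> is at most half the
  energy as soon as G \<le> sqrt (\<Lambda> (1 - x^2)). The hypothesis \<open>R\<close> keeps x a
  fixed multiple of 1/\<Lambda> away from 1.\<close>

lemma En_E2:
  assumes x: "0 \<le> x" "x < 1" and R: "\<Lambda> * (1 - x) \<ge> 1 + G^2"
  shows "En x * W x \<le> 2 * E2 x" "E2 x \<le> 3/2 * (En x * W x)"
proof -
  have "1 - x \<le> 1 - x^2" using x mult_left_mono[of x 1 x] by (simp add: power2_eq_square)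
  then have "\<Lambda> * (1 - x) \<le> \<Lambda> * (1 - x^2)" using lam by simp
  then have "G^2 \<le> \<Lambda> * (1 - x^2)" using R by linarith
  then have "G \<le> sqrt \<Lambda> * sqrt (1 - x^2)" using G_ge_0 by (simp add: real_le_rsqrt flip: real_sqrt_mult)
  moreover have pos: "sqrt \<Lambda> * sqrt (1 - x^2) > 0" using x lam by (simp add: abs_square_less_1)
  ultimately have r: "G / (2 * (sqrt \<Lambda> * sqrt (1 - x^2))) \<le> 1/2" by (simp add: field_simps)
  have e: "En x \<ge> 0" using x by (intro En_nonneg) auto
  have "\<bar>g x * (p x * p1 x)\<bar> \<le> G * (En x / (2 * (sqrt \<Lambda> * sqrt (1 - x^2))))"
    unfolding abs_mult[of "g x"] using x G_ge_0 by (intro mult_mono g_le cross_le) auto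
  also have "\<dots> = (G / (2 * (sqrt \<Lambda> * sqrt (1 - x^2)))) * En x" by simp
  also have "\<dots> \<le> 1/2 * En x" using r e by (rule mult_right_mono)
  finally have c: "\<bar>g x * (p x * p1 x)\<bar> \<le> 1/2 * En x" .
  have W: "W x \<ge> 0" using W_pos[of x] x by simp
  have "W x * (En x / 2) \<le> W x * (En x + g x * (p x * p1 x))" by (rule mult_left_mono[OF _ W]) (use c in linarith)
  then show "En x * W x \<le> 2 * E2 x" by (simp add: E2_def mult.commute)
  have "W x * (En x + g x * (p x * p1 x)) \<le> W x * (3/2 * En x)" by (rule mult_left_mono[OF _ W]) (use c in linarith)
  then show "E2 x \<le> 3/2 * (En x * W x)" by (simp add: E2_def mult_ac)
qed

text \<open>An antiderivative of the bound for |E2'| / E2 in \<open>E2_deriv_le\<close>. It stays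
  below 2 while \<Lambda> (1 - x) \<ge> 1 + G^2, so up to there \<open>E2\<close> changes by at most
  a factor exp 2.\<close>

definition H where "H x = 2 * G / (sqrt \<Lambda> * sqrt (1 - x))"

lemma H_deriv: "x < 1 \<Longrightarrow> (H has_real_derivative (G / (sqrt \<Lambda> * ((1 - x) * sqrt (1 - x))))) (at x)"
  unfolding H_def using lam
  by (auto intro!: derivative_eq_intros simp: divide_simps)

lemma E2_deriv_le:
  assumes x: "0 \<le> x" "x < 1" and R: "\<Lambda> * (1 - x) \<ge> 1 + G^2"
  shows "\<bar>W x * (p x * p1 x) * ((\<beta> - \<alpha>) * x - (\<alpha> + \<beta> + 1)) / (1 - x^2)\<bar>
     \<le> (G / (sqrt \<Lambda> * ((1 - x) * sqrt (1 - x)))) * E2 x"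
proof -
  have s: "1 - x \<le> 1 - x^2" using x mult_left_mono[of x 1 x] by (simp add: power2_eq_square)
  have s0: "1 - x > 0" using x by simp
  have W: "W x > 0" using W_pos[of x] x by simp
  have e: "En x \<ge> 0" using x by (intro En_nonneg) auto
  have "\<bar>W x * (p x * p1 x) * ((\<beta> - \<alpha>) * x - (\<alpha> + \<beta> + 1)) / (1 - x^2)\<bar>
     = W x * (\<bar>p x * p1 x\<bar> * \<bar>(\<beta> - \<alpha>) * x - (\<alpha> + \<beta> + 1)\<bar>) / (1 - x^2)"
    using W s s0 by (simp add: abs_mult abs_divide mult.assoc)
  also have "\<dots> \<le> W x * ((En x / (2 * (sqrt \<Lambda> * sqrt (1 - x^2)))) * G) / (1 - x^2)"
    using W s s0 x e lam by (intro divide_right_mono mult_left_mono mult_mono cross_le g2_le) auto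
  also have "\<dots> = G / (sqrt \<Lambda> * ((1 - x^2) * sqrt (1 - x^2))) * (En x * W x / 2)" by (simp add: mult_ac)
  also have "\<dots> \<le> G / (sqrt \<Lambda> * ((1 - x) * sqrt (1 - x))) * (En x * W x / 2)"
    using s s0 G_ge_0 lam e W
    by (intro mult_right_mono divide_left_mono mult_left_mono mult_mono mult_pos_pos) auto
  also have "\<dots> \<le> G / (sqrt \<Lambda> * ((1 - x) * sqrt (1 - x))) * E2 x"
    using En_E2(1)[OF assms] G_ge_0 lam s0 by (intro mult_left_mono) auto
  finally show ?thesis .
qed

lemma H_le: "x < 1 \<Longrightarrow> \<Lambda> * (1 - x) \<ge> 1 + G^2 \<Longrightarrow> H x \<le> 2"
proof -
  assume x: "x < 1" "\<Lambda> * (1 - x) \<ge> 1 + G^2"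
  have "G \<le> sqrt \<Lambda> * sqrt (1 - x)" using x G_ge_0 by (simp add: real_le_rsqrt flip: real_sqrt_mult)
  moreover have "sqrt \<Lambda> * sqrt (1 - x) > 0" using x lam by simp
  ultimately show ?thesis by (simp add: H_def field_simps)
qed

lemma H_nonneg: "x < 1 \<Longrightarrow> H x \<ge> 0" using lam G_ge_0 by (simp add: H_def)

text \<open>Gronwall's argument in both directions: on [0, x] the function
  \<open>E2 * exp (- H)\<close> is nonincreasing and \<open>E2 * exp H\<close>
  nondecreasing.\<close>

lemma E2_compare:
  assumes x: "0 \<le> x" "x < 1" and R: "\<Lambda> * (1 - x) \<ge> 1 + G^2"
  shows "E2 x \<le> exp 2 * E2 0" "E2 0 \<le> exp 2 * E2 x"
proof -
  have Ry: "\<Lambda> * (1 - y) \<ge> 1 + G^2" if "y \<le> x" for y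
  proof -
    have "\<Lambda> * (1 - x) \<le> \<Lambda> * (1 - y)" using that lam by (intro mult_left_mono) auto
    then show ?thesis using R by linarith
  qed
  have pos: "E2 y \<ge> 0" if "0 \<le> y" "y \<le> x" for y
    using En_E2(1)[of y] Ry[of y] that x En_nonneg[of y] W_pos[of y]
    by (smt (verit) mult_nonneg_nonneg)
  have "E2 x * exp (- H x) \<le> E2 0 * exp (- H 0)"
  proof (rule DERIV_nonpos_imp_nonincreasing[OF x(1)])
    fix y assume y: "0 \<le> y" "y \<le> x"
    let ?d = "W y * (p y * p1 y) * ((\<beta> - \<alpha>) * y - (\<alpha> + \<beta> + 1)) / (1 - y^2)"
    let ?h = "G / (sqrt \<Lambda> * ((1 - y) * sqrt (1 - y)))"
    have "((\<lambda>y. E2 y * exp (- H y)) has_real_derivative (?d - ?h * E2 y) * exp (- H y)) (at y)"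
      using y x by (auto intro!: derivative_eq_intros E2_deriv H_deriv simp: algebra_simps)
    moreover have "(?d - ?h * E2 y) * exp (- H y) \<le> 0"
      using abs_le_D1[OF E2_deriv_le[of y]] Ry[of y] y x by (intro mult_nonpos_nonneg) auto
    ultimately show "\<exists>z. ((\<lambda>y. E2 y * exp (- H y)) has_real_derivative z) (at y) \<and> z \<le> 0" by blast
  qed
  then have "E2 x \<le> E2 0 * exp (H x - H 0)"
    by (simp add: exp_minus exp_diff field_simps)
  also have "\<dots> \<le> E2 0 * exp 2"
    using H_le[OF x(2) R] H_nonneg[of 0] pos[of 0] x by (intro mult_left_mono) auto
  finally show "E2 x \<le> exp 2 * E2 0" by (simp add: mult.commute)
  have "E2 0 * exp (H 0) \<le> E2 x * exp (H x)"
  proof (rule DERIV_nonneg_imp_nondecreasing[OF x(1)])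
    fix y assume y: "0 \<le> y" "y \<le> x"
    let ?d = "W y * (p y * p1 y) * ((\<beta> - \<alpha>) * y - (\<alpha> + \<beta> + 1)) / (1 - y^2)"
    let ?h = "G / (sqrt \<Lambda> * ((1 - y) * sqrt (1 - y)))"
    have "((\<lambda>y. E2 y * exp (H y)) has_real_derivative (?d + ?h * E2 y) * exp (H y)) (at y)"
      using y x by (auto intro!: derivative_eq_intros E2_deriv H_deriv simp: algebra_simps)
    moreover have "(?d + ?h * E2 y) * exp (H y) \<ge> 0"
      using abs_le_D2[OF E2_deriv_le[of y]] Ry[of y] y x by (intro mult_nonneg_nonneg) auto
    ultimately show "\<exists>z. ((\<lambda>y. E2 y * exp (H y)) has_real_derivative z) (at y) \<and> 0 \<le> z" by blast
  qed
  then have "E2 0 \<le> E2 x * exp (H x - H 0)"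
    by (simp add: exp_diff field_simps)
  also have "\<dots> \<le> E2 x * exp 2"
    using H_le[OF x(2) R] H_nonneg[of 0] pos[of x] x by (intro mult_left_mono) auto
  finally show "E2 0 \<le> exp 2 * E2 x" by (simp add: mult.commute)
qed

lemma En_compare_interior:
  assumes x: "0 \<le> x" "x < 1" and R: "\<Lambda> * (1 - x) \<ge> 1 + G^2"
  shows "En x * W x \<le> 3 * exp 2 * En 0" "En 0 \<le> 3 * exp 2 * (En x * W x)"
proof -
  have "\<Lambda> * (1 - x) \<le> \<Lambda> * (1 - 0)" using x lam by (intro mult_left_mono) auto
  then have R0: "\<Lambda> * (1 - 0) \<ge> 1 + G^2" using R by linarith
  note e = En_E2[OF x R] and e0 = En_E2[of 0, OF _ _ R0, simplified W_0]
  note c = E2_compare[OF x R]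
  have "En x * W x \<le> 2 * E2 x" by (rule e)
  also have "\<dots> \<le> 2 * (exp 2 * E2 0)" using c by simp
  also have "\<dots> \<le> 2 * (exp 2 * (3/2 * (En 0)))" using e0 by (intro mult_left_mono) auto
  finally show "En x * W x \<le> 3 * exp 2 * En 0" by simp
  have "En 0 \<le> 2 * E2 0" using e0 by simp
  also have "\<dots> \<le> 2 * (exp 2 * E2 x)" using c by simp
  also have "\<dots> \<le> 2 * (exp 2 * (3/2 * (En x * W x)))" using e by (intro mult_left_mono) auto
  finally show "En 0 \<le> 3 * exp 2 * (En x * W x)" by (simp add: mult_ac)
qed

lemma En_ge: "0 \<le> x \<Longrightarrow> x \<le> 1 \<Longrightarrow> (1 - x) * (p1 x)^2 \<le> En x"
  and En_ge': "0 \<le> x \<Longrightarrow> x \<le> 1 \<Longrightarrow> \<Lambda> * (p x)^2 \<le> En x"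
proof -
  assume x: "0 \<le> x" "x \<le> 1"
  have s: "1 - x \<le> 1 - x^2" "0 \<le> 1 - x^2" using x mult_left_mono[of x 1 x] by (auto simp: power2_eq_square abs_square_le_1 mult_le_one)
  have "(1 - x) * (p1 x)^2 \<le> (1 - x^2) * (p1 x)^2" using s by (intro mult_right_mono) auto
  moreover have "0 \<le> \<Lambda> * (p x)^2" using lam by simp
  ultimately show "(1 - x) * (p1 x)^2 \<le> En x" unfolding En_def by linarith
  have "0 \<le> (1 - x^2) * (p1 x)^2" using s by (intro mult_nonneg_nonneg) auto
  then show "\<Lambda> * (p x)^2 \<le> En x" unfolding En_def by linarith
qed

text \<open>A cruder Gronwall argument, from |En'| \<le> 2 G En / (1 - x). It loses a power of the
  ratio of the distances to 1, which is harmless where that ratio is bounded, as in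
  \<open>En_transition\<close>.\<close>

lemma En_compare:
  assumes xy: "0 \<le> x" "x \<le> y" "y < 1"
  shows "En y \<le> ((1 - x) / (1 - y)) powr (2 * G) * En x" "En x \<le> ((1 - x) / (1 - y)) powr (2 * G) * En y"
proof -
  have d: "((\<lambda>z. (1 - z) powr k) has_real_derivative (- k * (1 - z) powr k / (1 - z))) (at z)" if "z < 1" for z k
  proof -
    have "((\<lambda>z. (1 - z) powr k) has_real_derivative (k * (1 - z) powr (k - 1) * (- 1))) (at z)"
      using that by (auto intro!: derivative_eq_intros)
    moreover have "(1 - z) powr (k - 1) = (1 - z) powr k / (1 - z)" using that powr_diff[of "1 - z" k 1] by simp
    ultimately show ?thesis by simp
  qed
  have b: "\<bar>- 2 * g z * (p1 z)^2\<bar> \<le> 2 * G * En z / (1 - z)" if "0 \<le> z" "z < 1" for z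
  proof -
    have "(p1 z)^2 \<le> En z / (1 - z)" using En_ge[of z] that by (simp add: field_simps)
    then have "\<bar>g z\<bar> * (p1 z)^2 \<le> G * (En z / (1 - z))"
      using that G_ge_0 by (intro mult_mono g_le) auto
    then show ?thesis by (simp add: abs_mult)
  qed
  have "En y * (1 - y) powr (2 * G) \<le> En x * (1 - x) powr (2 * G)"
  proof (rule DERIV_nonpos_imp_nonincreasing[OF xy(2)])
    fix z assume z: "x \<le> z" "z \<le> y"
    have "((\<lambda>z. En z * (1 - z) powr (2 * G)) has_real_derivative
       (- 2 * g z * (p1 z)^2) * (1 - z) powr (2*G) + (- (2*G) * (1 - z) powr (2*G) / (1 - z)) * En z) (at z)"
      using xy z by (intro DERIV_mult En_deriv d) auto
    moreover have "(- 2 * g z * (p1 z)^2) * (1 - z) powr (2*G) + (- (2*G) * (1 - z) powr (2*G) / (1 - z)) * En z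
      = (- 2 * g z * (p1 z)^2 - 2 * G * En z / (1 - z)) * (1 - z) powr (2*G)"
      by (simp add: divide_inverse algebra_simps)
    moreover have "\<dots> \<le> 0" using abs_le_D1[OF b[of z]] xy z by (intro mult_nonpos_nonneg) auto
    ultimately show "\<exists>d. ((\<lambda>z. En z * (1 - z) powr (2 * G)) has_real_derivative d) (at z) \<and> d \<le> 0" by auto
  qed
  then show "En y \<le> ((1 - x) / (1 - y)) powr (2 * G) * En x"
    using xy by (simp add: powr_divide field_simps)
  have "En x * (1 - x) powr (- (2 * G)) \<le> En y * (1 - y) powr (- (2 * G))"
  proof (rule DERIV_nonneg_imp_nondecreasing[OF xy(2)])
    fix z assume z: "x \<le> z" "z \<le> y"
    have "((\<lambda>z. En z * (1 - z) powr (- (2 * G))) has_real_derivative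
       (- 2 * g z * (p1 z)^2) * (1 - z) powr (- (2*G)) + (- (- (2*G)) * (1 - z) powr (- (2*G)) / (1 - z)) * En z) (at z)"
      using xy z by (intro DERIV_mult En_deriv d) auto
    moreover have "(- 2 * g z * (p1 z)^2) * (1 - z) powr (- (2*G)) + (- (- (2*G)) * (1 - z) powr (- (2*G)) / (1 - z)) * En z
      = (- 2 * g z * (p1 z)^2 + 2 * G * En z / (1 - z)) * (1 - z) powr (- (2*G))"
      by (simp add: divide_inverse algebra_simps)
    moreover have "\<dots> \<ge> 0" using abs_le_D2[OF b[of z]] xy z by (intro mult_nonneg_nonneg) auto
    ultimately show "\<exists>d. ((\<lambda>z. En z * (1 - z) powr (- (2 * G))) has_real_derivative d) (at z) \<and> 0 \<le> d" by auto
  qed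
  then show "En x \<le> ((1 - x) / (1 - y)) powr (2 * G) * En y"
    using xy by (simp add: powr_divide powr_minus field_simps)
qed

section \<open>The boundary layer at the end point\<close>

lemma p_cont: "continuous_on S p" and p1_cont: "continuous_on S p1"
  using d0 d1 by (meson DERIV_continuous continuous_at_imp_continuous_on)+

text \<open>At a maximum z of |p1| the term with p2 has a favourable sign: at z = 1 its coefficient
  vanishes, and elsewhere the wrong sign would let |p1| increase to the right of z. The coefficient
  of p1 in the equation is at most - (\<alpha> + 1) near 1, so (\<alpha> + 1) |p1| is bounded by
  \<Lambda> |p|.\<close>

lemma endpoint_max_principle:
  assumes x0: "0 \<le> x0" "x0 < 1" "(\<alpha> + \<beta> + 2) * (1 - x0) \<le> \<alpha> + 1"
    and m: "\<And>x. x0 \<le> x \<Longrightarrow> x \<le> 1 \<Longrightarrow> \<bar>p x\<bar> \<le> m" and x: "x0 \<le> x" "x \<le> 1"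
  shows "\<bar>p1 x\<bar> \<le> \<Lambda> * m / (\<alpha> + 1)"
proof -
  have "\<exists>z\<in>{x0..1}. \<forall>y\<in>{x0..1}. \<bar>p1 y\<bar> \<le> \<bar>p1 z\<bar>"
    using x0 by (intro continuous_attains_sup continuous_on_rabs p1_cont) auto
  then obtain z where z: "x0 \<le> z" "z \<le> 1" "\<And>y. x0 \<le> y \<Longrightarrow> y \<le> 1 \<Longrightarrow> \<bar>p1 y\<bar> \<le> \<bar>p1 z\<bar>" by auto
  define \<sigma> :: real where "\<sigma> = (if p1 z \<ge> 0 then 1 else -1)"
  have sz: "\<sigma> * p1 z = \<bar>p1 z\<bar>" "\<bar>\<sigma>\<bar> = 1" by (auto simp: \<sigma>_def)
  have "(1 - z^2) * (\<sigma> * p2 z) \<le> 0"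
  proof (cases "z = 1")
    case False
    have "\<sigma> * p2 z \<le> 0"
    proof (rule ccontr)
      assume "\<not> \<sigma> * p2 z \<le> 0"
      then have pos: "\<sigma> * p2 z > 0" by simp
      have "((\<lambda>x. \<sigma> * p1 x) has_real_derivative \<sigma> * p2 z) (at z)" by (intro DERIV_cmult d1)
      \<comment> \<open>Only increments to the right are examined, so z may be the left end of the
        interval.\<close>
      from DERIV_pos_inc_right[OF this pos] obtain d where d: "d > 0"
        "\<And>h. h > 0 \<Longrightarrow> h < d \<Longrightarrow> \<sigma> * p1 z < \<sigma> * p1 (z + h)" by blast
      define h where "h = min (d/2) (1 - z)"
      have h: "h > 0" "h < d" "z + h \<le> 1" using d(1) z(2) False by (auto simp: h_def)
      have "\<sigma> * p1 (z + h) \<le> \<bar>p1 (z + h)\<bar>" by (auto simp: \<sigma>_def)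
      also have "\<dots> \<le> \<bar>p1 z\<bar>" using z h by (intro z(3)) auto
      finally show False using d(2)[OF h(1,2)] sz by simp
    qed
    moreover have "1 - z^2 \<ge> 0" using z x0 by (simp add: abs_square_le_1)
    ultimately show ?thesis by (simp add: mult_nonneg_nonpos)
  qed simp
  moreover have "(1 - z^2) * (\<sigma> * p2 z) + (\<beta> - \<alpha> - (\<alpha> + \<beta> + 2) * z) * (\<sigma> * p1 z) + \<Lambda> * (\<sigma> * p z) = 0"
    using ode[of z] by algebra
  moreover have "\<Lambda> * (\<sigma> * p z) \<le> \<Lambda> * m"
  proof -
    have "\<sigma> * p z \<le> \<bar>p z\<bar>" by (auto simp: \<sigma>_def)
    also have "\<dots> \<le> m" by (rule m[OF z(1,2)])
    finally show ?thesis using lam by simp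
  qed
  ultimately have "- (\<beta> - \<alpha> - (\<alpha> + \<beta> + 2) * z) * \<bar>p1 z\<bar> \<le> \<Lambda> * m" unfolding sz by linarith
  moreover have "(\<alpha> + 1) * \<bar>p1 z\<bar> \<le> - (\<beta> - \<alpha> - (\<alpha> + \<beta> + 2) * z) * \<bar>p1 z\<bar>"
  proof (rule mult_right_mono)
    have "(\<alpha> + \<beta> + 2) * (1 - z) \<le> (\<alpha> + \<beta> + 2) * (1 - x0)"
      using alpha beta z by (intro mult_left_mono) auto
    then show "\<alpha> + 1 \<le> - (\<beta> - \<alpha> - (\<alpha> + \<beta> + 2) * z)" using x0(3) by (simp add: algebra_simps)
  qed simp
  ultimately have "(\<alpha> + 1) * \<bar>p1 z\<bar> \<le> \<Lambda> * m" by linarith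
  then have "\<bar>p1 z\<bar> \<le> \<Lambda> * m / (\<alpha> + 1)" using alpha by (simp add: field_simps)
  then show ?thesis using z(3)[OF x] by linarith
qed

text \<open>On the last interval, of length \<open>cc\<close>/\<Lambda>, the slope bound \<Lambda> m
  / (\<alpha> + 1) lets p change by at most a quarter of its maximum m.\<close>

definition cc where "cc = min 1 ((\<alpha> + 1) / 4)"
text \<open>Large enough for two things: the point at distance (1 + G^2)/\<Lambda> from 1 is still
  in [0, 1], and \<open>endpoint_max_principle\<close> applies on the interval of length
  \<open>cc\<close>/\<Lambda>.\<close>

definition LL where "LL = 1 + G^2 + (\<alpha> + \<beta> + 2) / (\<alpha> + 1)"

lemma cc: "cc > 0" "cc \<le> 1" "cc \<le> (\<alpha> + 1) / 4" using alpha by (auto simp: cc_def min_def)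

text \<open>The mean value theorem with the slope bound of \<open>endpoint_max_principle\<close>;
  the choice of \<open>cc\<close> leaves three quarters of the maximum.\<close>

lemma endpoint_flat:
  assumes L: "\<Lambda> \<ge> LL"
  obtains m where "m \<ge> 0" "\<And>x. 1 - cc / \<Lambda> \<le> x \<Longrightarrow> x \<le> 1 \<Longrightarrow> \<bar>p x\<bar> \<le> m \<and> 3/4 * m \<le> \<bar>p x\<bar> \<and> \<bar>p1 x\<bar> \<le> \<Lambda> * m / (\<alpha> + 1)"
proof -
  let ?x = "1 - cc / \<Lambda>"
  have L': "(\<alpha> + \<beta> + 2) / (\<alpha> + 1) \<le> \<Lambda>" "1 \<le> \<Lambda>"
    using L alpha beta zero_le_power2[of G] divide_nonneg_pos[of "\<alpha> + \<beta> + 2" "\<alpha> + 1"] unfolding LL_def by linarith+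
  have x0: "0 \<le> ?x" "?x < 1" using cc lam L' by (auto simp: field_simps)
  have "(\<alpha> + \<beta> + 2) * (1 - ?x) \<le> (\<alpha> + \<beta> + 2) * (1 / \<Lambda>)"
    using alpha beta cc lam by (intro mult_left_mono) (auto simp: divide_right_mono)
  also have "\<dots> \<le> \<alpha> + 1" using L'(1) alpha lam by (simp add: field_simps)
  finally have x0': "(\<alpha> + \<beta> + 2) * (1 - ?x) \<le> \<alpha> + 1" .
  have "\<exists>z\<in>{?x..1}. \<forall>y\<in>{?x..1}. \<bar>p y\<bar> \<le> \<bar>p z\<bar>"
    using x0 by (intro continuous_attains_sup continuous_on_rabs p_cont) auto
  then obtain z where z: "?x \<le> z" "z \<le> 1" "\<And>y. ?x \<le> y \<Longrightarrow> y \<le> 1 \<Longrightarrow> \<bar>p y\<bar> \<le> \<bar>p z\<bar>" by auto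
  note mp = endpoint_max_principle[OF x0 x0' z(3)]
  have "3/4 * \<bar>p z\<bar> \<le> \<bar>p x\<bar>" if x: "?x \<le> x" "x \<le> 1" for x
  proof -
    have "norm (p z - p x) \<le> (\<Lambda> * \<bar>p z\<bar> / (\<alpha> + 1)) * norm (z - x)"
    proof (rule field_differentiable_bound[of "{?x..1}" p p1])
      show "(p has_field_derivative p1 y) (at y within {?x..1})" for y
        using d0 has_field_derivative_at_within by blast
    qed (use mp x z in auto)
    also have "\<dots> \<le> (\<Lambda> * \<bar>p z\<bar> / (\<alpha> + 1)) * (cc / \<Lambda>)"
      using x z lam alpha by (intro mult_left_mono) auto
    also have "\<dots> = \<bar>p z\<bar> * (cc / (\<alpha> + 1))" using lam by simp
    also have "\<dots> \<le> \<bar>p z\<bar> * (1/4)" using cc alpha by (intro mult_left_mono) (auto simp: field_simps)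
    finally show ?thesis unfolding real_norm_def by linarith
  qed
  then show ?thesis using that[of "\<bar>p z\<bar>"] z(3) mp by auto
qed

text \<open>Losses accumulate towards 1: \<open>K1\<close> serves the interior, \<open>K2\<close>
  the point at distance (1 + G^2)/\<Lambda>, \<open>K3\<close> everything down to distance
  \<open>cc\<close>/\<Lambda>.\<close>

definition K1 where "K1 = 3 * exp 2 * 2 powr \<bar>\<beta> + 1/2\<bar>"
definition K2 where "K2 = K1 * (1 + G^2) powr \<bar>\<alpha> + 1/2\<bar>"
definition K3 where "K3 = K2 * ((1 + G^2) / cc) powr (2 * G)"

lemma K1: "K1 \<ge> 1"
proof -
  have "1 * 1 * 1 \<le> 3 * exp (2::real) * 2 powr \<bar>\<beta> + 1/2\<bar>"
    by (intro mult_mono) (auto intro: ge_one_powr_ge_zero)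
  then show ?thesis by (simp add: K1_def)
qed

lemma K2: "K2 \<ge> K1"
  using mult_left_mono[OF ge_one_powr_ge_zero[of "1 + G^2" "\<bar>\<alpha> + 1/2\<bar>"], of K1] K1 by (simp add: K2_def)

lemma K3: "K3 \<ge> K2"
proof -
  have "1 \<le> (1 + G^2) / cc" using cc by (simp add: field_simps add_increasing2)
  then show ?thesis using mult_left_mono[OF ge_one_powr_ge_zero[of "(1 + G^2) / cc" "2 * G"], of K2] K1 K2 G_ge_0
    by (simp add: K3_def)
qed

lemma W_bounds:
  assumes "0 \<le> x" "x < 1"
  shows "W x \<le> 2 powr \<bar>\<beta> + 1/2\<bar> * (1 - x) powr (\<alpha> + 1/2)"
    and "(1 - x) powr (\<alpha> + 1/2) \<le> 2 powr \<bar>\<beta> + 1/2\<bar> * W x"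
proof -
  have a: "(1 + x) powr (\<beta> + 1/2) \<le> 2 powr \<bar>\<beta> + 1/2\<bar>"
    using powr_comparable[of 1 "1 + x" 2 "\<beta> + 1/2"] assms by simp
  show "W x \<le> 2 powr \<bar>\<beta> + 1/2\<bar> * (1 - x) powr (\<alpha> + 1/2)"
    unfolding W_def using mult_left_mono[OF a, of "(1 - x) powr (\<alpha> + 1/2)"] by (simp add: mult.commute)
  have b: "1 \<le> 2 powr \<bar>\<beta> + 1/2\<bar> * (1 + x) powr (\<beta> + 1/2)"
    using powr_comparable[of "1 + x" 1 2 "\<beta> + 1/2"] assms by simp
  show "(1 - x) powr (\<alpha> + 1/2) \<le> 2 powr \<bar>\<beta> + 1/2\<bar> * W x"
    unfolding W_def using mult_left_mono[OF b, of "(1 - x) powr (\<alpha> + 1/2)"] by (simp add: mult_ac)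
qed

lemma En_interior:
  assumes x: "0 \<le> x" "x < 1" and R: "\<Lambda> * (1 - x) \<ge> 1 + G^2"
  shows "En x \<le> K1 * En 0 * (1 - x) powr (- (\<alpha> + 1/2))"
    and "En 0 \<le> K1 * En x * (1 - x) powr (\<alpha> + 1/2)"
proof -
  let ?s = "(1 - x) powr (\<alpha> + 1/2)" and ?k = "2 powr \<bar>\<beta> + 1/2\<bar>"
  have s: "?s > 0" using x by simp
  have e: "En x \<ge> 0" "En 0 \<ge> 0" using x by (auto intro!: En_nonneg)
  note c = En_compare_interior[OF x R] and w = W_bounds[OF x]
  have "En x * ?s \<le> En x * (?k * W x)" using e w by (intro mult_left_mono) auto
  also have "\<dots> = ?k * (En x * W x)" by simp
  also have "\<dots> \<le> ?k * (3 * exp 2 * En 0)" by (intro mult_left_mono c) auto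
  finally show "En x \<le> K1 * En 0 * (1 - x) powr (- (\<alpha> + 1/2))"
    unfolding powr_minus[of "1-x"] using s by (simp add: K1_def field_simps)
  have "En 0 \<le> 3 * exp 2 * (En x * W x)" by (rule c)
  also have "\<dots> \<le> 3 * exp 2 * (En x * (?k * ?s))" using e w by (intro mult_left_mono) auto
  finally show "En 0 \<le> K1 * En x * ?s" by (simp add: K1_def mult_ac)
qed

lemma LL: assumes "\<Lambda> \<ge> LL" shows "\<Lambda> \<ge> 1 + G^2" "\<Lambda> \<ge> 1"
  using assms alpha beta zero_le_power2[of G] divide_nonneg_pos[of "\<alpha> + \<beta> + 2" "\<alpha> + 1"] unfolding LL_def by linarith+

text \<open>\<open>En_interior\<close> reaches the point z at distance (1 + G^2)/\<Lambda> from 1.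
  From z to x the distance changes by a bounded factor, so \<open>En_compare\<close> costs only a
  constant.\<close>

lemma En_transition:
  assumes L: "\<Lambda> \<ge> LL" and x: "cc / \<Lambda> \<le> 1 - x" "1 - x \<le> (1 + G^2) / \<Lambda>"
  shows "En x \<le> K3 * En 0 * \<Lambda> powr (\<alpha> + 1/2)"
    and "En 0 \<le> K3 * En x * \<Lambda> powr (- (\<alpha> + 1/2))"
proof -
  define z where "z = 1 - (1 + G^2) / \<Lambda>"
  have z: "0 \<le> z" "z \<le> x" "x < 1"
  proof -
    show "x < 1" using x divide_pos_pos[OF cc(1) lam] by linarith
    show "0 \<le> z" using LL[OF L] lam by (simp add: z_def)
    show "z \<le> x" using x by (simp add: z_def)
  qed
  have "z < 1" using z by linarith
  have e: "En x \<ge> 0" "En 0 \<ge> 0" "En z \<ge> 0" using z by (auto intro!: En_nonneg)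
  have lz: "\<Lambda> * (1 - z) = 1 + G^2" using lam by (simp add: z_def)
  have R: "((1 - z) / (1 - x)) powr (2 * G) \<le> ((1 + G^2) / cc) powr (2 * G)"
  proof (rule powr_mono2)
    have "(1 - z) / (1 - x) \<le> ((1 + G^2) / \<Lambda>) / (cc / \<Lambda>)"
      using x z cc lam by (intro frac_le) (auto simp: z_def)
    also have "\<dots> = (1 + G^2) / cc" using lam by simp
    finally show "(1 - z) / (1 - x) \<le> (1 + G^2) / cc" .
  qed (use z G_ge_0 in auto)
  have c: "En x \<le> ((1 + G^2) / cc) powr (2 * G) * En z" "En z \<le> ((1 + G^2) / cc) powr (2 * G) * En x"
    using En_compare[OF z] mult_right_mono[OF R e(3)] mult_right_mono[OF R e(1)] by linarith+
  have zs: "(1 - z) powr k \<le> (1 + G^2) powr \<bar>k\<bar> * \<Lambda> powr (- k)" for k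
  proof -
    have "(1 - z) powr k \<le> (1 + G^2) powr \<bar>k\<bar> * (1 / \<Lambda>) powr k"
      using lam by (intro powr_comparable) (auto simp: z_def field_simps add_pos_nonneg)
    then show ?thesis using lam by (simp add: powr_divide powr_minus_divide)
  qed
  have i: "En z \<le> K1 * En 0 * (1 - z) powr (- (\<alpha> + 1/2))" "En 0 \<le> K1 * En z * (1 - z) powr (\<alpha> + 1/2)"
    using En_interior[OF z(1) \<open>z < 1\<close>] lz by auto
  have "En z \<le> K1 * En 0 * ((1 + G^2) powr \<bar>\<alpha> + 1/2\<bar> * \<Lambda> powr (\<alpha> + 1/2))"
  proof (rule order_trans[OF i(1) mult_left_mono])
    show "(1 - z) powr (- (\<alpha> + 1/2)) \<le> (1 + G^2) powr \<bar>\<alpha> + 1/2\<bar> * \<Lambda> powr (\<alpha> + 1/2)"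
      using zs[of "- (\<alpha> + 1/2)"] by (simp only: abs_minus_cancel minus_minus)
  qed (use K1 e in auto)
  then have 1: "En z \<le> K2 * En 0 * \<Lambda> powr (\<alpha> + 1/2)" by (simp add: K2_def mult_ac)
  have "En x \<le> ((1 + G^2) / cc) powr (2 * G) * (K2 * En 0 * \<Lambda> powr (\<alpha> + 1/2))"
    by (rule order_trans[OF c(1)]) (intro mult_left_mono 1, simp)
  then show "En x \<le> K3 * En 0 * \<Lambda> powr (\<alpha> + 1/2)" by (simp add: K3_def mult_ac)
  have "En 0 \<le> K1 * En z * ((1 + G^2) powr \<bar>\<alpha> + 1/2\<bar> * \<Lambda> powr (- (\<alpha> + 1/2)))"
    by (rule order_trans[OF i(2) mult_left_mono[OF zs]]) (use K1 e in auto)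
  then have "En 0 \<le> K2 * \<Lambda> powr (- (\<alpha> + 1/2)) * En z" by (simp add: K2_def mult_ac)
  also have "\<dots> \<le> K2 * \<Lambda> powr (- (\<alpha> + 1/2)) * (((1 + G^2) / cc) powr (2 * G) * En x)"
    using K1 K2 by (intro mult_left_mono c) auto
  finally show "En 0 \<le> K3 * En x * \<Lambda> powr (- (\<alpha> + 1/2))" by (simp add: K3_def mult_ac)
qed

text \<open>The price for replacing 1 - x or 1/\<Lambda> by their sum, for the two exponents that
  occur.\<close>

definition KX where "KX = (2 + G^2) powr (\<bar>\<alpha> + 1/2\<bar> + \<bar>\<alpha> + 3/2\<bar>)"
definition K4 where "K4 = 1 / cc + 2 / (\<alpha> + 1)^2 + 1"
definition CC where "CC = 2 * K3 * K4 * KX"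

lemma KX_compare:
  assumes "a > 0" "b > 0" "a \<le> (2 + G^2) * b" "b \<le> (2 + G^2) * a" "k = \<alpha> + 1/2 \<or> k = \<alpha> + 3/2"
  shows "b powr (- k) \<le> KX * a powr (- k)"
proof -
  have "b powr (- k) \<le> (2 + G^2) powr \<bar>- k\<bar> * a powr (- k)"
    using assms by (intro powr_comparable) auto
  also have "\<dots> \<le> KX * a powr (- k)"
    unfolding KX_def using assms(5) by (intro mult_right_mono powr_mono) auto
  finally show ?thesis .
qed

lemma K4: "K4 \<ge> 1" "1 / cc \<le> K4" "2 / (\<alpha> + 1)^2 \<le> K4" "1 + 2 / (\<alpha> + 1)^2 \<le> K4"
proof -
  have "1 / cc \<ge> 0" "2 / (\<alpha> + 1)^2 \<ge> 0" using cc by auto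
  then show "K4 \<ge> 1" "1 / cc \<le> K4" "2 / (\<alpha> + 1)^2 \<le> K4" "1 + 2 / (\<alpha> + 1)^2 \<le> K4" unfolding K4_def by linarith+
qed

lemma KX: "KX \<ge> 1" unfolding KX_def by (rule ge_one_powr_ge_zero) auto

lemma K_prod: "K1 * KX \<le> CC" "K3 * KX \<le> CC" "K3 * K4 * KX \<le> CC" "2 * K3 * KX \<le> CC" "K3 * K4 * 2 \<le> CC"
  "K1 \<le> CC" "CC > 0"
proof -
  have p: "K3 * KX \<ge> 1" using mult_mono[of 1 K3 1 KX] K1 K2 K3 KX by simp
  have "1 * (K3 * KX) \<le> K4 * (K3 * KX)" by (rule mult_right_mono) (use p K4 in auto)
  then have q: "K3 * KX \<le> K3 * K4 * KX" by (simp add: mult_ac)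
  have r: "K1 * KX \<le> K3 * KX" by (rule mult_right_mono) (use KX K2 K3 in auto)
  have "K3 * K4 * 1 \<le> K3 * K4 * KX" by (rule mult_left_mono) (use KX K1 K2 K3 K4 in auto)
  moreover have "K1 * 1 \<le> K1 * KX" by (rule mult_left_mono) (use KX K1 in auto)
  ultimately show "K1 * KX \<le> CC" "K3 * KX \<le> CC" "K3 * K4 * KX \<le> CC" "2 * K3 * KX \<le> CC" "K3 * K4 * 2 \<le> CC"
    "K1 \<le> CC" "CC > 0"
    using p q r unfolding CC_def by linarith+
qed

text \<open>The regularised distance 1 - x + 1/\<Lambda> covers three zones: the interior, the
  transition zone, and the last interval, where p is nearly constant. The third claim bounds p at 1
  from below: on the last interval |p| is comparable with its maximum m, and m controls the energy
  at the left end of that interval.\<close>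

lemma energy_upper:
  assumes L: "\<Lambda> \<ge> LL" and x: "0 \<le> x" "x \<le> 1"
  shows "\<Lambda> * (p x)^2 \<le> CC * En 0 * (1 - x + 1 / \<Lambda>) powr (- (\<alpha> + 1/2))"
    and "(p1 x)^2 \<le> CC * En 0 * (1 - x + 1 / \<Lambda>) powr (- (\<alpha> + 3/2))"
    and "\<Lambda> powr (\<alpha> + 1/2) * En 0 \<le> CC * (\<Lambda> * (p 1)^2)"
proof -
  let ?X = "1 - x + 1 / \<Lambda>"
  have X: "?X > 0" using x lam by (simp add: add_nonneg_pos)
  have e0: "En 0 \<ge> 0" by (rule En_nonneg) simp
  have L1: "\<Lambda> \<ge> 1" "\<Lambda> \<ge> 1 + G^2" using LL[OF L] by auto
  have lp: "\<Lambda> powr (\<alpha> + 3/2) = \<Lambda> * \<Lambda> powr (\<alpha> + 1/2)"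
    using lam powr_add[of \<Lambda> 1 "\<alpha> + 1/2"] by (simp add: add.commute)
  have lX: "\<Lambda> powr k \<le> KX * ?X powr (- k)"
    if "1 - x \<le> (1 + G^2) / \<Lambda>" "k = \<alpha> + 1/2 \<or> k = \<alpha> + 3/2" for k
  proof -
    have "(1 / \<Lambda>) powr (- k) \<le> KX * ?X powr (- k)"
    proof (rule KX_compare[OF X _ _ _ that(2)])
      show "?X \<le> (2 + G^2) * (1 / \<Lambda>)" using that(1) by (simp add: add_divide_distrib)
      have "1 * (1 / \<Lambda>) \<le> (2 + G^2) * ?X" using x lam by (intro mult_mono) auto
      then show "1 / \<Lambda> \<le> (2 + G^2) * ?X" by simp
    qed (use lam in auto)
    then show ?thesis using lam by (simp add: powr_divide powr_minus)
  qed
  obtain m where m: "m \<ge> 0" "\<And>x. 1 - cc / \<Lambda> \<le> x \<Longrightarrow> x \<le> 1 \<Longrightarrow> \<bar>p x\<bar> \<le> m \<and> 3/4 * m \<le> \<bar>p x\<bar> \<and> \<bar>p1 x\<bar> \<le> \<Lambda> * m / (\<alpha> + 1)"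
    using endpoint_flat[OF L] by metis
  define z where "z = 1 - cc / \<Lambda>"
  have z: "0 \<le> z" "z \<le> 1" using cc lam L1 by (auto simp: z_def field_simps)
  have zt: "cc / \<Lambda> \<le> 1 - z" "1 - z \<le> (1 + G^2) / \<Lambda>"
    using cc lam order_trans[OF cc(2), of "1 + G^2"] by (auto simp: z_def intro!: divide_right_mono)
  note tz = En_transition[OF L zt]
  have m2: "m^2 \<le> 2 * (p y)^2" if "1 - cc / \<Lambda> \<le> y" "y \<le> 1" for y
  proof -
    have "(3/4 * m)^2 \<le> \<bar>p y\<bar>^2" using m that by (intro power_mono) auto
    then have "9 * m^2 \<le> 16 * (p y)^2" by (simp add: power_mult_distrib power_divide)
    then show ?thesis using zero_le_power2[of "p y"] by linarith
  qed
  have lm: "\<Lambda> * m^2 \<le> 2 * K3 * En 0 * \<Lambda> powr (\<alpha> + 1/2)"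
  proof -
    have "\<Lambda> * m^2 \<le> \<Lambda> * (2 * (p z)^2)" using m2[of z] z lam by (intro mult_left_mono) (auto simp: z_def)
    also have "\<dots> \<le> 2 * En z" using En_ge'[OF z] by simp
    finally show ?thesis using tz(1) by simp
  qed
  have p1m: "(p1 y)^2 \<le> 2 / (\<alpha> + 1)^2 * K3 * En 0 * \<Lambda> powr (\<alpha> + 3/2)" if "1 - cc / \<Lambda> \<le> y" "y \<le> 1" for y
  proof -
    have "\<bar>p1 y\<bar>^2 \<le> (\<Lambda> * m / (\<alpha> + 1))^2" using m that by (intro power_mono) auto
    also have "\<dots> = \<Lambda> / (\<alpha> + 1)^2 * (\<Lambda> * m^2)" by (simp add: power_divide power_mult_distrib power2_eq_square)
    also have "\<dots> \<le> \<Lambda> / (\<alpha> + 1)^2 * (2 * K3 * En 0 * \<Lambda> powr (\<alpha> + 1/2))"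
      using lam by (intro mult_left_mono lm) auto
    finally show ?thesis by (simp add: lp mult_ac)
  qed
  consider "1 - x \<ge> (1 + G^2) / \<Lambda>" | "cc / \<Lambda> \<le> 1 - x" "1 - x \<le> (1 + G^2) / \<Lambda>" | "1 - x < cc / \<Lambda>" "1 - x \<le> (1 + G^2) / \<Lambda>"
    by linarith
  then have "\<Lambda> * (p x)^2 \<le> CC * (En 0 * ?X powr (- (\<alpha> + 1/2))) \<and> (p1 x)^2 \<le> CC * (En 0 * ?X powr (- (\<alpha> + 3/2)))"
  proof cases
    case 1
    have x1: "x < 1" using 1 lam zero_le_power2[of G] divide_pos_pos[of "1 + G^2" \<Lambda>] by (smt (verit))
    have R: "\<Lambda> * (1 - x) \<ge> 1 + G^2" using 1 lam by (simp add: field_simps)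
    have sX: "(1 - x) powr (- k) \<le> KX * ?X powr (- k)" if "k = \<alpha> + 1/2 \<or> k = \<alpha> + 3/2" for k
    proof (rule KX_compare[OF X _ _ _ that])
      have "1 / \<Lambda> \<le> (1 + G^2) / \<Lambda>" using lam by (intro divide_right_mono) auto
      from order_trans[OF this 1] have "?X \<le> 2 * (1 - x)" using add_left_mono[of "1 / \<Lambda>" "1 - x" "1 - x"] by simp
      also have "\<dots> \<le> (2 + G^2) * (1 - x)" using x by (intro mult_right_mono) auto
      finally show "?X \<le> (2 + G^2) * (1 - x)" .
      have "1 * (1 - x) \<le> (2 + G^2) * ?X" using x lam by (intro mult_mono) auto
      then show "1 - x \<le> (2 + G^2) * ?X" by simp
    qed (use x1 in auto)
    have E: "En x \<le> K1 * En 0 * (1 - x) powr (- (\<alpha> + 1/2))" by (rule En_interior(1)[OF x(1) x1 R])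
    have "\<Lambda> * (p x)^2 \<le> K1 * En 0 * (1 - x) powr (- (\<alpha> + 1/2))" using E En_ge'[OF x] by linarith
    also have "\<dots> \<le> K1 * En 0 * (KX * ?X powr (- (\<alpha> + 1/2)))"
      using K1 e0 by (intro mult_left_mono sX) auto
    also have "\<dots> = (K1 * KX) * (En 0 * ?X powr (- (\<alpha> + 1/2)))" by simp
    also have "\<dots> \<le> CC * (En 0 * ?X powr (- (\<alpha> + 1/2)))"
      using e0 by (intro mult_right_mono K_prod) auto
    finally have A: "\<Lambda> * (p x)^2 \<le> CC * (En 0 * ?X powr (- (\<alpha> + 1/2)))" .
    have "(p1 x)^2 \<le> En x / (1 - x)" using En_ge[OF x] x1 by (simp add: field_simps)
    also have "\<dots> \<le> K1 * En 0 * (1 - x) powr (- (\<alpha> + 1/2)) / (1 - x)" using E x1 by (intro divide_right_mono) auto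
    also have "\<dots> = K1 * En 0 * (1 - x) powr (- (\<alpha> + 3/2))"
      using x1 powr_diff[of "1 - x" "- (\<alpha> + 1/2)" 1] by (simp add: algebra_simps)
    also have "\<dots> \<le> K1 * En 0 * (KX * ?X powr (- (\<alpha> + 3/2)))"
      using K1 e0 by (intro mult_left_mono sX) auto
    also have "\<dots> = (K1 * KX) * (En 0 * ?X powr (- (\<alpha> + 3/2)))" by simp
    also have "\<dots> \<le> CC * (En 0 * ?X powr (- (\<alpha> + 3/2)))"
      using e0 by (intro mult_right_mono K_prod) auto
    finally show ?thesis using A by blast
  next
    case 2
    have x1: "x < 1" using 2 divide_pos_pos[OF cc(1) lam] by linarith
    note E = En_transition(1)[OF L 2]
    have "\<Lambda> * (p x)^2 \<le> K3 * En 0 * \<Lambda> powr (\<alpha> + 1/2)" using E En_ge'[OF x] by linarith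
    also have "\<dots> \<le> K3 * En 0 * (KX * ?X powr (- (\<alpha> + 1/2)))"
      using K1 K2 K3 e0 2 by (intro mult_left_mono lX) auto
    also have "\<dots> = (K3 * KX) * (En 0 * ?X powr (- (\<alpha> + 1/2)))" by simp
    also have "\<dots> \<le> CC * (En 0 * ?X powr (- (\<alpha> + 1/2)))"
      using e0 by (intro mult_right_mono K_prod) auto
    finally have A: "\<Lambda> * (p x)^2 \<le> CC * (En 0 * ?X powr (- (\<alpha> + 1/2)))" .
    have "(p1 x)^2 \<le> En x / (1 - x)" using En_ge[OF x] x1 by (simp add: field_simps)
    also have "\<dots> \<le> En x / (cc / \<Lambda>)"
      using 2 x1 cc lam x En_nonneg[of x] by (intro divide_left_mono) auto
    also have "\<dots> = (\<Lambda> / cc) * En x" by simp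
    also have "\<dots> \<le> (\<Lambda> / cc) * (K3 * En 0 * \<Lambda> powr (\<alpha> + 1/2))"
      using E lam cc by (intro mult_left_mono) auto
    also have "\<dots> = K3 * (1 / cc) * En 0 * \<Lambda> powr (\<alpha> + 3/2)" by (simp add: lp)
    also have "\<dots> \<le> K3 * K4 * En 0 * (KX * ?X powr (- (\<alpha> + 3/2)))"
      using K1 K2 K3 K4 KX e0 2 cc by (intro mult_mono lX mult_nonneg_nonneg) auto
    also have "\<dots> = (K3 * K4 * KX) * (En 0 * ?X powr (- (\<alpha> + 3/2)))" by simp
    also have "\<dots> \<le> CC * (En 0 * ?X powr (- (\<alpha> + 3/2)))"
      using e0 by (intro mult_right_mono K_prod) auto
    finally show ?thesis using A by blast
  next
    case 3
    have xz: "1 - cc / \<Lambda> \<le> x" using 3 by linarith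
    have "\<bar>p x\<bar>^2 \<le> m^2" using m(2)[OF xz x(2)] by (intro power_mono) auto
    then have "\<Lambda> * (p x)^2 \<le> \<Lambda> * m^2" using lam by simp
    also have "\<dots> \<le> 2 * K3 * En 0 * \<Lambda> powr (\<alpha> + 1/2)" by (rule lm)
    also have "\<dots> \<le> 2 * K3 * En 0 * (KX * ?X powr (- (\<alpha> + 1/2)))"
      using K1 K2 K3 e0 3 by (intro mult_left_mono lX) auto
    also have "\<dots> = (2 * K3 * KX) * (En 0 * ?X powr (- (\<alpha> + 1/2)))" by simp
    also have "\<dots> \<le> CC * (En 0 * ?X powr (- (\<alpha> + 1/2)))"
      using e0 by (intro mult_right_mono K_prod) auto
    finally have A: "\<Lambda> * (p x)^2 \<le> CC * (En 0 * ?X powr (- (\<alpha> + 1/2)))" .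
    have "(p1 x)^2 \<le> 2 / (\<alpha> + 1)^2 * K3 * En 0 * \<Lambda> powr (\<alpha> + 3/2)" by (rule p1m[OF xz x(2)])
    also have "\<dots> \<le> K4 * K3 * En 0 * (KX * ?X powr (- (\<alpha> + 3/2)))"
      using K1 K2 K3 K4 KX e0 3 by (intro mult_mono lX mult_nonneg_nonneg) auto
    also have "\<dots> = (K3 * K4 * KX) * (En 0 * ?X powr (- (\<alpha> + 3/2)))" by simp
    also have "\<dots> \<le> CC * (En 0 * ?X powr (- (\<alpha> + 3/2)))"
      using e0 by (intro mult_right_mono K_prod) auto
    finally show ?thesis using A by blast
  qed
  then show "\<Lambda> * (p x)^2 \<le> CC * En 0 * ?X powr (- (\<alpha> + 1/2))"
    "(p1 x)^2 \<le> CC * En 0 * ?X powr (- (\<alpha> + 3/2))" by (simp_all add: mult.assoc)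
  \<comment> \<open>The converse of \<open>lm\<close>: at the left end of the last interval m bounds
    p and, up to \<Lambda> / (\<alpha> + 1), also p1, hence the energy.\<close>
  have "En z \<le> K4 * (\<Lambda> * m^2)"
  proof -
    have mz: "\<bar>p z\<bar> \<le> m" "\<bar>p1 z\<bar> \<le> \<Lambda> * m / (\<alpha> + 1)" using m(2)[of z] z by (auto simp: z_def)
    have a: "\<Lambda> * (p z)^2 \<le> \<Lambda> * m^2" using mz(1) lam abs_le_square_iff[of "p z" m] m(1) by simp
    have b: "(p1 z)^2 \<le> (\<Lambda> * m / (\<alpha> + 1))^2" using power_mono[OF mz(2), of 2] by simp
    have c: "1 - z^2 \<le> 2 / \<Lambda>" "0 \<le> 1 - z^2"
    proof -
      have "1 - z^2 = (1 + z) * (1 - z)" by (simp add: power2_eq_square algebra_simps)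
      also have "\<dots> \<le> 2 * (1 / \<Lambda>)" using z cc lam by (intro mult_mono) (auto simp: z_def divide_right_mono)
      finally show "1 - z^2 \<le> 2 / \<Lambda>" by simp
      show "0 \<le> 1 - z^2" using z by (simp add: abs_square_le_1)
    qed
    have "(1 - z^2) * (p1 z)^2 \<le> (2 / \<Lambda>) * (\<Lambda> * m / (\<alpha> + 1))^2" using c lam by (intro mult_mono b) auto
    also have "\<dots> = 2 / (\<alpha> + 1)^2 * (\<Lambda> * m^2)" using lam by (simp add: power_divide power_mult_distrib power2_eq_square)
    finally have "En z \<le> (1 + 2 / (\<alpha> + 1)^2) * (\<Lambda> * m^2)" unfolding En_def using a by (simp add: distrib_right)
    also have "\<dots> \<le> K4 * (\<Lambda> * m^2)" using lam by (intro mult_right_mono K4) auto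
    finally show ?thesis .
  qed
  also have "\<dots> \<le> K4 * (\<Lambda> * (2 * (p 1)^2))" using lam K4 m2[of 1] cc by (intro mult_left_mono) auto
  finally have ez: "En z \<le> K4 * (\<Lambda> * (2 * (p 1)^2))" .
  have "\<Lambda> powr (\<alpha> + 1/2) * En 0 \<le> \<Lambda> powr (\<alpha> + 1/2) * (K3 * En z * \<Lambda> powr (- (\<alpha> + 1/2)))"
    by (intro mult_left_mono tz) auto
  also have "\<dots> = K3 * En z * (\<Lambda> powr (\<alpha> + 1/2) * \<Lambda> powr (- (\<alpha> + 1/2)))" by simp
  also have "\<Lambda> powr (\<alpha> + 1/2) * \<Lambda> powr (- (\<alpha> + 1/2)) = 1" using lam by (simp flip: powr_add)
  also have "K3 * En z * 1 = K3 * En z" by simp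
  also have "\<dots> \<le> K3 * (K4 * (\<Lambda> * (2 * (p 1)^2)))" using K1 K2 K3 by (intro mult_left_mono ez) auto
  also have "\<dots> = (K3 * K4 * 2) * (\<Lambda> * (p 1)^2)" by simp
  also have "\<dots> \<le> CC * (\<Lambda> * (p 1)^2)" using lam by (intro mult_right_mono K_prod) auto
  finally show "\<Lambda> powr (\<alpha> + 1/2) * En 0 \<le> CC * (\<Lambda> * (p 1)^2)" .
qed

lemma energy_lower:
  assumes "0 \<le> x" "x < 1" "\<Lambda> * (1 - x) \<ge> LL"
  shows "En 0 \<le> CC * En x * (1 - x) powr (\<alpha> + 1/2)"
proof -
  have "1 + G^2 \<le> LL" using alpha beta unfolding LL_def by simp
  then have R: "\<Lambda> * (1 - x) \<ge> 1 + G^2" using assms by linarith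
  have "En 0 \<le> K1 * (En x * (1 - x) powr (\<alpha> + 1/2))"
    using En_interior(2)[OF assms(1,2) R] by (simp add: mult.assoc)
  also have "\<dots> \<le> CC * (En x * (1 - x) powr (\<alpha> + 1/2))"
    using assms by (intro mult_right_mono K_prod mult_nonneg_nonneg En_nonneg) auto
  finally show ?thesis by (simp add: mult.assoc)
qed

end

section \<open>Jacobi polynomials and their kernels\<close>

lemma degree_basis_expansion:
  fixes P :: "nat \<Rightarrow> real poly"
  assumes P: "\<And>j. degree (P j) = j" "\<And>j. P j \<noteq> 0" and q: "degree q \<le> n"
  shows "\<exists>c. q = (\<Sum>j\<le>n. smult (c j) (P j))"
  using q
proof (induction n arbitrary: q)
  case 0
  then obtain c where c: "q = [:c:]" using degree_eq_zeroE by blast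
  from P(1)[of 0] obtain d where d: "P 0 = [:d:]" using degree_eq_zeroE by blast
  then have "d \<noteq> 0" using P(2)[of 0] by auto
  then show ?case using c d by (intro exI[of _ "\<lambda>_. c / d"]) simp
next
  case (Suc n)
  define c where "c = coeff q (Suc n) / coeff (P (Suc n)) (Suc n)"
  have nz: "coeff (P (Suc n)) (Suc n) \<noteq> 0"
    using P(2)[of "Suc n"] P(1)[of "Suc n"] leading_coeff_0_iff[of "P (Suc n)"] by simp
  let ?r = "q - smult c (P (Suc n))"
  have "degree ?r \<le> Suc n" using Suc.prems P(1)[of "Suc n"] by (intro degree_diff_le) auto
  moreover have "coeff ?r (Suc n) = 0" using nz by (simp add: c_def)
  ultimately have "degree ?r \<le> n" by (metis degree_0 le_SucE le0 leading_coeff_0_iff)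
  from Suc.IH[OF this] obtain e where e: "?r = (\<Sum>j\<le>n. smult (e j) (P j))" by blast
  then have "q = (\<Sum>j\<le>n. smult (e j) (P j)) + smult c (P (Suc n))" by (simp add: algebra_simps)
  also have "\<dots> = (\<Sum>j\<le>Suc n. smult ((e(Suc n := c)) j) (P j))" by simp
  finally show ?case by blast
qed

lemma abs_powr_nn_integral:
  fixes c k t :: real
  assumes k: "k > -1" and t: "t \<ge> 0"
  shows "(\<integral>\<^sup>+x\<in>{c-t..c+t}. ennreal (\<bar>x - c\<bar> powr k) \<partial>lborel) = ennreal (2 * t powr (k + 1) / (k + 1))"
proof -
  have 0: "((\<lambda>x. x powr k) has_integral (t powr (k+1) / (k+1))) {0..t}"
    using has_integral_powr_from_0[OF k t] .
  have 1: "((\<lambda>x. \<bar>x\<bar> powr k) has_integral (t powr (k+1) / (k+1))) {0..t}"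
    by (rule has_integral_eq[OF _ 0]) auto
  have "((\<lambda>x. \<bar>x\<bar> powr k) has_integral (t powr (k+1) / (k+1))) {-t..0}"
    using has_integral_reflect_real[of "\<lambda>x. \<bar>x\<bar> powr k" "t powr (k+1) / (k+1)" t 0] 1 by simp
  from has_integral_combine[OF _ _ this 1] t
  have "((\<lambda>x. \<bar>x\<bar> powr k) has_integral (2 * t powr (k+1) / (k+1))) {-t..t}" by simp
  then have "((\<lambda>x. \<bar>x - c\<bar> powr k) has_integral (2 * t powr (k+1) / (k+1))) {c-t..c+t}"
    using has_integral_affinity[of "\<lambda>x. \<bar>x\<bar> powr k" "2 * t powr (k+1) / (k+1)" "-t" t 1 "-c"]
    by (simp add: image_affinity_atLeastAtMost algebra_simps cbox_interval)
  then show ?thesis by (intro nn_integral_has_integral_lebesgue') auto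
qed

section \<open>The Jacobi weight and its measure\<close>

definition jw :: "real \<Rightarrow> real \<Rightarrow> real \<Rightarrow> real" where
  "jw \<alpha> \<beta> x = indicator {-1..1} x * (1 - x) powr \<alpha> * (1 + x) powr \<beta>"

definition jmu :: "real \<Rightarrow> real \<Rightarrow> real measure" where
  "jmu \<alpha> \<beta> = density lborel (\<lambda>x. ennreal (jw \<alpha> \<beta> x))"

lemma jw_measurable [measurable]: "jw \<alpha> \<beta> \<in> borel_measurable borel"
  unfolding jw_def by measurable

lemma jw_nonneg: "jw \<alpha> \<beta> x \<ge> 0" by (simp add: jw_def)

lemma jw_outside: "x \<notin> {-1..1} \<Longrightarrow> jw \<alpha> \<beta> x = 0" by (simp add: jw_def)

lemma sets_jmu [measurable_cong, simp]: "sets (jmu \<alpha> \<beta>) = sets borel" by (simp add: jmu_def)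
lemma space_jmu [simp]: "space (jmu \<alpha> \<beta>) = UNIV" by (simp add: jmu_def)

lemma powr_le_max: "1 \<le> y \<Longrightarrow> y \<le> 2 \<Longrightarrow> y powr k \<le> 2 powr \<bar>k\<bar>" for y k :: real
  by (smt (verit, best) powr_mono powr_mono2)

lemma jw_le:
  assumes "x \<in> {-1..1}"
  shows "jw \<alpha> \<beta> x \<le> 2 powr \<bar>\<beta>\<bar> * \<bar>x - 1\<bar> powr \<alpha> + 2 powr \<bar>\<alpha>\<bar> * \<bar>x - (-1)\<bar> powr \<beta>"
proof (cases "x \<ge> 0")
  case True
  have "(1 - x) powr \<alpha> * (1 + x) powr \<beta> \<le> (1 - x) powr \<alpha> * 2 powr \<bar>\<beta>\<bar>"
    using assms True by (intro mult_left_mono powr_le_max) auto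
  moreover have "0 \<le> 2 powr \<bar>\<alpha>\<bar> * \<bar>x - (-1)\<bar> powr \<beta>" by simp
  moreover have "\<bar>x - 1\<bar> = 1 - x" using assms by auto
  moreover have "jw \<alpha> \<beta> x = (1 - x) powr \<alpha> * (1 + x) powr \<beta>" using assms by (simp add: jw_def)
  ultimately show ?thesis by (metis add.commute add_increasing mult.commute)
next
  case False
  have "(1 - x) powr \<alpha> * (1 + x) powr \<beta> \<le> 2 powr \<bar>\<alpha>\<bar> * (1 + x) powr \<beta>"
    using assms False by (intro mult_right_mono powr_le_max) auto
  moreover have "0 \<le> 2 powr \<bar>\<beta>\<bar> * \<bar>x - 1\<bar> powr \<alpha>" by simp
  moreover have "\<bar>x - (-1)\<bar> = 1 + x" using assms by auto
  moreover have "jw \<alpha> \<beta> x = (1 - x) powr \<alpha> * (1 + x) powr \<beta>" using assms by (simp add: jw_def)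
  ultimately show ?thesis by (metis add_increasing)
qed

lemma finite_measure_jmu:
  assumes "\<alpha> > -1" "\<beta> > -1"
  shows "finite_measure (jmu \<alpha> \<beta>)"
proof (rule finite_measureI)
  have "emeasure (jmu \<alpha> \<beta>) UNIV = (\<integral>\<^sup>+x. ennreal (jw \<alpha> \<beta> x) \<partial>lborel)"
    by (simp add: jmu_def emeasure_density)
  also have "\<dots> \<le> (\<integral>\<^sup>+x. ennreal (2 powr \<bar>\<beta>\<bar>) * (ennreal (\<bar>x - 1\<bar> powr \<alpha>) * indicator {1-2..1+2} x)
       + ennreal (2 powr \<bar>\<alpha>\<bar>) * (ennreal (\<bar>x - (-1)\<bar> powr \<beta>) * indicator {-1-2..-1+2} x) \<partial>lborel)"
  proof (rule nn_integral_mono)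
    fix x :: real
    show "ennreal (jw \<alpha> \<beta> x) \<le> ennreal (2 powr \<bar>\<beta>\<bar>) * (ennreal (\<bar>x - 1\<bar> powr \<alpha>) * indicator {1-2..1+2} x)
       + ennreal (2 powr \<bar>\<alpha>\<bar>) * (ennreal (\<bar>x - (-1)\<bar> powr \<beta>) * indicator {-1-2..-1+2} x)"
    proof (cases "x \<in> {-1..1}")
      case True
      from ennreal_leI[OF jw_le[OF this, of \<alpha> \<beta>]] show ?thesis using True
        by (simp add: ennreal_plus ennreal_mult)
    qed (simp add: jw_outside)
  qed
  also have "\<dots> = ennreal (2 powr \<bar>\<beta>\<bar>) * ennreal (2 * 2 powr (\<alpha> + 1) / (\<alpha> + 1))
      + ennreal (2 powr \<bar>\<alpha>\<bar>) * ennreal (2 * 2 powr (\<beta> + 1) / (\<beta> + 1))"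
    using assms abs_powr_nn_integral[of \<alpha> 2 1] abs_powr_nn_integral[of \<beta> 2 "-1"]
    by (subst nn_integral_add) (auto simp: nn_integral_cmult simp del: abs_minus_commute)
  also have "\<dots> < \<infinity>" by (simp add: ennreal_mult_less_top)
  finally show "emeasure (jmu \<alpha> \<beta>) (space (jmu \<alpha> \<beta>)) \<noteq> \<infinity>" by simp
qed

lemma AE_jmu_Icc: "AE x in jmu \<alpha> \<beta>. x \<in> {-1..1}"
  unfolding jmu_def by (subst AE_density) (auto simp: jw_def indicator_def split: if_splits)

lemma AE_jmu_Ioo: "AE x in jmu \<alpha> \<beta>. x \<in> {-1<..<1}"
proof -
  have "x \<in> {-1<..<1}" if "0 < ennreal (jw \<alpha> \<beta> x)" for x
  proof -
    have "x \<in> {-1..1}" using that jw_outside[of x \<alpha> \<beta>] by force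
    \<comment> \<open>\<open>0 powr r\<close> is 0 for every r, so \<open>jw\<close> vanishes at the
      end points whatever the signs of the exponents.\<close>
    moreover have "x \<noteq> 1" "x \<noteq> -1" using that by (auto simp: jw_def)
    ultimately show ?thesis by auto
  qed
  then show ?thesis unfolding jmu_def by (subst AE_density) (auto intro!: AE_I2)
qed

lemma integrable_jmu_bounded:
  fixes f :: "real \<Rightarrow> real"
  assumes ab: "\<alpha> > -1" "\<beta> > -1" and f: "f \<in> borel_measurable borel" "\<And>x. x \<in> {-1..1} \<Longrightarrow> \<bar>f x\<bar> \<le> B"
  shows "integrable (jmu \<alpha> \<beta>) f"
proof -
  interpret finite_measure "jmu \<alpha> \<beta>" by (rule finite_measure_jmu[OF ab])
  show ?thesis
    by (rule integrable_const_bound[of _ B]) (use f in \<open>auto intro: eventually_mono[OF AE_jmu_Icc]\<close>)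
qed

lemma poly_bounded_Icc: "\<exists>B\<ge>0. \<forall>x\<in>{-1..1}. \<bar>poly q x\<bar> \<le> B" for q :: "real poly"
proof -
  have "compact (poly q ` {-1..1})" by (intro compact_continuous_image continuous_intros) auto
  then obtain B where "\<forall>y\<in>poly q ` {-1..1}. norm y \<le> B" using compact_imp_bounded bounded_iff by blast
  then show ?thesis by (intro exI[of _ "max 0 B"]) (auto intro: le_max_iff_disj[THEN iffD2])
qed

lemma poly_measurable [measurable]: "poly q \<in> borel_measurable borel" for q :: "real poly"
  by (intro borel_measurable_continuous_onI continuous_intros)

lemma integrable_jmu_poly: "\<alpha> > -1 \<Longrightarrow> \<beta> > -1 \<Longrightarrow> integrable (jmu \<alpha> \<beta>) (poly q)"
  using poly_bounded_Icc[of q] integrable_jmu_bounded[of \<alpha> \<beta> "poly q"] poly_measurable[of q] by blast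

definition jX :: "real poly" where "jX = [:1, 0, -1:]"
definition jQ :: "real \<Rightarrow> real \<Rightarrow> real poly" where "jQ \<alpha> \<beta> = [:\<beta> - \<alpha>, - (\<alpha> + \<beta> + 2):]"

lemma poly_jX: "poly jX x = 1 - x^2" by (simp add: jX_def power2_eq_square)
lemma poly_jQ: "poly (jQ \<alpha> \<beta>) x = \<beta> - \<alpha> - (\<alpha> + \<beta> + 2) * x" by (simp add: jQ_def algebra_simps)

section \<open>Jacobi polynomials as eigenfunctions of a symmetric operator\<close>

locale jacobi =
  fixes \<alpha> \<beta> :: real
  assumes ab: "\<alpha> > -1" "\<beta> > -1"
begin

abbreviation \<mu> where "\<mu> \<equiv> jmu \<alpha> \<beta>"
definition I where "I f = (\<integral>x. poly f x \<partial>\<mu>)"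

lemma I_add: "I (f + g) = I f + I g"
  and I_diff: "I (f - g) = I f - I g"
  and I_minus: "I (- f) = - I f"
  and I_smult: "I (smult c f) = c * I f"
proof -
  have "poly (f + g) = (\<lambda>x. poly f x + poly g x)" "poly (f - g) = (\<lambda>x. poly f x - poly g x)"
    "poly (- f) = (\<lambda>x. - poly f x)" "poly (smult c f) = (\<lambda>x. c * poly f x)" by (simp_all add: fun_eq_iff)
  then show "I (f + g) = I f + I g" "I (f - g) = I f - I g" "I (- f) = - I f" "I (smult c f) = c * I f"
    unfolding I_def by (simp_all add: integrable_jmu_poly[OF ab])
qed

lemma I_sum: "I (sum f S) = (\<Sum>i\<in>S. I (f i))"
  by (induction S rule: infinite_finite_induct) (auto simp: I_add I_def[of 0])

text \<open>The integrand times the weight is the derivative of (1 - x) powr (\<alpha> + 1) (1 + x)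
  powr (\<beta> + 1) h, which is continuous and vanishes at both end points because \<alpha> and
  \<beta> exceed -1.\<close>

lemma I_by_parts: "I (jX * pderiv h + jQ \<alpha> \<beta> * h) = 0"
proof -
  let ?P = "jX * pderiv h + jQ \<alpha> \<beta> * h"
  define F where "F x = (1 - x) powr (\<alpha> + 1) * (1 + x) powr (\<beta> + 1) * poly h x" for x
  have "((\<lambda>x. jw \<alpha> \<beta> x * poly ?P x) has_integral (F 1 - F (-1))) {-1..1}"
  proof (rule fundamental_theorem_of_calculus_interior)
    show "continuous_on {-1..1} F"
      unfolding F_def using ab by (intro continuous_intros continuous_on_powr') auto
    fix x :: real assume "x \<in> {-1<..<1}"
    then have x: "1 - x > 0" "1 + x > 0" by auto
    have e: "(1 - x) powr (\<alpha> + 1) = (1 - x) powr \<alpha> * (1 - x)" "(1 + x) powr (\<beta> + 1) = (1 + x) powr \<beta> * (1 + x)"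
      using x by (simp_all add: powr_add)
    have "(F has_real_derivative
      (((\<alpha> + 1) * (1 - x) powr \<alpha> * (- 1)) * (1 + x) powr (\<beta> + 1) + (1 - x) powr (\<alpha> + 1) * ((\<beta> + 1) * (1 + x) powr \<beta>)) * poly h x
       + (1 - x) powr (\<alpha> + 1) * (1 + x) powr (\<beta> + 1) * poly (pderiv h) x) (at x)"
      unfolding F_def using x by (auto intro!: derivative_eq_intros)
    moreover have "(((\<alpha> + 1) * (1 - x) powr \<alpha> * (- 1)) * (1 + x) powr (\<beta> + 1) + (1 - x) powr (\<alpha> + 1) * ((\<beta> + 1) * (1 + x) powr \<beta>)) * poly h x
       + (1 - x) powr (\<alpha> + 1) * (1 + x) powr (\<beta> + 1) * poly (pderiv h) x = jw \<alpha> \<beta> x * poly ?P x"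
      unfolding e using x by (simp add: jw_def poly_jX poly_jQ power2_eq_square algebra_simps)
    ultimately show "(F has_vector_derivative (jw \<alpha> \<beta> x * poly ?P x)) (at x)"
      by (simp add: has_real_derivative_iff_has_vector_derivative)
  qed simp
  moreover have "F 1 = 0" "F (-1) = 0" by (simp_all add: F_def)
  ultimately have hi: "((\<lambda>x. jw \<alpha> \<beta> x * poly ?P x) has_integral 0) {-1..1}" by simp
  have il: "integrable lborel (\<lambda>x. jw \<alpha> \<beta> x * poly ?P x)"
    using integrable_jmu_poly[OF ab, of ?P] unfolding jmu_def
    by (subst (asm) integrable_density) (auto simp: jw_nonneg)
  have "I ?P = (\<integral>x. jw \<alpha> \<beta> x * poly ?P x \<partial>lborel)"
    unfolding I_def jmu_def by (subst integral_density) (auto simp: jw_nonneg)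
  also have "\<dots> = (\<integral>x. indicator {-1..1} x *\<^sub>R (jw \<alpha> \<beta> x * poly ?P x) \<partial>lborel)"
    by (intro Bochner_Integration.integral_cong) (auto simp: jw_def indicator_def)
  also have "\<dots> = integral {-1..1} (\<lambda>x. jw \<alpha> \<beta> x * poly ?P x)"
  proof -
    have "set_integrable lborel {-1..1} (\<lambda>x. jw \<alpha> \<beta> x * poly ?P x)"
      unfolding set_integrable_def by (rule integrable_mult_indicator[OF _ il]) simp
    from set_borel_integral_eq_integral(2)[OF this] show ?thesis by (simp add: set_lebesgue_integral_def)
  qed
  also have "\<dots> = 0" using hi by (rule integral_unique)
  finally show ?thesis .
qed

text \<open>The Jacobi differential operator. It is symmetric for the weight by \<open>I_DL\<close>,
  whence the orthogonality of its eigenfunctions.\<close>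

definition DL where "DL f = jX * pderiv (pderiv f) + jQ \<alpha> \<beta> * pderiv f"

lemma I_DL: "I (DL f * g) = - I (jX * pderiv f * pderiv g)"
proof -
  have "DL f * g + jX * pderiv f * pderiv g = jX * pderiv (pderiv f * g) + jQ \<alpha> \<beta> * (pderiv f * g)"
    by (simp add: DL_def pderiv_mult algebra_simps)
  then show ?thesis using I_by_parts[of "pderiv f * g"] I_add[of "DL f * g" "jX * pderiv f * pderiv g"] by simp
qed

lemma I_DL_sym: "I (DL f * g) = I (f * DL g)"
  using I_DL[of f g] I_DL[of g f] by (simp add: mult_ac)

definition ev :: "nat \<Rightarrow> real" where "ev n = real n * (real n + \<alpha> + \<beta> + 1)"

lemma ev_strict: "k < n \<Longrightarrow> ev k < ev n"
proof -
  assume kn: "k < n"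
  have "ev n - ev k = (real n - real k) * (real n + real k + \<alpha> + \<beta> + 1)" by (simp add: ev_def algebra_simps)
  moreover have "real n + real k + \<alpha> + \<beta> + 1 > 0" using kn ab by linarith
  ultimately show ?thesis using kn by (smt (verit) mult_pos_pos of_nat_less_iff)
qed

text \<open>Coefficients in powers of 1 - x of the eigenfunction with value 1 at 1, a terminating
  hypergeometric series. The recursion compares coefficients in \<open>DL_one_minus_power\<close>;
  the factor \<open>ev n - ev k\<close> stops it after k = n.\<close>

fun jc :: "nat \<Rightarrow> nat \<Rightarrow> real" where
  "jc n 0 = 1"
| "jc n (Suc k) = - (ev n - ev k) * jc n k / (2 * (real k + 1) * (real k + 1 + \<alpha>))"

definition J :: "nat \<Rightarrow> real poly" where "J n = (\<Sum>k\<le>n. smult (jc n k) ([:1, -1:] ^ k))"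

lemma DL_add: "DL (f + g) = DL f + DL g" and DL_smult: "DL (smult c f) = smult c (DL f)"
  by (simp_all add: DL_def pderiv_add pderiv_smult algebra_simps smult_add_right)

lemma DL_sum: "DL (sum f S) = (\<Sum>i\<in>S. DL (f i))"
  by (induction S rule: infinite_finite_induct) (auto simp: DL_add DL_def[of 0])

lemma pderiv_one_minus_power: "pderiv ([:1, -1:] ^ k) = smult (- real k) ([:1, -1:] ^ (k - 1) :: real poly)"
  by (cases k) (simp_all add: pderiv_power_Suc pderiv_pCons del: power_Suc)

lemma DL_one_minus_power:
  "DL ([:1, -1:] ^ k) = smult (2 * real k * (real k + \<alpha>)) ([:1, -1:] ^ (k - 1)) - smult (ev k) ([:1, -1:] ^ k)"
proof -
  have "poly (DL ([:1, -1:] ^ k)) x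
     = poly (smult (2 * real k * (real k + \<alpha>)) ([:1, -1:] ^ (k - 1)) - smult (ev k) ([:1, -1:] ^ k)) x" for x
  proof -
    consider "k = 0" | "k = 1" | j where "k = Suc (Suc j)" by (metis One_nat_def nat.exhaust)
    then show ?thesis
    proof cases
      case 3
      have "poly (DL ([:1, -1:] ^ k)) x = (1 - x^2) * ((real j + 2) * (real j + 1) * (1 - x)^j)
          + (\<beta> - \<alpha> - (\<alpha> + \<beta> + 2) * x) * (- (real j + 2) * ((1 - x)^j * (1 - x)))"
        unfolding DL_def pderiv_one_minus_power pderiv_smult 3
        by (simp add: poly_jX poly_jQ poly_power del: power_Suc) (simp add: algebra_simps)
      also have "\<dots> = 2 * (real j + 2) * (real j + 2 + \<alpha>) * ((1 - x)^j * (1 - x)) - ev k * ((1 - x)^j * (1 - x) * (1 - x))"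
        unfolding ev_def 3 by (simp add: power2_eq_square) algebra
      finally show ?thesis unfolding 3 by (simp only: poly_diff poly_smult poly_power) (simp add: mult_ac add.commute)
    qed (simp_all add: DL_def ev_def poly_jX poly_jQ pderiv_pCons pderiv_1 algebra_simps power2_eq_square)
  qed
  then show ?thesis by (simp add: poly_eq_poly_eq_iff[symmetric] fun_eq_iff)
qed

lemma DL_J: "DL (J n) = smult (- ev n) (J n)"
proof -
  let ?s = "[:1, -1:] :: real poly"
  have "DL (J n) = (\<Sum>k\<le>n. smult (jc n k * (2 * real k * (real k + \<alpha>))) (?s ^ (k - 1))) - (\<Sum>k\<le>n. smult (jc n k * ev k) (?s ^ k))"
    unfolding J_def DL_sum DL_smult DL_one_minus_power by (simp add: smult_diff_right sum_subtractf)
  also have "(\<Sum>k\<le>n. smult (jc n k * (2 * real k * (real k + \<alpha>))) (?s ^ (k - 1)))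
     = (\<Sum>k<n. smult (jc n (Suc k) * (2 * real (Suc k) * (real (Suc k) + \<alpha>))) (?s ^ k))"
    by (subst sum.atMost_shift) simp
  also have "\<dots> = (\<Sum>k<n. smult (jc n k * (ev k - ev n)) (?s ^ k))"
  proof (intro sum.cong refl)
    fix k
    define c where "c = 2 * (real k + 1) * (real k + 1 + \<alpha>)"
    have nz: "c \<noteq> 0" using ab by (auto simp: c_def)
    have "jc n (Suc k) = - (ev n - ev k) * jc n k / c" by (simp add: c_def)
    then have "jc n (Suc k) * c = - (ev n - ev k) * jc n k" using nz by (simp del: jc.simps)
    then have "jc n (Suc k) * (2 * (real k + 1) * (real k + 1 + \<alpha>)) = jc n k * (ev k - ev n)"
      unfolding c_def[symmetric] by (simp del: jc.simps add: mult.commute)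
    then have "jc n (Suc k) * (2 * real (Suc k) * (real (Suc k) + \<alpha>)) = jc n k * (ev k - ev n)"
      unfolding of_nat_Suc by (simp only: add.commute)
    then show "smult (jc n (Suc k) * (2 * real (Suc k) * (real (Suc k) + \<alpha>))) (?s ^ k) = smult (jc n k * (ev k - ev n)) (?s ^ k)" by simp
  qed
  \<comment> \<open>The added term, k = n, is zero.\<close>
  also have "\<dots> = (\<Sum>k\<le>n. smult (jc n k * (ev k - ev n)) (?s ^ k))"
    by (simp add: lessThan_Suc_atMost[symmetric])
  also have "\<dots> - (\<Sum>k\<le>n. smult (jc n k * ev k) (?s ^ k)) = (\<Sum>k\<le>n. smult (jc n k * (- ev n)) (?s ^ k))"
    by (simp add: sum_subtractf[symmetric] smult_diff_left[symmetric] right_diff_distrib)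
  also have "\<dots> = smult (- ev n) (J n)" by (simp add: J_def poly_eq_poly_eq_iff[symmetric] fun_eq_iff poly_sum sum_distrib_left sum_negf mult_ac)
  finally show ?thesis .
qed

lemma degree_one_minus_power: "degree ([:1, -1:] ^ k :: real poly) = k"
  by (simp add: degree_power_eq)

lemma jc_nonzero: "k \<le> n \<Longrightarrow> jc n k \<noteq> 0"
proof (induction k)
  case (Suc k)
  have "real k + 1 + \<alpha> > 0" using ab by linarith
  then show ?case using Suc ev_strict[of k n] by auto
qed simp

lemma degree_J: "degree (J n) = n"
proof (cases n)
  case (Suc m)
  have "J n = (\<Sum>k\<le>m. smult (jc n k) ([:1, -1:] ^ k)) + smult (jc n n) ([:1, -1:] ^ n)"
    by (simp add: J_def Suc)
  moreover have "degree (\<Sum>k\<le>m. smult (jc n k) ([:1, -1:] ^ k) :: real poly) < degree (smult (jc n n) ([:1, -1:] ^ n))"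
  proof -
    have "degree (\<Sum>k\<le>m. smult (jc n k) ([:1, -1:] ^ k) :: real poly) \<le> m"
      by (intro degree_sum_le) (auto simp: degree_one_minus_power)
    then show ?thesis using jc_nonzero[of n n] Suc by (simp add: degree_one_minus_power del: power_Suc jc.simps)
  qed
  ultimately show ?thesis using jc_nonzero[of n n] by (simp add: degree_add_eq_right degree_one_minus_power)
qed (simp add: J_def)

lemma J_orthogonal: "m \<noteq> n \<Longrightarrow> I (J m * J n) = 0"
proof -
  assume mn: "m \<noteq> n"
  have "- ev m * I (J m * J n) = - ev n * I (J m * J n)"
    using I_DL_sym[of "J m" "J n"] by (simp add: DL_J I_smult I_minus)
  moreover have "ev m \<noteq> ev n" using mn ev_strict[of m n] ev_strict[of n m] by (cases "m < n") auto
  ultimately show ?thesis by auto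
qed

lemma I_square_pos: "f \<noteq> 0 \<Longrightarrow> I (f * f) > 0"
proof -
  assume f: "f \<noteq> 0"
  have i: "integrable \<mu> (poly (f * f))" by (rule integrable_jmu_poly[OF ab])
  have "I (f * f) \<ge> 0" unfolding I_def by (intro integral_nonneg_AE) auto
  moreover have "I (f * f) \<noteq> 0"
  proof
    assume "I (f * f) = 0"
    then have "AE x in \<mu>. poly (f * f) x = 0"
      unfolding I_def using integral_nonneg_eq_0_iff_AE[OF i] by auto
    then have ae: "AE x in \<mu>. poly f x = 0" by simp
    then have "AE x in lborel. 0 < ennreal (jw \<alpha> \<beta> x) \<longrightarrow> poly f x = 0"
      unfolding jmu_def by (subst (asm) AE_density) auto
    moreover have "AE x in lborel. x \<notin> {x. poly f x = 0}"
      using poly_roots_finite[OF f] by (intro AE_not_in) (auto intro!: finite_imp_null_set_lborel)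
    ultimately have "AE x in lborel. x \<notin> {-1<..<1::real}"
      by eventually_elim (auto simp: jw_def)
    then have "emeasure lborel {-1<..<1::real} = 0"
      by (subst (asm) AE_iff_measurable[of "{-1<..<1}"]) auto
    then show False by simp
  qed
  ultimately show ?thesis by simp
qed

definition jp :: "nat \<Rightarrow> real poly" where "jp n = smult (1 / sqrt (I (J n * J n))) (J n)"

lemma poly_J_1: "poly (J n) 1 = 1"
  by (cases n) (simp_all add: J_def poly_sum poly_power sum.atMost_Suc_shift del: sum.atMost_Suc)

lemma I_J_pos: "I (J n * J n) > 0"
  by (rule I_square_pos) (use poly_J_1[of n] in auto)

lemma jp_orthonormal: "I (jp m * jp n) = (if m = n then 1 else 0)"
  using J_orthogonal[of m n] I_J_pos[of n] by (auto simp: jp_def I_smult)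

lemma degree_jp: "degree (jp n) = n"
  using I_J_pos[of n] by (simp add: jp_def degree_J)

lemma DL_jp: "DL (jp n) = smult (- ev n) (jp n)"
  by (simp add: jp_def DL_smult DL_J mult.commute)

lemma jp_nonzero: "jp n \<noteq> 0"
  using jp_orthonormal[of n n] by (auto simp: I_def)

lemma jp_expansion: "degree q \<le> n \<Longrightarrow> q = (\<Sum>j\<le>n. smult (I (q * jp j)) (jp j))"
proof -
  assume "degree q \<le> n"
  with degree_basis_expansion[of jp, OF degree_jp jp_nonzero]
  obtain c where c: "q = (\<Sum>j\<le>n. smult (c j) (jp j))" by blast
  have "I (q * jp i) = c i" if "i \<le> n" for i
  proof -
    have "I (q * jp i) = (\<Sum>j\<le>n. c j * I (jp j * jp i))" by (subst c) (simp add: sum_distrib_right I_sum I_smult)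
    also have "\<dots> = (\<Sum>j\<le>n. if j = i then c i else 0)" by (intro sum.cong) (auto simp: jp_orthonormal)
    finally show ?thesis using that by simp
  qed
  then show ?thesis using c by (metis (no_types, lifting) atMost_iff sum.cong)
qed

lemma jp_lower: "degree q < n \<Longrightarrow> I (jp n * q) = 0"
proof -
  assume q: "degree q < n"
  have "I (jp n * q) = (\<Sum>j\<le>degree q. I (q * jp j) * I (jp n * jp j))"
    by (subst jp_expansion[of q "degree q"]) (simp_all add: sum_distrib_left I_sum I_smult)
  also have "\<dots> = 0" using q by (intro sum.neutral) (auto simp: jp_orthonormal)
  finally show ?thesis .
qed

section \<open>The reproducing kernel and its Christoffel-Darboux formula\<close>

definition Kp :: "nat \<Rightarrow> real \<Rightarrow> real poly" where "Kp n x = (\<Sum>j\<le>n. smult (poly (jp j) x) (jp j))"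
definition Kj :: "nat \<Rightarrow> real \<Rightarrow> real \<Rightarrow> real" where "Kj n x y = poly (Kp n x) y"

lemma Kj_sum: "Kj n x y = (\<Sum>j\<le>n. poly (jp j) x * poly (jp j) y)"
  by (simp add: Kj_def Kp_def poly_sum)

lemma Kj_sym: "Kj n x y = Kj n y x" by (simp add: Kj_sum mult.commute)

lemma degree_Kp: "degree (Kp n x) \<le> n"
  unfolding Kp_def by (intro degree_sum_le order_trans[OF degree_smult_le]) (auto simp: degree_jp)

lemma Kp_reproducing: "degree q \<le> n \<Longrightarrow> I (Kp n x * q) = poly q x"
proof -
  assume q: "degree q \<le> n"
  have "I (Kp n x * q) = (\<Sum>j\<le>n. poly (jp j) x * I (q * jp j))"
    by (simp add: Kp_def sum_distrib_right I_sum I_smult) (simp add: mult.commute)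
  also have "\<dots> = poly (\<Sum>j\<le>n. smult (I (q * jp j)) (jp j)) x" by (simp add: poly_sum mult.commute)
  also have "\<dots> = poly q x" using jp_expansion[OF q] by simp
  finally show ?thesis .
qed

text \<open>\<open>jp n\<close> is orthogonal to all lower degrees, so only the coefficient of
  degree n is seen.\<close>

lemma jp_top: "degree q \<le> n \<Longrightarrow> I (jp n * q) = coeff q n * I (jp n * monom 1 n)"
proof -
  assume q: "degree q \<le> n"
  show ?thesis
  proof (cases "n = 0")
    case True
    then obtain c where "q = [:c:]" using q degree_eq_zeroE by blast
    then show ?thesis using True by (simp add: I_smult monom_0)
  next
    case False
    let ?r = "q - smult (coeff q n) (monom 1 n)"
    have "degree ?r \<le> n" using q by (intro degree_diff_le order_trans[OF degree_smult_le]) (auto simp: degree_monom_eq)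
    moreover have "coeff ?r n = 0" by simp
    ultimately have "degree ?r < n" using False by (metis degree_0 le_neq_implies_less leading_coeff_0_iff neq0_conv)
    then have "I (jp n * ?r) = 0" by (rule jp_lower)
    then show ?thesis by (simp add: right_diff_distrib I_diff I_smult)
  qed
qed

lemma ode_jp: "(1 - x^2) * poly (pderiv (pderiv (jp n))) x + (\<beta> - \<alpha> - (\<alpha> + \<beta> + 2) * x) * poly (pderiv (jp n)) x + ev n * poly (jp n) x = 0"
  using arg_cong[OF DL_jp[of n], of "\<lambda>q. poly q x"] by (simp add: DL_def poly_jX poly_jQ)

definition Dp :: "nat \<Rightarrow> real poly" where "Dp n = jX * pderiv (jp n)"

text \<open>Integration by parts moves the derivative to r. What remains has degree at most n, and
  by \<open>jp_top\<close> only its coefficient of degree n counts.\<close>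

lemma I_Dp:
  assumes n: "n \<ge> 1" and r: "degree r \<le> n - 1"
  shows "I (Dp n * r) = (real n + \<alpha> + \<beta> + 1) * I (jp n * (monom 1 1 * r))"
proof -
  have "Dp n * r + jp n * (jX * pderiv r + jQ \<alpha> \<beta> * r) = jX * pderiv (jp n * r) + jQ \<alpha> \<beta> * (jp n * r)"
    by (simp add: Dp_def pderiv_mult algebra_simps)
  then have e: "I (Dp n * r) = - I (jp n * (jX * pderiv r + jQ \<alpha> \<beta> * r))"
    using I_by_parts[of "jp n * r"] I_add[of "Dp n * r" "jp n * (jX * pderiv r + jQ \<alpha> \<beta> * r)"] by simp
  obtain m where m: "n = Suc m" using n by (cases n) auto
  have c: "coeff (jX * pderiv r + jQ \<alpha> \<beta> * r) n = - (real n + \<alpha> + \<beta> + 1) * coeff r m"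
  proof -
    have "coeff r (Suc m) = 0" "coeff r (Suc (Suc m)) = 0" using r m by (auto intro!: coeff_eq_0)
    moreover have "coeff (jX * pderiv r) n = coeff (pderiv r) n - (if m = 0 then 0 else coeff (pderiv r) (m - 1))"
      by (cases m) (simp_all add: jX_def m coeff_pCons)
    moreover have "coeff (pderiv r) (m - 1) = real m * coeff r m" if "m \<noteq> 0"
      using that by (cases m) (auto simp: coeff_pderiv)
    ultimately show ?thesis
      by (simp add: m jQ_def coeff_pderiv algebra_simps)
  qed
  have d1: "degree (jX * pderiv r + jQ \<alpha> \<beta> * r) \<le> n"
  proof (intro degree_add_le)
    show "degree (jX * pderiv r) \<le> n"
    proof (cases "pderiv r = 0")
      case False
      then have "degree r \<noteq> 0" by (metis pderiv_eq_0_iff)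
      then have "degree (pderiv r) + 2 \<le> n" using r n by (simp add: degree_pderiv)
      moreover have "degree jX \<le> 2" by (simp add: jX_def)
      ultimately show ?thesis using degree_mult_le[of jX "pderiv r"] by linarith
    qed simp
    have "degree (jQ \<alpha> \<beta>) \<le> 1" by (simp add: jQ_def)
    then show "degree (jQ \<alpha> \<beta> * r) \<le> n" using degree_mult_le[of "jQ \<alpha> \<beta>" r] r n by linarith
  qed
  have d2: "degree (monom 1 1 * r) \<le> n"
    using degree_mult_le[of "monom 1 1" r] r n by (simp add: degree_monom_eq)
  have c2: "coeff (monom 1 1 * r) n = coeff r m" by (simp add: m coeff_monom_mult)
  show ?thesis unfolding e jp_top[OF d1] jp_top[OF d2] c c2 by (simp add: algebra_simps)
qed

definition N2 :: "nat \<Rightarrow> real" where "N2 n = 2 * real n + \<alpha> + \<beta> + 1"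
definition N1 :: "nat \<Rightarrow> real" where "N1 n = real n + \<alpha> + \<beta> + 1"

lemma N2_pos: "n \<ge> 1 \<Longrightarrow> N2 n > 0"
proof -
  assume "n \<ge> 1"
  then have "real n \<ge> 1" by simp
  then show ?thesis using ab by (simp add: N2_def)
qed

text \<open>A Christoffel-Darboux formula with (1 - x^2) P_n' in the role of P_(n+1). As a
  polynomial in y, the right side divided by x - y is \<open>R\<close>. It reproduces values at x up
  to a scalar, and a multiple of the reproducing kernel is the only polynomial that does so. Testing
  with P_n determines the scalar, which is why P_n(x) must not vanish here.\<close>

lemma kernel_formula_aux:
  assumes n: "n \<ge> 1" and px: "poly (jp n) x \<noteq> 0"
  shows "N2 n * (x - y) * Kj n x y = N1 n * (x - y) * (poly (jp n) x * poly (jp n) y)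
     - (poly (Dp n) x * poly (jp n) y - poly (jp n) x * poly (Dp n) y)"
proof -
  let ?p = "jp n" and ?D = "Dp n"
  obtain m where m: "n = Suc m" using n by (cases n) auto
  \<comment> \<open>A polynomial in y that vanishes at y = x. Dividing out y - x leaves
    \<open>T\<close>, of degree at most n.\<close>
  define S where "S = smult (poly ?D x) ?p - smult (poly ?p x) ?D"
  have dD: "degree ?D \<le> Suc n"
  proof -
    have "degree (pderiv ?p) = m" by (simp add: degree_pderiv degree_jp m)
    moreover have "degree jX \<le> 2" by (simp add: jX_def)
    ultimately show ?thesis unfolding Dp_def using degree_mult_le[of jX "pderiv ?p"] m by linarith
  qed
  have cD: "coeff ?D (Suc n) = - real n * coeff ?p n"
  proof -
    have "coeff (pderiv ?p) (Suc (Suc m)) = 0" using degree_jp[of n] by (simp add: coeff_pderiv coeff_eq_0 m)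
    then show ?thesis by (simp add: Dp_def jX_def m coeff_pCons coeff_pderiv algebra_simps)
  qed
  have dS: "degree S \<le> Suc n" unfolding S_def
    using dD degree_jp[of n] by (intro degree_diff_le order_trans[OF degree_smult_le]) auto
  have cS: "coeff S (Suc n) = real n * coeff ?p n * poly ?p x"
    using degree_jp[of n] by (simp add: S_def cD coeff_eq_0)
  have "poly S x = 0" by (simp add: S_def)
  then obtain T where T: "S = [:-x, 1:] * T" by (auto simp: poly_eq_0_iff_dvd dvd_def)
  have dT: "degree T \<le> n"
  proof (cases "T = 0")
    case False
    then have "degree S = Suc (degree T)" unfolding T by (subst degree_mult_eq) auto
    then show ?thesis using dS by simp
  qed simp
  have cT: "coeff T n = real n * coeff ?p n * poly ?p x"
    using cS dT by (simp add: T coeff_eq_0)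
  define R where "R = smult (N1 n * poly ?p x) ?p + T"
  have dR: "degree R \<le> n" unfolding R_def
    using dT degree_jp[of n] by (intro degree_add_le order_trans[OF degree_smult_le]) auto
  have cR: "coeff R n = N2 n * coeff ?p n * poly ?p x" by (simp add: R_def cT N1_def N2_def algebra_simps)
  have kk: "coeff ?p n * I (?p * monom 1 n) = 1"
    using jp_top[of ?p n] jp_orthonormal[of n n] degree_jp[of n] by simp
  \<comment> \<open>Every q of degree at most n is its value at x plus (y - x) r. The second part
    contributes nothing: the terms from \<open>T\<close> and from P_n cancel by
    \<open>I_Dp\<close>.\<close>
  have key: "I (R * q) = poly q x * I R" if q: "degree q \<le> n" for q
  proof -
    have "[:-x, 1:] dvd (q - [:poly q x:])" by (simp add: poly_eq_0_iff_dvd[symmetric])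
    then obtain r where r: "q - [:poly q x:] = [:-x, 1:] * r" by (rule dvdE)
    have dr: "degree r \<le> n - 1"
    proof (cases "r = 0")
      case False
      then have "degree (q - [:poly q x:]) = Suc (degree r)" unfolding r by (subst degree_mult_eq) auto
      moreover have "degree (q - [:poly q x:]) \<le> n" using q by (intro degree_diff_le) auto
      ultimately show ?thesis by simp
    qed simp
    have pr: "I (?p * r) = 0" using dr n by (intro jp_lower) auto
    have mm: "[:-x, 1:] = monom 1 1 - [:x:]" by (simp add: monom_altdef)
    have xr: "?p * ([:-x, 1:] * r) = ?p * (monom 1 1 * r) - smult x (?p * r)"
      unfolding mm by (simp add: algebra_simps)
    have pyr: "I (?p * ([:-x, 1:] * r)) = I (?p * (monom 1 1 * r))"
      unfolding xr by (simp add: I_diff I_smult pr)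
    have Tr: "I (T * ([:-x, 1:] * r)) = - poly ?p x * I (?D * r)"
    proof -
      have "T * ([:-x, 1:] * r) = S * r" unfolding T by (simp only: mult_ac)
      also have "\<dots> = smult (poly ?D x) (?p * r) - smult (poly ?p x) (?D * r)"
        by (simp add: S_def left_diff_distrib)
      finally show ?thesis by (simp add: I_diff I_smult pr)
    qed
    have qr: "q = [:poly q x:] + [:-x, 1:] * r" unfolding r[symmetric] by simp
    have "R * ([:c:] + V) = smult c R + R * V" for c V by (simp add: distrib_left)
    from this[of "poly q x" "[:-x, 1:] * r", folded qr]
    have "I (R * q) = poly q x * I R + I (R * ([:-x, 1:] * r))" by (simp only: I_add I_smult)
    also have "I (R * ([:-x, 1:] * r)) = N1 n * poly ?p x * I (?p * ([:-x, 1:] * r)) + I (T * ([:-x, 1:] * r))"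
      unfolding R_def by (simp only: distrib_right I_add mult_smult_left I_smult)
    also have "\<dots> = 0" unfolding pyr Tr I_Dp[OF n dr] by (simp add: N1_def)
    finally show ?thesis by simp
  qed
  have "I (R * ?p) = N2 n * poly ?p x"
  proof -
    have "I (R * ?p) = coeff R n * I (?p * monom 1 n)" using jp_top[OF dR] by (simp add: mult.commute)
    then show ?thesis using kk unfolding cR by (simp add: mult_ac)
  qed
  then have IR: "I R = N2 n" using key[of ?p] degree_jp[of n] px by simp
  have "R = smult (N2 n) (Kp n x)"
  proof -
    let ?d = "R - smult (N2 n) (Kp n x)"
    have dd: "degree ?d \<le> n"
      using dR degree_Kp[of n x] by (intro degree_diff_le order_trans[OF degree_smult_le]) auto
    have "I (?d * q) = 0" if "degree q \<le> n" for q
      using key[OF that] Kp_reproducing[OF that, of x] by (simp add: left_diff_distrib I_diff I_smult IR)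
    then have "I (?d * ?d) = 0" using dd by blast
    then show ?thesis using I_square_pos[of ?d] by force
  qed
  then have "N2 n * Kj n x y = poly R y" by (simp add: Kj_def)
  also have "\<dots> = N1 n * poly ?p x * poly ?p y + poly T y" by (simp add: R_def)
  finally have "(x - y) * (N2 n * Kj n x y) = (x - y) * (N1 n * poly ?p x * poly ?p y + poly T y)" by simp
  moreover have "(x - y) * poly T y = - (poly ?D x * poly ?p y - poly ?p x * poly ?D y)"
  proof -
    have "poly S y = (y - x) * poly T y" unfolding T by (simp add: algebra_simps)
    moreover have "poly S y = poly ?D x * poly ?p y - poly ?p x * poly ?D y" by (simp add: S_def)
    ultimately show ?thesis by (simp add: algebra_simps)
  qed
  ultimately show ?thesis by (simp add: algebra_simps)
qed

text \<open>For fixed y both sides are polynomials in x that agree off the finitely many zeros of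
  P_n, hence everywhere.\<close>

lemma kernel_formula:
  assumes n: "n \<ge> 1"
  shows "N2 n * (x - y) * Kj n x y = N1 n * (x - y) * (poly (jp n) x * poly (jp n) y)
     - (poly (Dp n) x * poly (jp n) y - poly (jp n) x * poly (Dp n) y)"
proof -
  define Z where "Z = smult (N2 n) ([:-y, 1:] * Kp n y) - (smult (N1 n * poly (jp n) y) ([:-y, 1:] * jp n)
     - (smult (poly (jp n) y) (Dp n) - smult (poly (Dp n) y) (jp n)))"
  have Z: "poly Z x = N2 n * (x - y) * Kj n x y - (N1 n * (x - y) * (poly (jp n) x * poly (jp n) y)
     - (poly (Dp n) x * poly (jp n) y - poly (jp n) x * poly (Dp n) y))" for x
    unfolding Kj_sym[of n x y] by (simp add: Z_def Kj_def algebra_simps)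
  have "Z = 0"
  proof (rule ccontr)
    assume "Z \<noteq> 0"
    then have "finite ({x. poly Z x = 0} \<union> {x. poly (jp n) x = 0})" using poly_roots_finite jp_nonzero by blast
    moreover have "{x. poly Z x = 0} \<union> {x. poly (jp n) x = 0} = UNIV"
      using kernel_formula_aux[OF n] Z by auto
    ultimately show False using infinite_UNIV_char_0[where 'a=real] by simp
  qed
  then show ?thesis using Z[of x] by simp
qed

text \<open>The kernel formula is differentiated in x at x = y; the second derivative of P_n is
  removed by the differential equation.\<close>

lemma kernel_diag:
  assumes n: "n \<ge> 1"
  shows "N2 n * Kj n y y = N1 n * (poly (jp n) y)^2 + ev n * (poly (jp n) y)^2 + (1 - y^2) * (poly (pderiv (jp n)) y)^2
     + (\<beta> - \<alpha> - (\<alpha> + \<beta>) * y) * (poly (jp n) y * poly (pderiv (jp n)) y)"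
proof -
  let ?p = "jp n" and ?D = "Dp n"
  have d: "((\<lambda>x. N2 n * (x - y) * poly (Kp n y) x) has_real_derivative N2 n * (1 * poly (Kp n y) y + poly (pderiv (Kp n y)) y * (y - y))) (at y)"
    unfolding mult.assoc by (intro DERIV_cmult DERIV_mult poly_DERIV) (auto intro!: derivative_eq_intros)
  have 1: "((\<lambda>x. N2 n * (x - y) * Kj n x y) has_real_derivative N2 n * Kj n y y) (at y)"
  proof -
    have "Kj n x y = poly (Kp n y) x" for x using Kj_sym[of n x y] by (simp add: Kj_def)
    then show ?thesis using d by simp
  qed
  have "((\<lambda>x. N1 n * (x - y) * (poly ?p x * poly ?p y) - (poly ?D x * poly ?p y - poly ?p x * poly ?D y))
     has_real_derivative N1 n * (poly ?p y * poly ?p y) - (poly (pderiv ?D) y * poly ?p y - poly (pderiv ?p) y * poly ?D y)) (at y)"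
    by (auto intro!: derivative_eq_intros poly_DERIV)
  then have 2: "((\<lambda>x. N2 n * (x - y) * Kj n x y) has_real_derivative
     N1 n * (poly ?p y * poly ?p y) - (poly (pderiv ?D) y * poly ?p y - poly (pderiv ?p) y * poly ?D y)) (at y)"
    unfolding kernel_formula[OF n] .
  have 3: "poly (pderiv ?D) y = - ev n * poly ?p y - (\<beta> - \<alpha> - (\<alpha> + \<beta>) * y) * poly (pderiv ?p) y"
  proof -
    have "pderiv jX = [:0, -2:]" by (simp add: jX_def pderiv_pCons)
    then have "poly (pderiv ?D) y = (1 - y^2) * poly (pderiv (pderiv ?p)) y - 2 * y * poly (pderiv ?p) y"
      by (simp add: Dp_def pderiv_mult poly_jX)
    then show ?thesis using ode_jp[of y n] by (simp add: algebra_simps)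
  qed
  show ?thesis using DERIV_unique[OF 1 2] unfolding 3
    by (simp add: Dp_def poly_jX power2_eq_square algebra_simps)
qed

lemma I_deriv: "I (jX * pderiv (jp n) * pderiv (jp n)) = ev n"
  using I_DL[of "jp n" "jp n"] by (simp add: DL_jp I_smult I_minus jp_orthonormal)

end

section \<open>Pointwise bounds for Jacobi polynomials\<close>

definition dd :: "real \<Rightarrow> real" where "dd x = 1 - \<bar>x\<bar>"

lemma dd_measurable [measurable]: "dd \<in> borel_measurable borel" unfolding dd_def by measurable

text \<open>The exponent - \<theta> (\<gamma> + 1) is the critical one for weak L^(1/\<theta>). The
  integral is split at distance t from c: inside, the power is integrated over the whole interval;
  outside, it is at most its value at distance t.\<close>

lemma power_weight_integral:
  fixes S :: "real set"
  assumes ab: "\<alpha> > -1" "\<beta> > -1" and \<gamma>: "\<gamma> > -1" and \<theta>: "0 \<le> \<theta>" "\<theta> < 1" and "K \<ge> 0"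
    and w: "\<And>x. x \<in> S \<Longrightarrow> jw \<alpha> \<beta> x \<le> K * \<bar>x - c\<bar> powr \<gamma>"
  shows "\<exists>C>0. \<forall>E. E \<in> sets borel \<longrightarrow> E \<subseteq> S \<longrightarrow>
    (\<integral>\<^sup>+x\<in>E. ennreal (\<bar>x - c\<bar> powr (- (\<theta> * (\<gamma> + 1)))) \<partial>jmu \<alpha> \<beta>) \<le> ennreal (C * measure (jmu \<alpha> \<beta>) E powr (1 - \<theta>))"
proof -
  interpret finite_measure "jmu \<alpha> \<beta>" by (rule finite_measure_jmu[OF ab])
  define \<kappa> where "\<kappa> = \<theta> * (\<gamma> + 1)"
  define k where "k = \<gamma> - \<kappa>"
  have k1: "k + 1 = (1 - \<theta>) * (\<gamma> + 1)" by (simp add: k_def \<kappa>_def algebra_simps)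
  have kpos: "k + 1 > 0" unfolding k1 using \<theta> \<gamma> by simp
  have \<kappa>0: "\<kappa> \<ge> 0" using \<theta> \<gamma> by (simp add: \<kappa>_def)
  define C where "C = 1 + K * (2 / (k + 1))"
  have "(\<integral>\<^sup>+x\<in>E. ennreal (\<bar>x - c\<bar> powr (- \<kappa>)) \<partial>jmu \<alpha> \<beta>) \<le> ennreal (C * measure (jmu \<alpha> \<beta>) E powr (1 - \<theta>))"
    if E [measurable]: "E \<in> sets borel" and ES: "E \<subseteq> S" for E
  proof (cases "measure (jmu \<alpha> \<beta>) E = 0")
    case True
    then have "emeasure (jmu \<alpha> \<beta>) E = 0" by (simp add: emeasure_eq_measure)
    then have "AE x in jmu \<alpha> \<beta>. x \<notin> E" by (intro AE_not_in) (auto simp: null_sets_def)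
    then have "(\<integral>\<^sup>+x\<in>E. ennreal (\<bar>x - c\<bar> powr (- \<kappa>)) \<partial>jmu \<alpha> \<beta>) = (\<integral>\<^sup>+x. 0 \<partial>jmu \<alpha> \<beta>)"
      by (intro nn_integral_cong_AE) (auto elim!: eventually_mono)
    then show ?thesis by simp
  next
    case False
    define m where "m = measure (jmu \<alpha> \<beta>) E"
    have m: "m > 0" using False measure_nonneg[of "jmu \<alpha> \<beta>" E] unfolding m_def by linarith
    \<comment> \<open>At this distance both parts are multiples of the same power m powr (1 -
      \<theta>).\<close>
    define t where "t = m powr (1 / (\<gamma> + 1))"
    have t: "t > 0" using m by (simp add: t_def)
    have t1: "t powr (- \<kappa>) * m = m powr (1 - \<theta>)"
    proof -
      have "t powr (- \<kappa>) = m powr (- \<theta>)" using \<gamma> by (simp add: t_def \<kappa>_def powr_powr)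
      then show ?thesis using m powr_add[of m "- \<theta>" 1] by simp
    qed
    have t2: "t powr (k + 1) = m powr (1 - \<theta>)"
      using \<gamma> by (simp add: t_def k1 powr_powr)
    have "(\<integral>\<^sup>+x\<in>E. ennreal (\<bar>x - c\<bar> powr (- \<kappa>)) \<partial>jmu \<alpha> \<beta>)
       = (\<integral>\<^sup>+x. ennreal (jw \<alpha> \<beta> x) * (ennreal (\<bar>x - c\<bar> powr (- \<kappa>)) * indicator E x) \<partial>lborel)"
      unfolding jmu_def by (subst nn_integral_density) auto
    also have "\<dots> \<le> (\<integral>\<^sup>+x. ennreal (t powr (- \<kappa>)) * (ennreal (jw \<alpha> \<beta> x) * indicator E x)
         + ennreal K * (ennreal (\<bar>x - c\<bar> powr k) * indicator {c-t..c+t} x) \<partial>lborel)"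
    proof (rule nn_integral_mono)
      fix x
      show "ennreal (jw \<alpha> \<beta> x) * (ennreal (\<bar>x - c\<bar> powr (- \<kappa>)) * indicator E x)
        \<le> ennreal (t powr (- \<kappa>)) * (ennreal (jw \<alpha> \<beta> x) * indicator E x)
         + ennreal K * (ennreal (\<bar>x - c\<bar> powr k) * indicator {c-t..c+t} x)"
      proof (cases "x \<in> E")
        case xE: True
        show ?thesis
        proof (cases "\<bar>x - c\<bar> \<le> t")
          case True
          then have xi: "x \<in> {c-t..c+t}" by auto
          have "jw \<alpha> \<beta> x * \<bar>x - c\<bar> powr (- \<kappa>) \<le> K * \<bar>x - c\<bar> powr \<gamma> * \<bar>x - c\<bar> powr (- \<kappa>)"
            using w[of x] xE ES by (intro mult_right_mono) auto
          also have "\<dots> = K * \<bar>x - c\<bar> powr k" by (simp add: k_def powr_add[symmetric])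
          finally have "ennreal (jw \<alpha> \<beta> x) * ennreal (\<bar>x - c\<bar> powr (- \<kappa>)) \<le> ennreal K * ennreal (\<bar>x - c\<bar> powr k)"
            using jw_nonneg \<open>K \<ge> 0\<close> by (simp add: ennreal_mult[symmetric] ennreal_leI)
          then show ?thesis using xE xi by (simp add: add_increasing)
        next
          case False
          then have "\<bar>x - c\<bar> powr (- \<kappa>) \<le> t powr (- \<kappa>)" using t \<kappa>0 by (intro powr_mono2') auto
          then have "ennreal (jw \<alpha> \<beta> x) * ennreal (\<bar>x - c\<bar> powr (- \<kappa>)) \<le> ennreal (t powr (- \<kappa>)) * ennreal (jw \<alpha> \<beta> x)"
            by (subst mult.commute) (intro mult_right_mono ennreal_leI, auto)
          then show ?thesis using xE by (simp add: add_increasing2)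
        qed
      qed simp
    qed
    also have "\<dots> = ennreal (t powr (- \<kappa>)) * (\<integral>\<^sup>+x. ennreal (jw \<alpha> \<beta> x) * indicator E x \<partial>lborel)
         + ennreal K * (\<integral>\<^sup>+x\<in>{c-t..c+t}. ennreal (\<bar>x - c\<bar> powr k) \<partial>lborel)"
      by (subst nn_integral_add) (auto simp: nn_integral_cmult)
    also have "(\<integral>\<^sup>+x. ennreal (jw \<alpha> \<beta> x) * indicator E x \<partial>lborel) = ennreal m"
      unfolding m_def emeasure_eq_measure[symmetric] by (simp add: jmu_def emeasure_density)
    also have "(\<integral>\<^sup>+x\<in>{c-t..c+t}. ennreal (\<bar>x - c\<bar> powr k) \<partial>lborel) = ennreal (2 * t powr (k + 1) / (k + 1))"
      using kpos t by (intro abs_powr_nn_integral) auto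
    also have "ennreal (t powr (- \<kappa>)) * ennreal m + ennreal K * ennreal (2 * t powr (k + 1) / (k + 1))
       = ennreal (t powr (- \<kappa>) * m + K * (2 * t powr (k + 1) / (k + 1)))"
    proof -
      have "ennreal u * ennreal m + ennreal K * ennreal v = ennreal (u * m + K * v)" if "u \<ge> 0" "v \<ge> 0" for u v
        using m \<open>K \<ge> 0\<close> that by (simp add: ennreal_mult ennreal_plus)
      then show ?thesis using kpos by simp
    qed
    also have "t powr (- \<kappa>) * m + K * (2 * t powr (k + 1) / (k + 1)) = C * m powr (1 - \<theta>)"
      unfolding t1 t2 C_def by (simp add: algebra_simps)
    finally show ?thesis unfolding m_def .
  qed
  moreover have "C > 0" using \<open>K \<ge> 0\<close> kpos by (simp add: C_def add_pos_nonneg)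
  ultimately show ?thesis unfolding \<kappa>_def by blast
qed

section \<open>The energy of the orthonormal polynomials\<close>

context jacobi
begin

definition gm :: "real \<Rightarrow> real" where "gm x = (if x \<ge> 0 then \<alpha> else \<beta>)"
text \<open>The critical power of the distance to the end points: a function in weak L^(1/\<theta>),
  a property that \<open>sg_integral\<close> expresses through integrals over sets.\<close>

definition sg where "sg \<theta> x = dd x powr (- (\<theta> * (gm x + 1)))"

lemma gm_measurable [measurable]: "gm \<in> borel_measurable borel"
proof -
  have "gm = (\<lambda>x. \<beta> + (\<alpha> - \<beta>) * indicator {0..} x)" by (auto simp: gm_def indicator_def)
  then show ?thesis by (simp only:) measurable
qed
lemma sg_measurable [measurable]: "sg \<theta> \<in> borel_measurable borel" unfolding sg_def by measurable

sublocale fin: finite_measure \<mu> by (rule finite_measure_jmu[OF ab])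

lemma sg_integral:
  assumes \<theta>: "0 \<le> \<theta>" "\<theta> < 1"
  shows "\<exists>C>0. \<forall>E. E \<in> sets borel \<longrightarrow> (\<integral>\<^sup>+x\<in>E. ennreal (sg \<theta> x) \<partial>\<mu>) \<le> ennreal (C * measure \<mu> E powr (1 - \<theta>))"
proof -
  have w1: "jw \<alpha> \<beta> x \<le> 2 powr \<bar>\<beta>\<bar> * \<bar>x - 1\<bar> powr \<alpha>" if "x \<in> {0..1}" for x
    using that powr_le_max[of "1 + x" \<beta>]
    by (auto simp: jw_def abs_minus_commute mult.commute[of "2 powr \<bar>\<beta>\<bar>"] intro!: mult_left_mono)
  have w2: "jw \<alpha> \<beta> x \<le> 2 powr \<bar>\<alpha>\<bar> * \<bar>x - (-1)\<bar> powr \<beta>" if "x \<in> {-1..<0}" for x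
    using that powr_le_max[of "1 - x" \<alpha>]
    by (auto simp: jw_def add.commute intro!: mult_right_mono)
  obtain C1 where C1: "C1 > 0" "\<And>E. E \<in> sets borel \<Longrightarrow> E \<subseteq> {0..1} \<Longrightarrow>
    (\<integral>\<^sup>+x\<in>E. ennreal (\<bar>x - 1\<bar> powr (- (\<theta> * (\<alpha> + 1)))) \<partial>\<mu>) \<le> ennreal (C1 * measure \<mu> E powr (1 - \<theta>))"
    using power_weight_integral[where S="{0..1}", OF ab ab(1) \<theta> _ w1] by auto
  obtain C2 where C2: "C2 > 0" "\<And>E. E \<in> sets borel \<Longrightarrow> E \<subseteq> {-1..<0} \<Longrightarrow>
    (\<integral>\<^sup>+x\<in>E. ennreal (\<bar>x - (-1)\<bar> powr (- (\<theta> * (\<beta> + 1)))) \<partial>\<mu>) \<le> ennreal (C2 * measure \<mu> E powr (1 - \<theta>))"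
    using power_weight_integral[where S="{-1..<0}", OF ab ab(2) \<theta> _ w2] by auto
  have "(\<integral>\<^sup>+x\<in>E. ennreal (sg \<theta> x) \<partial>\<mu>) \<le> ennreal ((C1 + C2) * measure \<mu> E powr (1 - \<theta>))"
    if E [measurable]: "E \<in> sets borel" for E
  proof -
    let ?E1 = "E \<inter> {0..1}" and ?E2 = "E \<inter> {-1..<0}"
    have "(\<integral>\<^sup>+x\<in>E. ennreal (sg \<theta> x) \<partial>\<mu>) \<le> (\<integral>\<^sup>+x. ennreal (\<bar>x - 1\<bar> powr (- (\<theta> * (\<alpha> + 1)))) * indicator ?E1 x
        + ennreal (\<bar>x - (-1)\<bar> powr (- (\<theta> * (\<beta> + 1)))) * indicator ?E2 x \<partial>\<mu>)"
    proof (rule nn_integral_mono_AE, rule eventually_mono[OF AE_jmu_Icc])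
      fix x :: real assume x: "x \<in> {-1..1}"
      show "ennreal (sg \<theta> x) * indicator E x \<le> ennreal (\<bar>x - 1\<bar> powr (- (\<theta> * (\<alpha> + 1)))) * indicator ?E1 x
        + ennreal (\<bar>x - (-1)\<bar> powr (- (\<theta> * (\<beta> + 1)))) * indicator ?E2 x"
      proof (cases "x \<ge> 0")
        case True
        then have "dd x = \<bar>x - 1\<bar>" using x by (auto simp: dd_def)
        then show ?thesis using True x by (auto simp: sg_def gm_def indicator_def)
      next
        case False
        then have "dd x = \<bar>x - (-1)\<bar>" using x by (auto simp: dd_def)
        then show ?thesis using False x by (auto simp: sg_def gm_def indicator_def)
      qed
    qed
    also have "\<dots> = (\<integral>\<^sup>+x\<in>?E1. ennreal (\<bar>x - 1\<bar> powr (- (\<theta> * (\<alpha> + 1)))) \<partial>\<mu>) + (\<integral>\<^sup>+x\<in>?E2. ennreal (\<bar>x - (-1)\<bar> powr (- (\<theta> * (\<beta> + 1)))) \<partial>\<mu>)"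
      by (rule nn_integral_add) auto
    also have "\<dots> \<le> ennreal (C1 * measure \<mu> ?E1 powr (1 - \<theta>)) + ennreal (C2 * measure \<mu> ?E2 powr (1 - \<theta>))"
      by (intro add_mono C1 C2) auto
    also have "\<dots> \<le> ennreal (C1 * measure \<mu> E powr (1 - \<theta>)) + ennreal (C2 * measure \<mu> E powr (1 - \<theta>))"
      using C1(1) C2(1) \<theta> by (intro add_mono ennreal_leI mult_left_mono powr_mono2 fin.finite_measure_mono) auto
    also have "\<dots> = ennreal ((C1 + C2) * measure \<mu> E powr (1 - \<theta>))"
      using C1(1) C2(1) by (simp add: ennreal_plus[symmetric] distrib_right del: ennreal_plus)
    finally show ?thesis .
  qed
  then show ?thesis using C1(1) C2(1) by (intro exI[of _ "C1 + C2"]) auto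
qed

abbreviation pn where "pn n \<equiv> poly (jp n)"
abbreviation pd where "pd n \<equiv> poly (pderiv (jp n))"

text \<open>The energy at 0, with which all other values are compared. Its own size is of order
  \<open>ev n\<close>, by \<open>e0_upper\<close> and \<open>e0_lower\<close>.\<close>

definition e0 where "e0 n = ev n * (pn n 0)^2 + (pd n 0)^2"
definition Ejp where "Ejp n x = ev n * (pn n x)^2 + (1 - x^2) * (pd n x)^2"

lemma ev_pos: "n \<ge> 1 \<Longrightarrow> ev n > 0" using ev_strict[of 0 n] by (simp add: ev_def)

lemma ode1: "n \<ge> 1 \<Longrightarrow> jacobi_ode \<alpha> \<beta> (ev n) (pn n) (pd n) (poly (pderiv (pderiv (jp n))))"
  by unfold_locales (use ab ev_pos ode_jp in \<open>auto intro: poly_DERIV\<close>)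

lemma ode2: "n \<ge> 1 \<Longrightarrow> jacobi_ode \<beta> \<alpha> (ev n) (\<lambda>x. pn n (-x)) (\<lambda>x. - pd n (-x)) (\<lambda>x. poly (pderiv (pderiv (jp n))) (-x))"
proof unfold_locales
  show "((\<lambda>x. pn n (-x)) has_real_derivative - pd n (-x)) (at x)" for x
    by (rule derivative_eq_intros poly_DERIV[THEN DERIV_chain2] refl | simp)+
  show "((\<lambda>x. - pd n (-x)) has_real_derivative poly (pderiv (pderiv (jp n))) (-x)) (at x)" for x
    by (rule derivative_eq_intros poly_DERIV[THEN DERIV_chain2] refl | simp)+
  show "(1 - x^2) * poly (pderiv (pderiv (jp n))) (-x) + (\<alpha> - \<beta> - (\<beta> + \<alpha> + 2) * x) * (- pd n (-x)) + ev n * pn n (-x) = 0" for x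
    using ode_jp[of "-x" n] by (simp add: algebra_simps)
qed (use ab ev_pos in auto)

lemma En1: "n \<ge> 1 \<Longrightarrow> jacobi_ode.En (ev n) (pn n) (pd n) x = Ejp n x"
  using jacobi_ode.En_def[OF ode1] by (simp add: Ejp_def)
lemma En2: "n \<ge> 1 \<Longrightarrow> jacobi_ode.En (ev n) (\<lambda>x. pn n (-x)) (\<lambda>x. - pd n (-x)) x = Ejp n (-x)"
  using jacobi_ode.En_def[OF ode2] by (simp add: Ejp_def)
lemma Ejp_0: "Ejp n 0 = e0 n" by (simp add: Ejp_def e0_def)

definition Lc where "Lc = max (jacobi_ode.LL \<alpha> \<beta>) (jacobi_ode.LL \<beta> \<alpha>)"
definition Cc where "Cc = max (jacobi_ode.CC \<alpha> \<beta>) (jacobi_ode.CC \<beta> \<alpha>)"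

definition Xr where "Xr n x = dd x + 1 / ev n"

lemma jp_energy_upper:
  assumes n: "n \<ge> 1" "ev n \<ge> Lc" and x: "x \<in> {-1..1}"
  shows "ev n * (pn n x)^2 \<le> Cc * e0 n * Xr n x powr (- (gm x + 1/2))"
    and "(pd n x)^2 \<le> Cc * e0 n * Xr n x powr (- (gm x + 3/2))"
proof -
  have e: "e0 n \<ge> 0" using ev_pos[OF n(1)] by (simp add: e0_def)
  have "ev n * (pn n x)^2 \<le> Cc * e0 n * Xr n x powr (- (gm x + 1/2)) \<and> (pd n x)^2 \<le> Cc * e0 n * Xr n x powr (- (gm x + 3/2))"
  proof (cases "x \<ge> 0")
    case True
    have c: "jacobi_ode.CC \<alpha> \<beta> \<le> Cc" by (simp add: Cc_def)
    have L: "ev n \<ge> jacobi_ode.LL \<alpha> \<beta>" using n by (simp add: Lc_def)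
    have "jacobi_ode.CC \<alpha> \<beta> * e0 n * r \<le> Cc * e0 n * r" if "r \<ge> 0" for r
      using c e that by (intro mult_right_mono) auto
    then show ?thesis
      using jacobi_ode.energy_upper(1,2)[OF ode1[OF n(1)] L, of x] x True n(1)
      by (auto simp: En1 Ejp_0 Xr_def dd_def gm_def intro: order_trans)
  next
    case False
    have c: "jacobi_ode.CC \<beta> \<alpha> \<le> Cc" by (simp add: Cc_def)
    have L: "ev n \<ge> jacobi_ode.LL \<beta> \<alpha>" using n by (simp add: Lc_def)
    have "jacobi_ode.CC \<beta> \<alpha> * e0 n * r \<le> Cc * e0 n * r" if "r \<ge> 0" for r
      using c e that by (intro mult_right_mono) auto
    then show ?thesis
      using jacobi_ode.energy_upper(1,2)[OF ode2[OF n(1)] L, of "-x"] x False n(1)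
      by (auto simp: En2 Ejp_0 Xr_def dd_def gm_def intro: order_trans)
  qed
  then show "ev n * (pn n x)^2 \<le> Cc * e0 n * Xr n x powr (- (gm x + 1/2))"
    "(pd n x)^2 \<le> Cc * e0 n * Xr n x powr (- (gm x + 3/2))" by auto
qed

lemma Ejp_nonneg: "n \<ge> 1 \<Longrightarrow> x \<in> {-1..1} \<Longrightarrow> Ejp n x \<ge> 0"
  using ev_pos[of n] by (auto simp: Ejp_def abs_square_le_1 intro!: add_nonneg_nonneg mult_nonneg_nonneg)

lemma Cc_pos: "Cc > 0"
  using jacobi_ode.K_prod(7)[OF ode1[of 1]] by (simp add: Cc_def)

lemma jp_energy_lower:
  assumes n: "n \<ge> 1" and x: "\<bar>x\<bar> < 1" and L: "ev n * dd x \<ge> Lc"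
  shows "e0 n \<le> Cc * Ejp n x * dd x powr (gm x + 1/2)"
proof -
  have E: "Ejp n x \<ge> 0" using x by (intro Ejp_nonneg[OF n]) auto
  show ?thesis
  proof (cases "x \<ge> 0")
    case True
    have "e0 n \<le> jacobi_ode.CC \<alpha> \<beta> * Ejp n x * (1 - x) powr (\<alpha> + 1/2)"
      using jacobi_ode.energy_lower[OF ode1[OF n], of x] x True L n by (auto simp: En1 Ejp_0 dd_def Lc_def)
    also have "\<dots> \<le> Cc * Ejp n x * (1 - x) powr (\<alpha> + 1/2)" using E by (intro mult_right_mono) (auto simp: Cc_def)
    finally show ?thesis using True by (simp add: dd_def gm_def)
  next
    case False
    have "e0 n \<le> jacobi_ode.CC \<beta> \<alpha> * Ejp n x * (1 + x) powr (\<beta> + 1/2)"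
      using jacobi_ode.energy_lower[OF ode2[OF n], of "-x"] x False L n by (auto simp: En2 Ejp_0 dd_def Lc_def)
    also have "\<dots> \<le> Cc * Ejp n x * (1 + x) powr (\<beta> + 1/2)" using E by (intro mult_right_mono) (auto simp: Cc_def)
    finally show ?thesis using False by (simp add: dd_def gm_def)
  qed
qed

lemma jp_endpoint_lower:
  assumes n: "n \<ge> 1" "ev n \<ge> Lc" and a: "a = 1 \<or> a = -1"
  shows "ev n powr (gm a + 1/2) * e0 n \<le> Cc * (ev n * (pn n a)^2)"
proof -
  have ev: "ev n > 0" using ev_pos n by auto
  have "ev n powr (\<alpha> + 1/2) * e0 n \<le> jacobi_ode.CC \<alpha> \<beta> * (ev n * (pn n 1)^2)"
    using jacobi_ode.energy_upper(3)[OF ode1[OF n(1)], of 0] n by (auto simp: En1 Ejp_0 Lc_def)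
  also have "\<dots> \<le> Cc * (ev n * (pn n 1)^2)" using ev by (intro mult_right_mono) (auto simp: Cc_def)
  finally have 1: "ev n powr (\<alpha> + 1/2) * e0 n \<le> Cc * (ev n * (pn n 1)^2)" .
  have "ev n powr (\<beta> + 1/2) * e0 n \<le> jacobi_ode.CC \<beta> \<alpha> * (ev n * (pn n (-1))^2)"
    using jacobi_ode.energy_upper(3)[OF ode2[OF n(1)], of 0] n by (auto simp: En2 Ejp_0 Lc_def)
  also have "\<dots> \<le> Cc * (ev n * (pn n (-1))^2)" using ev by (intro mult_right_mono) (auto simp: Cc_def)
  finally show ?thesis using 1 a by (auto simp: gm_def)
qed

text \<open>Orthonormality accounts for one \<open>ev n\<close> and an integration by parts,
  \<open>I_deriv\<close>, for the other. This exact value is what fixes the size of the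
  energy.\<close>

lemma Ejp_integral: "integrable \<mu> (Ejp n)" "(\<integral>x. Ejp n x \<partial>\<mu>) = 2 * ev n"
proof -
  let ?q = "smult (ev n) (jp n * jp n) + jX * pderiv (jp n) * pderiv (jp n)"
  have e: "Ejp n = poly ?q" by (auto simp: Ejp_def poly_jX power2_eq_square)
  show "integrable \<mu> (Ejp n)" unfolding e by (rule integrable_jmu_poly[OF ab])
  have "I ?q = 2 * ev n" by (simp only: I_add I_smult I_deriv jp_orthonormal) simp
  then show "(\<integral>x. Ejp n x \<partial>\<mu>) = 2 * ev n" unfolding e by (simp add: I_def)
qed

lemma measure_mid_pos: "measure \<mu> {0..1/2} > 0"
proof -
  have "emeasure \<mu> {0..1/2} \<noteq> 0"
  proof
    assume "emeasure \<mu> {0..1/2} = 0"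
    then have "{0..1/2} \<in> null_sets (density lborel (\<lambda>x. ennreal (jw \<alpha> \<beta> x)))" by (auto simp: null_sets_def jmu_def)
    then have "AE x in lborel. x \<in> {0..1/2} \<longrightarrow> ennreal (jw \<alpha> \<beta> x) = 0"
      by (subst (asm) null_sets_density_iff) auto
    then have "AE x in lborel. x \<notin> {0..1/2::real}"
      by eventually_elim (auto simp: jw_def)
    then have "emeasure lborel {0..1/2::real} = 0"
      by (subst (asm) AE_iff_measurable[of "{0..1/2}"]) auto
    then show False by simp
  qed
  then show ?thesis by (simp add: fin.emeasure_eq_measure zero_less_measure_iff)
qed

text \<open>On [0, 1/2] the energy is at least a fixed multiple of \<open>e0 n\<close>, while its
  whole integral is 2 \<open>ev n\<close>.\<close>

lemma e0_upper: "\<exists>C>0. \<forall>n\<ge>1. ev n \<ge> 2 * Lc \<longrightarrow> e0 n \<le> C * ev n"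
proof -
  define K where "K = Cc * 2 powr \<bar>\<alpha> + 1/2\<bar>"
  have K: "K > 0" using Cc_pos by (simp add: K_def)
  have "e0 n \<le> (2 * K / measure \<mu> {0..1/2}) * ev n" if n: "n \<ge> 1" "ev n \<ge> 2 * Lc" for n
  proof -
    have pw: "e0 n \<le> K * Ejp n x" if x: "x \<in> {0..1/2}" for x
    proof -
      \<comment> \<open>The distance to the end points is at least 1/2 here, hence the factor 2 in
        front of \<open>Lc\<close>.\<close>
      have "ev n * (1/2) \<le> ev n * dd x" using x ev_pos[OF n(1)] by (intro mult_left_mono) (auto simp: dd_def)
      then have "e0 n \<le> Cc * Ejp n x * dd x powr (gm x + 1/2)" using n x by (intro jp_energy_lower) auto
      also have "\<dots> \<le> Cc * Ejp n x * 2 powr \<bar>\<alpha> + 1/2\<bar>"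
        using x Ejp_nonneg[of n x] n Cc_pos powr_comparable[of 1 "dd x" 2 "\<alpha> + 1/2"]
        by (intro mult_left_mono) (auto simp: gm_def dd_def)
      finally show ?thesis by (simp add: K_def mult_ac)
    qed
    have "(\<integral>x. e0 n * indicator {0..1/2} x \<partial>\<mu>) \<le> (\<integral>x. K * Ejp n x \<partial>\<mu>)"
    proof (rule integral_mono_AE)
      show "integrable \<mu> (\<lambda>x. e0 n * indicator {0..1/2} x)" by (rule integrable_mult_right[OF integrable_real_indicator]) (auto simp: fin.emeasure_finite less_top[symmetric])
      show "AE x in \<mu>. e0 n * indicator {0..1/2} x \<le> K * Ejp n x"
      proof (rule eventually_mono[OF AE_jmu_Icc])
        fix x :: real assume "x \<in> {-1..1}"
        then show "e0 n * indicator {0..1/2} x \<le> K * Ejp n x"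
          using pw[of x] Ejp_nonneg[OF n(1), of x] K by (cases "x \<in> {0..1/2}") auto
      qed
    qed (simp add: Ejp_integral)
    then have "e0 n * measure \<mu> {0..1/2} \<le> K * (2 * ev n)" by (simp add: Ejp_integral)
    then show ?thesis using measure_mid_pos by (simp add: field_simps)
  qed
  moreover have "2 * K / measure \<mu> {0..1/2} > 0" using K measure_mid_pos by simp
  ultimately show ?thesis by blast
qed

definition \<kappa>K where "\<kappa>K = 2 powr (\<bar>\<alpha> + 1/2\<bar> + \<bar>\<beta> + 1/2\<bar>)"

lemma Xr_powr_le:
  assumes n: "n \<ge> 1" "ev n \<ge> 1" and x: "\<bar>x\<bar> < 1" and \<theta>: "\<theta> \<ge> 0" "gm x + 1/2 \<le> \<theta> * (gm x + 1)"
  shows "Xr n x powr (- (gm x + 1/2)) \<le> \<kappa>K * sg \<theta> x"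
proof -
  have d: "dd x > 0" "dd x \<le> 1" using x by (auto simp: dd_def)
  have g: "gm x + 1 \<ge> 0" using ab by (auto simp: gm_def)
  have K1: "\<kappa>K \<ge> 1" unfolding \<kappa>K_def by (rule ge_one_powr_ge_zero) auto
  have s1: "sg \<theta> x \<ge> 1" unfolding sg_def using d \<theta> g powr_mono'[of "- (\<theta> * (gm x + 1))" 0 "dd x"] by simp
  have e: "1 / ev n > 0" "1 / ev n \<le> 1" using n by auto
  have X: "Xr n x \<ge> dd x" "Xr n x \<le> 2" "Xr n x > 0" using d e unfolding Xr_def by linarith+
  show ?thesis
  proof (cases "gm x + 1/2 \<ge> 0")
    case True
    have "Xr n x powr (- (gm x + 1/2)) \<le> dd x powr (- (gm x + 1/2))"
      using True d X by (intro powr_mono2') auto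
    also have "\<dots> \<le> sg \<theta> x" unfolding sg_def using d \<theta> by (intro powr_mono') auto
    also have "\<dots> \<le> \<kappa>K * sg \<theta> x" using mult_right_mono[OF K1, of "sg \<theta> x"] s1 by simp
    finally show ?thesis .
  next
    case False
    have "Xr n x powr (- (gm x + 1/2)) \<le> 2 powr (- (gm x + 1/2))"
      using False X by (intro powr_mono2) auto
    also have "\<dots> \<le> \<kappa>K" unfolding \<kappa>K_def using False by (intro powr_mono) (auto simp: gm_def)
    also have "\<dots> \<le> \<kappa>K * sg \<theta> x" using mult_left_mono[OF s1, of \<kappa>K] K1 by simp
    finally show ?thesis .
  qed
qed

lemma Ejp_le:
  assumes n: "n \<ge> 1" "ev n \<ge> Lc" and x: "x \<in> {-1..1}"
  shows "Ejp n x \<le> 3 * Cc * e0 n * Xr n x powr (- (gm x + 1/2))"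
proof -
  have e: "e0 n \<ge> 0" using ev_pos[OF n(1)] by (simp add: e0_def)
  have X: "Xr n x > 0" using x ev_pos[OF n(1)] by (auto simp: Xr_def dd_def intro!: add_nonneg_pos)
  have d: "0 \<le> 1 - x^2" "1 - x^2 \<le> 2 * Xr n x"
  proof -
    have "1 - x^2 = (1 + \<bar>x\<bar>) * (1 - \<bar>x\<bar>)" by (simp add: power2_eq_square algebra_simps)
    also have "\<dots> \<le> 2 * (1 - \<bar>x\<bar>)" using x by (intro mult_right_mono) auto
    also have "\<dots> \<le> 2 * Xr n x" using ev_pos[OF n(1)] by (simp add: Xr_def dd_def)
    finally show "1 - x^2 \<le> 2 * Xr n x" .
    show "0 \<le> 1 - x^2" using x by (auto simp: abs_square_le_1)
  qed
  have "(1 - x^2) * (pd n x)^2 \<le> 2 * Xr n x * (Cc * e0 n * Xr n x powr (- (gm x + 3/2)))"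
    using d X by (intro mult_mono jp_energy_upper[OF n x]) auto
  also have "\<dots> = 2 * Cc * e0 n * (Xr n x powr 1 * Xr n x powr (- (gm x + 3/2)))" using X by simp
  also have "Xr n x powr 1 * Xr n x powr (- (gm x + 3/2)) = Xr n x powr (- (gm x + 1/2))"
    unfolding powr_add[symmetric] by (rule arg_cong[where f="\<lambda>k. Xr n x powr k"]) simp
  finally show ?thesis using jp_energy_upper(1)[OF n x] unfolding Ejp_def by simp
qed

text \<open>The upper bound for the energy divided by \<open>e0 n\<close> has an integral bounded
  uniformly in n, so the integral 2 \<open>ev n\<close> of the energy is at most a multiple of
  \<open>e0 n\<close>.\<close>

lemma e0_lower: "\<exists>C>0. \<forall>n\<ge>1. ev n \<ge> max 1 Lc \<longrightarrow> ev n \<le> C * e0 n"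
proof -
  define m where "m = max \<alpha> \<beta>"
  \<comment> \<open>Unless m + 1/2 is negative, this is the solution of \<theta> (m + 1) = m + 1/2.
    The power in \<open>Ejp_le\<close> is then dominated by \<open>sg \<theta>\<close>, with
    \<theta> < 1.\<close>
  define \<theta> where "\<theta> = max 0 (1 - 1 / (2 * (m + 1)))"
  have m: "m + 1 > 0" using ab by (simp add: m_def)
  have \<theta>: "0 \<le> \<theta>" "\<theta> < 1" using m by (auto simp: \<theta>_def)
  have \<theta>g: "gm x + 1/2 \<le> \<theta> * (gm x + 1)" for x
  proof -
    have g: "gm x + 1 > 0" "gm x \<le> m" using ab by (auto simp: gm_def m_def)
    have "1 / (2 * (m + 1)) \<le> 1 / (2 * (gm x + 1))" using g by (intro divide_left_mono) auto
    then have "1 - 1 / (2 * (gm x + 1)) \<le> \<theta>" unfolding \<theta>_def by linarith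
    then have "(1 - 1 / (2 * (gm x + 1))) * (gm x + 1) \<le> \<theta> * (gm x + 1)" using g by (intro mult_right_mono) auto
    moreover have "(1 - 1 / (2 * (gm x + 1))) * (gm x + 1) = gm x + 1/2" using g by (simp add: field_simps)
    ultimately show ?thesis by simp
  qed
  obtain C where C: "C > 0" "\<And>E. E \<in> sets borel \<Longrightarrow> (\<integral>\<^sup>+x\<in>E. ennreal (sg \<theta> x) \<partial>\<mu>) \<le> ennreal (C * measure \<mu> E powr (1 - \<theta>))"
    using sg_integral[OF \<theta>] by blast
  define B where "B = C * measure \<mu> UNIV powr (1 - \<theta>)"
  have B: "B \<ge> 0" using C by (simp add: B_def)
  have "ev n \<le> (3 * Cc * \<kappa>K * (B + 1)) * e0 n" if n: "n \<ge> 1" "ev n \<ge> max 1 Lc" for n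
  proof -
    have e: "e0 n \<ge> 0" using ev_pos[OF n(1)] by (simp add: e0_def)
    have k: "3 * Cc * e0 n * \<kappa>K \<ge> 0" using e Cc_pos by (simp add: \<kappa>K_def)
    have "ennreal (2 * ev n) = (\<integral>\<^sup>+x. ennreal (Ejp n x) \<partial>\<mu>)"
      using Ejp_integral[of n] Ejp_nonneg[OF n(1)]
      by (subst nn_integral_eq_integral) (auto intro!: eventually_mono[OF AE_jmu_Icc])
    also have "\<dots> \<le> (\<integral>\<^sup>+x. ennreal (3 * Cc * e0 n * \<kappa>K) * (ennreal (sg \<theta> x) * indicator UNIV x) \<partial>\<mu>)"
    proof (rule nn_integral_mono_AE, rule eventually_mono[OF AE_jmu_Ioo])
      fix x :: real assume x: "x \<in> {-1<..<1}"
      have "Ejp n x \<le> 3 * Cc * e0 n * Xr n x powr (- (gm x + 1/2))" using n x by (intro Ejp_le) auto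
      also have "\<dots> \<le> 3 * Cc * e0 n * (\<kappa>K * sg \<theta> x)"
        using n x e Cc_pos \<theta> \<theta>g by (intro mult_left_mono Xr_powr_le) auto
      finally have "Ejp n x \<le> (3 * Cc * e0 n * \<kappa>K) * sg \<theta> x" by (simp add: mult_ac)
      then show "ennreal (Ejp n x) \<le> ennreal (3 * Cc * e0 n * \<kappa>K) * (ennreal (sg \<theta> x) * indicator UNIV x)"
        using k by (simp add: ennreal_mult[symmetric] sg_def ennreal_leI)
    qed
    also have "\<dots> = ennreal (3 * Cc * e0 n * \<kappa>K) * (\<integral>\<^sup>+x\<in>UNIV. ennreal (sg \<theta> x) \<partial>\<mu>)"
      by (rule nn_integral_cmult) auto
    also have "\<dots> \<le> ennreal (3 * Cc * e0 n * \<kappa>K) * ennreal B" unfolding B_def by (intro mult_left_mono C) auto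
    also have "\<dots> = ennreal (3 * Cc * e0 n * \<kappa>K * B)" using k B by (simp add: ennreal_mult[symmetric])
    finally have "2 * ev n \<le> 3 * Cc * e0 n * \<kappa>K * B"
      using mult_nonneg_nonneg[OF k B] by (simp add: ennreal_le_iff)
    moreover have "3 * Cc * e0 n * \<kappa>K * B \<le> (3 * Cc * \<kappa>K * (B + 1)) * e0 n" using k by (simp add: algebra_simps)
    ultimately show ?thesis using n by simp
  qed
  moreover have "3 * Cc * \<kappa>K * (B + 1) > 0" using Cc_pos B by (simp add: \<kappa>K_def)
  ultimately show ?thesis by blast
qed

text \<open>A majorant of |P_n| up to a constant, see \<open>jp_bounds\<close>: the distance to the
  end points is regularised at the scale 1/\<open>ev n\<close>.\<close>

definition Ab where "Ab n x = Xr n x powr (- (gm x / 2 + 1/4))"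

lemma Xr_pos: "n \<ge> 1 \<Longrightarrow> x \<in> {-1..1} \<Longrightarrow> Xr n x > 0"
  using ev_pos[of n] by (auto simp: Xr_def dd_def intro!: add_nonneg_pos)

lemma Ab_pos: "n \<ge> 1 \<Longrightarrow> x \<in> {-1..1} \<Longrightarrow> Ab n x > 0"
  using Xr_pos[of n x] by (simp add: Ab_def)

lemma Ab_square: "n \<ge> 1 \<Longrightarrow> x \<in> {-1..1} \<Longrightarrow> (Ab n x)^2 = Xr n x powr (- (gm x + 1/2))"
  unfolding Ab_def power2_eq_square powr_add[symmetric] by (rule arg_cong[where f="\<lambda>k. Xr n x powr k"]) simp

lemma jp_bounds:
  "\<exists>C>0. \<exists>L. \<forall>n\<ge>1. ev n \<ge> L \<longrightarrow> (\<forall>x\<in>{-1..1}. \<bar>pn n x\<bar> \<le> C * Ab n x \<and>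
     \<bar>pd n x\<bar> \<le> C * sqrt (ev n) * Ab n x / sqrt (Xr n x))"
proof -
  obtain C1 where C1: "C1 > 0" "\<And>n. n \<ge> 1 \<Longrightarrow> ev n \<ge> 2 * Lc \<Longrightarrow> e0 n \<le> C1 * ev n" using e0_upper by blast
  define C where "C = sqrt (Cc * C1)"
  have C0: "C > 0" using C1 Cc_pos by (simp add: C_def)
  have CC: "C^2 = Cc * C1" using C1 Cc_pos by (simp add: C_def)
  have "\<bar>pn n x\<bar> \<le> C * Ab n x \<and> \<bar>pd n x\<bar> \<le> C * sqrt (ev n) * Ab n x / sqrt (Xr n x)"
    if n: "n \<ge> 1" "ev n \<ge> max Lc (2 * Lc)" and x: "x \<in> {-1..1}" for n x
  proof -
    have ev: "ev n > 0" using ev_pos n by auto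
    have X: "Xr n x > 0" using Xr_pos n x by auto
    have L: "ev n \<ge> Lc" "ev n \<ge> 2 * Lc" using n by auto
    have e: "Cc * e0 n \<le> C^2 * ev n" using C1(2)[OF n(1) L(2)] Cc_pos by (simp add: CC)
    have "ev n * (pn n x)^2 \<le> Cc * e0 n * (Ab n x)^2" using jp_energy_upper(1)[OF n(1) L(1) x] Ab_square[OF n(1) x] by simp
    also have "\<dots> \<le> C^2 * ev n * (Ab n x)^2" using e by (intro mult_right_mono) auto
    finally have "ev n * (pn n x)^2 \<le> ev n * (C * Ab n x)^2" by (simp add: power_mult_distrib mult_ac)
    then have "(pn n x)^2 \<le> (C * Ab n x)^2" using ev by simp
    then have 1: "\<bar>pn n x\<bar> \<le> C * Ab n x"
      using C0 Ab_pos[OF n(1) x] by (simp add: abs_le_square_iff[symmetric])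
    have "Xr n x powr (- (gm x + 3/2)) = (Ab n x)^2 / Xr n x"
    proof -
      have "Xr n x powr (- (gm x + 3/2)) = Xr n x powr (- (gm x + 1/2) - 1)" by (rule arg_cong[where f="\<lambda>k. Xr n x powr k"]) simp
      then show ?thesis unfolding powr_diff Ab_square[OF n(1) x] using X by simp
    qed
    then have "(pd n x)^2 \<le> Cc * e0 n * ((Ab n x)^2 / Xr n x)" using jp_energy_upper(2)[OF n(1) L(1) x] by simp
    also have "\<dots> \<le> C^2 * ev n * ((Ab n x)^2 / Xr n x)" using e X by (intro mult_right_mono) auto
    also have "\<dots> = (C * sqrt (ev n) * Ab n x / sqrt (Xr n x))^2"
      using ev X by (simp add: power_mult_distrib power_divide)
    finally have 2: "\<bar>pd n x\<bar> \<le> C * sqrt (ev n) * Ab n x / sqrt (Xr n x)"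
      using C0 Ab_pos[OF n(1) x] ev X by (simp add: abs_le_square_iff[symmetric])
    show ?thesis using 1 2 by blast
  qed
  then show ?thesis using C0 by blast
qed

lemma N2_square: "(N2 n)^2 = 4 * ev n + (\<alpha> + \<beta> + 1)^2"
  by (simp add: N2_def ev_def power2_eq_square algebra_simps)

lemma N2_ge: "n \<ge> 1 \<Longrightarrow> 2 * sqrt (ev n) \<le> N2 n"
proof -
  assume n: "n \<ge> 1"
  have "(2 * sqrt (ev n))^2 \<le> (N2 n)^2" using ev_pos[OF n] by (simp add: N2_square power_mult_distrib)
  then show ?thesis by (rule power2_le_imp_le) (use N2_pos[OF n] in simp)
qed

lemma N2_le: "n \<ge> 1 \<Longrightarrow> ev n \<ge> 1 \<Longrightarrow> N2 n \<le> (2 + \<bar>\<alpha> + \<beta> + 1\<bar>) * sqrt (ev n)"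
proof -
  assume n: "n \<ge> 1" "ev n \<ge> 1"
  define u where "u = \<bar>\<alpha> + \<beta> + 1\<bar>"
  have u: "(\<alpha> + \<beta> + 1)^2 = u^2" "u \<ge> 0" by (simp_all add: u_def)
  have "u^2 * 1 \<le> u^2 * ev n" using n by (intro mult_left_mono) auto
  moreover have "0 \<le> u * ev n" using n u by simp
  ultimately have "(N2 n)^2 \<le> ((2 + \<bar>\<alpha> + \<beta> + 1\<bar>) * sqrt (ev n))^2"
    using n unfolding N2_square power_mult_distrib u(1) u_def[symmetric] by (simp add: power2_sum algebra_simps)
  then show ?thesis using n by (intro power2_le_imp_le[of "N2 n"]) auto
qed

lemma N1_bounds: "n \<ge> 1 \<Longrightarrow> 0 \<le> N1 n \<and> N1 n \<le> N2 n"
proof -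
  assume "n \<ge> 1"
  then have "real n \<ge> 1" by simp
  then show ?thesis using ab by (simp add: N1_def N2_def)
qed

lemma one_minus_square_le: "x \<in> {-1..1} \<Longrightarrow> 0 \<le> 1 - x^2 \<and> 1 - x^2 \<le> 2 * dd x" for x :: real
proof -
  assume x: "x \<in> {-1..1}"
  have "1 - x^2 = (1 + \<bar>x\<bar>) * (1 - \<bar>x\<bar>)" by (simp add: power2_eq_square algebra_simps)
  also have "\<dots> \<le> 2 * (1 - \<bar>x\<bar>)" using x by (intro mult_right_mono) auto
  finally show ?thesis using x by (auto simp: dd_def abs_square_le_1)
qed

text \<open>\<open>Bb\<close> bounds \<open>(1 - x\<^sup>2) P\<^sub>n'(x)\<close> divided by the square root of the eigenvalue.\<close>

definition Bb where "Bb n x = dd x * Ab n x / sqrt (Xr n x)"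

lemma Bb_le: "n \<ge> 1 \<Longrightarrow> x \<in> {-1..1} \<Longrightarrow> 0 \<le> Bb n x \<and> Bb n x \<le> sqrt (dd x) * Ab n x"
proof -
  assume n: "n \<ge> 1" and x: "x \<in> {-1..1}"
  have d: "dd x \<ge> 0" using x by (auto simp: dd_def)
  have X: "Xr n x > 0" "dd x \<le> Xr n x" using Xr_pos[OF n x] ev_pos[OF n] by (auto simp: Xr_def)
  have "dd x / sqrt (Xr n x) \<le> sqrt (dd x)"
  proof -
    have "dd x = sqrt (dd x) * sqrt (dd x)" using d by simp
    also have "\<dots> \<le> sqrt (dd x) * sqrt (Xr n x)" using d X by (intro mult_left_mono) auto
    finally show ?thesis using X by (simp add: field_simps)
  qed
  from mult_right_mono[OF this, of "Ab n x"] show ?thesis using Ab_pos[OF n x] d X by (simp add: Bb_def)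
qed

lemma Dp_bounds:
  "\<exists>C>0. \<exists>L. \<forall>n\<ge>1. ev n \<ge> L \<longrightarrow> (\<forall>x\<in>{-1..1}. \<bar>pn n x\<bar> \<le> C * Ab n x \<and> \<bar>pd n x\<bar> \<le> C * sqrt (ev n) * Ab n x / sqrt (Xr n x) \<and>
     \<bar>poly (Dp n) x\<bar> \<le> C * sqrt (ev n) * Bb n x)"
proof -
  obtain C L where C: "C > 0" and b: "\<And>n x. n \<ge> 1 \<Longrightarrow> ev n \<ge> L \<Longrightarrow> x \<in> {-1..1} \<Longrightarrow> \<bar>pn n x\<bar> \<le> C * Ab n x \<and>
     \<bar>pd n x\<bar> \<le> C * sqrt (ev n) * Ab n x / sqrt (Xr n x)" using jp_bounds by blast
  have "\<bar>pn n x\<bar> \<le> 2 * C * Ab n x \<and> \<bar>pd n x\<bar> \<le> 2 * C * sqrt (ev n) * Ab n x / sqrt (Xr n x) \<and> \<bar>poly (Dp n) x\<bar> \<le> 2 * C * sqrt (ev n) * Bb n x"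
    if n: "n \<ge> 1" "ev n \<ge> L" and x: "x \<in> {-1..1}" for n x
  proof -
    note bb = b[OF n x]
    have "\<bar>poly (Dp n) x\<bar> = (1 - x^2) * \<bar>pd n x\<bar>" using one_minus_square_le[OF x] by (simp add: Dp_def poly_jX abs_mult)
    also have "\<dots> \<le> (2 * dd x) * (C * sqrt (ev n) * Ab n x / sqrt (Xr n x))"
      using one_minus_square_le[OF x] bb by (intro mult_mono) auto
    finally have "\<bar>poly (Dp n) x\<bar> \<le> 2 * C * sqrt (ev n) * Bb n x" by (simp add: Bb_def mult_ac)
    moreover have "C * Ab n x \<ge> 0" using C Ab_pos[OF n(1) x] by simp
    moreover have "C * sqrt (ev n) * Ab n x / sqrt (Xr n x) \<ge> 0"
      using C Ab_pos[OF n(1) x] Xr_pos[OF n(1) x] ev_pos[OF n(1)] by simp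
    ultimately show ?thesis using bb by (simp add: mult.assoc)
  qed
  then show ?thesis using C by (intro exI[of _ "2 * C"] conjI exI[of _ L]) auto
qed

end

section \<open>Pointwise bounds for the Jacobi kernel\<close>

context jacobi
begin

text \<open>Off the diagonal this is \<open>kernel_formula\<close> with the bounds for P_n and (1 -
  x^2) P_n'. On the diagonal \<open>kernel_diag\<close> gives the order sqrt (\<open>ev n\<close>),
  and Cauchy-Schwarz for the sum over degrees carries this to all pairs.\<close>

lemma kernel_offdiag_bound:
  "\<exists>C>0. \<exists>L. \<forall>n\<ge>1. ev n \<ge> L \<longrightarrow> (\<forall>x\<in>{-1..1}. \<forall>y\<in>{-1..1}.
     (x \<noteq> y \<longrightarrow> \<bar>Kj n x y\<bar> \<le> C * (Ab n x * Ab n y) * (1 + (sqrt (dd x) + sqrt (dd y)) / \<bar>x - y\<bar>)) \<and>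
     \<bar>Kj n x y\<bar> \<le> C * sqrt (ev n) * (Ab n x * Ab n y))"
proof -
  obtain C L where C: "C > 0" and b: "\<And>n x. n \<ge> 1 \<Longrightarrow> ev n \<ge> L \<Longrightarrow> x \<in> {-1..1} \<Longrightarrow> \<bar>pn n x\<bar> \<le> C * Ab n x \<and>
     \<bar>pd n x\<bar> \<le> C * sqrt (ev n) * Ab n x / sqrt (Xr n x) \<and> \<bar>poly (Dp n) x\<bar> \<le> C * sqrt (ev n) * Bb n x" using Dp_bounds by blast
  define G where "G = \<bar>\<beta> - \<alpha>\<bar> + \<bar>\<alpha> + \<beta>\<bar>"
  have G0: "G \<ge> 0" by (simp add: G_def)
  have off: "\<bar>Kj n x y\<bar> \<le> C^2 * (Ab n x * Ab n y) * (1 + (sqrt (dd x) + sqrt (dd y)) / \<bar>x - y\<bar>)"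
    if n: "n \<ge> 1" "ev n \<ge> L" and x: "x \<in> {-1..1}" and y: "y \<in> {-1..1}" and xy: "x \<noteq> y" for n x y
  proof -
    have ev: "ev n > 0" and N2: "N2 n > 0" using ev_pos N2_pos n by auto
    have A: "Ab n x > 0" "Ab n y > 0" using Ab_pos n x y by auto
    have dx: "sqrt (dd x) \<ge> 0" "sqrt (dd y) \<ge> 0" using x y by (auto simp: dd_def)
    let ?P = "C^2 * (Ab n x * Ab n y)"
    have P0: "?P \<ge> 0" using A by simp
    have pp: "\<bar>pn n x\<bar> * \<bar>pn n y\<bar> \<le> ?P"
      using mult_mono[of "\<bar>pn n x\<bar>" "C * Ab n x" "\<bar>pn n y\<bar>" "C * Ab n y"] b[OF n x] b[OF n y] C A by (simp add: power2_eq_square mult_ac)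
    have Db: "\<bar>poly (Dp n) u\<bar> \<le> C * sqrt (ev n) * (sqrt (dd u) * Ab n u)" if u: "u \<in> {-1..1}" for u
    proof (rule order_trans)
      show "\<bar>poly (Dp n) u\<bar> \<le> C * sqrt (ev n) * Bb n u" using b[OF n u] by blast
      show "C * sqrt (ev n) * Bb n u \<le> C * sqrt (ev n) * (sqrt (dd u) * Ab n u)"
        using Bb_le[OF n(1) u] C ev by (intro mult_left_mono) auto
    qed
    have Dx: "\<bar>poly (Dp n) x\<bar> * \<bar>pn n y\<bar> \<le> sqrt (ev n) * ?P * sqrt (dd x)"
      using mult_mono[OF Db[OF x], of "\<bar>pn n y\<bar>" "C * Ab n y"] b[OF n y] C A ev dx by (simp add: power2_eq_square mult_ac)
    have Dy: "\<bar>pn n x\<bar> * \<bar>poly (Dp n) y\<bar> \<le> sqrt (ev n) * ?P * sqrt (dd y)"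
      using mult_mono[OF _ Db[OF y], of "\<bar>pn n x\<bar>" "C * Ab n x"] b[OF n x] C A ev dx by (simp add: power2_eq_square mult_ac)
    have "N2 n * \<bar>x - y\<bar> * \<bar>Kj n x y\<bar> = \<bar>N1 n * (x - y) * (pn n x * pn n y) - (poly (Dp n) x * pn n y - pn n x * poly (Dp n) y)\<bar>"
      using N2 unfolding kernel_formula[OF n(1), symmetric] by (simp add: abs_mult)
    also have "\<dots> \<le> N1 n * \<bar>x - y\<bar> * (\<bar>pn n x\<bar> * \<bar>pn n y\<bar>) + (\<bar>poly (Dp n) x\<bar> * \<bar>pn n y\<bar> + \<bar>pn n x\<bar> * \<bar>poly (Dp n) y\<bar>)"
    proof -
      have "\<bar>N1 n * (x - y) * (pn n x * pn n y)\<bar> = N1 n * \<bar>x - y\<bar> * (\<bar>pn n x\<bar> * \<bar>pn n y\<bar>)"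
        using N1_bounds[OF n(1)] by (simp add: abs_mult)
      moreover have "\<bar>poly (Dp n) x * pn n y - pn n x * poly (Dp n) y\<bar> \<le> \<bar>poly (Dp n) x\<bar> * \<bar>pn n y\<bar> + \<bar>pn n x\<bar> * \<bar>poly (Dp n) y\<bar>"
        using abs_triangle_ineq4[of "poly (Dp n) x * pn n y" "pn n x * poly (Dp n) y"] by (simp add: abs_mult)
      ultimately show ?thesis
        using abs_triangle_ineq4[of "N1 n * (x - y) * (pn n x * pn n y)" "poly (Dp n) x * pn n y - pn n x * poly (Dp n) y"] by linarith
    qed
    also have "\<dots> \<le> N2 n * \<bar>x - y\<bar> * ?P + (sqrt (ev n) * ?P * sqrt (dd x) + sqrt (ev n) * ?P * sqrt (dd y))"
      using N1_bounds[OF n(1)] N2 P0 by (intro add_mono mult_mono pp Dx Dy) auto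
    also have "\<dots> \<le> N2 n * \<bar>x - y\<bar> * ?P + N2 n * ?P * (sqrt (dd x) + sqrt (dd y))"
    proof -
      have "sqrt (ev n) \<le> N2 n" using N2_ge[OF n(1)] ev real_sqrt_ge_zero[of "ev n"] by linarith
      then have "sqrt (ev n) * (?P * (sqrt (dd x) + sqrt (dd y))) \<le> N2 n * (?P * (sqrt (dd x) + sqrt (dd y)))"
        using P0 dx by (intro mult_right_mono) auto
      then show ?thesis by (simp add: algebra_simps)
    qed
    also have "\<dots> = N2 n * \<bar>x - y\<bar> * (?P * (1 + (sqrt (dd x) + sqrt (dd y)) / \<bar>x - y\<bar>))"
      using xy by (simp add: field_simps)
    finally show ?thesis using N2 xy by simp
  qed
  define B where "B = C^2 * (4 + G)"
  have diag: "Kj n x x \<le> B * sqrt (ev n) * (Ab n x)^2"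
    if n: "n \<ge> 1" "ev n \<ge> max L 1" and x: "x \<in> {-1..1}" for n x
  proof -
    have ev: "ev n \<ge> 1" and L: "ev n \<ge> L" and N2: "N2 n > 0" using N2_pos n by auto
    have A: "Ab n x > 0" using Ab_pos n x by auto
    have X: "Xr n x > 0" "1 / ev n \<le> Xr n x" "dd x \<le> Xr n x" "dd x \<ge> 0" using Xr_pos[OF n(1) x] x ev by (auto simp: Xr_def dd_def)
    note bb = b[OF n(1) L x]
    have p2: "(pn n x)^2 \<le> C^2 * (Ab n x)^2"
      using power_mono[of "\<bar>pn n x\<bar>" "C * Ab n x" 2] bb by (simp add: power_mult_distrib)
    have d2: "(pd n x)^2 \<le> C^2 * ev n * (Ab n x)^2 / Xr n x"
      using power_mono[of "\<bar>pd n x\<bar>" "C * sqrt (ev n) * Ab n x / sqrt (Xr n x)" 2] bb ev X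
      by (simp add: power_mult_distrib power_divide)
    have t1: "(1 - x^2) * (pd n x)^2 \<le> 2 * C^2 * ev n * (Ab n x)^2"
    proof -
      have "(1 - x^2) * (pd n x)^2 \<le> (2 * Xr n x) * (C^2 * ev n * (Ab n x)^2 / Xr n x)"
        using one_minus_square_le[OF x] X by (intro mult_mono d2) auto
      then show ?thesis using X by simp
    qed
    have sX: "1 / sqrt (Xr n x) \<le> sqrt (ev n)"
    proof -
      have "sqrt (1 / ev n) \<le> sqrt (Xr n x)" using X by simp
      then have "1 / sqrt (Xr n x) \<le> 1 / sqrt (1 / ev n)" using ev X by (intro divide_left_mono) auto
      then show ?thesis by (simp add: real_sqrt_divide)
    qed
    \<comment> \<open>Near the end points P_n' may exceed the order sqrt (\<open>ev n\<close>)
      relative to \<open>Ab\<close>; because \<open>Xr\<close> is at least 1/\<open>ev n\<close>,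
      the product still has order at most \<open>ev n\<close>.\<close>
    have t2: "\<bar>pn n x\<bar> * \<bar>pd n x\<bar> \<le> C^2 * ev n * (Ab n x)^2"
    proof -
      have "\<bar>pd n x\<bar> \<le> C * sqrt (ev n) * Ab n x * (1 / sqrt (Xr n x))" using bb by simp
      also have "\<dots> \<le> C * sqrt (ev n) * Ab n x * sqrt (ev n)" using sX C A ev by (intro mult_left_mono) auto
      also have "\<dots> = C * (sqrt (ev n) * sqrt (ev n)) * Ab n x" by simp
      also have "sqrt (ev n) * sqrt (ev n) = ev n" using ev by simp
      finally have "\<bar>pd n x\<bar> \<le> C * ev n * Ab n x" .
      then have "\<bar>pn n x\<bar> * \<bar>pd n x\<bar> \<le> (C * Ab n x) * (C * ev n * Ab n x)" using bb C A by (intro mult_mono) auto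
      then show ?thesis by (simp add: power2_eq_square mult_ac)
    qed
    have t3: "(\<beta> - \<alpha> - (\<alpha> + \<beta>) * x) * (pn n x * pd n x) \<le> G * (C^2 * ev n * (Ab n x)^2)"
    proof -
      have "\<bar>(\<alpha> + \<beta>) * x\<bar> \<le> \<bar>\<alpha> + \<beta>\<bar> * 1" unfolding abs_mult using x by (intro mult_left_mono) auto
      then have "\<bar>\<beta> - \<alpha> - (\<alpha> + \<beta>) * x\<bar> \<le> G"
        using abs_triangle_ineq4[of "\<beta> - \<alpha>" "(\<alpha> + \<beta>) * x"] by (simp add: G_def)
      then have "\<bar>\<beta> - \<alpha> - (\<alpha> + \<beta>) * x\<bar> * (\<bar>pn n x\<bar> * \<bar>pd n x\<bar>) \<le> G * (C^2 * ev n * (Ab n x)^2)"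
        using t2 G0 by (intro mult_mono[of _ G]) auto
      then show ?thesis using abs_ge_self[of "(\<beta> - \<alpha> - (\<alpha> + \<beta>) * x) * (pn n x * pd n x)"] by (simp add: abs_mult)
    qed
    have s1: "sqrt (ev n) \<ge> 1" using ev by simp
    have evN: "ev n \<le> N2 n * sqrt (ev n)"
    proof -
      have "ev n = sqrt (ev n) * sqrt (ev n)" using ev by simp
      also have "\<dots> \<le> N2 n * sqrt (ev n)"
      proof (rule mult_right_mono)
        show "sqrt (ev n) \<le> N2 n" using N2_ge[OF n(1)] s1 by linarith
      qed (use s1 in simp)
      finally show ?thesis .
    qed
    have t0: "N1 n * (pn n x)^2 \<le> N2 n * sqrt (ev n) * (C^2 * (Ab n x)^2)"
    proof -
      have "N1 n * (pn n x)^2 \<le> (N2 n * sqrt (ev n)) * (C^2 * (Ab n x)^2)"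
      proof (rule mult_mono)
        have "N2 n * 1 \<le> N2 n * sqrt (ev n)" using s1 N2 by (intro mult_left_mono) auto
        then show "N1 n \<le> N2 n * sqrt (ev n)" using N1_bounds[OF n(1)] by simp
      qed (use p2 N2 s1 in auto)
      then show ?thesis .
    qed
    have tE: "ev n * (C^2 * (Ab n x)^2) \<le> N2 n * sqrt (ev n) * (C^2 * (Ab n x)^2)" using evN by (intro mult_right_mono) auto
    have t4: "ev n * (pn n x)^2 \<le> ev n * (C^2 * (Ab n x)^2)" using p2 ev by (intro mult_left_mono) auto
    have "N2 n * Kj n x x \<le> N2 n * sqrt (ev n) * (C^2 * (Ab n x)^2) + (3 + G) * (ev n * (C^2 * (Ab n x)^2))"
      unfolding kernel_diag[OF n(1)] using t0 t1 t3 t4 by (simp add: algebra_simps)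
    also have "\<dots> \<le> N2 n * sqrt (ev n) * (C^2 * (Ab n x)^2) + (3 + G) * (N2 n * sqrt (ev n) * (C^2 * (Ab n x)^2))"
      using tE G0 by (intro add_left_mono mult_left_mono) auto
    also have "\<dots> = N2 n * (B * sqrt (ev n) * (Ab n x)^2)" by (simp add: B_def algebra_simps)
    finally show ?thesis using N2 by simp
  qed
  have B0: "B > 0" using C G0 by (simp add: B_def add_pos_nonneg)
  have cs: "\<bar>Kj n x y\<bar> \<le> B * sqrt (ev n) * (Ab n x * Ab n y)"
    if n: "n \<ge> 1" "ev n \<ge> max L 1" and x: "x \<in> {-1..1}" and y: "y \<in> {-1..1}" for n x y
  proof -
    have A: "Ab n x > 0" "Ab n y > 0" using Ab_pos n x y by auto
    have s: "sqrt (ev n) \<ge> 0" using n by simp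
    have "(Kj n x y)^2 \<le> Kj n x x * Kj n y y"
      using Cauchy_Schwarz_ineq_sum[of "\<lambda>j. pn j x" "\<lambda>j. pn j y" "{..n}"] by (simp add: Kj_sum power2_eq_square)
    also have "\<dots> \<le> (B * sqrt (ev n) * (Ab n x)^2) * (B * sqrt (ev n) * (Ab n y)^2)"
      using diag[OF n x] diag[OF n y] B0 s
      by (intro mult_mono) (auto simp: Kj_sum intro!: sum_nonneg)
    also have "\<dots> = (B * sqrt (ev n) * (Ab n x * Ab n y))^2" by (simp add: power2_eq_square mult_ac)
    finally show ?thesis using B0 s A by (simp add: abs_le_square_iff[symmetric])
  qed
  have CB: "C^2 \<le> B" using G0 mult_left_mono[of 1 "4 + G" "C^2"] by (simp add: B_def)
  have "(x \<noteq> y \<longrightarrow> \<bar>Kj n x y\<bar> \<le> B * (Ab n x * Ab n y) * (1 + (sqrt (dd x) + sqrt (dd y)) / \<bar>x - y\<bar>)) \<and>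
     \<bar>Kj n x y\<bar> \<le> B * sqrt (ev n) * (Ab n x * Ab n y)"
    if n: "n \<ge> 1" "ev n \<ge> max L 1" and x: "x \<in> {-1..1}" and y: "y \<in> {-1..1}" for n x y
  proof (intro conjI impI cs[OF that])
    assume xy: "x \<noteq> y"
    have A: "Ab n x > 0" "Ab n y > 0" using Ab_pos n x y by auto
    have dx: "sqrt (dd x) \<ge> 0" "sqrt (dd y) \<ge> 0" using x y by (auto simp: dd_def)
    have "\<bar>Kj n x y\<bar> \<le> C^2 * (Ab n x * Ab n y) * (1 + (sqrt (dd x) + sqrt (dd y)) / \<bar>x - y\<bar>)"
      using n by (intro off x y xy) auto
    also have "\<dots> \<le> B * (Ab n x * Ab n y) * (1 + (sqrt (dd x) + sqrt (dd y)) / \<bar>x - y\<bar>)"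
      using CB A dx by (intro mult_right_mono) auto
    finally show "\<bar>Kj n x y\<bar> \<le> B * (Ab n x * Ab n y) * (1 + (sqrt (dd x) + sqrt (dd y)) / \<bar>x - y\<bar>)" .
  qed
  then show ?thesis using B0 by (intro exI[of _ B] conjI exI[of _ "max L 1"]) auto
qed

lemma Ab_interior_bound:
  assumes "\<bar>a\<bar> < 1"
  shows "\<exists>K\<ge>1. \<forall>n\<ge>1. ev n \<ge> 1 \<longrightarrow> (Ab n a)^2 \<le> K"
proof -
  define r where "r = 2 / dd a"
  have d: "dd a > 0" "dd a \<le> 1" using assms by (auto simp: dd_def)
  have r: "r \<ge> 2" using d by (simp add: r_def field_simps)
  have "(Ab n a)^2 \<le> r powr \<bar>- (gm a + 1/2)\<bar>" if n: "n \<ge> 1" "ev n \<ge> 1" for n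
  proof -
    have "1 / ev n \<le> 1" "1 / ev n \<ge> 0" using n by auto
    then have X: "Xr n a \<ge> dd a" "Xr n a \<le> 2" using d unfolding Xr_def by linarith+
    have "Xr n a powr (- (gm a + 1/2)) \<le> r powr \<bar>- (gm a + 1/2)\<bar> * 1 powr (- (gm a + 1/2))"
    proof (rule powr_comparable)
      have "r * dd a \<le> r * Xr n a" using X r by (intro mult_left_mono) auto
      moreover have "r * dd a = 2" using d by (simp add: r_def)
      ultimately show "1 \<le> r * Xr n a" by linarith
    qed (use X r d in auto)
    moreover have "a \<in> {-1..1}" using assms by auto
    ultimately show ?thesis using Ab_square[of n a] n(1) by simp
  qed
  then show ?thesis using r by (intro exI[of _ "r powr \<bar>- (gm a + 1/2)\<bar>"]) (auto intro: ge_one_powr_ge_zero)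
qed

text \<open>In the interior the energy dominates, as the mixed term in \<open>kernel_diag\<close> is
  only of order sqrt (\<open>ev n\<close>). At an end point the mixed term has the order of the
  energy; there the differential equation determines P_n' from P_n and shows that the two do not
  cancel.\<close>

lemma kernel_lower:
  assumes a: "a \<in> {-1..1}"
  shows "\<exists>c>0. \<exists>L. \<forall>n\<ge>1. ev n \<ge> L \<longrightarrow> c * sqrt (ev n) * (Ab n a)^2 \<le> Kj n a a"
proof -
  obtain C1 where C1: "C1 > 0" "\<And>n. n \<ge> 1 \<Longrightarrow> ev n \<ge> max 1 Lc \<Longrightarrow> ev n \<le> C1 * e0 n" using e0_lower by blast
  define D where "D = 2 + \<bar>\<alpha> + \<beta> + 1\<bar>"
  have D0: "D > 0" by (simp add: D_def)
  show ?thesis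
  proof (cases "\<bar>a\<bar> < 1")
    case True
    obtain C L where C: "C > 0" and b: "\<And>n x. n \<ge> 1 \<Longrightarrow> ev n \<ge> L \<Longrightarrow> x \<in> {-1..1} \<Longrightarrow> \<bar>pn n x\<bar> \<le> C * Ab n x \<and>
      \<bar>pd n x\<bar> \<le> C * sqrt (ev n) * Ab n x / sqrt (Xr n x)" using jp_bounds by blast
    obtain K where K: "K \<ge> 1" "\<And>n. n \<ge> 1 \<Longrightarrow> ev n \<ge> 1 \<Longrightarrow> (Ab n a)^2 \<le> K" using Ab_interior_bound[OF True] by blast
    define G where "G = \<bar>\<beta> - \<alpha> - (\<alpha> + \<beta>) * a\<bar>"
    have d: "dd a > 0" using True by (simp add: dd_def)
    define q where "q = C1 * Cc * dd a powr (gm a + 1/2)"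
    have q: "q > 0" using C1 Cc_pos d by (simp add: q_def)
    define B where "B = G * (C^2 * K / sqrt (dd a))"
    have B0: "B \<ge> 0" using K d by (simp add: B_def G_def)
    \<comment> \<open>The last entry makes the mixed term at most half of the lower bound for the
      energy; \<open>Lc / dd a\<close> is what \<open>jp_energy_lower\<close> asks for at this
      point.\<close>
    define L2 where "L2 = max (max 1 L) (max (max Lc (Lc / dd a)) ((2 * q * B)^2))"
    have "(1 / (2 * q * D * K)) * sqrt (ev n) * (Ab n a)^2 \<le> Kj n a a" if n: "n \<ge> 1" "ev n \<ge> L2" for n
    proof -
      have ev: "ev n \<ge> 1" "ev n \<ge> L" "ev n \<ge> Lc" "ev n \<ge> Lc / dd a" "ev n \<ge> (2 * q * B)^2" using n by (auto simp: L2_def)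
      have X: "Xr n a > 0" "dd a \<le> Xr n a" using Xr_pos[OF n(1) a] ev by (auto simp: Xr_def)
      have evd: "ev n * dd a \<ge> Lc" using ev(4) d by (simp add: field_simps)
      have "ev n \<le> C1 * e0 n" using C1(2)[OF n(1)] ev by auto
      also have "\<dots> \<le> C1 * (Cc * Ejp n a * dd a powr (gm a + 1/2))"
        using C1(1) jp_energy_lower[OF n(1) True evd] by (intro mult_left_mono) auto
      also have "\<dots> = q * Ejp n a" by (simp add: q_def)
      finally have E: "ev n / q \<le> Ejp n a" using q by (simp add: field_simps)
      have pp: "\<bar>pn n a\<bar> * \<bar>pd n a\<bar> \<le> C^2 * K / sqrt (dd a) * sqrt (ev n)"
      proof -
        have "\<bar>pn n a\<bar> * \<bar>pd n a\<bar> \<le> (C * Ab n a) * (C * sqrt (ev n) * Ab n a / sqrt (Xr n a))"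
          using b[OF n(1) ev(2) a] C Ab_pos[OF n(1) a] by (intro mult_mono) auto
        also have "\<dots> = C^2 * (Ab n a)^2 * sqrt (ev n) / sqrt (Xr n a)" by (simp add: power2_eq_square)
        also have "\<dots> \<le> C^2 * K * sqrt (ev n) / sqrt (dd a)"
          using K(2)[OF n(1) ev(1)] K(1) X d ev by (intro frac_le mult_right_mono mult_left_mono) auto
        finally show ?thesis by simp
      qed
      have "(\<beta> - \<alpha> - (\<alpha> + \<beta>) * a) * (pn n a * pd n a) \<ge> - (G * (\<bar>pn n a\<bar> * \<bar>pd n a\<bar>))"
        using abs_ge_minus_self[of "(\<beta> - \<alpha> - (\<alpha> + \<beta>) * a) * (pn n a * pd n a)"] by (simp add: G_def abs_mult)
      moreover have "G * (\<bar>pn n a\<bar> * \<bar>pd n a\<bar>) \<le> G * (C^2 * K / sqrt (dd a) * sqrt (ev n))"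
        by (intro mult_left_mono pp) (simp add: G_def)
      ultimately have cr: "(\<beta> - \<alpha> - (\<alpha> + \<beta>) * a) * (pn n a * pd n a) \<ge> - (B * sqrt (ev n))" by (simp add: B_def mult_ac)
      have Bs: "B * sqrt (ev n) \<le> ev n / (2 * q)"
      proof -
        have "2 * q * B \<le> sqrt (ev n)" using ev(5) B0 q by (intro real_le_rsqrt)
        then have "(2 * q * B) * sqrt (ev n) \<le> sqrt (ev n) * sqrt (ev n)" using ev by (intro mult_right_mono) auto
        then show ?thesis using ev q by (simp add: field_simps)
      qed
      have N1p: "N1 n * (pn n a)^2 \<ge> 0" using N1_bounds[OF n(1)] by simp
      have "N2 n * Kj n a a \<ge> ev n / q - ev n / (2 * q)"
        unfolding kernel_diag[OF n(1)] using E cr Bs N1p unfolding Ejp_def by linarith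
      also have "ev n / q - ev n / (2 * q) = ev n / (2 * q)" by simp
      finally have 1: "ev n / (2 * q) \<le> N2 n * Kj n a a" .
      also have "\<dots> \<le> (D * sqrt (ev n)) * Kj n a a"
        using N2_le[OF n(1) ev(1)] by (intro mult_right_mono) (auto simp: D_def Kj_sum intro!: sum_nonneg)
      finally have "sqrt (ev n) * (sqrt (ev n) / (2 * q)) \<le> sqrt (ev n) * (D * Kj n a a)" using ev by (simp add: mult_ac)
      then have 2: "sqrt (ev n) / (2 * q) \<le> D * Kj n a a" using ev by (subst (asm) mult_le_cancel_left_pos) auto
      have "(1 / (2 * q * D * K)) * sqrt (ev n) * (Ab n a)^2 \<le> (1 / (2 * q * D * K)) * sqrt (ev n) * K"
        using K(2)[OF n(1) ev(1)] q D0 K(1) ev by (intro mult_left_mono) auto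
      also have "\<dots> = sqrt (ev n) / (2 * q) / D" using K(1) by simp
      also have "\<dots> \<le> Kj n a a" using divide_right_mono[OF 2, of D] D0 by simp
      finally show ?thesis .
    qed
    moreover have "1 / (2 * q * D * K) > 0" using q D0 K by simp
    ultimately show ?thesis by blast
  next
    case False
    then have a1: "a = 1 \<or> a = -1" using a by auto
    have g: "gm a + 1 > 0" using ab by (auto simp: gm_def)
    have "(1 / (C1 * Cc * D * (gm a + 1))) * sqrt (ev n) * (Ab n a)^2 \<le> Kj n a a" if n: "n \<ge> 1" "ev n \<ge> max 1 Lc" for n
    proof -
      have ev: "ev n \<ge> 1" "ev n \<ge> Lc" using n by auto
      \<comment> \<open>The coefficient 1 - x^2 vanishes at a, which leaves a first order
        relation.\<close>
      have ode: "2 * (gm a + 1) * pd n a = a * (ev n * pn n a)"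
        using a1 ode_jp[of a n] by (auto simp: gm_def algebra_simps)
      have coef: "(\<beta> - \<alpha> - (\<alpha> + \<beta>) * a) = - a * (2 * gm a)" using a1 by (auto simp: gm_def)
      have pdv: "pd n a = a * (ev n * pn n a) / (2 * (gm a + 1))" using ode g by (simp add: field_simps)
      have "(\<beta> - \<alpha> - (\<alpha> + \<beta>) * a) * (pn n a * pd n a) = - (gm a / (gm a + 1)) * (ev n * (pn n a)^2)"
      proof -
        have gen: "- a * (2 * u) * (P * (a * (e * P) / (2 * (u + 1)))) = - (a * a) * (u / (u + 1)) * (e * P^2)" if "u + 1 \<noteq> 0" for u P e :: real
          using that by (simp add: field_simps power2_eq_square)
        have "a * a = 1" using a1 by auto
        then show ?thesis unfolding coef pdv using gen[of "gm a"] g by simp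
      qed
      then have "N2 n * Kj n a a = N1 n * (pn n a)^2 + ev n * (pn n a)^2 * (1 - gm a / (gm a + 1))"
        unfolding kernel_diag[OF n(1)] using a1 by (auto simp: algebra_simps)
      \<comment> \<open>Positive for every exponent above -1: this is what survives of the energy
        after the mixed term is added.\<close>
      also have "1 - gm a / (gm a + 1) = 1 / (gm a + 1)" using g by (simp add: field_simps)
      finally have k: "N2 n * Kj n a a \<ge> ev n * (pn n a)^2 / (gm a + 1)" using N1_bounds[OF n(1)] by simp
      have A2: "(Ab n a)^2 = ev n powr (gm a + 1/2)"
      proof -
        have "Xr n a = 1 / ev n" using a1 by (auto simp: Xr_def dd_def)
        moreover have "(1 / ev n) powr (- k) = ev n powr k" for k using ev by (simp add: powr_divide powr_minus)
        ultimately show ?thesis unfolding Ab_square[OF n(1) a] by (simp only:)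
      qed
      have "ev n * (Ab n a)^2 \<le> (C1 * e0 n) * (Ab n a)^2" using C1(2)[OF n] by (intro mult_right_mono) auto
      also have "\<dots> = C1 * (ev n powr (gm a + 1/2) * e0 n)" unfolding A2 by simp
      also have "\<dots> \<le> C1 * (Cc * (ev n * (pn n a)^2))"
        using C1(1) jp_endpoint_lower[OF n(1) ev(2) a1] by (intro mult_left_mono) auto
      also have "\<dots> = (C1 * Cc * (gm a + 1)) * (ev n * (pn n a)^2 / (gm a + 1))" using g by simp
      also have "\<dots> \<le> (C1 * Cc * (gm a + 1)) * (N2 n * Kj n a a)" using k C1(1) Cc_pos g by (intro mult_left_mono) auto
      also have "\<dots> \<le> (C1 * Cc * (gm a + 1)) * ((D * sqrt (ev n)) * Kj n a a)"
        using N2_le[OF n(1) ev(1)] C1(1) Cc_pos g by (intro mult_left_mono mult_right_mono) (auto simp: D_def Kj_sum intro!: sum_nonneg)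
      also have "\<dots> = sqrt (ev n) * ((C1 * Cc * D * (gm a + 1)) * Kj n a a)" by simp
      also have "ev n * (Ab n a)^2 = sqrt (ev n) * (sqrt (ev n) * (Ab n a)^2)"
        using ev by (simp flip: mult.assoc)
      finally have "sqrt (ev n) * (sqrt (ev n) * (Ab n a)^2) \<le> sqrt (ev n) * ((C1 * Cc * D * (gm a + 1)) * Kj n a a)" .
      then have "sqrt (ev n) * (Ab n a)^2 \<le> (C1 * Cc * D * (gm a + 1)) * Kj n a a" using ev by (subst (asm) mult_le_cancel_left_pos) auto
      moreover have "1 / Q * s * t \<le> K" if "s * t \<le> Q * K" "Q > 0" for Q s t K :: real
        using that by (simp add: field_simps)
      ultimately show ?thesis using C1(1) Cc_pos D0 g by simp
    qed
    moreover have "1 / (C1 * Cc * D * (gm a + 1)) > 0" using C1(1) Cc_pos D0 g by simp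
    ultimately show ?thesis by blast
  qed
qed

end

section \<open>Bilinear forms of kernels\<close>

text \<open>Young's inequality, term by term after division by the two sums. The exponents add up to
  1, so block estimates can be summed without loss.\<close>

lemma holder_powr_sum:
  fixes u v :: "'a \<Rightarrow> real"
  assumes I: "finite I" and u: "\<And>i. i \<in> I \<Longrightarrow> u i \<ge> 0" and v: "\<And>i. i \<in> I \<Longrightarrow> v i \<ge> 0"
    and \<theta>: "0 < \<theta>" "\<theta> < 1"
  shows "(\<Sum>i\<in>I. u i powr \<theta> * v i powr (1 - \<theta>)) \<le> (\<Sum>i\<in>I. u i) powr \<theta> * (\<Sum>i\<in>I. v i) powr (1 - \<theta>)"
proof -
  define U where "U = (\<Sum>i\<in>I. u i)"
  define V where "V = (\<Sum>i\<in>I. v i)"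
  have UV: "U \<ge> 0" "V \<ge> 0" using u v by (auto simp: U_def V_def intro!: sum_nonneg)
  show ?thesis
  proof (cases "U = 0 \<or> V = 0")
    case True
    then have "\<And>i. i \<in> I \<Longrightarrow> u i powr \<theta> * v i powr (1 - \<theta>) = 0"
      using I u v unfolding U_def V_def by (auto simp: sum_nonneg_eq_0_iff)
    then have "(\<Sum>i\<in>I. u i powr \<theta> * v i powr (1 - \<theta>)) = 0" by (intro sum.neutral) auto
    then show ?thesis by simp
  next
    case False
    then have p: "U > 0" "V > 0" using UV by auto
    have "u i powr \<theta> * v i powr (1 - \<theta>) \<le> U powr \<theta> * V powr (1 - \<theta>) * (\<theta> * (u i / U) + (1 - \<theta>) * (v i / V))"
      if i: "i \<in> I" for i
    proof (cases "u i = 0 \<or> v i = 0")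
      case True
      have "0 \<le> \<theta> * (u i / U) + (1 - \<theta>) * (v i / V)" using u[OF i] v[OF i] p \<theta> by simp
      then have "0 \<le> U powr \<theta> * V powr (1 - \<theta>) * (\<theta> * (u i / U) + (1 - \<theta>) * (v i / V))" by simp
      then show ?thesis using True by auto
    next
      case False
      then have q: "u i > 0" "v i > 0" using u[OF i] v[OF i] by auto
      have "(u i / U) powr \<theta> * (v i / V) powr (1 - \<theta>) \<le> \<theta> * (u i / U) + (1 - \<theta>) * (v i / V)"
        using p q \<theta> by (intro Youngs_inequality_0) auto
      then have "U powr \<theta> * V powr (1 - \<theta>) * ((u i / U) powr \<theta> * (v i / V) powr (1 - \<theta>))
          \<le> U powr \<theta> * V powr (1 - \<theta>) * (\<theta> * (u i / U) + (1 - \<theta>) * (v i / V))"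
        by (intro mult_left_mono) auto
      moreover have "U powr \<theta> * V powr (1 - \<theta>) * ((u i / U) powr \<theta> * (v i / V) powr (1 - \<theta>)) = u i powr \<theta> * v i powr (1 - \<theta>)"
        using p q by (simp add: powr_divide)
      ultimately show ?thesis by simp
    qed
    then have "(\<Sum>i\<in>I. u i powr \<theta> * v i powr (1 - \<theta>))
       \<le> (\<Sum>i\<in>I. U powr \<theta> * V powr (1 - \<theta>) * (\<theta> * (u i / U) + (1 - \<theta>) * (v i / V)))" by (rule sum_mono)
    also have "\<dots> = U powr \<theta> * V powr (1 - \<theta>) * (\<theta> * (U / U) + (1 - \<theta>) * (V / V))"
    proof -
      have "(\<Sum>i\<in>I. \<theta> * (u i / U) + (1 - \<theta>) * (v i / V)) = \<theta> * (U / U) + (1 - \<theta>) * (V / V)"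
        by (simp only: sum.distrib sum_distrib_left[symmetric] sum_divide_distrib[symmetric] U_def[symmetric] V_def[symmetric])
      then show ?thesis by (simp only: sum_distrib_left[symmetric])
    qed
    also have "\<dots> = U powr \<theta> * V powr (1 - \<theta>)" using p by simp
    finally show ?thesis by (simp add: U_def V_def)
  qed
qed

lemma powr_product_le_max:
  fixes s t x y :: real
  assumes "s > 0" "t > 0" "x \<ge> 0" "y \<ge> 0" "x + y = 1"
  shows "s powr x * t powr y \<le> max s t"
proof -
  have "s powr x * t powr y \<le> max s t powr x * max s t powr y"
    using assms by (intro mult_mono powr_mono2) auto
  also have "\<dots> = max s t powr (x + y)" by (simp add: powr_add)
  also have "\<dots> = max s t" using assms by simp
  finally show ?thesis .
qed

text \<open>The two factors model \<open>Ab\<close> and \<open>Bb\<close>, with \<rho> for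
  1/\<open>ev n\<close> and b for half the exponent of the weight plus 1/4. The condition on u + v
  gives both sides the same degree of homogeneity at \<rho> = 0. For b \<ge> 0 the term \<rho> is
  dropped; for b < 0 both factors increase with their arguments, which are replaced by the larger
  one.\<close>

lemma product_kernel_bound:
  fixes s t \<rho> b u v :: real
  assumes st: "s > 0" "t > 0" and \<rho>: "\<rho> > 0" and b: "b > -1/4" and uv: "u \<ge> max b 0" "v \<ge> max b 0" "u + v = 2 * b + 1/2"
  shows "(s + \<rho>) powr (- b) * (t * (t + \<rho>) powr (- b - 1/2)) \<le> max s t * (s powr (- u) * t powr (- v))"
proof (cases "b \<ge> 0")
  case True
  have 1: "(s + \<rho>) powr (- b) \<le> s powr (- b)" using st \<rho> True by (intro powr_mono2') auto
  have 2: "t * (t + \<rho>) powr (- b - 1/2) \<le> t powr (1/2 - b)"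
  proof -
    have "t * (t + \<rho>) powr (- b - 1/2) \<le> t powr 1 * t powr (- b - 1/2)" using st \<rho> True by (intro mult_mono powr_mono2') auto
    also have "\<dots> = t powr (1 + (- b - 1/2))" by (simp only: powr_add)
    finally show ?thesis by (simp add: algebra_simps)
  qed
  have "(s + \<rho>) powr (- b) * (t * (t + \<rho>) powr (- b - 1/2)) \<le> s powr (- b) * t powr (1/2 - b)"
    using st \<rho> by (intro mult_mono 1 2) auto
  also have "\<dots> = (s powr (u - b) * t powr (v - b + 1/2)) * (s powr (- u) * t powr (- v))"
  proof -
    have "s powr (- b) = s powr (u - b) * s powr (- u)" "t powr (1/2 - b) = t powr (v - b + 1/2) * t powr (- v)"
      by (simp_all flip: powr_add)
    then show ?thesis by simp
  qed
  also have "\<dots> \<le> max s t * (s powr (- u) * t powr (- v))"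
    using st uv by (intro mult_right_mono powr_product_le_max) auto
  finally show ?thesis .
next
  case False
  define M where "M = max s t"
  have M: "M > 0" "s \<le> M" "t \<le> M" using st by (auto simp: M_def)
  define k where "k = b + 1/2"
  have k: "0 < k" "k < 1" using b False by (auto simp: k_def)
  have 1: "(s + \<rho>) powr (- b) \<le> (M + \<rho>) powr (- b)" using st \<rho> False M by (intro powr_mono2) auto
  have 2: "t * (t + \<rho>) powr (- k) \<le> M * (M + \<rho>) powr (- k)"
  proof -
    have e: "z * (z + \<rho>) powr (- k) = z powr (1 - k) * (z / (z + \<rho>)) powr k" if "z > 0" for z
      using that \<rho> by (simp add: powr_divide powr_minus powr_diff field_simps)
    have "t / (t + \<rho>) \<le> M / (M + \<rho>)" using st M \<rho> by (simp add: field_simps mult_left_mono)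
    then show ?thesis unfolding e[OF st(2)] e[OF M(1)] using st M k \<rho> by (intro mult_mono powr_mono2) auto
  qed
  have "(s + \<rho>) powr (- b) * (t * (t + \<rho>) powr (- k)) \<le> (M + \<rho>) powr (- b) * (M * (M + \<rho>) powr (- k))"
    using st by (intro mult_mono 1 2) auto
  also have "\<dots> = M * (M + \<rho>) powr (- (u + v))"
  proof -
    have "(M + \<rho>) powr (- b) * (M + \<rho>) powr (- k) = (M + \<rho>) powr (- b + - k)" by (simp only: powr_add)
    also have "- b + - k = - (u + v)" using uv by (simp add: k_def)
    finally show ?thesis by simp
  qed
  also have "\<dots> \<le> M * M powr (- (u + v))" using M \<rho> uv by (intro mult_left_mono powr_mono2') auto
  also have "M powr (- (u + v)) = M powr (- u) * M powr (- v)" by (simp flip: powr_add)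
  also have "M * (M powr (- u) * M powr (- v)) \<le> M * (s powr (- u) * t powr (- v))"
    using M st uv by (intro mult_left_mono mult_mono powr_mono2') auto
  finally show ?thesis by (simp add: k_def M_def)
qed

text \<open>The first set belongs to the inner variable y, the second to the outer variable
  x.\<close>

definition bilin :: "real measure \<Rightarrow> (real \<Rightarrow> real \<Rightarrow> real) \<Rightarrow> real set \<Rightarrow> real set \<Rightarrow> real" where
  "bilin M k E F = (\<integral>x. indicator F x * (\<integral>y. indicator E y * k x y \<partial>M) \<partial>M)"

text \<open>A qualitative bound: it secures integrability and passages to the limit and does not
  enter the constants that are uniform in n.\<close>

definition bkern :: "(real \<Rightarrow> real \<Rightarrow> real) \<Rightarrow> real \<Rightarrow> bool" where
  "bkern k B \<longleftrightarrow> case_prod k \<in> borel_measurable (borel \<Otimes>\<^sub>M borel) \<and> B \<ge> 0 \<and> (\<forall>x\<in>{-1..1}. \<forall>y\<in>{-1..1}. \<bar>k x y\<bar> \<le> B)"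

section \<open>Rules for the bilinear form\<close>

context jacobi
begin

context
  fixes k B assumes k: "bkern k B"
begin

lemma kern_meas: "case_prod k \<in> borel_measurable (borel \<Otimes>\<^sub>M borel)" using k by (simp add: bkern_def)

lemma kern_meas1: "(\<lambda>y. k x y) \<in> borel_measurable borel"
  using measurable_compose_Pair1[OF _ kern_meas, of x] by simp

lemma kern_inner_integrable:
  assumes "E \<in> sets borel" "x \<in> {-1..1}" shows "integrable \<mu> (\<lambda>y. indicator E y * k x y)"
proof (rule integrable_jmu_bounded[OF ab, of _ B])
  note kern_meas1[measurable]
  show "(\<lambda>y. indicator E y * k x y) \<in> borel_measurable borel" using assms(1) by measurable
  show "\<bar>indicator E y * k x y\<bar> \<le> B" if "y \<in> {-1..1}" for y
    using k assms(2) that by (auto simp: bkern_def indicator_def)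
qed

lemma kern_inner_meas:
  assumes [measurable]: "E \<in> sets borel" shows "(\<lambda>x. \<integral>y. indicator E y * k x y \<partial>\<mu>) \<in> borel_measurable borel"
proof (rule fin.borel_measurable_lebesgue_integral)
  note kern_meas[measurable]
  have "(\<lambda>(x, y). indicator E y * k x y) \<in> borel_measurable (borel \<Otimes>\<^sub>M borel)" by measurable
  then show "(\<lambda>(x, y). indicator E y * k x y) \<in> borel_measurable (borel \<Otimes>\<^sub>M \<mu>)"
    by (simp cong: measurable_cong_sets sets_pair_measure_cong)
qed

lemma kern_inner_bound:
  assumes [measurable]: "E \<in> sets borel" and x: "x \<in> {-1..1}"
  shows "\<bar>\<integral>y. indicator E y * k x y \<partial>\<mu>\<bar> \<le> B * measure \<mu> E"
proof -
  have "\<bar>\<integral>y. indicator E y * k x y \<partial>\<mu>\<bar> \<le> (\<integral>y. \<bar>indicator E y * k x y\<bar> \<partial>\<mu>)"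
    using integral_norm_bound[of \<mu> "\<lambda>y. indicator E y * k x y"] by simp
  also have "\<dots> \<le> (\<integral>y. B * indicator E y \<partial>\<mu>)"
  proof (rule integral_mono_AE)
    show "integrable \<mu> (\<lambda>y. \<bar>indicator E y * k x y\<bar>)" using kern_inner_integrable[OF assms] by simp
    show "integrable \<mu> (\<lambda>y. B * indicator E y)"
      by (rule integrable_mult_right[OF integrable_real_indicator]) (auto simp: fin.emeasure_finite less_top[symmetric])
    show "AE y in \<mu>. \<bar>indicator E y * k x y\<bar> \<le> B * indicator E y"
      by (rule eventually_mono[OF AE_jmu_Icc]) (use k x in \<open>auto simp: bkern_def indicator_def\<close>)
  qed
  finally show ?thesis by simp
qed

lemma kern_outer_integrable:
  assumes E [measurable]: "E \<in> sets borel" and F [measurable]: "F \<in> sets borel"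
  shows "integrable \<mu> (\<lambda>x. indicator F x * (\<integral>y. indicator E y * k x y \<partial>\<mu>))"
proof (rule integrable_jmu_bounded[OF ab, of _ "B * measure \<mu> E"])
  show "(\<lambda>x. indicator F x * (\<integral>y. indicator E y * k x y \<partial>\<mu>)) \<in> borel_measurable borel"
    using kern_inner_meas[OF E] by measurable
  show "\<bar>indicator F x * (\<integral>y. indicator E y * k x y \<partial>\<mu>)\<bar> \<le> B * measure \<mu> E" if "x \<in> {-1..1}" for x
    using kern_inner_bound[OF E that] k by (auto simp: indicator_def bkern_def)
qed

lemma bilin_le_nn:
  assumes [measurable]: "E \<in> sets borel" "F \<in> sets borel"
  shows "ennreal \<bar>bilin \<mu> k E F\<bar> \<le> (\<integral>\<^sup>+x\<in>F. (\<integral>\<^sup>+y\<in>E. ennreal \<bar>k x y\<bar> \<partial>\<mu>) \<partial>\<mu>)"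
proof -
  have "ennreal \<bar>bilin \<mu> k E F\<bar> \<le> (\<integral>\<^sup>+x. ennreal \<bar>indicator F x * (\<integral>y. indicator E y * k x y \<partial>\<mu>)\<bar> \<partial>\<mu>)"
    unfolding bilin_def using integral_norm_bound_ennreal[OF kern_outer_integrable[OF assms]] by simp
  also have "\<dots> \<le> (\<integral>\<^sup>+x\<in>F. (\<integral>\<^sup>+y\<in>E. ennreal \<bar>k x y\<bar> \<partial>\<mu>) \<partial>\<mu>)"
  proof (rule nn_integral_mono_AE, rule eventually_mono[OF AE_jmu_Icc])
    fix x :: real assume x: "x \<in> {-1..1}"
    have "ennreal \<bar>\<integral>y. indicator E y * k x y \<partial>\<mu>\<bar> \<le> (\<integral>\<^sup>+y. ennreal \<bar>indicator E y * k x y\<bar> \<partial>\<mu>)"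
      using integral_norm_bound_ennreal[OF kern_inner_integrable[OF assms(1) x]] by simp
    also have "\<dots> = (\<integral>\<^sup>+y\<in>E. ennreal \<bar>k x y\<bar> \<partial>\<mu>)"
      by (intro nn_integral_cong) (auto simp: indicator_def)
    finally show "ennreal \<bar>indicator F x * (\<integral>y. indicator E y * k x y \<partial>\<mu>)\<bar> \<le> (\<integral>\<^sup>+y\<in>E. ennreal \<bar>k x y\<bar> \<partial>\<mu>) * indicator F x"
      by (cases "x \<in> F") auto
  qed
  finally show ?thesis .
qed

text \<open>A majorant with separated variables reduces the double integral to two single
  ones.\<close>

lemma bilin_far:
  assumes [measurable]: "E \<in> sets borel" "F \<in> sets borel" "\<sigma> \<in> borel_measurable borel" "\<tau> \<in> borel_measurable borel"
    and C: "C \<ge> 0" "S \<ge> 0" "T \<ge> 0" and st: "\<And>x. \<sigma> x \<ge> 0" "\<And>x. \<tau> x \<ge> 0"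
    and kb: "\<And>x y. x \<in> {-1<..<1} \<Longrightarrow> y \<in> {-1<..<1} \<Longrightarrow> x \<in> F \<Longrightarrow> y \<in> E \<Longrightarrow> \<bar>k x y\<bar> \<le> C * (\<sigma> x * \<tau> y)"
    and S: "(\<integral>\<^sup>+x\<in>F. ennreal (\<sigma> x) \<partial>\<mu>) \<le> ennreal S" and T: "(\<integral>\<^sup>+y\<in>E. ennreal (\<tau> y) \<partial>\<mu>) \<le> ennreal T"
  shows "\<bar>bilin \<mu> k E F\<bar> \<le> C * (S * T)"
proof -
  have "ennreal \<bar>bilin \<mu> k E F\<bar> \<le> (\<integral>\<^sup>+x\<in>F. (\<integral>\<^sup>+y\<in>E. ennreal \<bar>k x y\<bar> \<partial>\<mu>) \<partial>\<mu>)" by (rule bilin_le_nn) measurable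
  also have "\<dots> \<le> (\<integral>\<^sup>+x. (ennreal (\<sigma> x) * indicator F x) * ennreal (C * T) \<partial>\<mu>)"
  proof (rule nn_integral_mono_AE, rule eventually_mono[OF AE_jmu_Ioo])
    fix x :: real assume x: "x \<in> {-1<..<1}"
    show "(\<integral>\<^sup>+y\<in>E. ennreal \<bar>k x y\<bar> \<partial>\<mu>) * indicator F x \<le> (ennreal (\<sigma> x) * indicator F x) * ennreal (C * T)"
    proof (cases "x \<in> F")
      case True
      have "(\<integral>\<^sup>+y\<in>E. ennreal \<bar>k x y\<bar> \<partial>\<mu>) \<le> (\<integral>\<^sup>+y. ennreal (C * \<sigma> x) * (ennreal (\<tau> y) * indicator E y) \<partial>\<mu>)"
      proof (rule nn_integral_mono_AE, rule eventually_mono[OF AE_jmu_Ioo])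
        fix y :: real assume y: "y \<in> {-1<..<1}"
        show "ennreal \<bar>k x y\<bar> * indicator E y \<le> ennreal (C * \<sigma> x) * (ennreal (\<tau> y) * indicator E y)"
        proof (cases "y \<in> E")
          case yE: True
          have "ennreal \<bar>k x y\<bar> \<le> ennreal ((C * \<sigma> x) * \<tau> y)"
            using kb[OF x y True yE] by (intro ennreal_leI) (simp add: mult.assoc)
          also have "\<dots> = ennreal (C * \<sigma> x) * ennreal (\<tau> y)" using C st by (intro ennreal_mult) auto
          finally show ?thesis using yE by simp
        qed simp
      qed
      also have "\<dots> = ennreal (C * \<sigma> x) * (\<integral>\<^sup>+y\<in>E. ennreal (\<tau> y) \<partial>\<mu>)" by (rule nn_integral_cmult) measurable
      also have "\<dots> \<le> ennreal (C * \<sigma> x) * ennreal T" by (intro mult_left_mono T) auto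
      also have "\<dots> = ennreal (\<sigma> x) * ennreal (C * T)"
        using C st by (simp add: ennreal_mult[symmetric] mult_ac)
      finally show ?thesis using True by simp
    qed simp
  qed
  also have "\<dots> = (\<integral>\<^sup>+x\<in>F. ennreal (\<sigma> x) \<partial>\<mu>) * ennreal (C * T)" by (rule nn_integral_multc) measurable
  also have "\<dots> \<le> ennreal S * ennreal (C * T)" by (intro mult_right_mono S) auto
  also have "\<dots> = ennreal (C * (S * T))" using C by (simp add: ennreal_mult[symmetric] mult_ac)
  finally show ?thesis using C by (simp add: ennreal_le_iff)
qed

lemma bilin_bound:
  assumes [measurable]: "E \<in> sets borel" "F \<in> sets borel"
  shows "\<bar>bilin \<mu> k E F\<bar> \<le> B * (measure \<mu> F * measure \<mu> E)"
proof (rule bilin_far[where \<sigma>="\<lambda>_. 1" and \<tau>="\<lambda>_. 1"])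
  show "(\<integral>\<^sup>+x\<in>F. ennreal 1 \<partial>\<mu>) \<le> ennreal (measure \<mu> F)" "(\<integral>\<^sup>+x\<in>E. ennreal 1 \<partial>\<mu>) \<le> ennreal (measure \<mu> E)"
    by (simp_all add: fin.emeasure_eq_measure)
qed (use k in \<open>auto simp: bkern_def\<close>)

lemma bilin_Un_E:
  assumes [measurable]: "E1 \<in> sets borel" "E2 \<in> sets borel" "F \<in> sets borel" and "E1 \<inter> E2 = {}"
  shows "bilin \<mu> k (E1 \<union> E2) F = bilin \<mu> k E1 F + bilin \<mu> k E2 F"
proof -
  have "bilin \<mu> k (E1 \<union> E2) F = (\<integral>x. indicator F x * (\<integral>y. indicator E1 y * k x y \<partial>\<mu>) + indicator F x * (\<integral>y. indicator E2 y * k x y \<partial>\<mu>) \<partial>\<mu>)"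
    unfolding bilin_def
  proof (rule integral_cong_AE)
    show "AE x in \<mu>. indicator F x * (\<integral>y. indicator (E1 \<union> E2) y * k x y \<partial>\<mu>) =
      indicator F x * (\<integral>y. indicator E1 y * k x y \<partial>\<mu>) + indicator F x * (\<integral>y. indicator E2 y * k x y \<partial>\<mu>)"
    proof (rule eventually_mono[OF AE_jmu_Icc])
      fix x :: real assume x: "x \<in> {-1..1}"
      have "indicator (E1 \<union> E2) y * k x y = indicator E1 y * k x y + indicator E2 y * k x y" for y
        using assms(4) by (auto simp: indicator_def)
      then have "(\<integral>y. indicator (E1 \<union> E2) y * k x y \<partial>\<mu>) = (\<integral>y. indicator E1 y * k x y \<partial>\<mu>) + (\<integral>y. indicator E2 y * k x y \<partial>\<mu>)"
        using kern_inner_integrable[OF assms(1) x] kern_inner_integrable[OF assms(2) x] by simp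
      then show "indicator F x * (\<integral>y. indicator (E1 \<union> E2) y * k x y \<partial>\<mu>) =
        indicator F x * (\<integral>y. indicator E1 y * k x y \<partial>\<mu>) + indicator F x * (\<integral>y. indicator E2 y * k x y \<partial>\<mu>)" by (simp add: algebra_simps)
    qed
  qed (use kern_inner_meas[of E1] kern_inner_meas[of E2] kern_inner_meas[of "E1 \<union> E2"] in measurable)
  then show ?thesis unfolding bilin_def using kern_outer_integrable assms(1-3) by simp
qed

end

lemma bilin_add:
  assumes k1: "bkern k1 B1" and k2: "bkern k2 B2" and [measurable]: "E \<in> sets borel" "F \<in> sets borel"
  shows "bilin \<mu> (\<lambda>x y. k1 x y + k2 x y) E F = bilin \<mu> k1 E F + bilin \<mu> k2 E F"
proof -
  have "bilin \<mu> (\<lambda>x y. k1 x y + k2 x y) E F = (\<integral>x. indicator F x * (\<integral>y. indicator E y * k1 x y \<partial>\<mu>) + indicator F x * (\<integral>y. indicator E y * k2 x y \<partial>\<mu>) \<partial>\<mu>)"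
    unfolding bilin_def
  proof (rule integral_cong_AE)
    have "(\<lambda>x. \<integral>y. indicator E y * (k1 x y + k2 x y) \<partial>\<mu>) \<in> borel_measurable borel"
    proof (rule kern_inner_meas)
      show "bkern (\<lambda>x y. k1 x y + k2 x y) (B1 + B2)" using k1 k2 unfolding bkern_def split_beta'
        by (auto intro!: order_trans[OF abs_triangle_ineq] add_mono)
    qed measurable
    then show "(\<lambda>x. indicator F x * (\<integral>y. indicator E y * (k1 x y + k2 x y) \<partial>\<mu>)) \<in> borel_measurable \<mu>" by measurable
    show "(\<lambda>x. indicator F x * (\<integral>y. indicator E y * k1 x y \<partial>\<mu>) + indicator F x * (\<integral>y. indicator E y * k2 x y \<partial>\<mu>)) \<in> borel_measurable \<mu>"
      using kern_inner_meas[OF k1, of E] kern_inner_meas[OF k2, of E] by measurable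
    show "AE x in \<mu>. indicator F x * (\<integral>y. indicator E y * (k1 x y + k2 x y) \<partial>\<mu>) =
      indicator F x * (\<integral>y. indicator E y * k1 x y \<partial>\<mu>) + indicator F x * (\<integral>y. indicator E y * k2 x y \<partial>\<mu>)"
    proof (rule eventually_mono[OF AE_jmu_Icc])
      fix x :: real assume x: "x \<in> {-1..1}"
      have "(\<integral>y. indicator E y * (k1 x y + k2 x y) \<partial>\<mu>) = (\<integral>y. indicator E y * k1 x y \<partial>\<mu>) + (\<integral>y. indicator E y * k2 x y \<partial>\<mu>)"
        unfolding distrib_left using kern_inner_integrable[OF k1 assms(3) x] kern_inner_integrable[OF k2 assms(3) x] by simp
      then show "indicator F x * (\<integral>y. indicator E y * (k1 x y + k2 x y) \<partial>\<mu>) =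
        indicator F x * (\<integral>y. indicator E y * k1 x y \<partial>\<mu>) + indicator F x * (\<integral>y. indicator E y * k2 x y \<partial>\<mu>)" by (simp add: algebra_simps)
    qed
  qed
  then show ?thesis unfolding bilin_def using kern_outer_integrable[OF k1] kern_outer_integrable[OF k2] assms(3,4) by simp
qed

lemma bilin_cmult: "bilin \<mu> (\<lambda>x y. c * k x y) E F = c * bilin \<mu> k E F"
proof -
  have "indicator F x * (\<integral>y. indicator E y * (c * k x y) \<partial>\<mu>) = c * (indicator F x * (\<integral>y. indicator E y * k x y \<partial>\<mu>))" for x
  proof -
    have "(\<integral>y. indicator E y * (c * k x y) \<partial>\<mu>) = c * (\<integral>y. indicator E y * k x y \<partial>\<mu>)"
      by (subst integral_mult_right_zero[symmetric]) (simp add: mult_ac)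
    then show ?thesis by simp
  qed
  then show ?thesis unfolding bilin_def by (simp only: integral_mult_right_zero)
qed

end

section \<open>Dyadic blocks and singular kernels\<close>

definition lev :: "real \<Rightarrow> nat" where "lev x = nat \<lfloor>- log 2 (dd x)\<rfloor>"
text \<open>Numbered by all integers so that adjacent blocks have adjacent numbers: the blocks 0 and
  -1 meet at the origin.\<close>

definition blk :: "real \<Rightarrow> int" where "blk x = (if x \<ge> 0 then int (lev x) else - int (lev x) - 1)"
definition tau :: "int \<Rightarrow> real" where "tau i = (1/2) ^ (nat (if i \<ge> 0 then i else - i - 1))"

lemma dd_range: "\<bar>x\<bar> < 1 \<Longrightarrow> 0 < dd x \<and> dd x \<le> 1" by (simp add: dd_def)

lemma lev_bounds:
  assumes "\<bar>x\<bar> < 1"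
  shows "(1/2) ^ Suc (lev x) < dd x" "dd x \<le> (1/2) ^ lev x"
proof -
  have d: "0 < dd x" "dd x \<le> 1" using dd_range[OF assms] by auto
  define l where "l = - log 2 (dd x)"
  have l0: "l \<ge> 0" using d by (simp add: l_def)
  have L: "real (lev x) \<le> l" "l < real (lev x) + 1"
    using l0 by (simp_all add: lev_def l_def[symmetric])
  have dl: "dd x = 2 powr (- l)" using d by (simp add: l_def)
  have p: "(1/2) ^ k = 2 powr (- real k)" for k :: nat by (simp add: powr_minus powr_realpow power_one_over inverse_eq_divide)
  show "(1/2) ^ Suc (lev x) < dd x" unfolding p dl using L by simp
  show "dd x \<le> (1/2) ^ lev x" unfolding p dl using L by simp
qed

lemma lev_measurable [measurable]: "lev \<in> measurable borel (count_space UNIV)"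
  unfolding lev_def by measurable

lemma blk_measurable [measurable]: "blk \<in> measurable borel (count_space UNIV)"
proof -
  have "Measurable.pred borel (\<lambda>x::real. x \<ge> 0)" by measurable
  then show ?thesis unfolding blk_def by (intro measurable_If) measurable
qed

text \<open>A neighbour can lie on the other side of the origin only for the blocks 0 and -1. There
  \<open>tau\<close> is 1, so that the exponent to which it is raised makes no difference.\<close>

lemma near_dd:
  assumes x: "\<bar>x\<bar> < 1" and n: "\<bar>blk x - i\<bar> \<le> 1"
  shows "tau i / 4 \<le> dd x" "dd x \<le> 2 * tau i" "(x \<ge> 0) = (i \<ge> 0) \<or> tau i = 1"
proof -
  note l = lev_bounds[OF x]
  define j where "j = nat (if i \<ge> 0 then i else - i - 1)"
  have "((x \<ge> 0) = (i \<ge> 0) \<and> (lev x = j \<or> lev x = Suc j \<or> Suc (lev x) = j)) \<or> (j = 0 \<and> lev x = 0)"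
    using n unfolding blk_def j_def by (auto split: if_splits)
  then have "tau i / 4 \<le> dd x \<and> dd x \<le> 2 * tau i \<and> ((x \<ge> 0) = (i \<ge> 0) \<or> tau i = 1)"
    using l unfolding tau_def j_def[symmetric] by (auto simp: field_simps)
  then show "tau i / 4 \<le> dd x" "dd x \<le> 2 * tau i" "(x \<ge> 0) = (i \<ge> 0) \<or> tau i = 1" by auto
qed

lemma tau_pos: "tau i > 0" "tau i \<le> 1" by (simp_all add: tau_def power_le_one)

text \<open>Levels that differ by at least two force a factor two between the distances to the end
  point. On opposite sides one of the points has level at least 1 and is therefore at least 1/2 away
  from the origin.\<close>

lemma far_distance:
  assumes x: "\<bar>x\<bar> < 1" and y: "\<bar>y\<bar> < 1" and f: "\<bar>blk x - blk y\<bar> \<ge> 2"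
  shows "(x \<ge> 0) = (y \<ge> 0) \<Longrightarrow> max (dd x) (dd y) \<le> 2 * \<bar>x - y\<bar>"
    and "(x \<ge> 0) \<noteq> (y \<ge> 0) \<Longrightarrow> 1/2 \<le> \<bar>x - y\<bar>"
proof -
  note lx = lev_bounds[OF x] and ly = lev_bounds[OF y]
  have dec: "(1/2::real) ^ b \<le> (1/2) ^ a" if "a \<le> b" for a b using that by (intro power_decreasing) auto
  show "max (dd x) (dd y) \<le> 2 * \<bar>x - y\<bar>" if s: "(x \<ge> 0) = (y \<ge> 0)"
  proof -
    have e: "\<bar>x - y\<bar> = \<bar>dd x - dd y\<bar>" using s by (auto simp: dd_def)
    have "lev x + 2 \<le> lev y \<or> lev y + 2 \<le> lev x" using f s by (auto simp: blk_def split: if_splits)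
    then show ?thesis
    proof
      assume "lev x + 2 \<le> lev y"
      then have "dd y \<le> (1/2) ^ (lev x + 2)" using ly(2) dec[of "lev x + 2" "lev y"] by linarith
      then have "2 * dd y \<le> dd x" using lx(1) by simp
      then show ?thesis unfolding e using dd_range[OF x] dd_range[OF y] by auto
    next
      assume "lev y + 2 \<le> lev x"
      then have "dd x \<le> (1/2) ^ (lev y + 2)" using lx(2) dec[of "lev y + 2" "lev x"] by linarith
      then have "2 * dd x \<le> dd y" using ly(1) by simp
      then show ?thesis unfolding e using dd_range[OF x] dd_range[OF y] by auto
    qed
  qed
  show "1/2 \<le> \<bar>x - y\<bar>" if s: "(x \<ge> 0) \<noteq> (y \<ge> 0)"
  proof -
    have "lev x \<ge> 1 \<or> lev y \<ge> 1" using f s by (auto simp: blk_def split: if_splits)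
    then have "dd x \<le> 1/2 \<or> dd y \<le> 1/2" using lx(2) ly(2) dec[of 1 "lev x"] dec[of 1 "lev y"] by auto
    then show ?thesis using s by (auto simp: dd_def)
  qed
qed

text \<open>The inequalities say that the power in \<open>Ab\<close> does not exceed the critical
  one at either end point. The condition \<theta> \<le> 1/2 matches p \<ge> 2 in
  \<open>restricted_conj_poisson\<close> and gives the same inequalities for 1 - \<theta>.\<close>

locale jacobi_exp = jacobi +
  fixes \<theta> :: real
  assumes \<theta>: "0 < \<theta>" "\<theta> \<le> 1/2"
    and \<theta>a: "\<alpha> / 2 + 1/4 \<le> \<theta> * (\<alpha> + 1)" and \<theta>b: "\<beta> / 2 + 1/4 \<le> \<theta> * (\<beta> + 1)"
begin

section \<open>Sizes on a block and its neighbours\<close>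

definition gmi where "gmi (i::int) = (if i \<ge> 0 then \<alpha> else \<beta>)"
definition Kw where "Kw = 8 powr (\<bar>\<alpha>\<bar> + \<bar>\<beta>\<bar>)"
definition KA where "KA = 8 powr (\<bar>\<alpha> / 2 + 1/4\<bar> + \<bar>\<beta> / 2 + 1/4\<bar>)"
definition Ai where "Ai n i = (tau i + 1 / ev n) powr (- (gmi i / 2 + 1/4))"

lemma Kw: "Kw \<ge> 1" unfolding Kw_def by (rule ge_one_powr_ge_zero) auto
lemma KA: "KA \<ge> 1" unfolding KA_def by (rule ge_one_powr_ge_zero) auto

lemma near_w:
  assumes x: "\<bar>x\<bar> < 1" and n: "\<bar>blk x - i\<bar> \<le> 1"
  shows "jw \<alpha> \<beta> x \<le> Kw * tau i powr gmi i" "tau i powr gmi i \<le> Kw * jw \<alpha> \<beta> x"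
proof -
  note nd = near_dd[OF x n]
  have d: "0 < dd x" "dd x \<le> 1" using dd_range[OF x] by auto
  define g where "g = gm x"
  define g' where "g' = (if x \<ge> 0 then \<beta> else \<alpha>)"
  have jw: "jw \<alpha> \<beta> x = dd x powr g * (2 - dd x) powr g'"
    using x by (auto simp: jw_def dd_def g_def g'_def gm_def)
  have gi: "gmi i = g \<or> tau i = 1" using nd(3) by (auto simp: gmi_def g_def gm_def)
  have abs: "\<bar>g\<bar> + \<bar>g'\<bar> = \<bar>\<alpha>\<bar> + \<bar>\<beta>\<bar>" by (auto simp: g_def g'_def gm_def)
  have c1: "dd x powr g \<le> 4 powr \<bar>g\<bar> * tau i powr gmi i" "tau i powr gmi i \<le> 4 powr \<bar>g\<bar> * dd x powr g"
  proof -
    have t: "tau i powr gmi i = tau i powr g" using gi by auto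
    show "dd x powr g \<le> 4 powr \<bar>g\<bar> * tau i powr gmi i" "tau i powr gmi i \<le> 4 powr \<bar>g\<bar> * dd x powr g"
      unfolding t using nd tau_pos[of i] d by (intro powr_comparable; simp)+
  qed
  have c2: "(2 - dd x) powr g' \<le> 2 powr \<bar>g'\<bar>" "1 \<le> 2 powr \<bar>g'\<bar> * (2 - dd x) powr g'"
    using powr_comparable[of 1 "2 - dd x" 2 g'] powr_comparable[of "2 - dd x" 1 2 g'] d by auto
  have K: "4 powr \<bar>g\<bar> * 2 powr \<bar>g'\<bar> \<le> Kw"
  proof -
    have "4 powr \<bar>g\<bar> * 2 powr \<bar>g'\<bar> \<le> 8 powr \<bar>g\<bar> * 8 powr \<bar>g'\<bar>" by (intro mult_mono powr_mono2) auto
    then show ?thesis by (simp add: Kw_def abs[symmetric] powr_add)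
  qed
  have t0: "tau i powr gmi i \<ge> 0" by simp
  have "jw \<alpha> \<beta> x \<le> (4 powr \<bar>g\<bar> * tau i powr gmi i) * 2 powr \<bar>g'\<bar>"
    unfolding jw by (intro mult_mono c1 c2) auto
  also have "\<dots> = (4 powr \<bar>g\<bar> * 2 powr \<bar>g'\<bar>) * tau i powr gmi i" by simp
  also have "\<dots> \<le> Kw * tau i powr gmi i" by (intro mult_right_mono K t0)
  finally show "jw \<alpha> \<beta> x \<le> Kw * tau i powr gmi i" .
  have "tau i powr gmi i * 1 \<le> (4 powr \<bar>g\<bar> * dd x powr g) * (2 powr \<bar>g'\<bar> * (2 - dd x) powr g')"
    by (intro mult_mono c1 c2) auto
  also have "\<dots> = (4 powr \<bar>g\<bar> * 2 powr \<bar>g'\<bar>) * jw \<alpha> \<beta> x" by (simp add: jw)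
  also have "\<dots> \<le> Kw * jw \<alpha> \<beta> x" by (intro mult_right_mono K jw_nonneg)
  finally show "tau i powr gmi i \<le> Kw * jw \<alpha> \<beta> x" by simp
qed

lemma near_Ab:
  assumes m: "m \<ge> 1" "ev m \<ge> 1" and x: "\<bar>x\<bar> < 1" and n: "\<bar>blk x - i\<bar> \<le> 1"
  shows "Ab m x \<le> KA * Ai m i" "Bb m x \<le> 4 * KA * (tau i * Ai m i / sqrt (tau i + 1 / ev m))"
proof -
  note nd = near_dd[OF x n]
  have d: "0 < dd x" "dd x \<le> 1" using dd_range[OF x] by auto
  have e: "0 < 1 / ev m" "1 / ev m \<le> 1" using m by auto
  define Y where "Y = tau i + 1 / ev m"
  have Y: "Y > 0" using tau_pos[of i] e unfolding Y_def by linarith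
  have gen: "u + r \<le> 4 * (t + r) \<and> t + r \<le> 4 * (u + r) \<and> u + r > 0"
    if "0 < r" "t / 4 \<le> u" "u \<le> 2 * t" "0 < u" "0 < t" for r t u :: real using that by auto
  have X: "Xr m x \<le> 4 * Y" "Y \<le> 4 * Xr m x" "Xr m x > 0"
    using gen[OF e(1) nd(1,2) d(1) tau_pos(1)[of i]] unfolding Xr_def Y_def by blast+
  define b where "b = gm x / 2 + 1/4"
  define b' where "b' = (if x \<ge> 0 then \<beta> else \<alpha>) / 2 + 1/4"
  have abs: "\<bar>b\<bar> + \<bar>b'\<bar> = \<bar>\<alpha> / 2 + 1/4\<bar> + \<bar>\<beta> / 2 + 1/4\<bar>" by (auto simp: b_def b'_def gm_def)
  have "Ab m x \<le> 4 powr \<bar>b\<bar> * Y powr (- b)"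
    unfolding Ab_def b_def[symmetric] using powr_comparable[of Y "Xr m x" 4 "- b"] X Y by simp
  also have "Y powr (- b) \<le> 2 powr (\<bar>b\<bar> + \<bar>b'\<bar>) * Ai m i"
  proof (cases "gmi i = gm x")
    case True
    then have "Ai m i = Y powr (- b)" by (simp add: Ai_def Y_def b_def)
    moreover have "1 \<le> 2 powr (\<bar>b\<bar> + \<bar>b'\<bar>)" by (rule ge_one_powr_ge_zero) auto
    ultimately show ?thesis using mult_right_mono[of 1 "2 powr (\<bar>b\<bar> + \<bar>b'\<bar>)" "Y powr (- b)"] by simp
  next
    case False
    then have t: "tau i = 1" and gi: "gmi i / 2 + 1/4 = b'" using nd(3) by (auto simp: gmi_def gm_def b'_def)
    have Y2: "1 \<le> Y" "Y \<le> 2" using t e by (auto simp: Y_def)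
    have 1: "Y powr (- b) \<le> 2 powr \<bar>b\<bar>" using powr_comparable[of 1 Y 2 "- b"] Y2 by simp
    have 2: "1 \<le> 2 powr \<bar>b'\<bar> * Y powr (- b')" using powr_comparable[of Y 1 2 "- b'"] Y2 by simp
    have "Y powr (- b) * 1 \<le> 2 powr \<bar>b\<bar> * (2 powr \<bar>b'\<bar> * Y powr (- b'))" by (intro mult_mono 1 2) auto
    then show ?thesis by (simp add: Ai_def gi Y_def[symmetric] powr_add)
  qed
  also have "4 powr \<bar>b\<bar> * (2 powr (\<bar>b\<bar> + \<bar>b'\<bar>) * Ai m i) \<le> KA * Ai m i"
  proof -
    have "4 powr \<bar>b\<bar> * 2 powr (\<bar>b\<bar> + \<bar>b'\<bar>) \<le> 4 powr (\<bar>b\<bar> + \<bar>b'\<bar>) * 2 powr (\<bar>b\<bar> + \<bar>b'\<bar>)"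
      by (intro mult_right_mono powr_mono) auto
    also have "\<dots> = KA" by (simp add: KA_def abs powr_mult[symmetric])
    finally show ?thesis using mult_right_mono[of "4 powr \<bar>b\<bar> * 2 powr (\<bar>b\<bar> + \<bar>b'\<bar>)" KA "Ai m i"]
      by (simp add: Ai_def mult.assoc)
  qed
  finally show A: "Ab m x \<le> KA * Ai m i" by simp
  have s: "sqrt Y / 2 \<le> sqrt (Xr m x)" using real_sqrt_le_mono[OF X(2)] by (simp add: real_sqrt_mult)
  have "Bb m x \<le> (2 * tau i) * (KA * Ai m i) / (sqrt Y / 2)"
    unfolding Bb_def
  proof (intro frac_le mult_mono)
    show "0 \<le> Ab m x" by (simp add: Ab_def)
    show "0 \<le> 2 * tau i * (KA * Ai m i)" using tau_pos[of i] KA by (simp add: Ai_def)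
  qed (use nd d A s Y tau_pos[of i] in auto)
  then show "Bb m x \<le> 4 * KA * (tau i * Ai m i / sqrt (tau i + 1 / ev m))" by (simp add: Y_def mult_ac)
qed

text \<open>This cancellation makes the block estimate uniform in block and degree: on a block the
  bounds for P_n and for (1 - x^2) P_n' / sqrt (\<open>ev n\<close>) multiply to at most the inverse
  of the weight.\<close>

lemma near_product:
  assumes m: "m \<ge> 1" "ev m \<ge> 1"
  shows "Ai m i * (tau i * Ai m i / sqrt (tau i + 1 / ev m)) * tau i powr gmi i \<le> 1"
proof -
  define Y where "Y = tau i + 1 / ev m"
  have e: "0 < 1 / ev m" using m by auto
  have t: "tau i > 0" by (rule tau_pos)
  have Y: "Y > 0" "tau i \<le> Y" using t e unfolding Y_def by linarith+
  have g: "gmi i + 1 > 0" using ab by (auto simp: gmi_def)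
  have "Ai m i * (tau i * Ai m i / sqrt Y) = tau i * (Y powr (- (gmi i / 2 + 1/4)) * Y powr (- (gmi i / 2 + 1/4)) * Y powr (- (1/2)))"
    using Y by (simp add: Ai_def Y_def[symmetric] powr_minus powr_half_sqrt field_simps)
  also have "\<dots> = tau i * Y powr (- (gmi i + 1))" unfolding powr_add[symmetric]
    by (rule arg_cong[where f="\<lambda>k. tau i * Y powr k"]) simp
  also have "\<dots> \<le> tau i * tau i powr (- (gmi i + 1))" using Y t g by (intro mult_left_mono powr_mono2') auto
  finally have "Ai m i * (tau i * Ai m i / sqrt Y) * tau i powr gmi i \<le> tau i * tau i powr (- (gmi i + 1)) * tau i powr gmi i"
    by (intro mult_right_mono) auto
  also have "\<dots> = tau i powr (1 + (- (gmi i + 1)) + gmi i)" using t by (simp only: powr_add powr_one[OF less_imp_le[OF t]])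
  also have "\<dots> = 1" using t by simp
  finally show ?thesis by (simp add: Y_def)
qed

lemma Ab_le_sg:
  assumes m: "m \<ge> 1" "ev m \<ge> 1" and x: "\<bar>x\<bar> < 1" and t: "gm x / 2 + 1/4 \<le> t * (gm x + 1)" "t \<ge> 0"
  shows "Ab m x \<le> KA * sg t x"
proof -
  define b where "b = gm x / 2 + 1/4"
  have d: "0 < dd x" "dd x \<le> 1" using dd_range[OF x] by auto
  have e: "0 < 1 / ev m" "1 / ev m \<le> 1" using m by auto
  have g: "gm x + 1 \<ge> 0" using ab by (auto simp: gm_def)
  have X: "dd x \<le> Xr m x" "Xr m x \<le> 2" "Xr m x > 0" using d e unfolding Xr_def by linarith+
  have s1: "sg t x \<ge> 1" unfolding sg_def using d t g powr_mono'[of "- (t * (gm x + 1))" 0 "dd x"] by simp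
  show ?thesis
  proof (cases "b \<ge> 0")
    case True
    have "Ab m x \<le> dd x powr (- b)" unfolding Ab_def b_def[symmetric] using X d True by (intro powr_mono2') auto
    also have "\<dots> \<le> sg t x" unfolding sg_def using d t by (intro powr_mono') (auto simp: b_def)
    also have "\<dots> \<le> KA * sg t x" using mult_right_mono[OF KA, of "sg t x"] s1 by simp
    finally show ?thesis .
  next
    case False
    have "Ab m x \<le> 2 powr (- b)" unfolding Ab_def b_def[symmetric] using X False by (intro powr_mono2) auto
    also have "\<dots> \<le> 8 powr (- b)" using False by (intro powr_mono2) auto
    also have "\<dots> \<le> KA" unfolding KA_def using False by (intro powr_mono) (auto simp: b_def gm_def)
    also have "\<dots> \<le> KA * sg t x" using mult_left_mono[OF s1, of KA] KA by simp
    finally show ?thesis .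
  qed
qed

lemma gm_\<theta>: "gm x / 2 + 1/4 \<le> \<theta> * (gm x + 1)" "gm x / 2 + 1/4 \<le> (1 - \<theta>) * (gm x + 1)"
  "0 \<le> \<theta> * (gm x + 1)" "0 \<le> (1 - \<theta>) * (gm x + 1)"
proof -
  have g: "gm x + 1 > 0" using ab by (auto simp: gm_def)
  show 1: "gm x / 2 + 1/4 \<le> \<theta> * (gm x + 1)" using \<theta>a \<theta>b by (auto simp: gm_def)
  have "\<theta> * (gm x + 1) \<le> (1 - \<theta>) * (gm x + 1)" using g \<theta> by (intro mult_right_mono) auto
  then show "gm x / 2 + 1/4 \<le> (1 - \<theta>) * (gm x + 1)" using 1 by linarith
  show "0 \<le> \<theta> * (gm x + 1)" "0 \<le> (1 - \<theta>) * (gm x + 1)" using g \<theta> by auto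
qed

lemma Ab_Ab_le:
  assumes m: "m \<ge> 1" "ev m \<ge> 1" and x: "\<bar>x\<bar> < 1" and y: "\<bar>y\<bar> < 1"
  shows "Ab m x * Ab m y \<le> KA^2 * (sg \<theta> x * sg (1 - \<theta>) y)"
proof -
  have "Ab m x * Ab m y \<le> (KA * sg \<theta> x) * (KA * sg (1 - \<theta>) y)"
    using KA \<theta> gm_\<theta> by (intro mult_mono Ab_le_sg m x y) (auto simp: Ab_def sg_def)
  then show ?thesis by (simp add: power2_eq_square mult_ac)
qed

text \<open>On opposite sides |x - y| is at least 1/2 and \<open>Bb\<close> is estimated by
  \<open>Ab\<close>. On the same side \<open>product_kernel_bound\<close> applies, and the larger of
  the distances to the end point is at most 2 |x - y|.\<close>

lemma far_bound:
  assumes m: "m \<ge> 1" "ev m \<ge> 1" and x: "\<bar>x\<bar> < 1" and y: "\<bar>y\<bar> < 1" and f: "\<bar>blk x - blk y\<bar> \<ge> 2"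
  shows "Ab m x * Bb m y \<le> \<bar>x - y\<bar> * (2 * KA^2 * (sg \<theta> x * sg (1 - \<theta>) y))"
    and "Bb m x * Ab m y \<le> \<bar>x - y\<bar> * (2 * KA^2 * (sg \<theta> x * sg (1 - \<theta>) y))"
proof -
  have d: "0 < dd x" "dd x \<le> 1" "0 < dd y" "dd y \<le> 1" using dd_range[OF x] dd_range[OF y] by auto
  have e: "0 < 1 / ev m" using m by auto
  have xy: "x \<in> {-1..1}" "y \<in> {-1..1}" using x y by auto
  have sg0: "sg \<theta> x \<ge> 0" "sg (1 - \<theta>) y \<ge> 0" by (auto simp: sg_def)
  have KA2: "1 \<le> KA^2" using KA by simp
  have Bb': "Bb m z = dd z * (dd z + 1 / ev m) powr (- (gm z / 2 + 1/4) - 1/2)" if "\<bar>z\<bar> < 1" for z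
  proof -
    have gen: "X powr (k - 1/2) = X powr k / sqrt X" if "X > 0" for X k :: real
      using that by (simp add: powr_diff powr_half_sqrt)
    have "dd z + 1 / ev m > 0" using dd_range[OF that] e by linarith
    from gen[OF this] show ?thesis by (simp only: Bb_def Ab_def Xr_def times_divide_eq_right)
  qed
  show "Ab m x * Bb m y \<le> \<bar>x - y\<bar> * (2 * KA^2 * (sg \<theta> x * sg (1 - \<theta>) y))"
    and "Bb m x * Ab m y \<le> \<bar>x - y\<bar> * (2 * KA^2 * (sg \<theta> x * sg (1 - \<theta>) y))"
  proof -
    have A0: "Ab m x \<ge> 0" "Ab m y \<ge> 0" by (auto simp: Ab_def)
    have B1: "Bb m z \<le> Ab m z" "Bb m z \<ge> 0" if "z \<in> {-1..1}" for z
    proof -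
      have "sqrt (dd z) \<le> 1" using that by (auto simp: dd_def)
      then have "sqrt (dd z) * Ab m z \<le> 1 * Ab m z" by (intro mult_right_mono) (auto simp: Ab_def)
      then show "Bb m z \<le> Ab m z" "Bb m z \<ge> 0" using Bb_le[OF m(1) that] by auto
    qed
    have "Ab m x * Bb m y \<le> \<bar>x - y\<bar> * (2 * KA^2 * (sg \<theta> x * sg (1 - \<theta>) y)) \<and> Bb m x * Ab m y \<le> \<bar>x - y\<bar> * (2 * KA^2 * (sg \<theta> x * sg (1 - \<theta>) y))"
    proof (cases "(x \<ge> 0) = (y \<ge> 0)")
      case False
      have h: "1/2 \<le> \<bar>x - y\<bar>" using far_distance(2)[OF x y f False] .
      have "Ab m x * Ab m y \<le> 1 * (KA^2 * (sg \<theta> x * sg (1 - \<theta>) y))" using Ab_Ab_le[OF m x y] by simp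
      also have "\<dots> \<le> (2 * \<bar>x - y\<bar>) * (KA^2 * (sg \<theta> x * sg (1 - \<theta>) y))"
        using h sg0 by (intro mult_right_mono) auto
      finally have "Ab m x * Ab m y \<le> \<bar>x - y\<bar> * (2 * KA^2 * (sg \<theta> x * sg (1 - \<theta>) y))" by simp
      moreover have "Ab m x * Bb m y \<le> Ab m x * Ab m y" "Bb m x * Ab m y \<le> Ab m x * Ab m y"
        using B1 xy A0 by (intro mult_left_mono mult_right_mono; auto)+
      ultimately show ?thesis by linarith
    next
      case True
      then have g: "gm y = gm x" by (auto simp: gm_def)
      define b where "b = gm x / 2 + 1/4"
      have b: "b > -1/4" using ab by (auto simp: b_def gm_def)
      define u where "u = \<theta> * (gm x + 1)"
      define v where "v = (1 - \<theta>) * (gm x + 1)"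
      have uv: "u \<ge> max b 0" "v \<ge> max b 0" "u + v = 2 * b + 1/2"
        using gm_\<theta>[of x] by (auto simp: u_def v_def b_def algebra_simps)
      have S: "sg \<theta> x * sg (1 - \<theta>) y = dd x powr (- u) * dd y powr (- v)" by (simp add: sg_def u_def v_def g)
      have M: "max (dd x) (dd y) \<le> 2 * \<bar>x - y\<bar>" by (rule far_distance(1)[OF x y f True])
      have S0: "0 \<le> dd x powr (- u) * dd y powr (- v)" by simp
      have MM: "max (dd x) (dd y) * (dd x powr (- u) * dd y powr (- v)) \<le> \<bar>x - y\<bar> * (2 * KA^2 * (dd x powr (- u) * dd y powr (- v)))"
      proof -
        have "max (dd x) (dd y) * (dd x powr (- u) * dd y powr (- v)) \<le> 2 * \<bar>x - y\<bar> * (dd x powr (- u) * dd y powr (- v))"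
          by (rule mult_right_mono[OF M S0])
        also have "\<dots> = \<bar>x - y\<bar> * (2 * 1 * (dd x powr (- u) * dd y powr (- v)))" by simp
        also have "\<dots> \<le> \<bar>x - y\<bar> * (2 * KA^2 * (dd x powr (- u) * dd y powr (- v)))"
          using KA2 S0 by (intro mult_left_mono mult_right_mono) auto
        finally show ?thesis .
      qed
      have "Ab m x * Bb m y \<le> max (dd x) (dd y) * (dd x powr (- u) * dd y powr (- v))"
        using product_kernel_bound[OF d(1) d(3) e b uv] by (simp add: Ab_def Xr_def b_def Bb'[OF y] g)
      moreover have "Bb m x * Ab m y \<le> max (dd x) (dd y) * (dd x powr (- u) * dd y powr (- v))"
        using product_kernel_bound[OF d(3) d(1) e b uv(2) uv(1)] uv(3)
        by (simp add: Ab_def Xr_def b_def Bb'[OF x] g max.commute mult.commute add.commute)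
      ultimately show ?thesis unfolding S using MM by linarith
    qed
    then show "Ab m x * Bb m y \<le> \<bar>x - y\<bar> * (2 * KA^2 * (sg \<theta> x * sg (1 - \<theta>) y))"
      "Bb m x * Ab m y \<le> \<bar>x - y\<bar> * (2 * KA^2 * (sg \<theta> x * sg (1 - \<theta>) y))" by auto
  qed
qed

end

text \<open>The kernel of \<open>conj_poisson\<close>, a regularised 1/t.\<close>

definition qk :: "real \<Rightarrow> real \<Rightarrow> real" where "qk \<epsilon> t = t / (t^2 + \<epsilon>^2)"

lemma qk_bounds:
  assumes "\<epsilon> > 0"
  shows "\<bar>qk \<epsilon> t\<bar> \<le> 1 / \<epsilon>" "t \<noteq> 0 \<Longrightarrow> \<bar>qk \<epsilon> t\<bar> \<le> 1 / \<bar>t\<bar>"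
proof -
  have pos: "t^2 + \<epsilon>^2 > 0" using assms by (simp add: add_nonneg_pos)
  have "0 \<le> (\<bar>t\<bar> - \<epsilon>)^2" "0 \<le> \<bar>t\<bar> * \<epsilon>" using assms by simp_all
  then have "\<bar>t\<bar> * \<epsilon> \<le> t^2 + \<epsilon>^2" unfolding power2_diff power2_abs by simp
  then show "\<bar>qk \<epsilon> t\<bar> \<le> 1 / \<epsilon>" using assms pos by (simp add: qk_def abs_divide field_simps)
  show "\<bar>qk \<epsilon> t\<bar> \<le> 1 / \<bar>t\<bar>" if "t \<noteq> 0"
  proof -
    have "\<bar>t\<bar> * \<bar>t\<bar> \<le> t^2 + \<epsilon>^2" by (simp add: power2_eq_square)
    then show ?thesis using that pos by (simp add: qk_def abs_divide field_simps)
  qed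
qed

lemma qk_measurable [measurable]: "qk \<epsilon> \<in> borel_measurable borel" unfolding qk_def by measurable

lemma (in jacobi) sum_measure_le:
  fixes c :: real
  assumes "finite T" "\<And>i. i \<in> T \<Longrightarrow> A i \<in> sets borel" "F \<in> sets borel" "\<And>x. (\<Sum>i\<in>T. indicator (A i) x) \<le> c * indicator F x"
  shows "(\<Sum>i\<in>T. measure \<mu> (A i)) \<le> c * measure \<mu> F"
proof -
  have int: "integrable \<mu> (indicator S :: real \<Rightarrow> real)" if "S \<in> sets borel" for S
    using that by (intro integrable_real_indicator) (auto simp: fin.emeasure_finite less_top[symmetric])
  have "(\<Sum>i\<in>T. measure \<mu> (A i)) = (\<integral>x. (\<Sum>i\<in>T. indicator (A i) x) \<partial>\<mu>)"
    using assms int by (subst Bochner_Integration.integral_sum) auto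
  also have "\<dots> \<le> (\<integral>x. c * indicator F x \<partial>\<mu>)"
    using assms int by (intro integral_mono Bochner_Integration.integrable_sum integrable_mult_right) auto
  finally show ?thesis by simp
qed

section \<open>The singular kernel near the diagonal\<close>

context jacobi_exp
begin

text \<open>On neighbouring blocks the weight is constant up to a factor, which reduces the form to
  Lebesgue measure: the inner weight is absorbed into the density of \<open>conj_poisson\<close>,
  the outer one is bounded, and the Lebesgue measures of E and F are converted back.\<close>

lemma near_estimate:
  "\<exists>C>0. \<forall>i \<epsilon> f g E F a b. \<epsilon> > 0 \<longrightarrow> f \<in> borel_measurable borel \<longrightarrow> g \<in> borel_measurable borel \<longrightarrow>
     E \<in> sets borel \<longrightarrow> F \<in> sets borel \<longrightarrow> (\<forall>x\<in>E. \<bar>x\<bar> < 1 \<and> \<bar>blk x - i\<bar> \<le> 1) \<longrightarrow> (\<forall>x\<in>F. \<bar>x\<bar> < 1 \<and> \<bar>blk x - i\<bar> \<le> 1) \<longrightarrow>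
     a \<ge> 0 \<longrightarrow> b > 0 \<longrightarrow> (\<forall>x\<in>F. \<bar>f x\<bar> \<le> a) \<longrightarrow> (\<forall>y\<in>E. \<bar>g y\<bar> \<le> b) \<longrightarrow>
     \<bar>bilin \<mu> (\<lambda>x y. f x * g y * qk \<epsilon> (x - y)) E F\<bar> \<le> C * (a * b * tau i powr gmi i) * (measure \<mu> E powr \<theta> * measure \<mu> F powr (1 - \<theta>))"
proof -
  have "2 \<le> 1 / \<theta>" using \<theta> by (simp add: field_simps)
  from restricted_conj_poisson[OF this] obtain C0 where C0: "C0 > 0" and H0: "\<forall>f E F \<epsilon>. f \<in> borel_measurable borel \<longrightarrow> E \<in> sets borel \<longrightarrow> F \<in> sets borel \<longrightarrow>
     E \<subseteq> {-1..1} \<longrightarrow> F \<subseteq> {-1..1} \<longrightarrow> (\<forall>y. \<bar>f y\<bar> \<le> indicator E y) \<longrightarrow> \<epsilon> > 0 \<longrightarrow>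
     integrable lborel (\<lambda>x. indicator F x * \<bar>conj_poisson \<epsilon> f x\<bar>) \<and> conj_poisson \<epsilon> f \<in> borel_measurable borel \<and>
     (\<integral>x. indicator F x * \<bar>conj_poisson \<epsilon> f x\<bar> \<partial>lborel)
       \<le> C0 * measure lborel E powr (1/(1/\<theta>)) * measure lborel F powr (1 - 1/(1/\<theta>))" by blast
  have main: "\<bar>bilin \<mu> (\<lambda>x y. f x * g y * qk \<epsilon> (x - y)) E F\<bar> \<le> (C0 * Kw^3) * (a * b * tau i powr gmi i) * (measure \<mu> E powr \<theta> * measure \<mu> F powr (1 - \<theta>))"
    if eps: "\<epsilon> > 0" and f [measurable]: "f \<in> borel_measurable borel" and g [measurable]: "g \<in> borel_measurable borel"
      and E [measurable]: "E \<in> sets borel" and F [measurable]: "F \<in> sets borel"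
      and En: "\<And>x. x \<in> E \<Longrightarrow> \<bar>x\<bar> < 1 \<and> \<bar>blk x - i\<bar> \<le> 1" and Fn: "\<And>x. x \<in> F \<Longrightarrow> \<bar>x\<bar> < 1 \<and> \<bar>blk x - i\<bar> \<le> 1"
      and a: "a \<ge> 0" and b: "b > 0" and fa: "\<And>x. x \<in> F \<Longrightarrow> \<bar>f x\<bar> \<le> a" and gb: "\<And>y. y \<in> E \<Longrightarrow> \<bar>g y\<bar> \<le> b"
    for i \<epsilon> f g E F a b
  proof -
    let ?w = "jw \<alpha> \<beta>"
    define c where "c = tau i powr gmi i"
    have c: "c > 0" using tau_pos[of i] by (simp add: c_def)
    have E1: "E \<subseteq> {-1..1}" and F1: "F \<subseteq> {-1..1}"
    proof -
      show "E \<subseteq> {-1..1}" using En by (force simp: abs_less_iff)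
      show "F \<subseteq> {-1..1}" using Fn by (force simp: abs_less_iff)
    qed
    have Kw0: "Kw > 0" using Kw by simp
    \<comment> \<open>Normalises the density: on E the product of |g| and the weight is at most
      q.\<close>
    define q where "q = b * (Kw * c)"
    have q: "q > 0" using b Kw0 c by (simp add: q_def)
    define h where "h y = indicator E y * g y * ?w y / q" for y
    have hm [measurable]: "h \<in> borel_measurable borel" unfolding h_def by measurable
    have hE: "\<bar>h y\<bar> \<le> indicator E y" for y
    proof (cases "y \<in> E")
      case True
      have "\<bar>g y\<bar> * ?w y \<le> b * (Kw * c)"
        using gb[OF True] near_w(1)[of y i] En[OF True] jw_nonneg b by (intro mult_mono) (auto simp: c_def)
      then show ?thesis using True q jw_nonneg by (simp add: h_def abs_mult abs_divide q_def[symmetric])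
    qed (simp add: h_def)
    note HH = H0[rule_format, OF hm E F E1 F1 hE eps]
    then have cpm [measurable]: "conj_poisson \<epsilon> h \<in> borel_measurable borel"
      and cpi: "integrable lborel (\<lambda>x. indicator F x * \<bar>conj_poisson \<epsilon> h x\<bar>)"
      and cpb: "(\<integral>x. indicator F x * \<bar>conj_poisson \<epsilon> h x\<bar> \<partial>lborel) \<le> C0 * measure lborel E powr \<theta> * measure lborel F powr (1 - \<theta>)" by auto
    have inner: "(\<integral>y. indicator E y * (f x * g y * qk \<epsilon> (x - y)) \<partial>\<mu>) = f x * q * conj_poisson \<epsilon> h x" for x
    proof -
      have "(\<integral>y. indicator E y * (f x * g y * qk \<epsilon> (x - y)) \<partial>\<mu>) = (\<integral>y. ?w y *\<^sub>R (indicator E y * (f x * g y * qk \<epsilon> (x - y))) \<partial>lborel)"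
        unfolding jmu_def by (subst integral_density) (auto simp: jw_nonneg)
      also have "\<dots> = (\<integral>y. f x * q * (h y * ((x - y) / ((x - y)^2 + \<epsilon>^2))) \<partial>lborel)"
        using q by (intro Bochner_Integration.integral_cong) (auto simp: h_def qk_def)
      also have "\<dots> = f x * q * conj_poisson \<epsilon> h x" unfolding conj_poisson_def by (rule integral_mult_right_zero)
      finally show ?thesis .
    qed
    have bl: "bilin \<mu> (\<lambda>x y. f x * g y * qk \<epsilon> (x - y)) E F = (\<integral>x. ?w x *\<^sub>R (indicator F x * (f x * q * conj_poisson \<epsilon> h x)) \<partial>lborel)"
    proof -
      have "bilin \<mu> (\<lambda>x y. f x * g y * qk \<epsilon> (x - y)) E F = (\<integral>x. indicator F x * (f x * q * conj_poisson \<epsilon> h x) \<partial>\<mu>)"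
        unfolding bilin_def inner ..
      also have "\<dots> = (\<integral>x. ?w x *\<^sub>R (indicator F x * (f x * q * conj_poisson \<epsilon> h x)) \<partial>lborel)"
        unfolding jmu_def by (subst integral_density) (auto simp: jw_nonneg)
      finally show ?thesis .
    qed
    define Q where "Q = Kw * c * a * q"
    have Q0: "Q \<ge> 0" using Kw0 c a q by (simp add: Q_def)
    have pw: "\<bar>?w x *\<^sub>R (indicator F x * (f x * q * conj_poisson \<epsilon> h x))\<bar> \<le> Q * (indicator F x * \<bar>conj_poisson \<epsilon> h x\<bar>)" for x
    proof (cases "x \<in> F")
      case True
      have "?w x * \<bar>f x\<bar> \<le> (Kw * c) * a"
        using near_w(1)[of x i] Fn[OF True] fa[OF True] jw_nonneg Kw0 c by (intro mult_mono) (auto simp: c_def)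
      then have "(?w x * \<bar>f x\<bar>) * (q * \<bar>conj_poisson \<epsilon> h x\<bar>) \<le> ((Kw * c) * a) * (q * \<bar>conj_poisson \<epsilon> h x\<bar>)"
        using q by (intro mult_right_mono) auto
      then show ?thesis using True q jw_nonneg by (simp add: abs_mult Q_def mult_ac)
    qed simp
    have "\<bar>bilin \<mu> (\<lambda>x y. f x * g y * qk \<epsilon> (x - y)) E F\<bar> \<le> (\<integral>x. \<bar>?w x *\<^sub>R (indicator F x * (f x * q * conj_poisson \<epsilon> h x))\<bar> \<partial>lborel)"
      unfolding bl using integral_norm_bound[of lborel "\<lambda>x. ?w x *\<^sub>R (indicator F x * (f x * q * conj_poisson \<epsilon> h x))"] by simp
    also have "\<dots> \<le> (\<integral>x. Q * (indicator F x * \<bar>conj_poisson \<epsilon> h x\<bar>) \<partial>lborel)"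
    proof (rule integral_mono)
      show "integrable lborel (\<lambda>x. Q * (indicator F x * \<bar>conj_poisson \<epsilon> h x\<bar>))" using cpi by simp
      then show "integrable lborel (\<lambda>x. \<bar>?w x *\<^sub>R (indicator F x * (f x * q * conj_poisson \<epsilon> h x))\<bar>)"
        by (rule Bochner_Integration.integrable_bound) (use pw Q0 in \<open>auto intro!: AE_I2\<close>)
    qed (use pw in auto)
    also have "\<dots> = Q * (\<integral>x. indicator F x * \<bar>conj_poisson \<epsilon> h x\<bar> \<partial>lborel)" by simp
    also have "\<dots> \<le> Q * (C0 * measure lborel E powr \<theta> * measure lborel F powr (1 - \<theta>))" by (intro mult_left_mono cpb Q0)
    also have "\<dots> \<le> Q * (C0 * ((Kw / c) * measure \<mu> E) powr \<theta> * ((Kw / c) * measure \<mu> F) powr (1 - \<theta>))"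
    proof -
      have ml: "measure lborel S \<le> (Kw / c) * measure \<mu> S" if S [measurable]: "S \<in> sets borel" and Sn: "\<And>x. x \<in> S \<Longrightarrow> \<bar>x\<bar> < 1 \<and> \<bar>blk x - i\<bar> \<le> 1" for S
      proof -
        have "emeasure lborel S = (\<integral>\<^sup>+x. indicator S x \<partial>lborel)" by simp
        also have "\<dots> \<le> (\<integral>\<^sup>+x. ennreal (Kw / c) * (ennreal (?w x) * indicator S x) \<partial>lborel)"
        proof (rule nn_integral_mono)
          fix x
          show "indicator S x \<le> ennreal (Kw / c) * (ennreal (?w x) * indicator S x)"
          proof (cases "x \<in> S")
            case True
            then have "1 \<le> (Kw / c) * ?w x" using near_w(2)[of x i] Sn[OF True] c by (simp add: c_def field_simps)
            then have "ennreal 1 \<le> ennreal ((Kw / c) * ?w x)" by (rule ennreal_leI)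
            also have "\<dots> = ennreal (Kw / c) * ennreal (?w x)" using Kw0 c jw_nonneg by (intro ennreal_mult) auto
            finally show ?thesis using True by simp
          qed simp
        qed
        also have "\<dots> = ennreal (Kw / c) * emeasure \<mu> S" unfolding jmu_def by (subst nn_integral_cmult) (auto simp: emeasure_density)
        also have "\<dots> = ennreal ((Kw / c) * measure \<mu> S)" unfolding fin.emeasure_eq_measure using Kw0 c by (intro ennreal_mult[symmetric]) auto
        finally show ?thesis using Kw0 c by (simp add: measure_def enn2real_leI)
      qed
      show ?thesis using Q0 C0 \<theta> ml[OF E En] ml[OF F Fn] by (intro mult_left_mono mult_mono powr_mono2) auto
    qed
    also have "\<dots> = (C0 * Kw^3) * (a * b * c) * (measure \<mu> E powr \<theta> * measure \<mu> F powr (1 - \<theta>))"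
    proof -
      have "((Kw / c) * measure \<mu> E) powr \<theta> * ((Kw / c) * measure \<mu> F) powr (1 - \<theta>)
         = ((Kw / c) powr \<theta> * (Kw / c) powr (1 - \<theta>)) * (measure \<mu> E powr \<theta> * measure \<mu> F powr (1 - \<theta>))"
      proof -
        have "(r * u) powr \<theta> * (r * v) powr (1 - \<theta>) = (r powr \<theta> * r powr (1 - \<theta>)) * (u powr \<theta> * v powr (1 - \<theta>))"
          if "r \<ge> 0" "u \<ge> 0" "v \<ge> 0" for r u v :: real using that by (simp add: powr_mult)
        from this[of "Kw / c"] show ?thesis using Kw0 c measure_nonneg by (metis divide_nonneg_pos less_imp_le)
      qed
      \<comment> \<open>The exponents sum to 1, so the conversion of the measures gives one factor
        1/c against the two factors c from the weights.\<close>
      also have "(Kw / c) powr \<theta> * (Kw / c) powr (1 - \<theta>) = Kw / c" using Kw0 c by (simp flip: powr_add)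
      finally have e: "((Kw / c) * measure \<mu> E) powr \<theta> * ((Kw / c) * measure \<mu> F) powr (1 - \<theta>) = (Kw / c) * (measure \<mu> E powr \<theta> * measure \<mu> F powr (1 - \<theta>))" .
      have QK: "Q * (Kw / c) = Kw^3 * (a * b * c)" using c by (simp add: Q_def q_def power3_eq_cube)
      have "Q * (C0 * ((Kw / c) * R)) = (C0 * Kw^3) * (a * b * c) * R" for R
      proof -
        have "Q * (C0 * ((Kw / c) * R)) = (C0 * R) * (Q * (Kw / c))" by (simp only: mult_ac)
        also have "\<dots> = (C0 * R) * (Kw^3 * (a * b * c))" by (simp only: QK)
        also have "\<dots> = (C0 * Kw^3) * (a * b * c) * R" by (simp only: mult_ac)
        finally show ?thesis .
      qed
      then show ?thesis using e by (simp only: mult.assoc)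
    qed
    finally show ?thesis by (simp add: c_def)
  qed
  have pos: "C0 * Kw^3 > 0" using C0 Kw by simp
  show ?thesis by (intro exI[of _ "C0 * Kw^3"] conjI allI impI pos main) auto
qed

lemma bilin_UN_E:
  assumes k: "bkern k B" and F: "F \<in> sets borel" and "finite T" and "\<And>i. i \<in> T \<Longrightarrow> E i \<in> sets borel" and "disjoint_family_on E T"
  shows "bilin \<mu> k (\<Union>i\<in>T. E i) F = (\<Sum>i\<in>T. bilin \<mu> k (E i) F)"
  using assms(3-5)
proof (induction T rule: finite_induct)
  case empty
  show ?case by (simp add: bilin_def)
next
  case (insert i T)
  have "E i \<inter> (\<Union>i\<in>T. E i) = {}" using insert by (auto simp: disjoint_family_on_def)
  then have "bilin \<mu> k (E i \<union> (\<Union>i\<in>T. E i)) F = bilin \<mu> k (E i) F + bilin \<mu> k (\<Union>i\<in>T. E i) F"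
    using insert F by (intro bilin_Un_E[OF k]) auto
  moreover have "disjoint_family_on E T" using insert by (auto simp: disjoint_family_on_def)
  ultimately show ?case using insert by simp
qed

end

definition nearset :: "int \<Rightarrow> real set \<Rightarrow> bool" where
  "nearset i S \<longleftrightarrow> (\<forall>x\<in>S. \<bar>x\<bar> < 1 \<and> \<bar>blk x - i\<bar> \<le> 1)"

context jacobi_exp
begin

text \<open>The two orders in which P_n and (1 - x^2) P_n' occur in the kernel formula, after
  normalisation.\<close>

definition ABpair where
  "ABpair m f g \<longleftrightarrow> (\<forall>x. \<bar>x\<bar> < 1 \<longrightarrow> \<bar>f x\<bar> \<le> Ab m x \<and> \<bar>g x\<bar> \<le> Bb m x) \<or> (\<forall>x. \<bar>x\<bar> < 1 \<longrightarrow> \<bar>f x\<bar> \<le> Bb m x \<and> \<bar>g x\<bar> \<le> Ab m x)"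

lemma bkern_mult_bound:
  assumes "bkern k B" "case_prod r \<in> borel_measurable (borel \<Otimes>\<^sub>M borel)" "\<And>x y. \<bar>r x y\<bar> \<le> 1"
  shows "bkern (\<lambda>x y. r x y * k x y) B"
proof -
  have [measurable]: "case_prod k \<in> borel_measurable (borel \<Otimes>\<^sub>M borel)" using assms by (simp add: bkern_def)
  have [measurable]: "case_prod r \<in> borel_measurable (borel \<Otimes>\<^sub>M borel)" by (rule assms)
  have "\<bar>r x y * k x y\<bar> \<le> B" if "x \<in> {-1..1}" "y \<in> {-1..1}" for x y
  proof -
    have "\<bar>r x y * k x y\<bar> \<le> 1 * B" unfolding abs_mult using assms that by (intro mult_mono) (auto simp: bkern_def)
    then show ?thesis by simp
  qed
  then show ?thesis using assms unfolding bkern_def by (auto simp: split_beta' intro!: borel_measurable_times)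
qed

lemma near_block:
  "\<exists>C>0. \<forall>m\<ge>1. ev m \<ge> 1 \<longrightarrow> (\<forall>i \<epsilon> f g E F. \<epsilon> > 0 \<longrightarrow> f \<in> borel_measurable borel \<longrightarrow> g \<in> borel_measurable borel \<longrightarrow>
     ABpair m f g \<longrightarrow>
     E \<in> sets borel \<longrightarrow> F \<in> sets borel \<longrightarrow> nearset i E \<longrightarrow> nearset i F \<longrightarrow>
     \<bar>bilin \<mu> (\<lambda>x y. f x * g y * qk \<epsilon> (x - y)) E F\<bar> \<le> C * (measure \<mu> E powr \<theta> * measure \<mu> F powr (1 - \<theta>)))"
proof -
  obtain C0 where C0: "C0 > 0" and H: "\<And>i \<epsilon> f g E F a b. \<epsilon> > 0 \<Longrightarrow> f \<in> borel_measurable borel \<Longrightarrow> g \<in> borel_measurable borel \<Longrightarrow>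
     E \<in> sets borel \<Longrightarrow> F \<in> sets borel \<Longrightarrow> nearset i E \<Longrightarrow> nearset i F \<Longrightarrow>
     a \<ge> 0 \<Longrightarrow> b > 0 \<Longrightarrow> (\<forall>x\<in>F. \<bar>f x\<bar> \<le> a) \<Longrightarrow> (\<forall>y\<in>E. \<bar>g y\<bar> \<le> b) \<Longrightarrow>
     \<bar>bilin \<mu> (\<lambda>x y. f x * g y * qk \<epsilon> (x - y)) E F\<bar> \<le> C0 * (a * b * tau i powr gmi i) * (measure \<mu> E powr \<theta> * measure \<mu> F powr (1 - \<theta>))"
    using near_estimate unfolding nearset_def by blast
  have main: "\<bar>bilin \<mu> (\<lambda>x y. f x * g y * qk \<epsilon> (x - y)) E F\<bar> \<le> (C0 * (4 * KA^2)) * (measure \<mu> E powr \<theta> * measure \<mu> F powr (1 - \<theta>))"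
    if m: "m \<ge> 1" "ev m \<ge> 1" and eps: "\<epsilon> > 0" and fg: "f \<in> borel_measurable borel" "g \<in> borel_measurable borel"
      and b: "ABpair m f g"
      and EF: "E \<in> sets borel" "F \<in> sets borel"
      and En: "nearset i E" and Fn: "nearset i F" for m i \<epsilon> f g E F
  proof -
    define a1 where "a1 = KA * Ai m i"
    define a2 where "a2 = 4 * KA * (tau i * Ai m i / sqrt (tau i + 1 / ev m))"
    have e: "tau i + 1 / ev m > 0" using m tau_pos[of i] by (simp add: add_pos_pos)
    have A: "Ai m i > 0" using e by (simp add: Ai_def)
    have a1: "a1 > 0" and a2: "a2 > 0" using KA A tau_pos[of i] e by (auto simp: a1_def a2_def)
    have prod: "a1 * a2 * tau i powr gmi i \<le> 4 * KA^2"
    proof -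
      have "a1 * a2 * tau i powr gmi i = 4 * KA^2 * (Ai m i * (tau i * Ai m i / sqrt (tau i + 1 / ev m)) * tau i powr gmi i)"
        by (simp add: a1_def a2_def power2_eq_square)
      also have "\<dots> \<le> 4 * KA^2 * 1" by (intro mult_left_mono near_product[OF m]) simp
      finally show ?thesis by simp
    qed
    have ne: "Ab m x \<le> a1" "Bb m x \<le> a2" if "\<bar>x\<bar> < 1 \<and> \<bar>blk x - i\<bar> \<le> 1" for x
      using near_Ab[OF m, of x i] that by (auto simp: a1_def a2_def)
    have "\<bar>bilin \<mu> (\<lambda>x y. f x * g y * qk \<epsilon> (x - y)) E F\<bar> \<le> C0 * (a1 * a2 * tau i powr gmi i) * (measure \<mu> E powr \<theta> * measure \<mu> F powr (1 - \<theta>))"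
      using b unfolding ABpair_def
    proof
      assume b: "\<forall>x. \<bar>x\<bar> < 1 \<longrightarrow> \<bar>f x\<bar> \<le> Ab m x \<and> \<bar>g x\<bar> \<le> Bb m x"
      show ?thesis
      proof (rule H[OF eps fg EF En Fn])
        show "\<forall>x\<in>F. \<bar>f x\<bar> \<le> a1" "\<forall>y\<in>E. \<bar>g y\<bar> \<le> a2" using b En Fn ne unfolding nearset_def by (meson order_trans)+
      qed (use a1 a2 in auto)
    next
      assume b: "\<forall>x. \<bar>x\<bar> < 1 \<longrightarrow> \<bar>f x\<bar> \<le> Bb m x \<and> \<bar>g x\<bar> \<le> Ab m x"
      have "\<bar>bilin \<mu> (\<lambda>x y. f x * g y * qk \<epsilon> (x - y)) E F\<bar> \<le> C0 * (a2 * a1 * tau i powr gmi i) * (measure \<mu> E powr \<theta> * measure \<mu> F powr (1 - \<theta>))"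
      proof (rule H[OF eps fg EF En Fn])
        show "\<forall>x\<in>F. \<bar>f x\<bar> \<le> a2" "\<forall>y\<in>E. \<bar>g y\<bar> \<le> a1" using b En Fn ne unfolding nearset_def by (meson order_trans)+
      qed (use a1 a2 in auto)
      then show ?thesis by (simp add: mult.commute)
    qed
    also have "\<dots> \<le> (C0 * (4 * KA^2)) * (measure \<mu> E powr \<theta> * measure \<mu> F powr (1 - \<theta>))"
      using C0 by (intro mult_right_mono mult_left_mono prod) auto
    finally show ?thesis .
  qed
  have pos: "C0 * (4 * KA^2) > 0" using C0 KA by simp
  show ?thesis by (intro exI[of _ "C0 * (4 * KA^2)"] conjI allI impI pos main) assumption+
qed

lemma bilin_restrict_F:
  assumes [measurable]: "G \<in> sets borel" "E \<in> sets borel" "F \<in> sets borel" and k: "bkern k B" "bkern k' B'"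
    and eq: "\<And>x y. \<bar>x\<bar> < 1 \<Longrightarrow> y \<in> E \<Longrightarrow> indicator F x * k x y = indicator G x * k' x y"
  shows "bilin \<mu> k E F = bilin \<mu> k' E G"
  unfolding bilin_def
proof (rule integral_cong_AE)
  show "(\<lambda>x. indicator F x * (\<integral>y. indicator E y * k x y \<partial>\<mu>)) \<in> borel_measurable \<mu>"
    "(\<lambda>x. indicator G x * (\<integral>y. indicator E y * k' x y \<partial>\<mu>)) \<in> borel_measurable \<mu>"
    using kern_inner_meas[OF k(1), of E] kern_inner_meas[OF k(2), of E] by measurable
  show "AE x in \<mu>. indicator F x * (\<integral>y. indicator E y * k x y \<partial>\<mu>) = indicator G x * (\<integral>y. indicator E y * k' x y \<partial>\<mu>)"
  proof (rule eventually_mono[OF AE_jmu_Ioo])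
    fix x :: real assume x: "x \<in> {-1<..<1}"
    have p: "indicator F x * (indicator E y * k x y) = indicator G x * (indicator E y * k' x y)" for y
      using eq[of x y] x by (cases "y \<in> E") auto
    have "indicator F x * (\<integral>y. indicator E y * k x y \<partial>\<mu>) = (\<integral>y. indicator F x * (indicator E y * k x y) \<partial>\<mu>)" by simp
    also have "\<dots> = indicator G x * (\<integral>y. indicator E y * k' x y \<partial>\<mu>)" unfolding p by simp
    finally show "indicator F x * (\<integral>y. indicator E y * k x y \<partial>\<mu>) = indicator G x * (\<integral>y. indicator E y * k' x y \<partial>\<mu>)" .
  qed
qed

text \<open>Pairs of points are separated by their blocks. Blocks at least two apart are handled by
  \<open>far_bound\<close>. Otherwise E is cut into blocks and F into their neighbourhoods; each
  block is estimated alone, and Hoelder's inequality adds the estimates, each point of F being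
  counted at most three times.\<close>

lemma singular_bilin:
  "\<exists>C>0. \<forall>m\<ge>1. ev m \<ge> 1 \<longrightarrow> (\<forall>\<epsilon> f g B E F. \<epsilon> > 0 \<longrightarrow> f \<in> borel_measurable borel \<longrightarrow> g \<in> borel_measurable borel \<longrightarrow>
     B \<ge> 0 \<longrightarrow> (\<forall>x\<in>{-1..1}. \<bar>f x\<bar> \<le> B \<and> \<bar>g x\<bar> \<le> B) \<longrightarrow>
     ABpair m f g \<longrightarrow>
     E \<in> sets borel \<longrightarrow> F \<in> sets borel \<longrightarrow>
     \<bar>bilin \<mu> (\<lambda>x y. f x * g y * qk \<epsilon> (x - y)) E F\<bar> \<le> C * (measure \<mu> E powr \<theta> * measure \<mu> F powr (1 - \<theta>)))"
proof -
  obtain C0 where C0H: "C0 > 0 \<and> (\<forall>m\<ge>1. ev m \<ge> 1 \<longrightarrow> (\<forall>i \<epsilon> f g E F. \<epsilon> > 0 \<longrightarrow> f \<in> borel_measurable borel \<longrightarrow> g \<in> borel_measurable borel \<longrightarrow>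
     ABpair m f g \<longrightarrow>
     E \<in> sets borel \<longrightarrow> F \<in> sets borel \<longrightarrow> nearset i E \<longrightarrow> nearset i F \<longrightarrow>
     \<bar>bilin \<mu> (\<lambda>x y. f x * g y * qk \<epsilon> (x - y)) E F\<bar> \<le> C0 * (measure \<mu> E powr \<theta> * measure \<mu> F powr (1 - \<theta>))))"
    using near_block by (rule exE)
  note C0 = C0H[THEN conjunct1] and H = C0H[THEN conjunct2, rule_format]
  have th: "0 \<le> \<theta>" "\<theta> < 1" "0 \<le> 1 - \<theta>" "1 - \<theta> < 1" using \<theta> by auto
  obtain C1 where C1: "C1 > 0" "\<And>E. E \<in> sets borel \<Longrightarrow> (\<integral>\<^sup>+x\<in>E. ennreal (sg \<theta> x) \<partial>\<mu>) \<le> ennreal (C1 * measure \<mu> E powr (1 - \<theta>))"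
    using sg_integral[OF th(1,2)] by blast
  obtain C2 where C2: "C2 > 0" "\<And>E. E \<in> sets borel \<Longrightarrow> (\<integral>\<^sup>+x\<in>E. ennreal (sg (1 - \<theta>) x) \<partial>\<mu>) \<le> ennreal (C2 * measure \<mu> E powr (1 - (1 - \<theta>)))"
    using sg_integral[OF th(3,4)] by blast
  define D where "D = 3 * C0 + 2 * KA^2 * (C1 * C2)"
  have main: "\<bar>bilin \<mu> (\<lambda>x y. f x * g y * qk \<epsilon> (x - y)) E F\<bar> \<le> D * (measure \<mu> E powr \<theta> * measure \<mu> F powr (1 - \<theta>))"
    if m: "m \<ge> 1" "ev m \<ge> 1" and eps: "\<epsilon> > 0" and f [measurable]: "f \<in> borel_measurable borel" and g [measurable]: "g \<in> borel_measurable borel"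
      and B: "B \<ge> 0" "\<And>x. x \<in> {-1..1} \<Longrightarrow> \<bar>f x\<bar> \<le> B \<and> \<bar>g x\<bar> \<le> B"
      and b: "ABpair m f g"
      and E [measurable]: "E \<in> sets borel" and F [measurable]: "F \<in> sets borel" for m \<epsilon> f g B E F
  proof -
    define k where "k x y = f x * g y * qk \<epsilon> (x - y)" for x y
    define Bk where "Bk = B * B * (1 / \<epsilon>)"
    have k: "bkern k Bk"
    proof -
      have "case_prod k \<in> borel_measurable (borel \<Otimes>\<^sub>M borel)" unfolding k_def split_beta' by measurable
      moreover have "\<bar>k x y\<bar> \<le> Bk" if "x \<in> {-1..1}" "y \<in> {-1..1}" for x y
        unfolding k_def Bk_def abs_mult using B that eps by (intro mult_mono qk_bounds) auto
      ultimately show ?thesis using B eps by (auto simp: bkern_def Bk_def)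
    qed
    define rn where "rn x y = (if \<bar>blk x - blk y\<bar> \<le> 1 then 1 else 0 :: real)" for x y
    define rf where "rf x y = (if \<bar>blk x - blk y\<bar> \<le> 1 then 0 else 1 :: real)" for x y
    have pm: "Measurable.pred (borel \<Otimes>\<^sub>M borel) (\<lambda>p. \<bar>blk (fst p) - blk (snd p)\<bar> \<le> 1)"
    proof -
      have [measurable]: "(\<lambda>x. real_of_int (blk x)) \<in> borel_measurable borel"
        by (rule measurable_compose[OF blk_measurable]) simp
      have "(\<lambda>p. \<bar>blk (fst p) - blk (snd p)\<bar> \<le> 1) = (\<lambda>p. \<bar>real_of_int (blk (fst p)) - real_of_int (blk (snd p))\<bar> \<le> 1)"
        by (rule ext) linarith
      then show ?thesis by (simp only:) measurable
    qed
    have rnm: "case_prod rn \<in> borel_measurable (borel \<Otimes>\<^sub>M borel)" and rfm: "case_prod rf \<in> borel_measurable (borel \<Otimes>\<^sub>M borel)"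
      unfolding rn_def rf_def split_beta' using pm by (auto intro!: measurable_If)
    have kn: "bkern (\<lambda>x y. rn x y * k x y) Bk" and kf: "bkern (\<lambda>x y. rf x y * k x y) Bk"
      by (rule bkern_mult_bound[OF k rnm] bkern_mult_bound[OF k rfm]; simp add: rn_def rf_def)+
    let ?kn = "\<lambda>x y. rn x y * k x y" and ?kf = "\<lambda>x y. rf x y * k x y"
    have "k = (\<lambda>x y. ?kn x y + ?kf x y)" by (auto simp: fun_eq_iff rn_def rf_def)
    then have split: "bilin \<mu> k E F = bilin \<mu> ?kn E F + bilin \<mu> ?kf E F" using bilin_add[OF kn kf E F] by simp
    define P where "P = measure \<mu> E powr \<theta> * measure \<mu> F powr (1 - \<theta>)"
    have far: "\<bar>bilin \<mu> ?kf E F\<bar> \<le> 2 * KA^2 * ((C1 * measure \<mu> F powr (1 - \<theta>)) * (C2 * measure \<mu> E powr (1 - (1 - \<theta>))))"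
    proof (rule bilin_far[OF kf E F sg_measurable sg_measurable _ _ _ _ _ _ C1(2)[OF F] C2(2)[OF E]])
      fix x y :: real assume "x \<in> {-1<..<1}" "y \<in> {-1<..<1}"
      then have x: "\<bar>x\<bar> < 1" and y: "\<bar>y\<bar> < 1" by auto
      show "\<bar>?kf x y\<bar> \<le> 2 * KA^2 * (sg \<theta> x * sg (1 - \<theta>) y)"
      proof (cases "\<bar>blk x - blk y\<bar> \<le> 1")
        case True
        then show ?thesis by (simp add: rf_def sg_def)
      next
        case False
        then have fr: "\<bar>blk x - blk y\<bar> \<ge> 2" by simp
        then have xy: "x \<noteq> y" by auto
        have "\<bar>f x\<bar> * \<bar>g y\<bar> \<le> \<bar>x - y\<bar> * (2 * KA^2 * (sg \<theta> x * sg (1 - \<theta>) y))"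
          using b unfolding ABpair_def
        proof
          assume h: "\<forall>x. \<bar>x\<bar> < 1 \<longrightarrow> \<bar>f x\<bar> \<le> Ab m x \<and> \<bar>g x\<bar> \<le> Bb m x"
          then have "\<bar>f x\<bar> * \<bar>g y\<bar> \<le> Ab m x * Bb m y" using x y by (intro mult_mono) (auto simp: Ab_def)
          then show ?thesis using far_bound(1)[OF m x y fr] by linarith
        next
          assume h: "\<forall>x. \<bar>x\<bar> < 1 \<longrightarrow> \<bar>f x\<bar> \<le> Bb m x \<and> \<bar>g x\<bar> \<le> Ab m x"
          then have "\<bar>f x\<bar> * \<bar>g y\<bar> \<le> Bb m x * Ab m y" using x y order_trans[OF abs_ge_zero, of "f x" "Bb m x"] by (intro mult_mono) auto
          then show ?thesis using far_bound(2)[OF m x y fr] by linarith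
        qed
        then have "\<bar>f x\<bar> * \<bar>g y\<bar> * \<bar>qk \<epsilon> (x - y)\<bar> \<le> (\<bar>x - y\<bar> * (2 * KA^2 * (sg \<theta> x * sg (1 - \<theta>) y))) * (1 / \<bar>x - y\<bar>)"
          using xy qk_bounds(2)[OF eps, of "x - y"] by - (rule mult_mono, auto simp: sg_def)
        then show ?thesis using False xy by (simp add: rf_def k_def abs_mult)
      qed
    qed (use C1 C2 in \<open>auto simp: sg_def\<close>)
    \<comment> \<open>Finitely many blocks at a time, as \<open>bilin_UN_E\<close> is for finite
      unions; the measure of the rest of E tends to 0 as J grows.\<close>
    define EJ where "EJ J = {y \<in> E. \<bar>y\<bar> < 1 \<and> \<bar>blk y\<bar> \<le> int J}" for J :: nat
    define Ei where "Ei i = {y \<in> E. \<bar>y\<bar> < 1 \<and> blk y = i}" for i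
    define Fi where "Fi i = {x \<in> F. \<bar>x\<bar> < 1 \<and> \<bar>blk x - i\<bar> \<le> 1}" for i
    have bs: "{y \<in> S. \<bar>y\<bar> < 1 \<and> blk y \<in> T} \<in> sets borel" if [measurable]: "S \<in> sets borel" for S T
    proof -
      have [measurable]: "blk -` T \<in> sets borel" using measurable_sets[OF blk_measurable, of T] by simp
      have "{y \<in> S. \<bar>y\<bar> < 1 \<and> blk y \<in> T} = S \<inter> {y. \<bar>y\<bar> < 1} \<inter> blk -` T" by auto
      then show ?thesis by simp
    qed
    have Eim [measurable]: "Ei i \<in> sets borel" for i using bs[OF E, of "{i}"] by (simp add: Ei_def)
    have Fim [measurable]: "Fi i \<in> sets borel" for i using bs[OF F, of "{j. \<bar>j - i\<bar> \<le> 1}"] by (simp add: Fi_def)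
    have EJm [measurable]: "EJ J \<in> sets borel" for J using bs[OF E, of "{j. \<bar>j\<bar> \<le> int J}"] by (simp add: EJ_def)
    have nearJ: "\<bar>bilin \<mu> ?kn (EJ J) F\<bar> \<le> 3 * C0 * P" for J
    proof -
      let ?T = "{- int J..int J}"
      have "EJ J = (\<Union>i\<in>?T. Ei i)" by (auto simp: EJ_def Ei_def)
      then have "bilin \<mu> ?kn (EJ J) F = (\<Sum>i\<in>?T. bilin \<mu> ?kn (Ei i) F)"
        using bilin_UN_E[OF kn F, of ?T Ei] by (simp add: disjoint_family_on_def Ei_def Int_def)
      \<comment> \<open>For y in block i the cut-off \<open>rn\<close> acts on x in F as the
        indicator of \<open>Fi i\<close>, so it moves from the kernel into the set.\<close>
      also have "\<dots> = (\<Sum>i\<in>?T. bilin \<mu> k (Ei i) (Fi i))"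
        by (intro sum.cong refl bilin_restrict_F[OF Fim Eim F kn k]) (auto simp: rn_def Ei_def Fi_def indicator_def)
      finally have "\<bar>bilin \<mu> ?kn (EJ J) F\<bar> \<le> (\<Sum>i\<in>?T. \<bar>bilin \<mu> k (Ei i) (Fi i)\<bar>)" by simp
      also have "\<dots> \<le> (\<Sum>i\<in>?T. C0 * (measure \<mu> (Ei i) powr \<theta> * measure \<mu> (Fi i) powr (1 - \<theta>)))"
        unfolding k_def by (intro sum_mono H[OF m eps f g b Eim Fim]) (auto simp: Ei_def Fi_def nearset_def)
      also have "\<dots> = C0 * (\<Sum>i\<in>?T. measure \<mu> (Ei i) powr \<theta> * measure \<mu> (Fi i) powr (1 - \<theta>))" by (simp add: sum_distrib_left)
      also have "\<dots> \<le> C0 * ((\<Sum>i\<in>?T. measure \<mu> (Ei i)) powr \<theta> * (\<Sum>i\<in>?T. measure \<mu> (Fi i)) powr (1 - \<theta>))"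
        using C0 \<theta> by (intro mult_left_mono holder_powr_sum) auto
      also have "\<dots> \<le> C0 * (measure \<mu> E powr \<theta> * (3 * measure \<mu> F) powr (1 - \<theta>))"
      proof -
        have "(\<Sum>i\<in>?T. measure \<mu> (Ei i)) \<le> 1 * measure \<mu> E"
        proof (rule sum_measure_le)
          fix x
          have "(\<Sum>i\<in>?T. indicator (Ei i) x) \<le> (\<Sum>i\<in>?T. if i = blk x then indicator E x else (0::real))"
            by (intro sum_mono) (auto simp: Ei_def indicator_def)
          also have "\<dots> = (if blk x \<in> ?T then indicator E x else 0)" by (rule sum.delta) simp
          also have "\<dots> \<le> 1 * indicator E x" by simp
          finally show "(\<Sum>i\<in>?T. indicator (Ei i) x) \<le> 1 * (indicator E x :: real)" .
        qed auto
        moreover have "(\<Sum>i\<in>?T. measure \<mu> (Fi i)) \<le> 3 * measure \<mu> F"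
        proof (rule sum_measure_le)
          fix x
          have "(\<Sum>i\<in>?T. indicator (Fi i) x) \<le> (\<Sum>i\<in>?T. if i \<in> {blk x - 1..blk x + 1} then indicator F x else (0::real))"
            by (intro sum_mono) (auto simp: Fi_def indicator_def)
          also have "\<dots> = (\<Sum>i\<in>?T \<inter> {blk x - 1..blk x + 1}. indicator F x)" by (subst sum.inter_restrict) auto
          also have "\<dots> = real (card (?T \<inter> {blk x - 1..blk x + 1})) * indicator F x" by simp
          also have "\<dots> \<le> 3 * indicator F x"
          proof (rule mult_right_mono)
            have "card (?T \<inter> {blk x - 1..blk x + 1}) \<le> card {blk x - 1..blk x + 1}" by (intro card_mono) auto
            then show "real (card (?T \<inter> {blk x - 1..blk x + 1})) \<le> 3" by simp
          qed simp
          finally show "(\<Sum>i\<in>?T. indicator (Fi i) x) \<le> 3 * (indicator F x :: real)" .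
        qed auto
        ultimately show ?thesis using C0 \<theta> by (intro mult_left_mono mult_mono powr_mono2) (auto intro!: sum_nonneg)
      qed
      also have "\<dots> = C0 * 3 powr (1 - \<theta>) * P" by (simp add: P_def powr_mult)
      also have "\<dots> \<le> C0 * 3 * P"
        using C0 \<theta> powr_mono[of "1 - \<theta>" 1 3] by (intro mult_right_mono mult_left_mono) (auto simp: P_def)
      finally show ?thesis by (simp add: mult_ac)
    qed
    have lim: "(\<lambda>J. measure \<mu> (E - EJ J)) \<longlonglongrightarrow> 0"
    proof -
      have "(\<lambda>J. measure \<mu> (E - EJ J)) \<longlonglongrightarrow> measure \<mu> (\<Inter>J. E - EJ J)"
      proof (rule fin.finite_Lim_measure_decseq)
        show "decseq (\<lambda>J. E - EJ J)" by (auto simp: decseq_def EJ_def)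
      qed auto
      moreover have "measure \<mu> (\<Inter>J. E - EJ J) = 0"
      proof -
        have "(\<Inter>J. E - EJ J) \<subseteq> {y. \<not> \<bar>y\<bar> < 1}"
        proof
          fix y assume y: "y \<in> (\<Inter>J. E - EJ J)"
          then have "y \<in> E - EJ (nat \<bar>blk y\<bar>)" by blast
          then show "y \<in> {y. \<not> \<bar>y\<bar> < 1}" by (auto simp: EJ_def)
        qed
        then have nin: "y \<in> {-1<..<1} \<Longrightarrow> y \<notin> (\<Inter>J. E - EJ J)" for y
          by (metis (mono_tags, lifting) abs_less_iff greaterThanLessThan_iff mem_Collect_eq minus_less_iff subsetD)
        have "AE y in \<mu>. y \<notin> (\<Inter>J. E - EJ J)" by (rule eventually_mono[OF AE_jmu_Ioo nin])
        then have "emeasure \<mu> (\<Inter>J. E - EJ J) = 0"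
          by (subst (asm) AE_iff_measurable[of "\<Inter>J. E - EJ J"]) auto
        then show ?thesis by (simp add: measure_def)
      qed
      ultimately show ?thesis by simp
    qed
    have near: "\<bar>bilin \<mu> ?kn E F\<bar> \<le> 3 * C0 * P"
    proof -
      have "\<bar>bilin \<mu> ?kn E F\<bar> \<le> 3 * C0 * P + Bk * measure \<mu> F * measure \<mu> (E - EJ J)" for J
      proof -
        have "EJ J \<union> (E - EJ J) = E" by (auto simp: EJ_def)
        then have "bilin \<mu> ?kn E F = bilin \<mu> ?kn (EJ J) F + bilin \<mu> ?kn (E - EJ J) F"
          using bilin_Un_E[OF kn EJm[of J] _ F, of "E - EJ J"] by auto
        moreover have "\<bar>bilin \<mu> ?kn (E - EJ J) F\<bar> \<le> Bk * (measure \<mu> F * measure \<mu> (E - EJ J))"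
          by (rule bilin_bound[OF kn]) auto
        ultimately show ?thesis using nearJ[of J] by (simp add: mult.assoc)
      qed
      moreover have "(\<lambda>J. 3 * C0 * P + Bk * measure \<mu> F * measure \<mu> (E - EJ J)) \<longlonglongrightarrow> 3 * C0 * P + Bk * measure \<mu> F * 0"
        by (intro tendsto_intros lim)
      ultimately show ?thesis using LIMSEQ_le_const[of _ "3 * C0 * P + Bk * measure \<mu> F * 0"] by auto
    qed
    have "\<bar>bilin \<mu> k E F\<bar> \<le> 3 * C0 * P + 2 * KA^2 * ((C1 * measure \<mu> F powr (1 - \<theta>)) * (C2 * measure \<mu> E powr (1 - (1 - \<theta>))))"
      unfolding split using near far abs_triangle_ineq[of "bilin \<mu> ?kn E F" "bilin \<mu> ?kf E F"] by linarith
    also have "\<dots> = D * P" by (simp add: D_def P_def algebra_simps)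
    finally show ?thesis by (simp add: k_def[abs_def] P_def)
  qed
  have pos: "D > 0" using C0 C1 C2 KA by (auto simp: D_def intro!: add_pos_nonneg)
  show ?thesis
    by (intro exI[of _ D] conjI allI impI pos, rule main) (assumption | (drule bspec, assumption, assumption))+
qed

end

section \<open>The bilinear bound for the Jacobi kernel\<close>

context jacobi
begin

lemma bkern_add:
  assumes "bkern k B" "bkern k' B'" shows "bkern (\<lambda>x y. k x y + k' x y) (B + B')"
proof -
  have [measurable]: "case_prod k \<in> borel_measurable (borel \<Otimes>\<^sub>M borel)" "case_prod k' \<in> borel_measurable (borel \<Otimes>\<^sub>M borel)"
    using assms by (simp_all add: bkern_def)
  have "(\<lambda>(x, y). k x y + k' x y) \<in> borel_measurable (borel \<Otimes>\<^sub>M borel)" by measurable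
  moreover have "\<bar>k x y + k' x y\<bar> \<le> B + B'" if "x \<in> {-1..1}" "y \<in> {-1..1}" for x y
  proof -
    have "\<bar>k x y\<bar> \<le> B" "\<bar>k' x y\<bar> \<le> B'" using assms that by (simp_all add: bkern_def)
    then show ?thesis by linarith
  qed
  ultimately show ?thesis using assms by (simp add: bkern_def)
qed

lemma AE_jmu_neq: "AE y in \<mu>. y \<noteq> x"
  unfolding jmu_def by (subst AE_density) (auto intro: eventually_mono[OF AE_lborel_singleton[of x]])

text \<open>Dominated convergence twice. The diagonal, where the kernels need not converge, meets
  each line of constant x in a null set.\<close>

lemma bilin_LIMSEQ:
  assumes k: "\<And>j. bkern (k j) B" and k': "bkern k' B" and [measurable]: "E \<in> sets borel" "F \<in> sets borel"
    and lim: "\<And>x y. \<bar>x\<bar> < 1 \<Longrightarrow> \<bar>y\<bar> < 1 \<Longrightarrow> x \<noteq> y \<Longrightarrow> (\<lambda>j. k j x y) \<longlonglongrightarrow> k' x y"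
  shows "(\<lambda>j. bilin \<mu> (k j) E F) \<longlonglongrightarrow> bilin \<mu> k' E F"
proof -
  have bd: "\<And>j x y. x \<in> {-1..1} \<Longrightarrow> y \<in> {-1..1} \<Longrightarrow> \<bar>k j x y\<bar> \<le> B" "B \<ge> 0" using k by (auto simp: bkern_def)
  have m1: "k j x \<in> borel_measurable borel" "k' x \<in> borel_measurable borel" for j x
    using kern_meas1[OF k[of j], of x] kern_meas1[OF k', of x] by auto
  note m1 [measurable]
  have inner: "(\<lambda>j. \<integral>y. indicator E y * k j x y \<partial>\<mu>) \<longlonglongrightarrow> (\<integral>y. indicator E y * k' x y \<partial>\<mu>)" if x: "\<bar>x\<bar> < 1" for x
  proof (rule integral_dominated_convergence[where w="\<lambda>_. B"])
    show "AE y in \<mu>. (\<lambda>j. indicator E y * k j x y) \<longlonglongrightarrow> indicator E y * k' x y"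
      using AE_jmu_neq[of x] AE_jmu_Ioo
      by eventually_elim (use x in \<open>auto intro!: tendsto_intros lim\<close>)
    show "AE y in \<mu>. norm (indicator E y * k j x y) \<le> B" for j
      using AE_jmu_Ioo by eventually_elim (use x bd in \<open>auto simp: indicator_def abs_less_iff\<close>)
  qed (auto simp: fin.integrable_const)
  show ?thesis unfolding bilin_def
  proof (rule integral_dominated_convergence[where w="\<lambda>_. B * measure \<mu> E"])
    show "(\<lambda>x. indicator F x * (\<integral>y. indicator E y * k' x y \<partial>\<mu>)) \<in> borel_measurable \<mu>"
      using kern_inner_meas[OF k', of E] by measurable
    show "(\<lambda>x. indicator F x * (\<integral>y. indicator E y * k j x y \<partial>\<mu>)) \<in> borel_measurable \<mu>" for j
      using kern_inner_meas[OF k[of j], of E] by measurable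
    show "AE x in \<mu>. (\<lambda>j. indicator F x * (\<integral>y. indicator E y * k j x y \<partial>\<mu>)) \<longlonglongrightarrow> indicator F x * (\<integral>y. indicator E y * k' x y \<partial>\<mu>)"
      using AE_jmu_Ioo by eventually_elim (auto intro!: tendsto_intros inner)
    show "AE x in \<mu>. norm (indicator F x * (\<integral>y. indicator E y * k j x y \<partial>\<mu>)) \<le> B * measure \<mu> E" for j
      using AE_jmu_Ioo
    proof eventually_elim
      case (elim x)
      then show ?case using kern_inner_bound[OF k[of j], of E x] bd(2) by (auto simp: indicator_def)
    qed
  qed (auto simp: fin.integrable_const)
qed

lemma Kj_bkern: "\<exists>B. bkern (Kj n) B"
proof -
  have "\<forall>j. \<exists>B\<ge>0. \<forall>x\<in>{-1..1}. \<bar>pn j x\<bar> \<le> B" using poly_bounded_Icc by blast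
  then obtain b where b: "\<And>j. b j \<ge> 0" "\<And>j x. x \<in> {-1..1} \<Longrightarrow> \<bar>pn j x\<bar> \<le> b j" by metis
  have "\<bar>Kj n x y\<bar> \<le> (\<Sum>j\<le>n. b j * b j)" if "x \<in> {-1..1}" "y \<in> {-1..1}" for x y
    unfolding Kj_sum using b that
    by (intro order_trans[OF sum_abs] sum_mono) (auto simp: abs_mult intro!: mult_mono)
  moreover have "case_prod (Kj n) \<in> borel_measurable (borel \<Otimes>\<^sub>M borel)" unfolding Kj_sum split_beta' by measurable
  ultimately show ?thesis using b by (auto simp: bkern_def intro!: exI[of _ "\<Sum>j\<le>n. b j * b j"] sum_nonneg)
qed

end

context jacobi_exp
begin

text \<open>Multiplying the kernel by the cut-off \<open>r\<close> turns every 1/(x - y) of the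
  kernel formula into \<open>qk\<close>, to which \<open>singular_bilin\<close> applies; the term
  with \<open>N1\<close> is not singular and is bounded by a product of powers. The bound is uniform
  in \<epsilon>, and \<epsilon> tends to 0.\<close>

theorem jacobi_bilin:
  "\<exists>C>0. \<exists>L. \<forall>n\<ge>1. ev n \<ge> L \<longrightarrow> (\<forall>E F. E \<in> sets borel \<longrightarrow> F \<in> sets borel \<longrightarrow>
     \<bar>bilin \<mu> (Kj n) E F\<bar> \<le> C * (measure \<mu> E powr \<theta> * measure \<mu> F powr (1 - \<theta>)))"
proof -
  obtain C0 L0 where C0: "C0 > 0" and b0: "\<And>n x. n \<ge> 1 \<Longrightarrow> ev n \<ge> L0 \<Longrightarrow> x \<in> {-1..1} \<Longrightarrow> \<bar>pn n x\<bar> \<le> C0 * Ab n x"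
     "\<And>n x. n \<ge> 1 \<Longrightarrow> ev n \<ge> L0 \<Longrightarrow> x \<in> {-1..1} \<Longrightarrow> \<bar>poly (Dp n) x\<bar> \<le> C0 * sqrt (ev n) * Bb n x"
    using Dp_bounds by metis
  obtain Cs where CsH: "Cs > 0 \<and> (\<forall>m\<ge>1. ev m \<ge> 1 \<longrightarrow> (\<forall>\<epsilon> f g B E F. \<epsilon> > 0 \<longrightarrow> f \<in> borel_measurable borel \<longrightarrow> g \<in> borel_measurable borel \<longrightarrow>
     B \<ge> 0 \<longrightarrow> (\<forall>x\<in>{-1..1}. \<bar>f x\<bar> \<le> B \<and> \<bar>g x\<bar> \<le> B) \<longrightarrow>
     ABpair m f g \<longrightarrow>
     E \<in> sets borel \<longrightarrow> F \<in> sets borel \<longrightarrow>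
     \<bar>bilin \<mu> (\<lambda>x y. f x * g y * qk \<epsilon> (x - y)) E F\<bar> \<le> Cs * (measure \<mu> E powr \<theta> * measure \<mu> F powr (1 - \<theta>))))"
    using singular_bilin by (rule exE)
  note Cs = CsH[THEN conjunct1] and H = CsH[THEN conjunct2, rule_format]
  have th: "0 \<le> \<theta>" "\<theta> < 1" "0 \<le> 1 - \<theta>" "1 - \<theta> < 1" using \<theta> by auto
  obtain C1 where C1: "C1 > 0" "\<And>E. E \<in> sets borel \<Longrightarrow> (\<integral>\<^sup>+x\<in>E. ennreal (sg \<theta> x) \<partial>\<mu>) \<le> ennreal (C1 * measure \<mu> E powr (1 - \<theta>))"
    using sg_integral[OF th(1,2)] by blast
  obtain C2 where C2: "C2 > 0" "\<And>E. E \<in> sets borel \<Longrightarrow> (\<integral>\<^sup>+x\<in>E. ennreal (sg (1 - \<theta>) x) \<partial>\<mu>) \<le> ennreal (C2 * measure \<mu> E powr (1 - (1 - \<theta>)))"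
    using sg_integral[OF th(3,4)] by blast
  define D where "D = C0^2 * KA^2 * (C1 * C2) + 2 * C0^2 * Cs"
  have main: "\<bar>bilin \<mu> (Kj n) E F\<bar> \<le> D * (measure \<mu> E powr \<theta> * measure \<mu> F powr (1 - \<theta>))"
    if n: "n \<ge> 1" "ev n \<ge> max 1 L0" and E [measurable]: "E \<in> sets borel" and F [measurable]: "F \<in> sets borel" for n E F
  proof -
    define P where "P = measure \<mu> E powr \<theta> * measure \<mu> F powr (1 - \<theta>)"
    define s where "s = sqrt (ev n)"
    have s: "s > 0" using ev_pos[OF n(1)] by (simp add: s_def)
    have N2: "N2 n > 0" "2 * s \<le> N2 n" using N2_pos[OF n(1)] N2_ge[OF n(1)] by (auto simp: s_def)
    have N1: "0 \<le> N1 n" "N1 n \<le> N2 n" using N1_bounds[OF n(1)] by auto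
    define f where "f x = pn n x / C0" for x
    define g where "g x = poly (Dp n) x / (C0 * s)" for x
    have [measurable]: "f \<in> borel_measurable borel" "g \<in> borel_measurable borel" unfolding f_def g_def by measurable
    obtain B1 where B1: "B1 \<ge> 0" "\<And>x. x \<in> {-1..1} \<Longrightarrow> \<bar>pn n x\<bar> \<le> B1" using poly_bounded_Icc[of "jp n"] by auto
    obtain B2 where B2: "B2 \<ge> 0" "\<And>x. x \<in> {-1..1} \<Longrightarrow> \<bar>poly (Dp n) x\<bar> \<le> B2" using poly_bounded_Icc[of "Dp n"] by auto
    define B where "B = max (B1 / C0) (B2 / (C0 * s))"
    have B: "B \<ge> 0" using B1 C0 by (simp add: B_def le_max_iff_disj)
    have fg: "\<bar>f x\<bar> \<le> B \<and> \<bar>g x\<bar> \<le> B" if "x \<in> {-1..1}" for x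
      using B1(2)[OF that] B2(2)[OF that] C0 s by (auto simp: f_def g_def B_def le_max_iff_disj divide_right_mono)
    have ab: "\<bar>f x\<bar> \<le> Ab n x \<and> \<bar>g x\<bar> \<le> Bb n x" if "\<bar>x\<bar> < 1" for x
      using b0[of n x] abs_le_iff[of x 1] that n C0 s by (auto simp: f_def g_def s_def field_simps)
    have AB: "ABpair n f g" "ABpair n g f" using ab by (auto simp: ABpair_def)
    define r where "r \<epsilon> t = t^2 / (t^2 + \<epsilon>^2)" for \<epsilon> t :: real
    have rb: "\<bar>r \<epsilon> t\<bar> \<le> 1" if "\<epsilon> > 0" for \<epsilon> t
    proof -
      have "t^2 + \<epsilon>^2 > 0" using that by (simp add: add_nonneg_pos)
      then show ?thesis by (simp add: r_def)
    qed
    have rm: "(\<lambda>(x, y). r \<epsilon> (x - y)) \<in> borel_measurable (borel \<Otimes>\<^sub>M borel)" for \<epsilon>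
      unfolding r_def by measurable
    \<comment> \<open>The factor sqrt (\<open>ev n\<close>) taken out of (1 - x^2) P_n' is
      compensated by \<open>N2 n\<close>, which is at least as large.\<close>
    define c where "c = C0^2 * s / N2 n"
    have c: "0 \<le> c" "c \<le> C0^2"
    proof -
      show "0 \<le> c" using s N2 by (simp add: c_def)
      have "C0^2 * s \<le> C0^2 * N2 n" using s N2 by (intro mult_left_mono) auto
      then show "c \<le> C0^2" using N2 by (simp add: c_def field_simps)
    qed
    obtain BK where BK: "bkern (Kj n) BK" using Kj_bkern by blast
    have reg: "\<bar>bilin \<mu> (\<lambda>x y. r \<epsilon> (x - y) * Kj n x y) E F\<bar> \<le> D * P" if eps: "\<epsilon> > 0" for \<epsilon>
    proof -
      let ?k1 = "\<lambda>x y. r \<epsilon> (x - y) * (N1 n / N2 n * (pn n x * pn n y))"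
      let ?k2 = "\<lambda>x y. f x * g y * qk \<epsilon> (x - y)"
      let ?k3 = "\<lambda>x y. g x * f y * qk \<epsilon> (x - y)"
      have k1: "bkern ?k1 (B1 * B1)"
      proof (rule bkern_mult_bound[OF _ rm rb[OF eps]])
        have "\<bar>N1 n / N2 n * (pn n x * pn n y)\<bar> \<le> 1 * (B1 * B1)" if "x \<in> {-1..1}" "y \<in> {-1..1}" for x y
          unfolding abs_mult using N1 N2 B1 that by (intro mult_mono) auto
        moreover have "(\<lambda>(x, y). N1 n / N2 n * (pn n x * pn n y)) \<in> borel_measurable (borel \<Otimes>\<^sub>M borel)" by measurable
        ultimately show "bkern (\<lambda>x y. N1 n / N2 n * (pn n x * pn n y)) (B1 * B1)" using B1 by (auto simp: bkern_def)
      qed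
      have kk: "bkern (\<lambda>x y. d * (u x * v y * qk \<epsilon> (x - y))) (\<bar>d\<bar> * (B * B * (1 / \<epsilon>)))"
        if [measurable]: "u \<in> borel_measurable borel" "v \<in> borel_measurable borel" and "\<And>x. x \<in> {-1..1} \<Longrightarrow> \<bar>u x\<bar> \<le> B \<and> \<bar>v x\<bar> \<le> B" for u v d
      proof -
        have "\<bar>d * (u x * v y * qk \<epsilon> (x - y))\<bar> \<le> \<bar>d\<bar> * (B * B * (1 / \<epsilon>))" if "x \<in> {-1..1}" "y \<in> {-1..1}" for x y
          unfolding abs_mult using that(1,2) \<open>\<And>x. x \<in> {-1..1} \<Longrightarrow> \<bar>u x\<bar> \<le> B \<and> \<bar>v x\<bar> \<le> B\<close> eps B by (intro mult_mono qk_bounds) auto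
        moreover have "(\<lambda>(x, y). d * (u x * v y * qk \<epsilon> (x - y))) \<in> borel_measurable (borel \<Otimes>\<^sub>M borel)" by measurable
        ultimately show ?thesis using B eps by (auto simp: bkern_def)
      qed
      have k2: "bkern (\<lambda>x y. c * ?k2 x y) (\<bar>c\<bar> * (B * B * (1 / \<epsilon>)))" and k3: "bkern (\<lambda>x y. (-c) * ?k3 x y) (\<bar>-c\<bar> * (B * B * (1 / \<epsilon>)))"
        by (rule kk; use fg in simp)+
      have k23: "bkern (\<lambda>x y. c * ?k2 x y + (-c) * ?k3 x y) (\<bar>c\<bar> * (B * B * (1 / \<epsilon>)) + \<bar>-c\<bar> * (B * B * (1 / \<epsilon>)))"
        by (rule bkern_add[OF k2 k3])
      \<comment> \<open>No division by x - y takes place, so the identity also holds on the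
        diagonal, where both sides are 0.\<close>
      have id: "r \<epsilon> (x - y) * Kj n x y = ?k1 x y + (c * ?k2 x y + (-c) * ?k3 x y)" for x y
      proof -
        define h where "h = (x - y)^2 + \<epsilon>^2"
        have h: "h \<noteq> 0" using eps by (simp add: h_def add_nonneg_eq_0_iff)
        have "r \<epsilon> (x - y) * Kj n x y = (N2 n * (x - y) * Kj n x y) * ((x - y) / (h * N2 n))"
          using N2 by (simp add: r_def h_def power2_eq_square)
        also have "\<dots> = ?k1 x y + (c * ?k2 x y + (-c) * ?k3 x y)"
          unfolding kernel_formula[OF n(1)] r_def qk_def h_def[symmetric] f_def g_def c_def
          using h N2 C0 s by (simp add: field_simps power2_eq_square)
        finally show ?thesis .
      qed
      have "bilin \<mu> (\<lambda>x y. r \<epsilon> (x - y) * Kj n x y) E F = bilin \<mu> ?k1 E F + (c * bilin \<mu> ?k2 E F + (-c) * bilin \<mu> ?k3 E F)"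
        unfolding id bilin_add[OF k1 k23 E F] bilin_add[OF k2 k3 E F] bilin_cmult ..
      moreover have "\<bar>bilin \<mu> ?k1 E F\<bar> \<le> C0^2 * KA^2 * ((C1 * measure \<mu> F powr (1 - \<theta>)) * (C2 * measure \<mu> E powr (1 - (1 - \<theta>))))"
      proof (rule bilin_far[OF k1 E F sg_measurable sg_measurable _ _ _ _ _ _ C1(2)[OF F] C2(2)[OF E]])
        fix x y :: real assume "x \<in> {-1<..<1}" "y \<in> {-1<..<1}"
        then have x: "\<bar>x\<bar> < 1" and y: "\<bar>y\<bar> < 1" by auto
        have "\<bar>?k1 x y\<bar> \<le> 1 * (1 * ((C0 * Ab n x) * (C0 * Ab n y)))"
          unfolding abs_mult using rb[OF eps] N1 N2 x y n C0 b0(1)[of n x] b0(1)[of n y] abs_le_iff[of x 1] abs_le_iff[of y 1]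
          by (intro mult_mono) (auto simp: Ab_def)
        also have "\<dots> = C0^2 * (Ab n x * Ab n y)" by (simp add: power2_eq_square)
        also have "\<dots> \<le> C0^2 * (KA^2 * (sg \<theta> x * sg (1 - \<theta>) y))" using n x y by (intro mult_left_mono Ab_Ab_le) auto
        finally show "\<bar>?k1 x y\<bar> \<le> C0^2 * KA^2 * (sg \<theta> x * sg (1 - \<theta>) y)" by (simp add: mult.assoc)
      qed (use C1 C2 in \<open>auto simp: sg_def\<close>)
      moreover have b2: "\<bar>bilin \<mu> ?k2 E F\<bar> \<le> Cs * P" unfolding P_def
        by (rule H[OF n(1) _ eps _ _ B _ AB(1) E F]) (use n fg in auto)
      moreover have b3: "\<bar>bilin \<mu> ?k3 E F\<bar> \<le> Cs * P" unfolding P_def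
        by (rule H[OF n(1) _ eps _ _ B _ AB(2) E F]) (use n fg in auto)
      moreover have "\<bar>c * bilin \<mu> ?k2 E F\<bar> \<le> C0^2 * (Cs * P)" "\<bar>(-c) * bilin \<mu> ?k3 E F\<bar> \<le> C0^2 * (Cs * P)"
        unfolding abs_mult using c b2 b3 by (intro mult_mono; simp)+
      moreover have "D * P = C0^2 * KA^2 * ((C1 * measure \<mu> F powr (1 - \<theta>)) * (C2 * measure \<mu> E powr (1 - (1 - \<theta>)))) + (C0^2 * (Cs * P) + C0^2 * (Cs * P))"
        by (simp add: D_def P_def algebra_simps)
      ultimately show ?thesis by linarith
    qed
    have "(\<lambda>j. bilin \<mu> (\<lambda>x y. r (1 / real (Suc j)) (x - y) * Kj n x y) E F) \<longlonglongrightarrow> bilin \<mu> (Kj n) E F"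
    proof (rule bilin_LIMSEQ[OF _ BK E F])
      show "bkern (\<lambda>x y. r (1 / real (Suc j)) (x - y) * Kj n x y) BK" for j
        by (rule bkern_mult_bound[OF BK rm rb]) simp
      fix x y :: real assume xy: "x \<noteq> y"
      have "(\<lambda>j. r (1 / real (Suc j)) (x - y) * Kj n x y) \<longlonglongrightarrow> (x - y)^2 / ((x - y)^2 + 0^2) * Kj n x y"
        unfolding r_def using xy by (intro tendsto_intros lim_1_over_n[THEN LIMSEQ_Suc]) auto
      then show "(\<lambda>j. r (1 / real (Suc j)) (x - y) * Kj n x y) \<longlonglongrightarrow> Kj n x y" using xy by simp
    qed
    then have "(\<lambda>j. \<bar>bilin \<mu> (\<lambda>x y. r (1 / real (Suc j)) (x - y) * Kj n x y) E F\<bar>) \<longlonglongrightarrow> \<bar>bilin \<mu> (Kj n) E F\<bar>"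
      by (rule tendsto_rabs)
    then show ?thesis unfolding P_def[symmetric]
      by (rule LIMSEQ_le_const2) (auto intro!: reg)
  qed
  have "D > 0" using C0 C1 C2 Cs by (auto simp: D_def intro!: add_nonneg_pos)
  then show ?thesis by (intro exI[of _ D] exI[of _ "max 1 L0"] conjI allI impI main) auto
qed

end

section \<open>Kernels in the presence of point masses\<close>

context jacobi
begin

text \<open>Up to a constant |K(x, a)| is at most \<open>Ab n x * Ab n a * Th n x a\<close>; this
  merges the two parts of \<open>kernel_offdiag_bound\<close>.\<close>

definition Th where
  "Th n x a = (if x = a then sqrt (ev n) else min (sqrt (ev n)) (1 + (sqrt (dd x) + sqrt (dd a)) / \<bar>x - a\<bar>))"

text \<open>The power of sqrt (\<open>ev n\<close>) that it costs to bound the integral of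
  \<open>Ab * Th\<close> over a set by the measure to the power 1 - \<kappa>. Its values at \<theta>
  and 1 - \<theta> add up to 1, see \<open>zz_sum\<close>.\<close>

definition zz where "zz a \<kappa> = (if \<bar>a\<bar> < 1 then 1 - \<kappa> else gm a + 3/2 - 2 * \<kappa> * (gm a + 1))"

lemma Th_measurable [measurable]: "(\<lambda>x. Th n x a) \<in> borel_measurable borel" unfolding Th_def by measurable
lemma Ab_measurable [measurable]: "Ab n \<in> borel_measurable borel" unfolding Ab_def Xr_def by measurable

lemma Th_bounds:
  assumes "x \<in> {-1..1}" "a \<in> {-1..1}" "ev n \<ge> 1"
  shows "1 \<le> Th n x a" "Th n x a \<le> sqrt (ev n)" "x \<noteq> a \<Longrightarrow> Th n x a \<le> 1 + 2 / \<bar>x - a\<bar>"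
proof -
  have d: "0 \<le> dd x" "0 \<le> dd a" "dd x \<le> 1" "dd a \<le> 1" using assms by (auto simp: dd_def)
  then show "1 \<le> Th n x a" using assms by (auto simp: Th_def)
  show "Th n x a \<le> sqrt (ev n)" by (auto simp: Th_def)
  assume "x \<noteq> a"
  have "sqrt (dd x) + sqrt (dd a) \<le> 1 + 1" using d by (intro add_mono) auto
  then have "(sqrt (dd x) + sqrt (dd a)) / \<bar>x - a\<bar> \<le> 2 / \<bar>x - a\<bar>" by (intro divide_right_mono) auto
  then show "Th n x a \<le> 1 + 2 / \<bar>x - a\<bar>" using \<open>x \<noteq> a\<close> by (auto simp: Th_def)
qed

text \<open>Closer than 1/\<open>ev n\<close> to the end point the bound sqrt (\<open>ev n\<close>)
  is used, farther away a multiple of 1 / sqrt (\<open>dd x\<close>); each has the order of the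
  regularised distance to the power -1/2.\<close>

lemma Th_endpoint:
  assumes "n \<ge> 1" "ev n \<ge> 1" and x: "\<bar>x\<bar> < 1" and a: "dd a = 0" "\<bar>x - a\<bar> = dd x"
  shows "Th n x a \<le> 3 * Xr n x powr (- (1/2))"
proof -
  have d: "0 < dd x" "dd x \<le> 1" using x by (auto simp: dd_def)
  have e: "0 < ev n" using assms by simp
  have X: "Xr n x > 0" using d e by (simp add: Xr_def add_pos_pos)
  have xa: "x \<noteq> a" using a x by (auto simp: dd_def)
  have "(Th n x a)^2 * Xr n x \<le> 3^2"
  proof (cases "dd x \<le> 1 / ev n")
    case True
    have "(Th n x a)^2 \<le> (sqrt (ev n))^2" using d e a xa by (intro power_mono) (auto simp: Th_def)
    then have "(Th n x a)^2 * Xr n x \<le> ev n * (2 * (1 / ev n))"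
      using True X e by (intro mult_mono) (auto simp: Xr_def)
    also have "\<dots> \<le> 3^2" using e by simp
    finally show ?thesis .
  next
    case False
    have s: "sqrt (dd x) > 0" "sqrt (dd x) \<le> 1" using d by auto
    have "Th n x a \<le> 1 + sqrt (dd x) / dd x" using a xa by (auto simp: Th_def)
    also have "\<dots> = 1 + 1 / sqrt (dd x)" using d by (simp add: field_simps)
    also have "\<dots> \<le> 2 / sqrt (dd x)"
    proof -
      have "1 + 1 / t \<le> 2 / t" if "t > 0" "t \<le> 1" for t :: real using that by (simp add: field_simps)
      then show ?thesis using s by blast
    qed
    finally have "(Th n x a)^2 \<le> (2 / sqrt (dd x))^2" using d e a xa by (intro power_mono) (auto simp: Th_def)
    then have "(Th n x a)^2 * Xr n x \<le> (4 / dd x) * (2 * dd x)"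
      using False X d by (intro mult_mono) (auto simp: Xr_def power_divide)
    also have "\<dots> \<le> 3^2" using d by simp
    finally show ?thesis .
  qed
  then have "(Th n x a * sqrt (Xr n x))^2 \<le> 3^2" using X by (simp add: power_mult_distrib)
  then have "Th n x a * sqrt (Xr n x) \<le> 3" by (rule power2_le_imp_le) simp
  then show ?thesis using X by (simp add: powr_minus powr_half_sqrt field_simps)
qed

end

context jacobi_exp
begin

text \<open>Near an interior a the minimum of sqrt (\<open>ev n\<close>) and 1/|x - a| is
  interpolated between the two. At an end point the singularities of \<open>Ab\<close> and
  \<open>Th\<close> fall together, and the power beyond the critical one is paid for by a power of
  \<open>ev n\<close>. Elsewhere \<open>Th\<close> is bounded.\<close>

lemma Th_pointwise:
  assumes a: "a \<in> {-1..1}" and \<kappa>: "0 < \<kappa>" "\<kappa> < 1" "\<And>x. gm x / 2 + 1/4 \<le> \<kappa> * (gm x + 1)"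
    and ka: "\<kappa> * (gm a + 1) \<le> gm a / 2 + 3/4"
  shows "\<exists>C>0. \<forall>n\<ge>1. ev n \<ge> 1 \<longrightarrow> (\<forall>x. \<bar>x\<bar> < 1 \<longrightarrow> x \<noteq> a \<longrightarrow> Ab n x * Th n x a \<le>
     C * sqrt (ev n) powr (zz a \<kappa>) * (sg \<kappa> x + indicator {x. \<bar>x - a\<bar> < dd a / 2} x * \<bar>x - a\<bar> powr (- \<kappa>)))"
proof -
  have g1: "gm x + 1 > 0" for x using ab by (auto simp: gm_def)
  have z: "zz a \<kappa> \<ge> 0" using ka \<kappa> by (auto simp: zz_def)
  have Z: "sqrt (ev n) powr (zz a \<kappa>) \<ge> 1" if "ev n \<ge> 1" for n
    using that z by (intro ge_one_powr_ge_zero) auto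
  have away: "Ab n x * Th n x a \<le> C * sqrt (ev n) powr (zz a \<kappa>) * (sg \<kappa> x + r)"
    if n: "n \<ge> 1" "ev n \<ge> 1" and x: "\<bar>x\<bar> < 1" and T: "Th n x a \<le> T" and C: "KA * T \<le> C" and r: "r \<ge> 0" for n x T C r
  proof -
    have s0: "sg \<kappa> x \<ge> 0" by (simp add: sg_def)
    have xi: "x \<in> {-1..1}" using x by auto
    have T0: "T \<ge> 0" using Th_bounds(1)[OF xi a n(2)] T by linarith
    have C0: "C \<ge> 0" using C KA T0 by (meson mult_nonneg_nonneg order_trans zero_le_one)
    have "Ab n x * Th n x a \<le> (KA * sg \<kappa> x) * T"
      using T KA s0 Th_bounds(1)[OF xi a n(2)] \<kappa> by (intro mult_mono Ab_le_sg n x \<kappa>(3)) auto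
    also have "\<dots> = (KA * T) * sg \<kappa> x" by simp
    also have "\<dots> \<le> C * (sg \<kappa> x + r)" using C r s0 C0 by (intro mult_mono) auto
    also have "\<dots> \<le> (C * sqrt (ev n) powr (zz a \<kappa>)) * (sg \<kappa> x + r)"
      using Z[OF n(2)] C0 r s0 mult_left_mono[OF Z[OF n(2)], of C] by (intro mult_right_mono) auto
    finally show ?thesis by simp
  qed
  show ?thesis
  proof (cases "\<bar>a\<bar> < 1")
    case True
    define \<delta> where "\<delta> = dd a / 2"
    have \<delta>: "0 < \<delta>" "\<delta> \<le> 1/2" using True by (auto simp: \<delta>_def dd_def)
    define G where "G = KA * \<delta> powr (- (\<kappa> * (\<bar>\<alpha>\<bar> + \<bar>\<beta>\<bar> + 1)))"
    define C where "C = KA * (1 + 2 / \<delta>) + G * 3"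
    have G: "G > 0" using KA \<delta> by (auto simp: G_def)
    have CC: "KA * (1 + 2 / \<delta>) \<le> C" "G * 3 \<le> C" using G KA \<delta> by (auto simp: C_def)
    have "Ab n x * Th n x a \<le> C * sqrt (ev n) powr (zz a \<kappa>) * (sg \<kappa> x + indicator {x. \<bar>x - a\<bar> < \<delta>} x * \<bar>x - a\<bar> powr (- \<kappa>))"
      if n: "n \<ge> 1" "ev n \<ge> 1" and x: "\<bar>x\<bar> < 1" and xa: "x \<noteq> a" for n x
    proof (cases "\<bar>x - a\<bar> < \<delta>")
      case near: True
      have xi: "x \<in> {-1..1}" using x by auto
      define u where "u = \<bar>x - a\<bar>"
      define s where "s = sqrt (ev n)"
      have u: "0 < u" "u < \<delta>" using near xa by (auto simp: u_def)
      have s: "s \<ge> 1" using n by (simp add: s_def)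
      have dx: "\<delta> \<le> dd x" using u abs_triangle_ineq2[of x a] unfolding u_def \<delta>_def dd_def by (simp add: field_simps)
      have "Ab n x \<le> KA * sg \<kappa> x" using \<kappa> by (intro Ab_le_sg n x \<kappa>(3)) auto
      also have "sg \<kappa> x \<le> \<delta> powr (- (\<kappa> * (gm x + 1)))" unfolding sg_def using dx \<delta> \<kappa> g1[of x] by (intro powr_mono2') auto
      also have "\<dots> \<le> \<delta> powr (- (\<kappa> * (\<bar>\<alpha>\<bar> + \<bar>\<beta>\<bar> + 1)))"
        using \<delta> \<kappa> by (intro powr_mono') (auto simp: gm_def intro!: mult_left_mono)
      finally have A: "Ab n x \<le> G" using KA by (simp add: G_def)
      have T1: "Th n x a \<le> 3 * s" using Th_bounds(2)[OF xi a n(2)] s unfolding s_def[symmetric] by linarith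
      have "Th n x a \<le> 1 + 2 / u" using Th_bounds(3)[OF xi a n(2) xa] by (simp add: u_def)
      also have "\<dots> \<le> 3 * (1 / u)" using u \<delta> by (simp add: field_simps)
      finally have T2: "Th n x a \<le> 3 * (1 / u)" .
      define m where "m = min s (1 / u)"
      have m: "m > 0" "m \<le> s" "m \<le> 1 / u" using s u by (auto simp: m_def)
      have "m = m powr (1 - \<kappa>) * m powr \<kappa>" using m by (simp add: powr_add[symmetric])
      also have "\<dots> \<le> s powr (1 - \<kappa>) * (1 / u) powr \<kappa>" using m \<kappa> by (intro mult_mono powr_mono2) auto
      also have "\<dots> = s powr (1 - \<kappa>) * u powr (- \<kappa>)" using u by (simp add: powr_divide powr_minus divide_simps)
      finally have "Th n x a \<le> 3 * (s powr (1 - \<kappa>) * u powr (- \<kappa>))" using T1 T2 by (simp add: m_def min_def split: if_splits)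
      then have "Ab n x * Th n x a \<le> G * (3 * (s powr (1 - \<kappa>) * u powr (- \<kappa>)))"
        using A G Th_bounds(1)[OF xi a n(2)] by (intro mult_mono) auto
      also have "\<dots> = (G * 3) * (s powr (1 - \<kappa>) * u powr (- \<kappa>))" by simp
      also have "\<dots> \<le> C * (s powr (1 - \<kappa>) * (sg \<kappa> x + u powr (- \<kappa>)))"
        using CC G by - (rule mult_mono, auto simp: sg_def intro!: mult_left_mono)
      finally show ?thesis using near True by (simp add: u_def s_def zz_def mult.assoc)
    next
      case False
      have xi: "x \<in> {-1..1}" using x by auto
      have "2 / \<bar>x - a\<bar> \<le> 2 / \<delta>" using False \<delta> by (intro divide_left_mono) auto
      then have "Th n x a \<le> 1 + 2 / \<delta>" using Th_bounds(3)[OF xi a n(2) xa] by linarith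
      then show ?thesis by (rule away[OF n x _ CC(1)]) simp
    qed
    moreover have "C > 0" using CC G by linarith
    ultimately show ?thesis unfolding \<delta>_def by (intro exI[of _ C] conjI allI impI) simp_all
  next
    case False
    then have a1: "a = 1 \<or> a = -1" using a by auto
    then have da: "dd a = 0" by (auto simp: dd_def)
    define C where "C = KA * 3 + 3"
    have "Ab n x * Th n x a \<le> C * sqrt (ev n) powr (zz a \<kappa>) * (sg \<kappa> x + 0)"
      if n: "n \<ge> 1" "ev n \<ge> 1" and x: "\<bar>x\<bar> < 1" and xa: "x \<noteq> a" for n x
    proof (cases "gm x = gm a \<and> \<bar>x - a\<bar> = dd x")
      case True
      \<comment> \<open>The excess over the critical power, nonnegative by \<open>ka\<close>. Since
        the regularised distance is at least 1/\<open>ev n\<close>, it costs \<open>ev n\<close> to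
        the power e.\<close>
      define e where "e = gm a / 2 + 3/4 - \<kappa> * (gm a + 1)"
      have e: "e \<ge> 0" using ka by (simp add: e_def)
      have X: "Xr n x > 0" "dd x \<le> Xr n x" "1 / ev n \<le> Xr n x" "dd x > 0"
        using x n by (auto simp: Xr_def dd_def add_pos_pos)
      have "Ab n x * Th n x a \<le> Ab n x * (3 * Xr n x powr (- (1/2)))"
        using True by (intro mult_left_mono Th_endpoint n x da) (auto simp: Ab_def)
      also have "\<dots> = 3 * (Xr n x powr (- (gm a / 2 + 1/4)) * Xr n x powr (- (1/2)))" using True by (simp add: Ab_def)
      also have "Xr n x powr (- (gm a / 2 + 1/4)) * Xr n x powr (- (1/2)) = Xr n x powr (- e) * Xr n x powr (- (\<kappa> * (gm a + 1)))"
        unfolding powr_add[symmetric] by (rule arg_cong[where f="\<lambda>k. Xr n x powr k"]) (simp add: e_def)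
      also have "\<dots> \<le> (1 / ev n) powr (- e) * dd x powr (- (\<kappa> * (gm a + 1)))"
        using X e \<kappa> g1[of a] n by (intro mult_mono powr_mono2') auto
      also have "(1 / ev n) powr (- e) = sqrt (ev n) powr (zz a \<kappa>)"
      proof -
        have "(1 / ev n) powr (- e) = ev n powr e" using n by (simp add: powr_divide powr_minus)
        also have "\<dots> = (ev n powr (1/2)) powr (zz a \<kappa>)"
          unfolding powr_powr using False by (intro arg_cong[where f="\<lambda>k. ev n powr k"]) (simp add: zz_def e_def)
        finally show ?thesis using n by (simp add: powr_half_sqrt)
      qed
      also have "dd x powr (- (\<kappa> * (gm a + 1))) = sg \<kappa> x" using True by (simp add: sg_def)
      finally have "Ab n x * Th n x a \<le> 3 * (sqrt (ev n) powr (zz a \<kappa>) * sg \<kappa> x)" by simp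
      also have "\<dots> \<le> C * (sqrt (ev n) powr (zz a \<kappa>) * sg \<kappa> x)"
        using KA by (intro mult_right_mono) (auto simp: C_def sg_def)
      finally show ?thesis by (simp add: mult.assoc)
    next
      case False
      then have u: "\<bar>x - a\<bar> \<ge> 1" using a1 x by (auto simp: gm_def dd_def split: if_splits)
      have xi: "x \<in> {-1..1}" using x by auto
      have "2 / \<bar>x - a\<bar> \<le> 2" using u by (simp add: field_simps)
      then have "Th n x a \<le> 3" using Th_bounds(3)[OF xi a n(2) xa] by linarith
      then show ?thesis by (rule away[OF n x]) (auto simp: C_def)
    qed
    moreover have "C > 0" using KA by (simp add: C_def)
    ultimately show ?thesis using da by (intro exI[of _ C] conjI allI impI) simp_all
  qed
qed

lemma Th_integral:
  assumes a: "a \<in> {-1..1}" and \<kappa>: "0 < \<kappa>" "\<kappa> < 1" "\<And>x. gm x / 2 + 1/4 \<le> \<kappa> * (gm x + 1)"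
    and ka: "\<kappa> * (gm a + 1) \<le> gm a / 2 + 3/4"
  shows "\<exists>C>0. \<forall>n\<ge>1. ev n \<ge> 1 \<longrightarrow> (\<forall>E. E \<in> sets borel \<longrightarrow>
     (\<integral>\<^sup>+x\<in>E. ennreal (Ab n x * Th n x a) \<partial>\<mu>) \<le> ennreal (C * sqrt (ev n) powr (zz a \<kappa>) * measure \<mu> E powr (1 - \<kappa>)))"
proof -
  obtain C where C: "C > 0" and b: "\<And>n x. n \<ge> 1 \<Longrightarrow> ev n \<ge> 1 \<Longrightarrow> \<bar>x\<bar> < 1 \<Longrightarrow> x \<noteq> a \<Longrightarrow> Ab n x * Th n x a \<le>
     C * sqrt (ev n) powr (zz a \<kappa>) * (sg \<kappa> x + indicator {x. \<bar>x - a\<bar> < dd a / 2} x * \<bar>x - a\<bar> powr (- \<kappa>))"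
    using Th_pointwise[OF assms] by metis
  obtain C1 where C1: "C1 > 0" "\<And>E. E \<in> sets borel \<Longrightarrow> (\<integral>\<^sup>+x\<in>E. ennreal (sg \<kappa> x) \<partial>\<mu>) \<le> ennreal (C1 * measure \<mu> E powr (1 - \<kappa>))"
    using sg_integral[of \<kappa>] \<kappa> by auto
  define \<delta> where "\<delta> = dd a / 2"
  define S where "S = {x. \<bar>x - a\<bar> < \<delta>} - {a}"
  have [measurable]: "S \<in> sets borel" unfolding S_def by measurable
  define r where "r = 2 / \<delta>"
  \<comment> \<open>Near an interior point the weight is bounded, so
    \<open>power_weight_integral\<close> applies with exponent 0. For an end point
    \<open>\<delta>\<close> is 0 and \<open>S\<close> is empty.\<close>
  have w: "jw \<alpha> \<beta> x \<le> r powr \<bar>\<alpha>\<bar> * r powr \<bar>\<beta>\<bar> * \<bar>x - a\<bar> powr 0" if "x \<in> S" for x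
  proof -
    have u: "0 < \<bar>x - a\<bar>" "\<bar>x - a\<bar> < \<delta>" using that by (auto simp: S_def)
    have \<delta>: "\<delta> > 0" using u by linarith
    have dx: "\<delta> \<le> dd x" using u abs_triangle_ineq2[of x a] unfolding \<delta>_def dd_def by (simp add: field_simps)
    have x: "\<delta> \<le> 1 - x" "\<delta> \<le> 1 + x" "1 - x \<le> 2" "1 + x \<le> 2" "\<delta> \<le> 1" using dx \<delta> by (auto simp: dd_def)
    have r: "1 \<le> r * (1 - x)" "1 \<le> r * (1 + x)" "1 - x \<le> r" "1 + x \<le> r"
    proof -
      have "2 \<le> r" "r * \<delta> = 2" using x \<delta> by (simp_all add: r_def field_simps)
      moreover from this have "r * \<delta> \<le> r * (1 - x)" "r * \<delta> \<le> r * (1 + x)" using x by (intro mult_left_mono; simp)+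
      ultimately show "1 \<le> r * (1 - x)" "1 \<le> r * (1 + x)" "1 - x \<le> r" "1 + x \<le> r" using x by linarith+
    qed
    have "jw \<alpha> \<beta> x = (1 - x) powr \<alpha> * (1 + x) powr \<beta>" using x \<delta> by (simp add: jw_def)
    also have "\<dots> \<le> r powr \<bar>\<alpha>\<bar> * r powr \<bar>\<beta>\<bar>"
      using powr_comparable[of 1 "1 - x" r \<alpha>] powr_comparable[of 1 "1 + x" r \<beta>] r x \<delta> by (intro mult_mono) auto
    finally show ?thesis using u by simp
  qed
  obtain C2 where C2: "C2 > 0" "\<And>E. E \<in> sets borel \<Longrightarrow> E \<subseteq> S \<Longrightarrow>
    (\<integral>\<^sup>+x\<in>E. ennreal (\<bar>x - a\<bar> powr (- \<kappa>)) \<partial>\<mu>) \<le> ennreal (C2 * measure \<mu> E powr (1 - \<kappa>))"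
    using power_weight_integral[OF ab, of 0 \<kappa> "r powr \<bar>\<alpha>\<bar> * r powr \<bar>\<beta>\<bar>" S a] w \<kappa> by auto
  define D where "D = C * (C1 + C2)"
  have "(\<integral>\<^sup>+x\<in>E. ennreal (Ab n x * Th n x a) \<partial>\<mu>) \<le> ennreal (D * sqrt (ev n) powr (zz a \<kappa>) * measure \<mu> E powr (1 - \<kappa>))"
    if n: "n \<ge> 1" "ev n \<ge> 1" and E [measurable]: "E \<in> sets borel" for n E
  proof -
    define A where "A = C * sqrt (ev n) powr (zz a \<kappa>)"
    have A: "A \<ge> 0" using C by (simp add: A_def)
    let ?v = "\<lambda>x. \<bar>x - a\<bar> powr (- \<kappa>)"
    have "(\<integral>\<^sup>+x\<in>E. ennreal (Ab n x * Th n x a) \<partial>\<mu>) \<le> (\<integral>\<^sup>+x. ennreal A * (ennreal (sg \<kappa> x) * indicator E x + ennreal (?v x) * indicator (E \<inter> S) x) \<partial>\<mu>)"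
    proof (rule nn_integral_mono_AE, use AE_jmu_Ioo AE_jmu_neq[of a] in eventually_elim)
      case (elim x)
      show ?case
      proof (cases "x \<in> E")
        case True
        have "ennreal (Ab n x * Th n x a) \<le> ennreal (A * (sg \<kappa> x + indicator S x * ?v x))"
          using b[OF n, of x] elim by (intro ennreal_leI) (auto simp: A_def S_def \<delta>_def indicator_def)
        also have "\<dots> = ennreal A * (ennreal (sg \<kappa> x) + ennreal (?v x) * indicator S x)"
          using A by (auto simp: ennreal_mult ennreal_plus sg_def indicator_def)
        finally show ?thesis using True by (simp add: indicator_inter_arith)
      qed simp
    qed
    also have "\<dots> = ennreal A * ((\<integral>\<^sup>+x\<in>E. ennreal (sg \<kappa> x) \<partial>\<mu>) + (\<integral>\<^sup>+x\<in>E \<inter> S. ennreal (?v x) \<partial>\<mu>))"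
      by (subst nn_integral_cmult, measurable) (subst nn_integral_add, auto)
    also have "\<dots> \<le> ennreal A * (ennreal (C1 * measure \<mu> E powr (1 - \<kappa>)) + ennreal (C2 * measure \<mu> (E \<inter> S) powr (1 - \<kappa>)))"
      by (intro mult_left_mono add_mono C1 C2) auto
    also have "\<dots> = ennreal (A * (C1 * measure \<mu> E powr (1 - \<kappa>) + C2 * measure \<mu> (E \<inter> S) powr (1 - \<kappa>)))"
      using A C1(1) C2(1) by (simp add: ennreal_mult ennreal_plus)
    also have "\<dots> \<le> ennreal (D * sqrt (ev n) powr (zz a \<kappa>) * measure \<mu> E powr (1 - \<kappa>))"
    proof (rule ennreal_leI)
      have "measure \<mu> (E \<inter> S) \<le> measure \<mu> E" by (intro fin.finite_measure_mono) auto
      then have "measure \<mu> (E \<inter> S) powr (1 - \<kappa>) \<le> measure \<mu> E powr (1 - \<kappa>)" using \<kappa> by (intro powr_mono2) auto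
      then have "A * (C1 * measure \<mu> E powr (1 - \<kappa>) + C2 * measure \<mu> (E \<inter> S) powr (1 - \<kappa>)) \<le> A * (C1 * measure \<mu> E powr (1 - \<kappa>) + C2 * measure \<mu> E powr (1 - \<kappa>))"
        using A C2(1) by (intro mult_left_mono add_left_mono) auto
      then show "A * (C1 * measure \<mu> E powr (1 - \<kappa>) + C2 * measure \<mu> (E \<inter> S) powr (1 - \<kappa>)) \<le> D * sqrt (ev n) powr (zz a \<kappa>) * measure \<mu> E powr (1 - \<kappa>)"
        by (simp add: A_def D_def algebra_simps)
    qed
    finally show ?thesis .
  qed
  moreover have "D > 0" using C C1 C2 by (simp add: D_def)
  ultimately show ?thesis by (intro exI[of _ D] conjI allI impI) simp_all
qed

end

section \<open>Adding the masses one at a time\<close>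

context jacobi
begin

definition Jm where "Jm a M i q = I q + (\<Sum>j<(i::nat). M j * poly q (a j))" for a M :: "nat \<Rightarrow> real"

text \<open>The rank-one update of the reproducing kernel when a mass is added at
  \<open>a i\<close>. The argument x is the point of evaluation; the polynomial is in the other
  variable.\<close>

primrec Qm :: "(nat \<Rightarrow> real) \<Rightarrow> (nat \<Rightarrow> real) \<Rightarrow> nat \<Rightarrow> nat \<Rightarrow> real \<Rightarrow> real poly" where
  "Qm a M n 0 = Kp n"
| "Qm a M n (Suc i) = (\<lambda>x. Qm a M n i x -
     smult (M i * poly (Qm a M n i x) (a i) / (1 + M i * poly (Qm a M n i (a i)) (a i))) (Qm a M n i (a i)))"

definition Km where "Km a M n i x y = poly (Qm a M n i x) y"

lemma Km_0: "Km a M n 0 = Kj n" by (simp add: Km_def Kj_def fun_eq_iff)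

lemma Km_Suc: "Km a M n (Suc i) x y =
   Km a M n i x y - M i / (1 + M i * Km a M n i (a i) (a i)) * (Km a M n i x (a i) * Km a M n i (a i) y)"
  by (simp add: Km_def)

lemma Jm_diff: "Jm a M i (f - g) = Jm a M i f - Jm a M i g"
  by (simp add: Jm_def I_diff right_diff_distrib sum_subtractf)

lemma Jm_smult: "Jm a M i (smult c f) = c * Jm a M i f"
  by (simp add: Jm_def I_smult distrib_left sum_distrib_left mult_ac)

lemma Jm_Suc: "Jm a M (Suc i) q = Jm a M i q + M i * poly q (a i)" by (simp add: Jm_def)

lemma Jm_square_nonneg:
  assumes "\<And>j. j < i \<Longrightarrow> M j > 0" shows "Jm a M i (q * q) \<ge> 0"
proof -
  have "I (q * q) \<ge> 0" unfolding I_def by (intro integral_nonneg_AE) auto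
  moreover have "(\<Sum>j<i. M j * poly (q * q) (a j)) \<ge> 0" by (intro sum_nonneg mult_nonneg_nonneg) (auto simp: assms less_imp_le)
  ultimately show ?thesis by (simp add: Jm_def)
qed

lemma degree_Qm: "degree (Qm a M n i x) \<le> n"
  by (induction i arbitrary: x)
     (auto simp: degree_Kp intro!: degree_diff_le order_trans[OF degree_smult_le])

text \<open>The coefficient \<open>t\<close> of the update is exactly what cancels the new mass
  term. Its denominator is nonzero because the kernel at (\<open>a i\<close>, \<open>a i\<close>) is
  a square norm and hence nonnegative.\<close>

lemma Qm_reproducing:
  assumes "\<And>j. j < i \<Longrightarrow> M j > 0" "degree q \<le> n"
  shows "Jm a M i (Qm a M n i x * q) = poly q x"
  using assms
proof (induction i arbitrary: x q)
  case 0
  then show ?case by (simp add: Jm_def Kp_reproducing)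
next
  case (Suc i)
  have IH: "Jm a M i (Qm a M n i x * q) = poly q x" if "degree q \<le> n" for x q using Suc that by auto
  define kk where "kk = Km a M n i (a i) (a i)"
  define u where "u = Km a M n i x (a i)"
  define t where "t = M i * u / (1 + M i * kk)"
  have "kk = Jm a M i (Qm a M n i (a i) * Qm a M n i (a i))" using IH[OF degree_Qm[of a M n i "a i"]] by (simp add: kk_def Km_def)
  then have "kk \<ge> 0" using Jm_square_nonneg[of i M] Suc.prems(1) by simp
  then have d: "1 + M i * kk \<noteq> 0" using Suc.prems(1)[of i] by (simp add: add_pos_nonneg less_imp_neq[symmetric])
  have Q: "Qm a M n (Suc i) x * q = Qm a M n i x * q - smult t (Qm a M n i (a i) * q)"
    by (simp add: t_def u_def kk_def Km_def algebra_simps)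
  have e1: "Jm a M i (Qm a M n (Suc i) x * q) = poly q x - t * poly q (a i)"
    unfolding Q Jm_diff Jm_smult IH[OF Suc.prems(2)] ..
  have e2: "poly (Qm a M n (Suc i) x * q) (a i) = (u - t * kk) * poly q (a i)"
    by (simp add: t_def u_def kk_def Km_def algebra_simps)
  have "Jm a M (Suc i) (Qm a M n (Suc i) x * q) = poly q x + (M i * (u - t * kk) - t) * poly q (a i)"
    unfolding Jm_Suc e1 e2 by (simp add: algebra_simps)
  moreover have "M i * (u - t * kk) - t = 0"
  proof -
    have "M i * (u - t * kk) - t = M i * u - t * (1 + M i * kk)" by (simp add: algebra_simps)
    also have "\<dots> = 0" using d by (simp add: t_def)
    finally show ?thesis .
  qed
  ultimately show ?case by simp
qed

text \<open>The functional on the product of both polynomials can be evaluated by either reproducing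
  property. With the two families equal this is the symmetry of the kernel.\<close>

lemma reproducing_unique:
  assumes "\<And>x. degree (Q x) \<le> n" "\<And>x. degree (Q' x) \<le> n"
    and "\<And>x q. degree q \<le> n \<Longrightarrow> T (Q x * q) = poly q x" "\<And>x q. degree q \<le> n \<Longrightarrow> T (Q' x * q) = poly q x"
  shows "poly (Q x) y = poly (Q' y) x"
  using assms(3)[OF assms(2)[of y], of x] assms(4)[OF assms(1)[of x], of y] by (simp add: mult.commute)

lemma Km_sym:
  assumes "\<And>j. j < i \<Longrightarrow> M j > 0" shows "Km a M n i x y = Km a M n i y x"
  unfolding Km_def
  by (rule reproducing_unique[OF degree_Qm[of a M n i] degree_Qm[of a M n i], where T="Jm a M i"])
     (use Qm_reproducing[OF assms] in auto)

lemma bkern_prod: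
  assumes [measurable]: "u \<in> borel_measurable borel" "v \<in> borel_measurable borel"
    and "\<And>x. x \<in> {-1..1} \<Longrightarrow> \<bar>u x\<bar> \<le> B" "\<And>x. x \<in> {-1..1} \<Longrightarrow> \<bar>v x\<bar> \<le> B'" "B \<ge> 0" "B' \<ge> 0"
  shows "bkern (\<lambda>x y. u x * v y) (B * B')"
proof -
  have "(\<lambda>(x, y). u x * v y) \<in> borel_measurable (borel \<Otimes>\<^sub>M borel)" by measurable
  moreover have "\<bar>u x * v y\<bar> \<le> B * B'" if "x \<in> {-1..1}" "y \<in> {-1..1}" for x y
    unfolding abs_mult using assms that by (intro mult_mono) auto
  ultimately show ?thesis using assms by (auto simp: bkern_def)
qed

lemma bkern_cmult: "bkern k B \<Longrightarrow> bkern (\<lambda>x y. c * k x y) (\<bar>c\<bar> * B)"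
  unfolding bkern_def split_beta' by (auto simp: abs_mult intro!: mult_left_mono borel_measurable_times)

lemma Km_bkern:
  assumes M: "\<And>j. j < i \<Longrightarrow> M j > 0" "\<And>j. j < i \<Longrightarrow> a j \<in> {-1..1}"
  shows "\<exists>B. bkern (Km a M n i) B"
  using assms
proof (induction i)
  case 0
  then show ?case using Kj_bkern by (simp add: Km_0)
next
  case (Suc i)
  then obtain B where B: "bkern (Km a M n i) B" by auto
  have M': "\<And>j. j < i \<Longrightarrow> M j > 0" using Suc by auto
  have v: "Km a M n i (a i) \<in> borel_measurable borel" unfolding Km_def by measurable
  have vb: "\<bar>Km a M n i (a i) x\<bar> \<le> B" if "x \<in> {-1..1}" for x using B that Suc.prems(2)[of i] by (auto simp: bkern_def)
  have kp: "bkern (\<lambda>x y. Km a M n i (a i) x * Km a M n i (a i) y) (B * B)"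
    using B by (intro bkern_prod v vb) (auto simp: bkern_def)
  have eq: "Km a M n (Suc i) = (\<lambda>x y. Km a M n i x y + - (M i / (1 + M i * Km a M n i (a i) (a i))) * (Km a M n i (a i) x * Km a M n i (a i) y))"
  proof (intro ext)
    fix x y
    have "Km a M n i x (a i) = Km a M n i (a i) x" by (rule Km_sym[OF M'])
    then show "Km a M n (Suc i) x y = Km a M n i x y + - (M i / (1 + M i * Km a M n i (a i) (a i))) * (Km a M n i (a i) x * Km a M n i (a i) y)"
      unfolding Km_Suc by simp
  qed
  show ?case unfolding eq by (rule exI, rule bkern_add[OF B bkern_cmult[OF kp]])
qed

lemma ev_at_top: "filterlim ev at_top sequentially"
proof (rule filterlim_at_top_mono[OF filterlim_real_sequentially])
  have "\<forall>\<^sub>F n in sequentially. real n \<ge> \<bar>\<alpha> + \<beta> + 1\<bar> + 1"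
    using filterlim_real_sequentially unfolding filterlim_at_top by blast
  then show "\<forall>\<^sub>F n in sequentially. real n \<le> ev n"
  proof eventually_elim
    case (elim n)
    have "1 \<le> real n + \<alpha> + \<beta> + 1" using elim by linarith
    then have "real n * 1 \<le> real n * (real n + \<alpha> + \<beta> + 1)" by (rule mult_left_mono) simp
    then show ?case by (simp add: ev_def)
  qed
qed

lemma eventually_ev: "\<forall>\<^sub>F n in sequentially. n \<ge> 1 \<and> ev n \<ge> L"
proof (rule eventually_conj)
  show "\<forall>\<^sub>F n in sequentially. ev n \<ge> L" using ev_at_top unfolding filterlim_at_top by blast
qed (rule eventually_ge_at_top)

text \<open>The gain at a point b that carries a mass: adding the mass divides the kernel there by 1
  + M K(b, b), where K(b, b) is of order sqrt (\<open>ev n\<close>) times the square of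
  \<open>Ab n b\<close>.\<close>

definition mm where "mm a n i b = (if b \<in> a ` {..<(i::nat)} then 1 / (sqrt (ev n) * (Ab n b)^2) else 1)" for a :: "nat \<Rightarrow> real"

definition kernel_upper where "kernel_upper a M i \<longleftrightarrow> (\<forall>b\<in>{-1..1}. \<exists>C>0. \<forall>\<^sub>F n in sequentially. \<forall>x\<in>{-1..1}.
  \<bar>Km a M n i x b\<bar> \<le> C * (mm a n i b * (Ab n x * Ab n b * Th n x b)))"

text \<open>Only for points without a mass: at a mass the kernel on the diagonal stays bounded, see
  \<open>kernel_mass_mass\<close>.\<close>

definition kernel_diag_lower where "kernel_diag_lower a M i \<longleftrightarrow> (\<forall>b\<in>{-1..1} - a ` {..<(i::nat)}. \<exists>c>0. \<forall>\<^sub>F n in sequentially.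
  c * (sqrt (ev n) * (Ab n b)^2) \<le> Km a M n i b b)"

lemma kernel_upperD: "kernel_upper a M i \<Longrightarrow> b \<in> {-1..1} \<Longrightarrow> \<exists>C>0. \<forall>\<^sub>F n in sequentially. \<forall>x\<in>{-1..1}.
  \<bar>Km a M n i x b\<bar> \<le> C * (mm a n i b * (Ab n x * Ab n b * Th n x b))"
  unfolding kernel_upper_def by (erule (1) bspec)

lemma kernel_diag_lowerD: "kernel_diag_lower a M i \<Longrightarrow> b \<in> {-1..1} \<Longrightarrow> b \<notin> a ` {..<i} \<Longrightarrow>
  \<exists>c>0. \<forall>\<^sub>F n in sequentially. c * (sqrt (ev n) * (Ab n b)^2) \<le> Km a M n i b b"
  unfolding kernel_diag_lower_def by (erule bspec, rule DiffI)

lemma kernel_upper_0: "kernel_upper a M 0"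
proof -
  obtain C L where H: "C > 0 \<and> (\<forall>n\<ge>1. ev n \<ge> L \<longrightarrow> (\<forall>x\<in>{-1..1}. \<forall>y\<in>{-1..1}.
     (x \<noteq> y \<longrightarrow> \<bar>Kj n x y\<bar> \<le> C * (Ab n x * Ab n y) * (1 + (sqrt (dd x) + sqrt (dd y)) / \<bar>x - y\<bar>)) \<and>
     \<bar>Kj n x y\<bar> \<le> C * sqrt (ev n) * (Ab n x * Ab n y)))" using kernel_offdiag_bound by (elim exE conjE) (rule that, rule conjI)
  note C = H[THEN conjunct1] and b = H[THEN conjunct2, rule_format]
  have ub: "\<forall>\<^sub>F n in sequentially. \<forall>x\<in>{-1..1}. \<bar>Km a M n 0 x y\<bar> \<le> C * (mm a n 0 y * (Ab n x * Ab n y * Th n x y))"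
    if "y \<in> {-1..1}" for y
    using eventually_ev[of L]
  proof eventually_elim
    case (elim n)
    show ?case
    proof
      fix x :: real assume x: "x \<in> {-1..1}"
      show "\<bar>Km a M n 0 x y\<bar> \<le> C * (mm a n 0 y * (Ab n x * Ab n y * Th n x y))"
      proof -
        define u where "u = 1 + (sqrt (dd x) + sqrt (dd y)) / \<bar>x - y\<bar>"
        define G where "G = C * (Ab n x * Ab n y)"
        have n: "n \<ge> 1" "ev n \<ge> L" using elim by auto
        have 1: "x \<noteq> y \<Longrightarrow> \<bar>Kj n x y\<bar> \<le> G * u" and 2: "\<bar>Kj n x y\<bar> \<le> G * sqrt (ev n)"
          using b[OF n x that, THEN conjunct1, rule_format] b[OF n x that, THEN conjunct2] by (simp_all only: u_def G_def mult_ac simp_thms)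
        have "\<bar>Kj n x y\<bar> \<le> G * Th n x y" unfolding Th_def u_def[symmetric] using 1 2 by (cases "x = y") (simp_all add: min_def)
        then show ?thesis by (simp add: Km_0 mm_def G_def mult.assoc)
      qed
    qed
  qed
  show ?thesis unfolding kernel_upper_def by (rule ballI, rule exI[of _ C], rule conjI, rule C, rule ub)
qed

lemma kernel_diag_lower_0: "kernel_diag_lower a M 0"
proof -
  have lb: "\<exists>c>0. \<forall>\<^sub>F n in sequentially. c * (sqrt (ev n) * (Ab n b)^2) \<le> Km a M n 0 b b" if b: "b \<in> {-1..1}" for b
  proof -
    obtain c L where H: "c > 0 \<and> (\<forall>n\<ge>1. ev n \<ge> L \<longrightarrow> c * sqrt (ev n) * (Ab n b)^2 \<le> Kj n b b)"
      using kernel_lower[OF b] by (elim exE conjE) (rule that, rule conjI)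
    note c = H[THEN conjunct1] H[THEN conjunct2, rule_format]
    have "\<forall>\<^sub>F n in sequentially. c * (sqrt (ev n) * (Ab n b)^2) \<le> Km a M n 0 b b"
      using eventually_ev[of L] by eventually_elim (use c(2) in \<open>simp add: Km_0 mult.assoc\<close>)
    with c(1) show ?thesis by (intro exI[of _ c] conjI)
  qed
  show ?thesis unfolding kernel_diag_lower_def by (rule ballI, rule lb, erule DiffD1)
qed

lemma abs_mult3_le:
  fixes t d :: real
  assumes "0 \<le> t" "t \<le> d" "\<bar>u\<bar> \<le> U" "\<bar>v\<bar> \<le> V" shows "\<bar>t * (u * v)\<bar> \<le> d * (U * V)"
  unfolding abs_mult using assms order_trans[OF abs_ge_zero assms(3)] by (intro mult_mono) auto

lemma mass_ratio:
  fixes M k d :: real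
  assumes "M > 0" "0 < d" "d \<le> k"
  shows "0 \<le> M / (1 + M * k)" "M / (1 + M * k) \<le> 1 / d"
proof -
  have "0 < 1 + M * k" using assms by (intro add_pos_nonneg) auto
  then show "0 \<le> M / (1 + M * k)" using assms by simp
  have "M * d \<le> M * k" using assms by simp
  then have "M * d \<le> 1 + M * k" by simp
  then show "M / (1 + M * k) \<le> 1 / d" using assms \<open>0 < 1 + M * k\<close> by (simp add: field_simps)
qed

context
  fixes a M :: "nat \<Rightarrow> real" and i :: nat
  assumes M: "\<And>j. j \<le> i \<Longrightarrow> M j > 0" and ai: "a i \<in> {-1..1}" "a i \<notin> a ` {..<i}"
    and U: "kernel_upper a M i" and Lw: "kernel_diag_lower a M i"
begin

text \<open>At b = \<open>a i\<close> the new kernel is the old one divided by 1 + M K(b, b).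
  Elsewhere the correction obeys the old bound: one of its two \<open>Th\<close> factors is at most
  sqrt (\<open>ev n\<close>), which the denominator cancels, and the other is bounded because
  \<open>a i\<close> and b are at a fixed distance.\<close>

lemma kernel_upper_Suc: "kernel_upper a M (Suc i)"
proof -
  obtain Ca where Ca: "Ca > 0" and ev1: "\<forall>\<^sub>F n in sequentially. \<forall>x\<in>{-1..1}. \<bar>Km a M n i x (a i)\<bar> \<le> Ca * (mm a n i (a i) * (Ab n x * Ab n (a i) * Th n x (a i)))"
    using kernel_upperD[OF U ai(1)] by blast
  obtain c where c: "c > 0" and ev2: "\<forall>\<^sub>F n in sequentially. c * (sqrt (ev n) * (Ab n (a i))^2) \<le> Km a M n i (a i) (a i)"
    using kernel_diag_lowerD[OF Lw ai] by blast
  have mi: "mm a n i (a i) = 1" for n using ai by (simp add: mm_def)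
  have ub: "\<exists>C>0. \<forall>\<^sub>F n in sequentially. \<forall>x\<in>{-1..1}. \<bar>Km a M n (Suc i) x b\<bar> \<le> C * (mm a n (Suc i) b * (Ab n x * Ab n b * Th n x b))"
    if b: "b \<in> {-1..1}" for b
  proof (cases "b = a i")
    case True
    define C where "C = Ca * (1 / (M i * c))"
    have "\<forall>\<^sub>F n in sequentially. \<forall>x\<in>{-1..1}. \<bar>Km a M n (Suc i) x b\<bar> \<le> C * (mm a n (Suc i) b * (Ab n x * Ab n b * Th n x b))"
      using ev1 ev2 eventually_ev[of 1]
    proof eventually_elim
      case (elim n)
      then have n: "n \<ge> 1" "ev n \<ge> 1" by auto
      define kk where "kk = Km a M n i (a i) (a i)"
      define w where "w = sqrt (ev n) * (Ab n (a i))^2"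
      have w: "w > 0" using Ab_pos[of n "a i"] ai elim by (simp add: w_def)
      have kk: "c * w \<le> kk" using elim by (simp add: kk_def w_def)
      have cw: "0 < c * w" using c w by simp
      have pos: "1 + M i * kk > 0" using M[of i] kk cw by (intro add_pos_pos mult_pos_pos) auto
      have mw: "mm a n (Suc i) b = 1 / w" using True by (simp add: mm_def w_def)
      show ?case
      proof
        fix x :: real assume x: "x \<in> {-1..1}"
        have "Km a M n (Suc i) x b = Km a M n i x b * (1 / (1 + M i * kk))"
          unfolding Km_Suc True kk_def[symmetric] using pos by (simp add: field_simps)
        then have "\<bar>Km a M n (Suc i) x b\<bar> = \<bar>Km a M n i x b\<bar> * (1 / (1 + M i * kk))" using pos by (simp add: abs_mult)
        also have "\<dots> \<le> (Ca * (Ab n x * Ab n b * Th n x b)) * (1 / (M i * (c * w)))"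
        proof (rule mult_mono)
          show "\<bar>Km a M n i x b\<bar> \<le> Ca * (Ab n x * Ab n b * Th n x b)" using elim x True by (simp add: mi)
          have "M i * (c * w) \<le> M i * kk" using kk M[of i] by (intro mult_left_mono) auto
          then show "1 / (1 + M i * kk) \<le> 1 / (M i * (c * w))" using M[of i] cw pos mult_pos_pos[OF pos mult_pos_pos[OF M[OF order_refl] cw]]
            by (intro divide_left_mono) linarith+
          show "0 \<le> Ca * (Ab n x * Ab n b * Th n x b)"
            using Ca less_imp_le[OF Ab_pos[OF n(1) x]] less_imp_le[OF Ab_pos[OF n(1) b]] Th_bounds(1)[OF x b n(2)]
            by (intro mult_nonneg_nonneg) auto
        qed (use pos in simp)
        also have "\<dots> = C * (mm a n (Suc i) b * (Ab n x * Ab n b * Th n x b))" by (simp add: C_def mw)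
        finally show "\<bar>Km a M n (Suc i) x b\<bar> \<le> C * (mm a n (Suc i) b * (Ab n x * Ab n b * Th n x b))" .
      qed
    qed
    moreover have "C > 0" using Ca M[of i] c by (simp add: C_def)
    ultimately show ?thesis by blast
  next
    case False
    obtain Cb where Cb: "Cb > 0" and ev3: "\<forall>\<^sub>F n in sequentially. \<forall>x\<in>{-1..1}. \<bar>Km a M n i x b\<bar> \<le> Cb * (mm a n i b * (Ab n x * Ab n b * Th n x b))"
      using kernel_upperD[OF U b] by blast
    define T where "T = 1 + 2 / \<bar>a i - b\<bar>"
    have T: "T > 0" by (simp add: T_def add_pos_nonneg)
    define C where "C = Cb + Ca * Cb * T / c"
    have "\<forall>\<^sub>F n in sequentially. \<forall>x\<in>{-1..1}. \<bar>Km a M n (Suc i) x b\<bar> \<le> C * (mm a n (Suc i) b * (Ab n x * Ab n b * Th n x b))"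
      using ev1 ev2 ev3 eventually_ev[of 1]
    proof eventually_elim
      case (elim n)
      define m where "m = mm a n i b"
      define A where "A = Ab n (a i)"
      define s where "s = sqrt (ev n)"
      have s: "s \<ge> 1" using elim by (simp add: s_def)
      have A: "A > 0" using Ab_pos[of n "a i"] ai elim by (simp add: A_def)
      have B: "Ab n b > 0" using Ab_pos[of n b] b elim by simp
      have m: "m \<ge> 0" using elim by (simp add: m_def mm_def)
      have mS: "mm a n (Suc i) b = m" using False by (auto simp: m_def mm_def less_Suc_eq)
      define kk where "kk = Km a M n i (a i) (a i)"
      have kk: "c * (s * A^2) \<le> kk" using elim by (simp add: kk_def s_def A_def)
      have d: "0 < c * (s * A^2)" using c s A by simp
      note r = mass_ratio[OF M[OF order_refl] d kk]
      show ?case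
      proof
        fix x :: real assume x: "x \<in> {-1..1}"
        have X: "Ab n x > 0" using Ab_pos[of n x] x elim by simp
        have t1: "1 \<le> Th n x b" using Th_bounds(1)[OF x b] elim by simp
        have "\<bar>Km a M n i x (a i)\<bar> \<le> Ca * (Ab n x * A * Th n x (a i))" using elim x by (simp add: mi A_def)
        also have "\<dots> \<le> Ca * (Ab n x * A * s)"
          using Th_bounds(2)[OF x ai(1)] elim X A Ca by (intro mult_left_mono) (auto simp: s_def)
        finally have k1: "\<bar>Km a M n i x (a i)\<bar> \<le> Ca * (Ab n x * A * s)" .
        have "\<bar>Km a M n i (a i) b\<bar> \<le> Cb * (m * (A * Ab n b * Th n (a i) b))" using elim ai by (simp add: m_def A_def)
        also have "\<dots> \<le> Cb * (m * (A * Ab n b * T))"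
          using Th_bounds(3)[OF ai(1) b] elim False m A B Cb by (intro mult_left_mono) (auto simp: T_def)
        finally have k2: "\<bar>Km a M n i (a i) b\<bar> \<le> Cb * (m * (A * Ab n b * T))" .
        have "\<bar>Km a M n i x b\<bar> \<le> Cb * (m * (Ab n x * Ab n b * Th n x b))" using elim x by (simp add: m_def)
        moreover have "\<bar>M i / (1 + M i * kk) * (Km a M n i x (a i) * Km a M n i (a i) b)\<bar>
           \<le> (1 / (c * (s * A^2))) * ((Ca * (Ab n x * A * s)) * (Cb * (m * (A * Ab n b * T))))"
          by (rule abs_mult3_le[OF r k1 k2])
        moreover have "\<dots> = (Ca * Cb * T / c) * (m * (Ab n x * Ab n b * 1))"
          using c s A by (simp add: field_simps power2_eq_square)
        moreover have "\<dots> \<le> (Ca * Cb * T / c) * (m * (Ab n x * Ab n b * Th n x b))"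
          using t1 Ca Cb T c m X B by - (rule mult_left_mono, auto intro!: mult_left_mono)
        ultimately show "\<bar>Km a M n (Suc i) x b\<bar> \<le> C * (mm a n (Suc i) b * (Ab n x * Ab n b * Th n x b))"
          unfolding Km_Suc kk_def[symmetric] mS C_def distrib_right by linarith
      qed
    qed
    moreover have "C > 0" using Ca Cb c T by (auto simp: C_def intro!: add_pos_nonneg)
    ultimately show ?thesis by blast
  qed
  show ?thesis unfolding kernel_upper_def by (rule ballI, rule ub)
qed

text \<open>The two points are at a fixed distance, so the correction is of order
  \<open>Ab n b\<close> squared over sqrt (\<open>ev n\<close>), smaller than the main term by a
  factor \<open>ev n\<close>; for large n it is at most half of it.\<close>

lemma kernel_diag_lower_Suc: "kernel_diag_lower a M (Suc i)"
proof -
  obtain Ca where Ca: "Ca > 0" and ev1: "\<forall>\<^sub>F n in sequentially. \<forall>x\<in>{-1..1}. \<bar>Km a M n i x (a i)\<bar> \<le> Ca * (mm a n i (a i) * (Ab n x * Ab n (a i) * Th n x (a i)))"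
    using kernel_upperD[OF U ai(1)] by blast
  obtain c where c: "c > 0" and ev2: "\<forall>\<^sub>F n in sequentially. c * (sqrt (ev n) * (Ab n (a i))^2) \<le> Km a M n i (a i) (a i)"
    using kernel_diag_lowerD[OF Lw ai] by blast
  have mi: "mm a n i (a i) = 1" for n using ai by (simp add: mm_def)
  have M': "\<And>j. j < i \<Longrightarrow> M j > 0" using M by simp
  have lb: "\<exists>c>0. \<forall>\<^sub>F n in sequentially. c * (sqrt (ev n) * (Ab n b)^2) \<le> Km a M n (Suc i) b b"
    if b: "b \<in> {-1..1}" "b \<notin> a ` {..<Suc i}" for b
  proof -
    have bi: "b \<noteq> a i" "b \<notin> a ` {..<i}" using b by auto
    obtain cb where cb: "cb > 0" and ev3: "\<forall>\<^sub>F n in sequentially. cb * (sqrt (ev n) * (Ab n b)^2) \<le> Km a M n i b b"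
      using kernel_diag_lowerD[OF Lw b(1) bi(2)] by blast
    define T where "T = 1 + 2 / \<bar>b - a i\<bar>"
    define D where "D = Ca^2 * T^2 / c"
    have "\<forall>\<^sub>F n in sequentially. cb / 2 * (sqrt (ev n) * (Ab n b)^2) \<le> Km a M n (Suc i) b b"
      using ev1 ev2 ev3 eventually_ev[of "max 1 (2 * D / cb)"]
    proof eventually_elim
      case (elim n)
      define A where "A = Ab n (a i)"
      define B where "B = Ab n b"
      define s where "s = sqrt (ev n)"
      have s: "s \<ge> 1" "s * s = ev n" using elim by (auto simp: s_def)
      have A: "A > 0" using Ab_pos[of n "a i"] ai elim by (simp add: A_def)
      have B: "B > 0" using Ab_pos[of n b] b elim by (simp add: B_def)
      define kk where "kk = Km a M n i (a i) (a i)"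
      have kk: "c * (s * A^2) \<le> kk" using elim by (simp add: kk_def s_def A_def)
      have d: "0 < c * (s * A^2)" using c s A by simp
      note r = mass_ratio[OF M[OF order_refl] d kk]
      have "\<bar>Km a M n i b (a i)\<bar> \<le> Ca * (B * A * Th n b (a i))" using elim b by (simp add: mi A_def B_def)
      also have "\<dots> \<le> Ca * (B * A * T)"
        using Th_bounds(3)[OF b(1) ai(1)] elim bi A B Ca by (intro mult_left_mono) (auto simp: T_def)
      finally have k1: "\<bar>Km a M n i b (a i)\<bar> \<le> Ca * (B * A * T)" .
      have "Km a M n i (a i) b = Km a M n i b (a i)" by (rule Km_sym[OF M'])
      with k1 have k2: "\<bar>Km a M n i (a i) b\<bar> \<le> Ca * (B * A * T)" by simp
      have "\<bar>M i / (1 + M i * kk) * (Km a M n i b (a i) * Km a M n i (a i) b)\<bar> \<le> (1 / (c * (s * A^2))) * ((Ca * (B * A * T)) * (Ca * (B * A * T)))"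
        by (rule abs_mult3_le[OF r k1 k2])
      also have "\<dots> = D / s * B^2" using c s A by (simp add: D_def field_simps power2_eq_square)
      also have "\<dots> \<le> (cb / 2 * s) * B^2"
      proof (rule mult_right_mono)
        have "2 * D / cb \<le> s * s" using elim s by simp
        then show "D / s \<le> cb / 2 * s" using s cb by (simp add: field_simps)
      qed simp
      finally have 1: "\<bar>M i / (1 + M i * kk) * (Km a M n i b (a i) * Km a M n i (a i) b)\<bar> \<le> cb / 2 * (s * B^2)" by (simp add: mult.assoc)
      have 2: "cb * (s * B^2) \<le> Km a M n i b b" using elim by (simp add: s_def B_def)
      have "cb / 2 * (s * B^2) \<le> Km a M n i b b - M i / (1 + M i * kk) * (Km a M n i b (a i) * Km a M n i (a i) b)"
        using 1 2 by linarith
      then show ?case unfolding Km_Suc kk_def[symmetric] s_def[symmetric] B_def[symmetric] .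
    qed
    then show ?thesis using cb by (intro exI[of _ "cb / 2"] conjI) simp_all
  qed
  show ?thesis unfolding kernel_diag_lower_def by (rule ballI, rule lb) blast+
qed

end

lemma kernel_upper_lower:
  assumes "\<And>j. j < k \<Longrightarrow> M j > 0" "\<And>j. j < k \<Longrightarrow> a j \<in> {-1..1}" "inj_on a {..<k}" "i \<le> k"
  shows "kernel_upper a M i \<and> kernel_diag_lower a M i"
  using \<open>i \<le> k\<close>
proof (induction i)
  case 0
  show ?case using kernel_upper_0 kernel_diag_lower_0 by blast
next
  case (Suc i)
  have "a i \<notin> a ` {..<i}" using inj_onD[OF assms(3), of i] Suc.prems by fastforce
  moreover have "M j > 0" if "j \<le> i" for j using assms(1) that Suc.prems by simp
  moreover have "a i \<in> {-1..1}" using assms(2) Suc.prems by simp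
  moreover have "kernel_upper a M i" "kernel_diag_lower a M i" using Suc by simp_all
  ultimately show ?case by (intro conjI kernel_upper_Suc kernel_diag_lower_Suc)
qed

end

section \<open>Bilinear bounds in the presence of masses\<close>

context jacobi_exp
begin

lemma Th_integral_\<theta>:
  assumes a: "a \<in> {-1..1}"
  shows "\<exists>C>0. \<forall>n\<ge>1. ev n \<ge> 1 \<longrightarrow> (\<forall>E. E \<in> sets borel \<longrightarrow>
     (\<integral>\<^sup>+x\<in>E. ennreal (Ab n x * Th n x a) \<partial>\<mu>) \<le> ennreal (C * sqrt (ev n) powr (zz a \<theta>) * measure \<mu> E powr (1 - \<theta>)) \<and>
     (\<integral>\<^sup>+x\<in>E. ennreal (Ab n x * Th n x a) \<partial>\<mu>) \<le> ennreal (C * sqrt (ev n) powr (zz a (1 - \<theta>)) * measure \<mu> E powr \<theta>))"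
proof -
  have g: "gm a + 1 > 0" using ab by (auto simp: gm_def)
  have k2: "(1 - \<theta>) * (gm a + 1) \<le> gm a / 2 + 3/4" using gm_\<theta>(1)[of a] by (simp add: algebra_simps)
  have "\<theta> * (gm a + 1) \<le> (1 - \<theta>) * (gm a + 1)" using g \<theta> by (intro mult_right_mono) auto
  then have k1: "\<theta> * (gm a + 1) \<le> gm a / 2 + 3/4" using k2 by linarith
  have th: "0 < \<theta>" "\<theta> < 1" "0 < 1 - \<theta>" "1 - \<theta> < 1" using \<theta> by auto
  obtain C1 where H1: "C1 > 0 \<and> (\<forall>n\<ge>1. ev n \<ge> 1 \<longrightarrow> (\<forall>E. E \<in> sets borel \<longrightarrow>
     (\<integral>\<^sup>+x\<in>E. ennreal (Ab n x * Th n x a) \<partial>\<mu>) \<le> ennreal (C1 * sqrt (ev n) powr (zz a \<theta>) * measure \<mu> E powr (1 - \<theta>))))"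
    using Th_integral[OF a th(1,2) gm_\<theta>(1) k1] by (rule exE)
  note C1 = H1[THEN conjunct1] H1[THEN conjunct2, rule_format]
  obtain C2 where H2: "C2 > 0 \<and> (\<forall>n\<ge>1. ev n \<ge> 1 \<longrightarrow> (\<forall>E. E \<in> sets borel \<longrightarrow>
     (\<integral>\<^sup>+x\<in>E. ennreal (Ab n x * Th n x a) \<partial>\<mu>) \<le> ennreal (C2 * sqrt (ev n) powr (zz a (1 - \<theta>)) * measure \<mu> E powr (1 - (1 - \<theta>)))))"
    using Th_integral[OF a th(3,4) gm_\<theta>(2) k2] by (rule exE)
  note C2 = H2[THEN conjunct1] H2[THEN conjunct2, rule_format]
  have 1: "ennreal (C1 * u * v) \<le> ennreal (max C1 C2 * u * v)" and 2: "ennreal (C2 * u * v) \<le> ennreal (max C1 C2 * u * v)"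
    if "u \<ge> 0" "v \<ge> 0" for u v using that by (intro ennreal_leI mult_right_mono; simp)+
  have pos: "max C1 C2 > 0" using C1(1) by simp
  have eq: "1 - (1 - \<theta>) = \<theta>" by simp
  show ?thesis
    by (rule exI[of _ "max C1 C2"], intro conjI allI impI pos order_trans[OF C1(2) 1] order_trans[OF C2(2)[unfolded eq] 2]) simp_all
qed

lemma zz_sum: "zz a \<theta> + zz a (1 - \<theta>) = 1" by (simp add: zz_def algebra_simps)

text \<open>At a mass the kernel carries the factor 1 / (sqrt (\<open>ev n\<close>)
  \<open>Ab n a\<close>); this shows that the factor makes up for the power lost in
  \<open>Th_integral_\<theta>\<close>.\<close>

lemma zz_le_Ab:
  assumes a: "a \<in> {-1..1}"
  shows "\<exists>K>0. \<forall>n\<ge>1. ev n \<ge> 1 \<longrightarrow> sqrt (ev n) powr (zz a \<theta>) \<le> K * (sqrt (ev n) * Ab n a)"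
proof (cases "\<bar>a\<bar> < 1")
  case True
  define b where "b = - (gm a / 2 + 1/4)"
  define r where "r = 2 / dd a"
  have d: "dd a > 0" "dd a \<le> 1" using True by (auto simp: dd_def)
  have r: "r \<ge> 2" "r * dd a = 2" using d by (auto simp: r_def field_simps)
  have "sqrt (ev n) powr (zz a \<theta>) \<le> r powr \<bar>b\<bar> * (sqrt (ev n) * Ab n a)" if n: "n \<ge> 1" "ev n \<ge> 1" for n
  proof -
    have e: "0 < 1 / ev n" "1 / ev n \<le> 1" using n by auto
    have X: "dd a \<le> Xr n a" "Xr n a \<le> 2" using d e unfolding Xr_def by linarith+
    have "1 \<le> r * Xr n a" using mult_left_mono[OF X(1), of r] r by linarith
    then have "1 \<le> r powr \<bar>b\<bar> * Ab n a" using powr_comparable[of "Xr n a" 1 r b] X d r by (simp add: Ab_def b_def)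
    moreover have "sqrt (ev n) powr (zz a \<theta>) \<le> sqrt (ev n) powr 1" using n True \<theta> by (intro powr_mono) (auto simp: zz_def)
    ultimately have "sqrt (ev n) powr (zz a \<theta>) * 1 \<le> sqrt (ev n) * (r powr \<bar>b\<bar> * Ab n a)"
      using n by (intro mult_mono) auto
    then show ?thesis by (simp add: mult_ac)
  qed
  then show ?thesis using r by (intro exI[of _ "r powr \<bar>b\<bar>"]) auto
next
  case False
  then have da: "dd a = 0" using a by (auto simp: dd_def)
  have "sqrt (ev n) powr (zz a \<theta>) \<le> 1 * (sqrt (ev n) * Ab n a)" if n: "n \<ge> 1" "ev n \<ge> 1" for n
  proof -
    have s: "sqrt (ev n) = ev n powr (1/2)" using n by (simp add: powr_half_sqrt)
    have "Ab n a = ev n powr (gm a / 2 + 1/4)" using n unfolding Ab_def Xr_def da by (simp only: add_0 powr_minus powr_divide powr_one_eq_one) simp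
    then have "sqrt (ev n) * Ab n a = ev n powr (1/2 + (gm a / 2 + 1/4))" by (simp only: s powr_add)
    moreover have "sqrt (ev n) powr (zz a \<theta>) = ev n powr (1/2 * zz a \<theta>)" by (simp only: s powr_powr)
    moreover have "1/2 * zz a \<theta> \<le> 1/2 + (gm a / 2 + 1/4)" using False gm_\<theta>(3)[of a] by (simp add: zz_def)
    ultimately show ?thesis using n powr_mono[of "1/2 * zz a \<theta>" "1/2 + (gm a / 2 + 1/4)" "ev n"] by simp
  qed
  then show ?thesis by (intro exI[of _ 1]) auto
qed

definition kernel_bilin where "kernel_bilin a M i \<longleftrightarrow> (\<exists>C>0. \<forall>\<^sub>F n in sequentially. \<forall>E F. E \<in> sets borel \<longrightarrow> F \<in> sets borel \<longrightarrow>
  \<bar>bilin \<mu> (Km a M n i) E F\<bar> \<le> C * (measure \<mu> E powr \<theta> * measure \<mu> F powr (1 - \<theta>)))"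

text \<open>The correction is a multiple of u(x) u(y) with u = K(a_i, .). Integrating u over F with
  \<kappa> = \<theta> and over E with \<kappa> = 1 - \<theta> costs powers of sqrt
  (\<open>ev n\<close>) whose exponents add up to 1, exactly what the factor 1/K(a_i, a_i) gives
  back.\<close>

lemma kernel_bilin_Suc:
  assumes M: "\<And>j. j \<le> i \<Longrightarrow> M j > 0" and ai: "\<And>j. j \<le> i \<Longrightarrow> a j \<in> {-1..1}" "a i \<notin> a ` {..<i}"
    and U: "kernel_upper a M i" and Lw: "kernel_diag_lower a M i" and B: "kernel_bilin a M i"
  shows "kernel_bilin a M (Suc i)"
proof -
  have aI: "a i \<in> {-1..1}" using ai by simp
  obtain C0 where C0: "C0 > 0" and ev0: "\<forall>\<^sub>F n in sequentially. \<forall>E F. E \<in> sets borel \<longrightarrow> F \<in> sets borel \<longrightarrow>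
    \<bar>bilin \<mu> (Km a M n i) E F\<bar> \<le> C0 * (measure \<mu> E powr \<theta> * measure \<mu> F powr (1 - \<theta>))" using B unfolding kernel_bilin_def by blast
  obtain Ca where Ca: "Ca > 0" and ev1: "\<forall>\<^sub>F n in sequentially. \<forall>x\<in>{-1..1}. \<bar>Km a M n i x (a i)\<bar> \<le> Ca * (mm a n i (a i) * (Ab n x * Ab n (a i) * Th n x (a i)))"
    using kernel_upperD[OF U aI] by blast
  obtain c where c: "c > 0" and ev2: "\<forall>\<^sub>F n in sequentially. c * (sqrt (ev n) * (Ab n (a i))^2) \<le> Km a M n i (a i) (a i)"
    using kernel_diag_lowerD[OF Lw aI ai(2)] by blast
  have mi: "mm a n i (a i) = 1" for n using ai by (simp add: mm_def)
  have M': "\<And>j. j < i \<Longrightarrow> M j > 0" using M by simp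
  obtain C1 where H1: "C1 > 0 \<and> (\<forall>n\<ge>1. ev n \<ge> 1 \<longrightarrow> (\<forall>E. E \<in> sets borel \<longrightarrow>
     (\<integral>\<^sup>+x\<in>E. ennreal (Ab n x * Th n x (a i)) \<partial>\<mu>) \<le> ennreal (C1 * sqrt (ev n) powr (zz (a i) \<theta>) * measure \<mu> E powr (1 - \<theta>)) \<and>
     (\<integral>\<^sup>+x\<in>E. ennreal (Ab n x * Th n x (a i)) \<partial>\<mu>) \<le> ennreal (C1 * sqrt (ev n) powr (zz (a i) (1 - \<theta>)) * measure \<mu> E powr \<theta>)))"
    using Th_integral_\<theta>[OF aI] by (rule exE)
  note C1 = H1[THEN conjunct1] and I1 = H1[THEN conjunct2, rule_format, THEN conjunct1] H1[THEN conjunct2, rule_format, THEN conjunct2]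
  define C where "C = C0 + Ca^2 * C1^2 / c"
  have "\<forall>\<^sub>F n in sequentially. \<forall>E F. E \<in> sets borel \<longrightarrow> F \<in> sets borel \<longrightarrow>
    \<bar>bilin \<mu> (Km a M n (Suc i)) E F\<bar> \<le> C * (measure \<mu> E powr \<theta> * measure \<mu> F powr (1 - \<theta>))"
    using ev0 ev1 ev2 eventually_ev[of 1]
  proof eventually_elim
    case (elim n)
    have n: "n \<ge> 1" "ev n \<ge> 1" using elim(4) by auto
    define A where "A = Ab n (a i)"
    define s where "s = sqrt (ev n)"
    have s: "s \<ge> 1" using n by (simp add: s_def)
    have A: "A > 0" using Ab_pos[OF n(1) aI] by (simp add: A_def)
    define kk where "kk = Km a M n i (a i) (a i)"
    have kk: "c * (s * A^2) \<le> kk" using elim(3) by (simp add: kk_def s_def A_def)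
    have d: "0 < c * (s * A^2)" using c s A by simp
    note r = mass_ratio[OF M[OF order_refl] d kk]
    let ?u = "\<lambda>x. Km a M n i (a i) x"
    have u1: "\<bar>?u x\<bar> \<le> Ca * A * (Ab n x * Th n x (a i))" if "x \<in> {-1..1}" for x
    proof -
      have "?u x = Km a M n i x (a i)" by (rule Km_sym[OF M'])
      then show ?thesis using elim(2)[rule_format, OF that] by (simp add: mi A_def mult_ac)
    qed
    obtain BK where BK: "bkern (Km a M n i) BK" using Km_bkern[of i M a n, OF M' ai(1)] by auto
    have ku: "bkern (\<lambda>x y. ?u x * ?u y) (BK * BK)"
    proof (rule bkern_prod)
      show "\<bar>?u x\<bar> \<le> BK" if "x \<in> {-1..1}" for x using BK that aI by (auto simp: bkern_def)
      then show "\<bar>?u x\<bar> \<le> BK" if "x \<in> {-1..1}" for x using that .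
      show "?u \<in> borel_measurable borel" unfolding Km_def by measurable
      then show "?u \<in> borel_measurable borel" .
    qed (use BK in \<open>auto simp: bkern_def\<close>)
    define t where "t = M i / (1 + M i * kk)"
    have Keq: "Km a M n (Suc i) = (\<lambda>x y. Km a M n i x y + (- t) * (?u x * ?u y))"
    proof (intro ext)
      fix x y
      have "Km a M n i x (a i) = Km a M n i (a i) x" by (rule Km_sym[OF M'])
      then show "Km a M n (Suc i) x y = Km a M n i x y + (- t) * (?u x * ?u y)"
        unfolding Km_Suc kk_def[symmetric] t_def[symmetric] by simp
    qed
    show ?case
    proof (intro allI impI)
      fix E F :: "real set" assume E [measurable]: "E \<in> sets borel" and F [measurable]: "F \<in> sets borel"
      define P where "P = measure \<mu> E powr \<theta> * measure \<mu> F powr (1 - \<theta>)"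
      have "\<bar>bilin \<mu> (\<lambda>x y. ?u x * ?u y) E F\<bar> \<le> (Ca * A)^2 * ((C1 * s powr (zz (a i) \<theta>) * measure \<mu> F powr (1 - \<theta>)) * (C1 * s powr (zz (a i) (1 - \<theta>)) * measure \<mu> E powr \<theta>))"
        unfolding s_def
      proof (rule bilin_far[OF ku E F])
        \<comment> \<open>\<open>bilin_far\<close> asks for majorants that are nonnegative
          everywhere, also outside [-1, 1]. The conversion to \<open>ennreal\<close> truncates in
          the same way, so the integrals do not change.\<close>
        have m0: "ennreal (max 0 z) = ennreal z" for z :: real by (cases "z \<ge> 0") (auto simp: max_def ennreal_neg)
        show "(\<integral>\<^sup>+x\<in>F. ennreal (max 0 (Ab n x * Th n x (a i))) \<partial>\<mu>) \<le> ennreal (C1 * sqrt (ev n) powr (zz (a i) \<theta>) * measure \<mu> F powr (1 - \<theta>))"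
          "(\<integral>\<^sup>+x\<in>E. ennreal (max 0 (Ab n x * Th n x (a i))) \<partial>\<mu>) \<le> ennreal (C1 * sqrt (ev n) powr (zz (a i) (1 - \<theta>)) * measure \<mu> E powr \<theta>)"
          unfolding m0 by (rule I1[OF n F] I1[OF n E])+
      next
        fix x y :: real assume "x \<in> {-1<..<1}" "y \<in> {-1<..<1}"
        then have x: "x \<in> {-1..1}" and y: "y \<in> {-1..1}" by auto
        have "\<bar>?u x * ?u y\<bar> \<le> (Ca * A * (Ab n x * Th n x (a i))) * (Ca * A * (Ab n y * Th n y (a i)))"
          unfolding abs_mult by (intro mult_mono u1 x y order_trans[OF abs_ge_zero u1[OF x]]) auto
        also have "\<dots> \<le> (Ca * A * max 0 (Ab n x * Th n x (a i))) * (Ca * A * max 0 (Ab n y * Th n y (a i)))"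
          using Ca A order_trans[OF abs_ge_zero u1[OF y]] by (intro mult_mono mult_left_mono) auto
        finally show "\<bar>?u x * ?u y\<bar> \<le> (Ca * A)^2 * (max 0 (Ab n x * Th n x (a i)) * max 0 (Ab n y * Th n y (a i)))"
          by (simp add: power2_eq_square mult_ac)
      qed (use C1 in auto)
      also have "\<dots> = Ca^2 * A^2 * C1^2 * s * P"
      proof -
        have "s powr (zz (a i) \<theta>) * s powr (zz (a i) (1 - \<theta>)) = s" using s by (simp add: powr_add[symmetric] zz_sum)
        then show ?thesis by (simp add: P_def power2_eq_square)
      qed
      finally have b: "\<bar>bilin \<mu> (\<lambda>x y. ?u x * ?u y) E F\<bar> \<le> Ca^2 * A^2 * C1^2 * s * P" .
      have "bilin \<mu> (Km a M n (Suc i)) E F = bilin \<mu> (Km a M n i) E F + (- t) * bilin \<mu> (\<lambda>x y. ?u x * ?u y) E F"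
        unfolding Keq bilin_add[OF BK bkern_cmult[OF ku] E F] bilin_cmult ..
      moreover have "\<bar>bilin \<mu> (Km a M n i) E F\<bar> \<le> C0 * P" using elim(1)[rule_format, OF E F] by (simp add: P_def)
      moreover have "\<bar>(- t) * bilin \<mu> (\<lambda>x y. ?u x * ?u y) E F\<bar> \<le> 1 / (c * (s * A^2)) * (Ca^2 * A^2 * C1^2 * s * P)"
        unfolding abs_mult abs_minus_cancel using r b d unfolding t_def[symmetric] by - (rule mult_mono, auto)
      moreover have "1 / (c * (s * A^2)) * (Ca^2 * A^2 * C1^2 * s * P) = Ca^2 * C1^2 / c * P"
        using c s A by (simp add: field_simps)
      moreover have "C * P = C0 * P + Ca^2 * C1^2 / c * P" by (simp add: C_def distrib_right)
      ultimately show "\<bar>bilin \<mu> (Km a M n (Suc i)) E F\<bar> \<le> C * (measure \<mu> E powr \<theta> * measure \<mu> F powr (1 - \<theta>))"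
        unfolding P_def[symmetric] by linarith
    qed
  qed
  moreover have "C > 0" using C0 c by (auto simp: C_def intro!: add_pos_nonneg)
  ultimately show ?thesis unfolding kernel_bilin_def by (intro exI[of _ C] conjI)
qed

context
  fixes a M :: "nat \<Rightarrow> real" and k :: nat
  assumes M: "\<And>j. j < k \<Longrightarrow> M j > 0" and a: "\<And>j. j < k \<Longrightarrow> a j \<in> {-1..1}" and inj: "inj_on a {..<k}"
begin

lemma kernel_bilin_all: "i \<le> k \<Longrightarrow> kernel_bilin a M i"
proof (induction i)
  case 0
  obtain C L where H: "C > 0 \<and> (\<forall>n\<ge>1. ev n \<ge> L \<longrightarrow> (\<forall>E F. E \<in> sets borel \<longrightarrow> F \<in> sets borel \<longrightarrow>
     \<bar>bilin \<mu> (Kj n) E F\<bar> \<le> C * (measure \<mu> E powr \<theta> * measure \<mu> F powr (1 - \<theta>))))"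
    using jacobi_bilin by (elim exE conjE) (rule that, rule conjI)
  note C = H[THEN conjunct1] H[THEN conjunct2, rule_format]
  have "\<forall>\<^sub>F n in sequentially. \<forall>E F. E \<in> sets borel \<longrightarrow> F \<in> sets borel \<longrightarrow>
    \<bar>bilin \<mu> (Km a M n 0) E F\<bar> \<le> C * (measure \<mu> E powr \<theta> * measure \<mu> F powr (1 - \<theta>))"
    using eventually_ev[of L] by eventually_elim (auto simp: Km_0 intro!: C(2))
  with C(1) show ?case unfolding kernel_bilin_def by (intro exI[of _ C] conjI)
next
  case (Suc i)
  have "a i \<notin> a ` {..<i}" using inj_onD[OF inj, of i] Suc.prems by fastforce
  then show ?case using Suc M a kernel_upper_lower[of k M a i, OF M a inj] by (intro kernel_bilin_Suc) auto
qed

text \<open>The gain \<open>mm\<close> at the mass removes every power of n, by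
  \<open>zz_le_Ab\<close>.\<close>

lemma kernel_at_mass:
  assumes j: "j < k"
  shows "\<exists>C>0. \<forall>\<^sub>F n in sequentially. \<forall>F. F \<in> sets borel \<longrightarrow>
    (\<integral>\<^sup>+x\<in>F. ennreal \<bar>Km a M n k x (a j)\<bar> \<partial>\<mu>) \<le> ennreal (C * measure \<mu> F powr (1 - \<theta>))"
proof -
  have aj: "a j \<in> {-1..1}" using a j by simp
  have U: "kernel_upper a M k" using kernel_upper_lower[of k M a k, OF M a inj] by simp
  obtain Ca where Ca: "Ca > 0" and ev1: "\<forall>\<^sub>F n in sequentially. \<forall>x\<in>{-1..1}. \<bar>Km a M n k x (a j)\<bar> \<le> Ca * (mm a n k (a j) * (Ab n x * Ab n (a j) * Th n x (a j)))"
    using kernel_upperD[OF U aj] by blast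
  obtain K where K: "K > 0" "\<And>n. n \<ge> 1 \<Longrightarrow> ev n \<ge> 1 \<Longrightarrow> sqrt (ev n) powr (zz (a j) \<theta>) \<le> K * (sqrt (ev n) * Ab n (a j))"
    using zz_le_Ab[OF aj] by blast
  obtain C1 where H1: "C1 > 0 \<and> (\<forall>n\<ge>1. ev n \<ge> 1 \<longrightarrow> (\<forall>E. E \<in> sets borel \<longrightarrow>
     (\<integral>\<^sup>+x\<in>E. ennreal (Ab n x * Th n x (a j)) \<partial>\<mu>) \<le> ennreal (C1 * sqrt (ev n) powr (zz (a j) \<theta>) * measure \<mu> E powr (1 - \<theta>)) \<and>
     (\<integral>\<^sup>+x\<in>E. ennreal (Ab n x * Th n x (a j)) \<partial>\<mu>) \<le> ennreal (C1 * sqrt (ev n) powr (zz (a j) (1 - \<theta>)) * measure \<mu> E powr \<theta>)))"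
    using Th_integral_\<theta>[OF aj] by (rule exE)
  note C1 = H1[THEN conjunct1] and I1 = H1[THEN conjunct2, rule_format, THEN conjunct1]
  have "\<forall>\<^sub>F n in sequentially. \<forall>F. F \<in> sets borel \<longrightarrow>
    (\<integral>\<^sup>+x\<in>F. ennreal \<bar>Km a M n k x (a j)\<bar> \<partial>\<mu>) \<le> ennreal (Ca * C1 * K * measure \<mu> F powr (1 - \<theta>))"
    using ev1 eventually_ev[of 1]
  proof eventually_elim
    case (elim n)
    then have n: "n \<ge> 1" "ev n \<ge> 1" by auto
    define w where "w = sqrt (ev n) * Ab n (a j)"
    have A: "Ab n (a j) > 0" using Ab_pos[OF n(1) aj] .
    have w: "w > 0" using A n by (simp add: w_def)
    have "mm a n k (a j) * (Ab n x * Ab n (a j) * Th n x (a j)) = 1 / w * (Ab n x * Th n x (a j))" for x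
      using j A by (auto simp: mm_def w_def power2_eq_square)
    then have u1: "\<bar>Km a M n k x (a j)\<bar> \<le> Ca / w * (Ab n x * Th n x (a j))" if "x \<in> {-1..1}" for x using elim that by simp
    show ?case
    proof (intro allI impI)
      fix F :: "real set" assume F [measurable]: "F \<in> sets borel"
      have "(\<integral>\<^sup>+x\<in>F. ennreal \<bar>Km a M n k x (a j)\<bar> \<partial>\<mu>) \<le> (\<integral>\<^sup>+x. ennreal (Ca / w) * (ennreal (Ab n x * Th n x (a j)) * indicator F x) \<partial>\<mu>)"
      proof (rule nn_integral_mono_AE, use AE_jmu_Ioo in eventually_elim)
        case (elim x)
        then have "ennreal \<bar>Km a M n k x (a j)\<bar> \<le> ennreal (Ca / w * (Ab n x * Th n x (a j)))" by (intro ennreal_leI u1) auto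
        also have "\<dots> = ennreal (Ca / w) * ennreal (Ab n x * Th n x (a j))" using Ca w by (intro ennreal_mult') auto
        finally show ?case by (auto simp: indicator_def)
      qed
      also have "\<dots> = ennreal (Ca / w) * (\<integral>\<^sup>+x\<in>F. ennreal (Ab n x * Th n x (a j)) \<partial>\<mu>)" by (subst nn_integral_cmult) auto
      also have "\<dots> \<le> ennreal (Ca / w) * ennreal (C1 * sqrt (ev n) powr (zz (a j) \<theta>) * measure \<mu> F powr (1 - \<theta>))"
        by (intro mult_left_mono I1 n F) auto
      also have "\<dots> = ennreal (Ca / w * (C1 * sqrt (ev n) powr (zz (a j) \<theta>) * measure \<mu> F powr (1 - \<theta>)))"
        using Ca w C1 by (intro ennreal_mult[symmetric]) auto
      also have "\<dots> \<le> ennreal (Ca / w * (C1 * (K * w) * measure \<mu> F powr (1 - \<theta>)))"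
        using Ca w C1 K(2)[OF n] by (intro ennreal_leI mult_left_mono mult_right_mono) (auto simp: w_def)
      also have "Ca / w * (C1 * (K * w) * measure \<mu> F powr (1 - \<theta>)) = Ca * C1 * K * measure \<mu> F powr (1 - \<theta>)" using w by simp
      finally show "(\<integral>\<^sup>+x\<in>F. ennreal \<bar>Km a M n k x (a j)\<bar> \<partial>\<mu>) \<le> ennreal (Ca * C1 * K * measure \<mu> F powr (1 - \<theta>))" .
    qed
  qed
  moreover have "Ca * C1 * K > 0" using Ca C1 K by simp
  ultimately show ?thesis by blast
qed

text \<open>Read at one of the points, the upper bound gives the quotient of the two values of
  \<open>Ab\<close>; read at the other, its inverse. The product of both is constant.\<close>

lemma kernel_mass_mass:
  assumes j: "j < k" "l < k"
  shows "\<exists>C>0. \<forall>\<^sub>F n in sequentially. \<bar>Km a M n k (a j) (a l)\<bar> \<le> C"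
proof -
  have U: "kernel_upper a M k" using kernel_upper_lower[of k M a k, OF M a inj] by simp
  obtain C1 where C1: "C1 > 0" and ev1: "\<forall>\<^sub>F n in sequentially. \<forall>x\<in>{-1..1}. \<bar>Km a M n k x (a j)\<bar> \<le> C1 * (mm a n k (a j) * (Ab n x * Ab n (a j) * Th n x (a j)))"
    using kernel_upperD[OF U a[OF j(1)]] by blast
  obtain C2 where C2: "C2 > 0" and ev2: "\<forall>\<^sub>F n in sequentially. \<forall>x\<in>{-1..1}. \<bar>Km a M n k x (a l)\<bar> \<le> C2 * (mm a n k (a l) * (Ab n x * Ab n (a l) * Th n x (a l)))"
    using kernel_upperD[OF U a[OF j(2)]] by blast
  have "\<forall>\<^sub>F n in sequentially. \<bar>Km a M n k (a j) (a l)\<bar> \<le> sqrt (C1 * C2)"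
    using ev1 ev2 eventually_ev[of 1]
  proof eventually_elim
    case (elim n)
    then have n: "n \<ge> 1" "ev n \<ge> 1" by auto
    define A where "A = Ab n (a j)"
    define B where "B = Ab n (a l)"
    have AB: "A > 0" "B > 0" using Ab_pos[OF n(1)] a j by (auto simp: A_def B_def)
    define s where "s = sqrt (ev n)"
    have s: "s \<ge> 1" using n by (simp add: s_def)
    have T: "Th n (a l) (a j) \<le> s" "Th n (a j) (a l) \<le> s" using Th_bounds(2) a j n by (auto simp: s_def)
    have "\<bar>Km a M n k (a j) (a l)\<bar> \<le> C1 * (1 / (s * A^2) * (B * A * Th n (a l) (a j)))"
      using elim(1)[rule_format, OF a[OF j(2)]] j Km_sym[of k M a n "a j" "a l", OF M] by (simp add: mm_def s_def A_def B_def)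
    also have "\<dots> \<le> C1 * (1 / (s * A^2) * (B * A * s))" using C1 s AB T by (intro mult_left_mono) auto
    also have "\<dots> = C1 * (B / A)" using AB s by (simp add: power2_eq_square)
    finally have 1: "\<bar>Km a M n k (a j) (a l)\<bar> \<le> C1 * (B / A)" .
    have "\<bar>Km a M n k (a j) (a l)\<bar> \<le> C2 * (1 / (s * B^2) * (A * B * Th n (a j) (a l)))"
      using elim(2)[rule_format, OF a[OF j(1)]] j by (simp add: mm_def s_def A_def B_def)
    also have "\<dots> \<le> C2 * (1 / (s * B^2) * (A * B * s))" using C2 s AB T by (intro mult_left_mono) auto
    also have "\<dots> = C2 * (A / B)" using AB s by (simp add: power2_eq_square)
    finally have 2: "\<bar>Km a M n k (a j) (a l)\<bar> \<le> C2 * (A / B)" .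
    have "\<bar>Km a M n k (a j) (a l)\<bar>^2 \<le> (C1 * (B / A)) * (C2 * (A / B))"
      unfolding power2_eq_square using C1 AB by (intro mult_mono 1 2) auto
    also have "\<dots> = C1 * C2" using AB by simp
    finally show ?case by (rule real_le_rsqrt)
  qed
  then show ?thesis using C1 C2 by (intro exI[of _ "sqrt (C1 * C2)"]) auto
qed

end

end

section \<open>The measure with point masses and weak norms\<close>

lemma sets_jacobi_nu [measurable_cong, simp]: "sets (jacobi_nu \<alpha> \<beta> k a M) = sets borel"
  using sets.sigma_sets_eq[of "borel :: real measure"] by (simp add: jacobi_nu_def)

lemma emeasure_jacobi_nu:
  assumes A: "A \<in> sets borel"
  shows "emeasure (jacobi_nu \<alpha> \<beta> k a M) A = emeasure (jmu \<alpha> \<beta>) A + (\<Sum>i<k. ennreal (M i) * indicator A (a i))"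
proof -
  let ?f = "\<lambda>A. (\<integral>\<^sup>+ x. ennreal (indicator ({-1..1} \<inter> A) x * (1 - x) powr \<alpha> * (1 + x) powr \<beta>) \<partial>lborel)
          + (\<Sum>i<k. ennreal (M i) * indicator A (a i))"
  let ?g = "\<lambda>A. emeasure (jmu \<alpha> \<beta>) A + (\<Sum>i<k. ennreal (M i) * indicator A (a i))"
  have fg: "?f A = ?g A" if A: "A \<in> sets borel" for A
  proof -
    have "(\<integral>\<^sup>+ x. ennreal (indicator ({-1..1} \<inter> A) x * (1 - x) powr \<alpha> * (1 + x) powr \<beta>) \<partial>lborel) = emeasure (jmu \<alpha> \<beta>) A"
      unfolding jmu_def using A
      by (subst emeasure_density) (auto intro!: nn_integral_cong simp: jw_def indicator_def)
    then show ?thesis by simp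
  qed
  note sb = sets_jacobi_nu[of \<alpha> \<beta> k a M]
  have "emeasure (jacobi_nu \<alpha> \<beta> k a M) A = ?f A"
  proof (rule emeasure_measure_of[OF jacobi_nu_def])
    show "positive (sets (jacobi_nu \<alpha> \<beta> k a M)) ?f" by (simp add: positive_def)
    show "countably_additive (sets (jacobi_nu \<alpha> \<beta> k a M)) ?f"
    proof (rule countably_additiveI)
      fix B :: "nat \<Rightarrow> real set"
      assume B: "range B \<subseteq> sets (jacobi_nu \<alpha> \<beta> k a M)" "disjoint_family B"
      have Bm: "B i \<in> sets borel" for i using B(1) sb by auto
      then have Um: "(\<Union>i. B i) \<in> sets borel" by auto
      have ind: "(\<Sum>n. indicator (B n) x) = (indicator (\<Union>i. B i) x :: ennreal)" for x
        using B(2) by (rule suminf_indicator)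
      have "(\<Sum>n. ?g (B n)) = (\<Sum>n. emeasure (jmu \<alpha> \<beta>) (B n)) + (\<Sum>n. \<Sum>i<k. ennreal (M i) * indicator (B n) (a i))"
        by (rule suminf_add[symmetric]) (auto intro: summableI)
      also have "(\<Sum>n. \<Sum>i<k. ennreal (M i) * indicator (B n) (a i)) = (\<Sum>i<k. \<Sum>n. ennreal (M i) * indicator (B n) (a i))"
        by (rule suminf_sum) (auto intro: summableI)
      also have "(\<Sum>n. emeasure (jmu \<alpha> \<beta>) (B n)) = emeasure (jmu \<alpha> \<beta>) (\<Union>i. B i)"
        using Bm B(2) by (intro suminf_emeasure) auto
      finally have "(\<Sum>n. ?g (B n)) = ?g (\<Union>i. B i)" by (simp add: ind)
      then show "(\<Sum>n. ?f (B n)) = ?f (\<Union>i. B i)" by (simp only: fg[OF Bm] fg[OF Um])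
    qed
  qed (use A sb in auto)
  then show ?thesis using fg[OF A] by simp
qed

lemma space_jacobi_nu [simp]: "space (jacobi_nu \<alpha> \<beta> k a M) = UNIV"
  unfolding jacobi_nu_def by (simp add: space_measure_of_conv)

lemma nn_integral_jacobi_nu:
  assumes f: "f \<in> borel_measurable borel"
  shows "(\<integral>\<^sup>+x. f x \<partial>jacobi_nu \<alpha> \<beta> k a M) = (\<integral>\<^sup>+x. f x \<partial>jmu \<alpha> \<beta>) + (\<Sum>i<k. ennreal (M i) * f (a i))"
  using f
proof (induction rule: borel_measurable_induct[case_names cong set mult add seq])
  case (cong f g)
  then have "f = g" by auto
  then show ?case using cong by simp
next
  case (set A)
  then show ?case by (simp add: emeasure_jacobi_nu)
next
  case (mult u c)
  then show ?case by (simp add: nn_integral_cmult distrib_left sum_distrib_left mult_ac)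
next
  case (add u v)
  then show ?case by (simp add: nn_integral_add distrib_left sum.distrib ac_simps)
next
  case (seq U)
  let ?\<nu> = "jacobi_nu \<alpha> \<beta> k a M"
  have Um: "U i \<in> borel_measurable ?\<nu>" "U i \<in> borel_measurable (jmu \<alpha> \<beta>)" for i using seq by auto
  have inc: "incseq (\<lambda>i. U i x)" for x using \<open>incseq U\<close> by (auto simp: incseq_def le_fun_def)
  have m: "incseq (\<lambda>i. \<integral>\<^sup>+x. U i x \<partial>jmu \<alpha> \<beta>)"
    using \<open>incseq U\<close> by (auto simp: incseq_def le_fun_def intro!: nn_integral_mono)
  have c: "incseq (\<lambda>n. ennreal (M i) * U n (a i))" for i
    using inc[of "a i"] by (auto simp: incseq_def intro!: mult_left_mono)
  have "(\<integral>\<^sup>+x. (SUP i. U i x) \<partial>?\<nu>) = (SUP i. \<integral>\<^sup>+x. U i x \<partial>?\<nu>)"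
    by (rule nn_integral_monotone_convergence_SUP[OF \<open>incseq U\<close> Um(1)])
  also have "\<dots> = (SUP i. (\<integral>\<^sup>+x. U i x \<partial>jmu \<alpha> \<beta>) + (\<Sum>j<k. ennreal (M j) * U i (a j)))" using seq by simp
  also have "\<dots> = (SUP i. \<integral>\<^sup>+x. U i x \<partial>jmu \<alpha> \<beta>) + (SUP i. \<Sum>j<k. ennreal (M j) * U i (a j))"
    by (rule ennreal_SUP_add[OF m]) (use c in \<open>auto simp: incseq_def intro!: sum_mono\<close>)
  also have "(SUP i. \<Sum>j<k. ennreal (M j) * U i (a j)) = (\<Sum>j<k. ennreal (M j) * (SUP i. U i (a j)))"
    using ennreal_SUP_sum[of "{..<k}" "\<lambda>j i. ennreal (M j) * U i (a j)"] c by (simp add: SUP_mult_left_ennreal)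
  also have "(SUP i. \<integral>\<^sup>+x. U i x \<partial>jmu \<alpha> \<beta>) = (\<integral>\<^sup>+x. (SUP i. U i x) \<partial>jmu \<alpha> \<beta>)"
    by (rule nn_integral_monotone_convergence_SUP[OF \<open>incseq U\<close> Um(2), symmetric])
  finally show ?case by (simp add: image_comp)
qed

lemma integral_jacobi_nu:
  fixes f :: "real \<Rightarrow> real"
  assumes ab: "\<alpha> > -1" "\<beta> > -1" and M: "\<And>i. i < k \<Longrightarrow> M i > 0"
    and f [measurable]: "f \<in> borel_measurable borel" and B: "\<And>x. x \<in> {-1..1} \<Longrightarrow> \<bar>f x\<bar> \<le> B"
  shows "integrable (jacobi_nu \<alpha> \<beta> k a M) f"
    and "(\<integral>x. f x \<partial>jacobi_nu \<alpha> \<beta> k a M) = (\<integral>x. f x \<partial>jmu \<alpha> \<beta>) + (\<Sum>i<k. M i * f (a i))"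
proof -
  let ?\<nu> = "jacobi_nu \<alpha> \<beta> k a M"
  have im: "integrable (jmu \<alpha> \<beta>) f" by (rule integrable_jmu_bounded[OF ab f B])
  have nn: "(\<integral>\<^sup>+x. ennreal (g x) \<partial>?\<nu>) = (\<integral>\<^sup>+x. ennreal (g x) \<partial>jmu \<alpha> \<beta>) + ennreal (\<Sum>i<k. M i * max 0 (g (a i)))"
    if [measurable]: "g \<in> borel_measurable borel" for g
  proof -
    have "(\<Sum>i<k. ennreal (M i) * ennreal (g (a i))) = (\<Sum>i<k. ennreal (M i * max 0 (g (a i))))"
      using M by (intro sum.cong refl) (auto simp: ennreal_mult max_def ennreal_neg less_imp_le)
    also have "\<dots> = ennreal (\<Sum>i<k. M i * max 0 (g (a i)))" using M by (intro sum_ennreal) (simp add: less_imp_le)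
    finally show ?thesis by (simp add: nn_integral_jacobi_nu)
  qed
  have fin: "(\<integral>\<^sup>+x. ennreal \<bar>f x\<bar> \<partial>jmu \<alpha> \<beta>) < \<infinity>" using im by (simp add: integrable_iff_bounded)
  show i\<nu>: "integrable ?\<nu> f"
    using fin nn[of "\<lambda>x. \<bar>f x\<bar>"] by (simp add: integrable_iff_bounded ennreal_add_less_top)
  have lt: "(\<integral>\<^sup>+x. ennreal (f x) \<partial>jmu \<alpha> \<beta>) < \<infinity>" "(\<integral>\<^sup>+x. ennreal (- f x) \<partial>jmu \<alpha> \<beta>) < \<infinity>"
    by (rule le_less_trans[OF nn_integral_mono fin], simp)+
  have s0: "(\<Sum>i<k. M i * max 0 (g (a i))) \<ge> 0" for g using M by (intro sum_nonneg) (simp add: less_imp_le)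
  have "(\<integral>x. f x \<partial>?\<nu>) = (enn2real (\<integral>\<^sup>+x. ennreal (f x) \<partial>jmu \<alpha> \<beta>) + (\<Sum>i<k. M i * max 0 (f (a i))))
     - (enn2real (\<integral>\<^sup>+x. ennreal (- f x) \<partial>jmu \<alpha> \<beta>) + (\<Sum>i<k. M i * max 0 (- f (a i))))"
    unfolding real_lebesgue_integral_def[OF i\<nu>] using lt s0[of f] s0[of "\<lambda>x. - f x"]
    by (simp add: nn[of f] nn[of "\<lambda>x. - f x"] enn2real_plus)
  also have "\<dots> = (\<integral>x. f x \<partial>jmu \<alpha> \<beta>) + ((\<Sum>i<k. M i * max 0 (f (a i))) - (\<Sum>i<k. M i * max 0 (- f (a i))))"
    unfolding real_lebesgue_integral_def[OF im] by simp
  also have "(\<Sum>i<k. M i * max 0 (f (a i))) - (\<Sum>i<k. M i * max 0 (- f (a i))) = (\<Sum>i<k. M i * f (a i))"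
    unfolding sum_subtractf[symmetric] by (intro sum.cong refl) (auto simp: max_def)
  finally show "(\<integral>x. f x \<partial>?\<nu>) = (\<integral>x. f x \<partial>jmu \<alpha> \<beta>) + (\<Sum>i<k. M i * f (a i))" .
qed

lemma finite_measure_jacobi_nu:
  assumes "\<alpha> > -1" "\<beta> > -1" shows "finite_measure (jacobi_nu \<alpha> \<beta> k a M)"
proof
  interpret finite_measure "jmu \<alpha> \<beta>" by (rule finite_measure_jmu[OF assms])
  show "emeasure (jacobi_nu \<alpha> \<beta> k a M) (space (jacobi_nu \<alpha> \<beta> k a M)) \<noteq> \<infinity>"
    by (simp add: emeasure_jacobi_nu emeasure_eq_measure ennreal_mult_eq_top_iff)
qed

lemma measure_jacobi_nu_ge:
  assumes "\<alpha> > -1" "\<beta> > -1" "E \<in> sets borel"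
  shows "measure (jmu \<alpha> \<beta>) E \<le> measure (jacobi_nu \<alpha> \<beta> k a M) E"
    and "i < k \<Longrightarrow> a i \<in> E \<Longrightarrow> M i \<le> measure (jacobi_nu \<alpha> \<beta> k a M) E"
proof -
  interpret m: finite_measure "jmu \<alpha> \<beta>" by (rule finite_measure_jmu[OF assms(1,2)])
  interpret n: finite_measure "jacobi_nu \<alpha> \<beta> k a M" by (rule finite_measure_jacobi_nu[OF assms(1,2)])
  note e = emeasure_jacobi_nu[OF assms(3), of \<alpha> \<beta> k a M]
  have "emeasure (jmu \<alpha> \<beta>) E \<le> emeasure (jacobi_nu \<alpha> \<beta> k a M) E" unfolding e by simp
  then show "measure (jmu \<alpha> \<beta>) E \<le> measure (jacobi_nu \<alpha> \<beta> k a M) E"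
    by (simp add: m.emeasure_eq_measure n.emeasure_eq_measure)
  assume i: "i < k" "a i \<in> E"
  have "ennreal (M i) * indicator E (a i) \<le> (\<Sum>i<k. ennreal (M i) * indicator E (a i))"
    using i by (intro member_le_sum) auto
  then have "ennreal (M i) \<le> emeasure (jacobi_nu \<alpha> \<beta> k a M) E" unfolding e using i by (simp add: add_increasing)
  then show "M i \<le> measure (jacobi_nu \<alpha> \<beta> k a M) E" by (simp add: n.emeasure_eq_measure)
qed

text \<open>The function is tested on the sets where it exceeds s and where it is below - s. For a
  suitable s the assumption bounds the measure of each by t/2, so the rearrangement at t is at most
  s.\<close>

lemma weak_Lp_norm_le:
  assumes "finite_measure N" and f: "integrable N f" and q: "0 < q" "q < 1" and A: "A > 0" and C: "C > 0"
    and bound: "\<And>F. F \<in> sets N \<Longrightarrow> \<bar>\<integral>x. indicator F x * f x \<partial>N\<bar> \<le> C * (A powr q * measure N F powr (1 - q))"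
  shows "weak_Lp_norm N (1 / q) f \<le> ennreal (2 * C) * ennreal (A powr q)"
proof -
  interpret finite_measure N by fact
  have fm [measurable]: "f \<in> borel_measurable N" using f by simp
  have "ennreal (t powr (1 / (1 / q))) * rearrangement N f t \<le> ennreal (2 * C) * ennreal (A powr q)" if t: "t > 0" for t
  proof -
    \<comment> \<open>For a set of measure m the assumption yields s m^q \<le> C A^q, which with
      this s says m \<le> t/2. Moreover t^q s = C 2^q A^q does not depend on t.\<close>
    define s where "s = C * (2 * A / t) powr q"
    have s: "s > 0" using C A t by (simp add: s_def)
    have small: "measure N F \<le> t / 2" if F [measurable]: "F \<in> sets N" and le: "s * measure N F \<le> \<bar>\<integral>x. indicator F x * f x \<partial>N\<bar>" for F
    proof (cases "measure N F = 0")
      case True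
      then show ?thesis using t by simp
    next
      case False
      define m where "m = measure N F"
      have m: "m > 0" using False measure_nonneg[of N F] unfolding m_def by linarith
      have "s * (m powr q * m powr (1 - q)) \<le> C * (A powr q * m powr (1 - q))"
        using bound[OF F] le m by (simp add: m_def powr_add[symmetric])
      then have "(s * m powr q) * m powr (1 - q) \<le> (C * A powr q) * m powr (1 - q)" by (simp add: mult.assoc)
      then have "s * m powr q \<le> C * A powr q" using m by simp
      then have "(2 * A / t) powr q * m powr q \<le> A powr q" using C by (simp add: s_def)
      moreover have "(2 * A / t * m) powr q = (2 * A / t) powr q * m powr q" using A t m by (intro powr_mult)
      ultimately have "\<not> A < 2 * A / t * m" using powr_less_mono2[of q A "2 * A / t * m"] q A by linarith
      then have "2 * A / t * m \<le> A" by simp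
      then show ?thesis using A t by (simp add: m_def field_simps)
    qed
    have fi: "integrable N (\<lambda>x. indicator F x * f x)" if [measurable]: "F \<in> sets N" for F
      using f by (rule Bochner_Integration.integrable_bound) (auto simp: indicator_def)
    define F1 where "F1 = {x \<in> space N. s < f x}"
    define F2 where "F2 = {x \<in> space N. s < - f x}"
    have Fm [measurable]: "F1 \<in> sets N" "F2 \<in> sets N" unfolding F1_def F2_def by measurable
    have "s * measure N F1 = (\<integral>x. indicator F1 x * s \<partial>N)" by (simp add: mult.commute)
    also have "\<dots> \<le> (\<integral>x. indicator F1 x * f x \<partial>N)"
      by (intro integral_mono fi Fm integrable_mult_left integrable_real_indicator) (auto simp: F1_def indicator_def emeasure_finite less_top[symmetric])
    finally have 1: "measure N F1 \<le> t / 2" by (intro small) auto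
    have "s * measure N F2 = (\<integral>x. indicator F2 x * s \<partial>N)" by (simp add: mult.commute)
    also have "\<dots> \<le> (\<integral>x. - (indicator F2 x * f x) \<partial>N)"
      by (intro integral_mono fi Fm integrable_mult_left integrable_real_indicator integrable_minus) (auto simp: F2_def indicator_def emeasure_finite less_top[symmetric])
    also have "\<dots> = - (\<integral>x. indicator F2 x * f x \<partial>N)" by simp
    finally have 2: "measure N F2 \<le> t / 2" by (intro small) auto
    have "{x \<in> space N. ennreal s < ennreal \<bar>f x\<bar>} = F1 \<union> F2" using s by (auto simp: F1_def F2_def ennreal_less_iff abs_if)
    moreover have "measure N (F1 \<union> F2) \<le> t" using measure_Un_le[OF Fm] 1 2 by linarith
    ultimately have "emeasure N {x \<in> space N. ennreal s < ennreal \<bar>f x\<bar>} \<le> ennreal t" by (simp add: emeasure_eq_measure ennreal_leI)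
    then have "rearrangement N f t \<le> ennreal s" unfolding rearrangement_def by (intro Inf_lower) simp
    then have "ennreal (t powr (1 / (1 / q))) * rearrangement N f t \<le> ennreal (t powr q) * ennreal s" by (simp add: mult_left_mono)
    also have "\<dots> = ennreal (t powr q * s)" using s by (simp add: ennreal_mult)
    also have "t powr q * s = C * 2 powr q * A powr q" using t A by (simp add: s_def powr_mult powr_divide)
    also have "ennreal \<dots> \<le> ennreal (2 * C * A powr q)"
      using C q powr_mono[of q 1 2] by (intro ennreal_leI mult_right_mono) auto
    also have "\<dots> = ennreal (2 * C) * ennreal (A powr q)" using C by (simp add: ennreal_mult)
    finally show ?thesis .
  qed
  then show ?thesis unfolding weak_Lp_norm_def by (intro SUP_least) simp
qed

lemma Lp_norm_indicator:
  assumes "finite_measure N" "p > 0" "E \<in> sets N"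
  shows "Lp_norm N p (indicator E) = ennreal (measure N E powr (1 / p))"
proof -
  interpret finite_measure N by fact
  have "ennreal (\<bar>indicator E x\<bar> powr p) = indicator E x" for x by (auto simp: indicator_def)
  then have "(\<integral>\<^sup>+ x. ennreal (\<bar>indicator E x\<bar> powr p) \<partial>N) = ennreal (measure N E)"
    using assms(3) by (simp add: emeasure_eq_measure)
  then show ?thesis by (simp add: Lp_norm_def)
qed

section \<open>Partial sums for the measure with point masses\<close>

locale jacobi_masses = jacobi_exp +
  fixes k :: nat and a M :: "nat \<Rightarrow> real" and P :: "nat \<Rightarrow> real poly"
  assumes a: "\<And>j. j < k \<Longrightarrow> a j \<in> {-1..1}" and inj: "inj_on a {..<k}" and M: "\<And>j. j < k \<Longrightarrow> M j > 0"
    and P: "orthonormal_polys (jacobi_nu \<alpha> \<beta> k a M) P"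
begin

abbreviation \<nu> where "\<nu> \<equiv> jacobi_nu \<alpha> \<beta> k a M"

sublocale fin\<nu>: finite_measure \<nu> by (rule finite_measure_jacobi_nu[OF ab])

lemma nu_integral:
  fixes f :: "real \<Rightarrow> real"
  assumes "f \<in> borel_measurable borel" "\<And>x. x \<in> {-1..1} \<Longrightarrow> \<bar>f x\<bar> \<le> B"
  shows "integrable \<nu> f" "(\<integral>x. f x \<partial>\<nu>) = (\<integral>x. f x \<partial>\<mu>) + (\<Sum>i<k. M i * f (a i))"
  using integral_jacobi_nu[of \<alpha> \<beta> k M f B a] ab M assms by auto

lemma nu_integral_nonneg:
  fixes f :: "real \<Rightarrow> real"
  assumes "f \<in> borel_measurable borel" "\<And>x. x \<in> {-1..1} \<Longrightarrow> 0 \<le> f x" "\<And>x. x \<in> {-1..1} \<Longrightarrow> \<bar>f x\<bar> \<le> B"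
  shows "0 \<le> (\<integral>x. f x \<partial>\<nu>)"
proof -
  have "AE x in \<mu>. 0 \<le> f x" by (rule eventually_mono[OF AE_jmu_Icc assms(2)])
  then have "0 \<le> (\<integral>x. f x \<partial>\<mu>)" by (rule integral_nonneg_AE)
  moreover have "0 \<le> (\<Sum>i<k. M i * f (a i))"
    using M a assms(2) by (intro sum_nonneg mult_nonneg_nonneg) (auto intro: less_imp_le)
  moreover have "(\<integral>x. f x \<partial>\<nu>) = (\<integral>x. f x \<partial>\<mu>) + (\<Sum>i<k. M i * f (a i))" by (rule nu_integral(2)[OF assms(1,3)])
  ultimately show ?thesis by linarith
qed

lemma nu_integral_poly: "(\<integral>x. poly q x \<partial>\<nu>) = Jm a M k q"
proof -
  obtain B where "\<And>x. x \<in> {-1..1} \<Longrightarrow> \<bar>poly q x\<bar> \<le> B" using poly_bounded_Icc[of q] by blast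
  then show ?thesis using nu_integral(2)[OF poly_measurable, of q B] by (simp add: Jm_def I_def)
qed

lemma degree_P: "degree (P j) = j" using P by (simp add: orthonormal_polys_def)

lemma P_nonzero: "P j \<noteq> 0"
proof -
  have "lead_coeff (P j) > 0" using P unfolding orthonormal_polys_def by blast
  then show ?thesis by auto
qed

lemma P_orth: "Jm a M k (P i * P j) = (if i = j then 1 else 0)"
proof -
  have "Jm a M k (P i * P j) = (\<integral>x. poly (P i) x * poly (P j) x \<partial>\<nu>)"
    unfolding nu_integral_poly[symmetric] by (rule Bochner_Integration.integral_cong) simp_all
  then show ?thesis using P by (simp add: orthonormal_polys_def)
qed

lemma Jm_sum: "Jm a M k (\<Sum>j\<in>T. f j) = (\<Sum>j\<in>T. Jm a M k (f j))"
  by (simp add: Jm_def I_sum poly_sum sum_distrib_left sum.distrib) (rule sum.swap)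

text \<open>Both kernels reproduce the polynomials of degree at most n for the measure with all
  masses, so \<open>reproducing_unique\<close> identifies them.\<close>

lemma kernel_L_eq: "kernel_L P n x y = Km a M n k x y"
proof -
  define Q where "Q x = (\<Sum>j\<le>n. smult (poly (P j) x) (P j))" for x
  have "poly (Qm a M n k x) y = poly (Q y) x"
  proof (rule reproducing_unique[where T="Jm a M k" and Q="Qm a M n k" and Q'=Q])
    show "degree (Qm a M n k x) \<le> n" for x by (rule degree_Qm)
    show "degree (Q x) \<le> n" for x unfolding Q_def
      by (intro degree_sum_le order_trans[OF degree_smult_le]) (auto simp: degree_P)
    show "Jm a M k (Qm a M n k x * q) = poly q x" if "degree q \<le> n" for x q by (rule Qm_reproducing[OF M that])
    show "Jm a M k (Q x * q) = poly q x" if q: "degree q \<le> n" for x q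
    proof -
      obtain c where c: "q = (\<Sum>j\<le>n. smult (c j) (P j))"
        using degree_basis_expansion[of P, OF degree_P P_nonzero q] by blast
      have "Jm a M k (Q x * q) = (\<Sum>j\<le>n. \<Sum>l\<le>n. poly (P j) x * (c l * Jm a M k (P j * P l)))"
        unfolding c Q_def sum_product Jm_sum by (intro sum.cong refl) (simp add: Jm_smult)
      also have "\<dots> = (\<Sum>j\<le>n. poly (P j) x * c j)"
      proof (rule sum.cong[OF refl])
        fix j assume j: "j \<in> {..n}"
        have "(\<Sum>l\<le>n. poly (P j) x * (c l * Jm a M k (P j * P l))) = (\<Sum>l\<le>n. if l = j then poly (P j) x * c j else 0)"
          by (intro sum.cong) (auto simp: P_orth)
        then show "(\<Sum>l\<le>n. poly (P j) x * (c l * Jm a M k (P j * P l))) = poly (P j) x * c j" using j by simp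
      qed
      also have "\<dots> = poly q x" unfolding c by (simp add: poly_sum mult.commute)
      finally show ?thesis .
    qed
  qed
  then show ?thesis by (simp add: Km_def kernel_L_def Q_def poly_sum mult.commute)
qed

definition pm where "pm E j = (\<integral>y. indicator E y * poly (P j) y \<partial>\<nu>)"
text \<open>The pairing of the partial sum of \<chi>_E with \<chi>_F, written in Fourier
  coefficients so that its symmetry in E and F is visible.\<close>

definition TT where "TT n E F = (\<Sum>j\<le>n. pm E j * pm F j)"

lemma TT_sym: "TT n E F = TT n F E" by (simp add: TT_def mult.commute)

lemma ind_poly:
  assumes [measurable]: "E \<in> sets borel" and B: "\<And>x. x \<in> {-1..1} \<Longrightarrow> \<bar>poly q x\<bar> \<le> B"
  shows "integrable \<nu> (\<lambda>y. indicator E y * poly q y)" "\<bar>\<integral>y. indicator E y * poly q y \<partial>\<nu>\<bar> \<le> B * measure \<nu> E"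
proof -
  have B0: "B \<ge> 0" using B[of 0] by force
  show i: "integrable \<nu> (\<lambda>y. indicator E y * poly q y)"
    by (rule nu_integral(1)[where B=B]) (use B B0 in \<open>auto simp: indicator_def\<close>)
  have ii: "integrable \<nu> (\<lambda>y. B * indicator E y)" by (simp add: fin\<nu>.emeasure_eq_measure)
  have "0 \<le> (\<integral>y. B * indicator E y - indicator E y * poly q y \<partial>\<nu>)" "0 \<le> (\<integral>y. B * indicator E y + indicator E y * poly q y \<partial>\<nu>)"
    by (rule nu_integral_nonneg[where B="2 * B"]; use B B0 in \<open>force simp: indicator_def\<close>)+
  moreover have "(\<integral>y. B * indicator E y \<partial>\<nu>) = B * measure \<nu> E" by simp
  ultimately show "\<bar>\<integral>y. indicator E y * poly q y \<partial>\<nu>\<bar> \<le> B * measure \<nu> E" using i ii by (simp add: abs_le_iff)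
qed

lemma P_bounded: "\<exists>b. \<forall>j. b j \<ge> 0 \<and> (\<forall>x\<in>{-1..1}. \<bar>poly (P j) x\<bar> \<le> b j)"
  by (rule choice) (use poly_bounded_Icc in blast)

lemma partial_sum_eq:
  assumes E: "E \<in> sets borel"
  shows "partial_sum_op \<nu> P n (indicator E) x = (\<Sum>j\<le>n. poly (P j) x * pm E j)"
proof -
  obtain b where b: "\<And>j x. x \<in> {-1..1} \<Longrightarrow> \<bar>poly (P j) x\<bar> \<le> b j" using P_bounded by blast
  have "partial_sum_op \<nu> P n (indicator E) x = (\<integral>y. (\<Sum>j\<le>n. poly (P j) x * (indicator E y * poly (P j) y)) \<partial>\<nu>)"
    unfolding partial_sum_op_def kernel_L_def
    by (rule Bochner_Integration.integral_cong[OF refl], subst sum_distrib_right, rule sum.cong) simp_all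
  also have "\<dots> = (\<Sum>j\<le>n. poly (P j) x * pm E j)"
    unfolding pm_def using ind_poly(1)[OF E b] by simp
  finally show ?thesis .
qed

lemma TT_integral:
  assumes E: "E \<in> sets borel" and F: "F \<in> sets borel"
  shows "(\<integral>x. indicator F x * partial_sum_op \<nu> P n (indicator E) x \<partial>\<nu>) = TT n E F"
proof -
  obtain b where b: "\<And>j x. x \<in> {-1..1} \<Longrightarrow> \<bar>poly (P j) x\<bar> \<le> b j" using P_bounded by blast
  have "(\<integral>x. indicator F x * partial_sum_op \<nu> P n (indicator E) x \<partial>\<nu>) = (\<integral>x. (\<Sum>j\<le>n. pm E j * (indicator F x * poly (P j) x)) \<partial>\<nu>)"
    unfolding partial_sum_eq[OF E]
    by (rule Bochner_Integration.integral_cong[OF refl], subst sum_distrib_left, rule sum.cong) simp_all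
  also have "\<dots> = TT n E F" unfolding TT_def pm_def[of F] using ind_poly(1)[OF F b] by simp
  finally show ?thesis .
qed

lemma partial_sum_integrable:
  assumes E: "E \<in> sets borel" shows "integrable \<nu> (partial_sum_op \<nu> P n (indicator E))"
proof -
  obtain b where b: "\<And>j x. x \<in> {-1..1} \<Longrightarrow> \<bar>poly (P j) x\<bar> \<le> b j" using P_bounded by blast
  have "integrable \<nu> (poly (P j))" for j using ind_poly(1)[of UNIV "P j", OF _ b] by simp
  then show ?thesis unfolding partial_sum_eq[OF E, abs_def] by simp
qed

text \<open>Both integrations are split into weight and masses. This leaves one double integral, two
  kinds of single integrals against the kernel at a mass, and values of the kernel at pairs of
  masses.\<close>

lemma TT_expand:
  assumes E [measurable]: "E \<in> sets borel" and F [measurable]: "F \<in> sets borel"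
  shows "TT n E F = bilin \<mu> (Km a M n k) E F + (\<Sum>i<k. M i * (indicator E (a i) * (\<integral>x. indicator F x * Km a M n k x (a i) \<partial>\<mu>)))
     + (\<Sum>j<k. M j * (indicator F (a j) * ((\<integral>y. indicator E y * Km a M n k y (a j) \<partial>\<mu>) + (\<Sum>i<k. M i * (indicator E (a i) * Km a M n k (a j) (a i))))))"
proof -
  define S where "S x = partial_sum_op \<nu> P n (indicator E) x" for x
  obtain B where B: "bkern (Km a M n k) B" using Km_bkern[of k M a n, OF M a] by blast
  have Kb: "\<bar>Km a M n k x y\<bar> \<le> B" if "x \<in> {-1..1}" "y \<in> {-1..1}" for x y using B that by (auto simp: bkern_def)
  have B0: "B \<ge> 0" using B by (simp add: bkern_def)
  have [measurable]: "Km a M n k x \<in> borel_measurable borel" for x unfolding Km_def by measurable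
  have Ks: "Km a M n k x y = Km a M n k y x" for x y by (rule Km_sym[OF M])
  have [measurable]: "(\<lambda>x. Km a M n k x y) \<in> borel_measurable borel" for y unfolding Ks[of _ y] by measurable
  have S: "S x = (\<integral>y. indicator E y * Km a M n k x y \<partial>\<mu>) + (\<Sum>i<k. M i * (indicator E (a i) * Km a M n k x (a i)))"
    if x: "x \<in> {-1..1}" for x
  proof -
    have "S x = (\<integral>y. indicator E y * Km a M n k x y \<partial>\<nu>)"
      unfolding S_def partial_sum_op_def kernel_L_eq by (simp add: mult.commute)
    also have "\<dots> = (\<integral>y. indicator E y * Km a M n k x y \<partial>\<mu>) + (\<Sum>i<k. M i * (indicator E (a i) * Km a M n k x (a i)))"
      by (rule nu_integral(2)[where B=B]) (use Kb[OF x] B0 in \<open>auto simp: indicator_def\<close>)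
    finally show ?thesis .
  qed
  obtain b where b: "\<And>j x. x \<in> {-1..1} \<Longrightarrow> \<bar>poly (P j) x\<bar> \<le> b j" using P_bounded by blast
  have Seq: "S = (\<lambda>x. \<Sum>j\<le>n. poly (P j) x * pm E j)" unfolding S_def using partial_sum_eq[OF E] by auto
  have Sm [measurable]: "S \<in> borel_measurable borel" unfolding Seq by measurable
  define BS where "BS = (\<Sum>j\<le>n. b j * \<bar>pm E j\<bar>)"
  have Sb: "\<bar>S x\<bar> \<le> BS" if "x \<in> {-1..1}" for x
    unfolding Seq BS_def using b[OF that] by (intro order_trans[OF sum_abs] sum_mono) (auto simp: abs_mult intro!: mult_right_mono)
  have BS0: "BS \<ge> 0" using Sb[of 0] by force
  have "TT n E F = (\<integral>x. indicator F x * S x \<partial>\<nu>)" unfolding S_def TT_integral[OF E F] ..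
  also have "\<dots> = (\<integral>x. indicator F x * S x \<partial>\<mu>) + (\<Sum>j<k. M j * (indicator F (a j) * S (a j)))"
    by (rule nu_integral(2)[where B=BS]) (use Sb BS0 in \<open>auto simp: indicator_def\<close>)
  also have "(\<Sum>j<k. M j * (indicator F (a j) * S (a j))) = (\<Sum>j<k. M j * (indicator F (a j) * ((\<integral>y. indicator E y * Km a M n k y (a j) \<partial>\<mu>) + (\<Sum>i<k. M i * (indicator E (a i) * Km a M n k (a j) (a i))))))"
  proof (rule sum.cong[OF refl])
    fix j assume "j \<in> {..<k}"
    then have "a j \<in> {-1..1}" using a by simp
    from S[OF this] show "M j * (indicator F (a j) * S (a j)) = M j * (indicator F (a j) * ((\<integral>y. indicator E y * Km a M n k y (a j) \<partial>\<mu>) + (\<Sum>i<k. M i * (indicator E (a i) * Km a M n k (a j) (a i)))))"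
      by (simp only: Ks[of _ "a j"])
  qed
  also have "(\<integral>x. indicator F x * S x \<partial>\<mu>) = (\<integral>x. indicator F x * (\<integral>y. indicator E y * Km a M n k x y \<partial>\<mu>)
      + (\<Sum>i<k. M i * (indicator E (a i) * (indicator F x * Km a M n k x (a i)))) \<partial>\<mu>)"
  proof (rule integral_cong_AE)
    show "(\<lambda>x. indicator F x * (\<integral>y. indicator E y * Km a M n k x y \<partial>\<mu>)
      + (\<Sum>i<k. M i * (indicator E (a i) * (indicator F x * Km a M n k x (a i))))) \<in> borel_measurable \<mu>"
      using kern_inner_meas[OF B E] by measurable
    show "AE x in \<mu>. indicator F x * S x = indicator F x * (\<integral>y. indicator E y * Km a M n k x y \<partial>\<mu>)
      + (\<Sum>i<k. M i * (indicator E (a i) * (indicator F x * Km a M n k x (a i))))"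
    proof (rule eventually_mono[OF AE_jmu_Icc])
      fix x :: real assume x: "x \<in> {-1..1}"
      have "indicator F x * (\<Sum>i<k. M i * (indicator E (a i) * Km a M n k x (a i))) = (\<Sum>i<k. M i * (indicator E (a i) * (indicator F x * Km a M n k x (a i))))"
        by (subst sum_distrib_left, rule sum.cong) simp_all
      then show "indicator F x * S x = indicator F x * (\<integral>y. indicator E y * Km a M n k x y \<partial>\<mu>)
        + (\<Sum>i<k. M i * (indicator E (a i) * (indicator F x * Km a M n k x (a i))))"
        unfolding S[OF x] distrib_left by simp
    qed
  qed measurable
  also have "\<dots> = bilin \<mu> (Km a M n k) E F + (\<Sum>i<k. M i * (indicator E (a i) * (\<integral>x. indicator F x * Km a M n k x (a i) \<partial>\<mu>)))"
  proof -
    have "integrable \<mu> (\<lambda>x. indicator F x * Km a M n k x (a i))" if "i < k" for i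
      by (rule integrable_jmu_bounded[OF ab, where B=B]) (use Kb a[OF that] B0 in \<open>auto simp: indicator_def\<close>)
    then show ?thesis unfolding bilin_def
      by (subst Bochner_Integration.integral_add[OF kern_outer_integrable[OF B E F]]) auto
  qed
  finally show ?thesis by simp
qed

end

section \<open>From kernel bounds to the weak type inequality\<close>

context jacobi_masses
begin

text \<open>A set that contains a mass point has at least that mass as its measure, so any
  nonnegative power of the measure dominates the indicator up to a constant.\<close>

lemma mass_indicator_le:
  assumes "E \<in> sets borel" "i < k" "t \<ge> 0"
  shows "indicator E (a i) \<le> M i powr (- t) * measure \<nu> E powr t"
proof (cases "a i \<in> E")
  case True
  have "M i powr t \<le> measure \<nu> E powr t"
    using measure_jacobi_nu_ge(2)[OF ab assms(1,2), of a M] True M[OF assms(2)] assms(3) by (intro powr_mono2) auto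
  then have "M i powr (- t) * M i powr t \<le> M i powr (- t) * measure \<nu> E powr t" by (rule mult_left_mono) simp
  moreover have "M i powr (- t) * M i powr t = 1" using M[OF assms(2)] by (simp add: powr_add[symmetric])
  ultimately show ?thesis using True by simp
qed simp

lemma mu_powr_le_nu:
  assumes "E \<in> sets borel" "t \<ge> 0" shows "measure \<mu> E powr t \<le> measure \<nu> E powr t"
  using measure_jacobi_nu_ge(1)[OF ab assms(1)] assms(2) by (intro powr_mono2) auto

text \<open>The terms of \<open>TT_expand\<close> are bounded one by one for large n; a set that
  contains a mass supplies the missing power of its measure, by
  \<open>mass_indicator_le\<close>.\<close>

lemma TT_large:
  "\<exists>D\<ge>0. \<forall>\<^sub>F n in sequentially. \<forall>E F. E \<in> sets borel \<longrightarrow> F \<in> sets borel \<longrightarrow>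
     \<bar>TT n E F\<bar> \<le> D * (measure \<nu> E powr \<theta> * measure \<nu> F powr (1 - \<theta>))"
proof -
  obtain C1 where H1: "C1 > 0 \<and> (\<forall>\<^sub>F n in sequentially. \<forall>E F. E \<in> sets borel \<longrightarrow> F \<in> sets borel \<longrightarrow>
    \<bar>bilin \<mu> (Km a M n k) E F\<bar> \<le> C1 * (measure \<mu> E powr \<theta> * measure \<mu> F powr (1 - \<theta>)))"
    using kernel_bilin_all[of k M a k, OF M a inj order_refl] unfolding kernel_bilin_def by (rule exE)
  have "\<forall>j\<in>{..<k}. \<exists>C>0. \<forall>\<^sub>F n in sequentially. \<forall>F. F \<in> sets borel \<longrightarrow>
    (\<integral>\<^sup>+x\<in>F. ennreal \<bar>Km a M n k x (a j)\<bar> \<partial>\<mu>) \<le> ennreal (C * measure \<mu> F powr (1 - \<theta>))"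
    using kernel_at_mass[of k M a, OF M a inj] by (intro ballI) simp
  from bchoice[OF this] obtain C2 where H2: "\<forall>j\<in>{..<k}. C2 j > 0 \<and> (\<forall>\<^sub>F n in sequentially. \<forall>F. F \<in> sets borel \<longrightarrow>
    (\<integral>\<^sup>+x\<in>F. ennreal \<bar>Km a M n k x (a j)\<bar> \<partial>\<mu>) \<le> ennreal (C2 j * measure \<mu> F powr (1 - \<theta>)))" by (rule exE)
  have "\<forall>p\<in>{..<k} \<times> {..<k}. \<exists>C>0. \<forall>\<^sub>F n in sequentially. \<bar>Km a M n k (a (fst p)) (a (snd p))\<bar> \<le> C"
    using kernel_mass_mass[of k M a, OF M a inj] by (intro ballI) auto
  from bchoice[OF this] obtain C3 where H3: "\<forall>p\<in>{..<k} \<times> {..<k}. C3 p > 0 \<and> (\<forall>\<^sub>F n in sequentially. \<bar>Km a M n k (a (fst p)) (a (snd p))\<bar> \<le> C3 p)"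
    by (rule exE)
  have e2: "\<forall>\<^sub>F n in sequentially. \<forall>j\<in>{..<k}. \<forall>F. F \<in> sets borel \<longrightarrow>
    (\<integral>\<^sup>+x\<in>F. ennreal \<bar>Km a M n k x (a j)\<bar> \<partial>\<mu>) \<le> ennreal (C2 j * measure \<mu> F powr (1 - \<theta>))"
    using H2 by (intro eventually_ball_finite) auto
  have e3: "\<forall>\<^sub>F n in sequentially. \<forall>p\<in>{..<k} \<times> {..<k}. \<bar>Km a M n k (a (fst p)) (a (snd p))\<bar> \<le> C3 p"
    using H3 by (intro eventually_ball_finite) auto
  \<comment> \<open>Integrals over E against the kernel at a mass come with the power 1 - \<theta>
    of the measure, while \<theta> is wanted; the surplus power 1 - 2 \<theta> \<ge> 0 is bounded by
    that of the whole line.\<close>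
  define W where "W = measure \<mu> UNIV powr (1 - 2 * \<theta>)"
  define m1 where "m1 i = M i powr (- \<theta>)" for i
  define m2 where "m2 i = M i powr (- (1 - \<theta>))" for i
  define D where "D = C1 + (\<Sum>i<k. M i * (m1 i * C2 i)) + (\<Sum>j<k. M j * (m2 j * (C2 j * W + (\<Sum>i<k. M i * (m1 i * C3 (j, i))))))"
  have D: "D \<ge> 0" unfolding D_def using H1 H2 H3 M
    by (intro add_nonneg_nonneg sum_nonneg mult_nonneg_nonneg) (auto simp: W_def m1_def m2_def intro: less_imp_le)
  have "\<forall>\<^sub>F n in sequentially. \<forall>E F. E \<in> sets borel \<longrightarrow> F \<in> sets borel \<longrightarrow>
     \<bar>TT n E F\<bar> \<le> D * (measure \<nu> E powr \<theta> * measure \<nu> F powr (1 - \<theta>))"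
    using H1[THEN conjunct2] e2 e3
  proof eventually_elim
    case (elim n)
    note b1 = elim(1)[rule_format] and b2 = elim(2)[rule_format] and b3 = elim(3)[rule_format]
    show ?case
    proof (intro allI impI)
      fix E F :: "real set" assume E [measurable]: "E \<in> sets borel" and F [measurable]: "F \<in> sets borel"
      define pe where "pe = measure \<nu> E powr \<theta>"
      define pf where "pf = measure \<nu> F powr (1 - \<theta>)"
      have p0: "pe \<ge> 0" "pf \<ge> 0" by (auto simp: pe_def pf_def)
      have muE: "measure \<mu> E powr \<theta> \<le> pe" and muF: "measure \<mu> F powr (1 - \<theta>) \<le> pf"
        using \<theta> by (auto simp: pe_def pf_def intro!: mu_powr_le_nu)
      have muE': "measure \<mu> E powr (1 - \<theta>) \<le> W * pe"
      proof -
        have "measure \<mu> E powr (1 - \<theta>) = measure \<mu> E powr (1 - 2 * \<theta>) * measure \<mu> E powr \<theta>" by (simp add: powr_add[symmetric])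
        also have "\<dots> \<le> W * pe" unfolding W_def
          using \<theta> fin.finite_measure_mono[of E UNIV] muE by (intro mult_mono powr_mono2) auto
        finally show ?thesis .
      qed
      have iE: "indicator E (a i) \<le> m1 i * pe" and iF: "indicator F (a i) \<le> m2 i * pf" if "i < k" for i
        using mass_indicator_le[OF E that, of \<theta>] mass_indicator_le[OF F that, of "1 - \<theta>"] \<theta> by (auto simp: m1_def m2_def pe_def pf_def)
      have [measurable]: "(\<lambda>x. Km a M n k x y) \<in> borel_measurable borel" for y
      proof -
        have "(\<lambda>x. Km a M n k x y) = Km a M n k y" using Km_sym[of k M a n _ y, OF M] by (intro ext) simp
        then show ?thesis by (simp add: Km_def[abs_def])
      qed
      obtain B where B: "bkern (Km a M n k) B" using Km_bkern[of k M a n, OF M a] by blast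
      have int: "\<bar>\<integral>x. indicator G x * Km a M n k x (a j) \<partial>\<mu>\<bar> \<le> C2 j * measure \<mu> G powr (1 - \<theta>)"
        if j: "j < k" and G [measurable]: "G \<in> sets borel" for j G
      proof -
        have i: "integrable \<mu> (\<lambda>x. indicator G x * Km a M n k x (a j))"
          by (rule integrable_jmu_bounded[OF ab, where B=B]) (use B a[OF j] in \<open>auto simp: indicator_def bkern_def\<close>)
        have "ennreal \<bar>\<integral>x. indicator G x * Km a M n k x (a j) \<partial>\<mu>\<bar> \<le> (\<integral>\<^sup>+x. ennreal \<bar>indicator G x * Km a M n k x (a j)\<bar> \<partial>\<mu>)"
          using integral_norm_bound_ennreal[OF i] by simp
        also have "\<dots> = (\<integral>\<^sup>+x\<in>G. ennreal \<bar>Km a M n k x (a j)\<bar> \<partial>\<mu>)"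
          by (intro nn_integral_cong) (auto simp: indicator_def)
        also have "\<dots> \<le> ennreal (C2 j * measure \<mu> G powr (1 - \<theta>))" using b2[of j G] j G by simp
        finally show ?thesis using H2 j by (simp add: ennreal_le_iff less_imp_le)
      qed
      define T2 where "T2 i = M i * (indicator E (a i) * (\<integral>x. indicator F x * Km a M n k x (a i) \<partial>\<mu>))" for i
      define T3 where "T3 j = (\<integral>y. indicator E y * Km a M n k y (a j) \<partial>\<mu>) + (\<Sum>i<k. M i * (indicator E (a i) * Km a M n k (a j) (a i)))" for j
      have exp: "TT n E F = bilin \<mu> (Km a M n k) E F + (\<Sum>i<k. T2 i) + (\<Sum>j<k. M j * (indicator F (a j) * T3 j))"
        unfolding TT_expand[OF E F] T2_def T3_def ..
      have t1: "\<bar>bilin \<mu> (Km a M n k) E F\<bar> \<le> C1 * (pe * pf)"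
      proof (rule order_trans[OF b1[OF E F]])
        show "C1 * (measure \<mu> E powr \<theta> * measure \<mu> F powr (1 - \<theta>)) \<le> C1 * (pe * pf)"
          using H1 muE muF p0 by (intro mult_left_mono mult_mono) auto
      qed
      have t2: "\<bar>\<Sum>i<k. T2 i\<bar> \<le> (\<Sum>i<k. M i * (m1 i * C2 i)) * (pe * pf)"
        unfolding sum_distrib_right
      proof (rule order_trans[OF sum_abs sum_mono])
        fix i assume "i \<in> {..<k}"
        then have i: "i < k" by simp
        have c2: "C2 i > 0" using H2 i by simp
        have "\<bar>\<integral>x. indicator F x * Km a M n k x (a i) \<partial>\<mu>\<bar> \<le> C2 i * pf"
          using int[OF i F] mult_left_mono[OF muF, of "C2 i"] c2 by linarith
        then have "\<bar>T2 i\<bar> \<le> M i * ((m1 i * pe) * (C2 i * pf))"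
          unfolding T2_def abs_mult using iE[OF i] M[OF i] p0 by - (rule mult_mono, auto intro!: mult_mono simp: m1_def)
        then show "\<bar>T2 i\<bar> \<le> M i * (m1 i * C2 i) * (pe * pf)" by (simp add: mult_ac)
      qed
      have t3: "\<bar>T3 j\<bar> \<le> (C2 j * W + (\<Sum>i<k. M i * (m1 i * C3 (j, i)))) * pe" if j: "j < k" for j
      proof -
        have c2: "C2 j > 0" using H2 j by simp
        have "\<bar>\<integral>y. indicator E y * Km a M n k y (a j) \<partial>\<mu>\<bar> \<le> C2 j * W * pe"
          unfolding mult.assoc by (rule order_trans[OF int[OF j E] mult_left_mono[OF muE' less_imp_le[OF c2]]])
        moreover have "\<bar>\<Sum>i<k. M i * (indicator E (a i) * Km a M n k (a j) (a i))\<bar> \<le> (\<Sum>i<k. M i * (m1 i * C3 (j, i))) * pe"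
          unfolding sum_distrib_right
        proof (rule order_trans[OF sum_abs sum_mono])
          fix i assume "i \<in> {..<k}"
          then have i: "i < k" by simp
          have "\<bar>Km a M n k (a j) (a i)\<bar> \<le> C3 (j, i)" using b3[of "(j, i)"] i j by simp
          then have "\<bar>M i * (indicator E (a i) * Km a M n k (a j) (a i))\<bar> \<le> M i * ((m1 i * pe) * C3 (j, i))"
            unfolding abs_mult using iE[OF i] M[OF i] p0 by - (rule mult_mono, auto intro!: mult_mono simp: m1_def)
          then show "\<bar>M i * (indicator E (a i) * Km a M n k (a j) (a i))\<bar> \<le> M i * (m1 i * C3 (j, i)) * pe" by (simp add: mult_ac)
        qed
        ultimately show ?thesis unfolding T3_def distrib_right by linarith
      qed
      have t4: "\<bar>\<Sum>j<k. M j * (indicator F (a j) * T3 j)\<bar> \<le> (\<Sum>j<k. M j * (m2 j * (C2 j * W + (\<Sum>i<k. M i * (m1 i * C3 (j, i)))))) * (pe * pf)"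
        unfolding sum_distrib_right[of _ _ "pe * pf"]
      proof (rule order_trans[OF sum_abs sum_mono])
        fix j assume "j \<in> {..<k}"
        then have j: "j < k" by simp
        define X where "X = C2 j * W + (\<Sum>i<k. M i * (m1 i * C3 (j, i)))"
        have t3j: "\<bar>T3 j\<bar> \<le> X * pe" using t3[OF j] by (simp add: X_def)
        have "\<bar>M j * (indicator F (a j) * T3 j)\<bar> \<le> M j * ((m2 j * pf) * (X * pe))"
          unfolding abs_mult using iF[OF j] M[OF j] p0 t3j by - (rule mult_mono, auto intro!: mult_mono simp: m2_def)
        then show "\<bar>M j * (indicator F (a j) * T3 j)\<bar> \<le> M j * (m2 j * (C2 j * W + (\<Sum>i<k. M i * (m1 i * C3 (j, i))))) * (pe * pf)"
          unfolding X_def[symmetric] by (simp add: mult_ac)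
      qed
      show "\<bar>TT n E F\<bar> \<le> D * (measure \<nu> E powr \<theta> * measure \<nu> F powr (1 - \<theta>))"
        unfolding pe_def[symmetric] pf_def[symmetric] D_def distrib_right[of _ _ "pe * pf"] exp using t1 t2 t4 by linarith
    qed
  qed
  with D show ?thesis by (intro exI[of _ D] conjI)
qed

text \<open>For the finitely many remaining n the form is at most a constant times the product of
  the two measures, and the finite total measure allows the smaller powers.\<close>

lemma TT_bound:
  "\<exists>D>0. \<forall>n E F. E \<in> sets borel \<longrightarrow> F \<in> sets borel \<longrightarrow> \<bar>TT n E F\<bar> \<le> D * (measure \<nu> E powr \<theta> * measure \<nu> F powr (1 - \<theta>))"
proof -
  obtain D where D: "D \<ge> 0" and ev: "\<forall>\<^sub>F n in sequentially. \<forall>E F. E \<in> sets borel \<longrightarrow> F \<in> sets borel \<longrightarrow>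
     \<bar>TT n E F\<bar> \<le> D * (measure \<nu> E powr \<theta> * measure \<nu> F powr (1 - \<theta>))" using TT_large by blast
  obtain N where N: "\<And>n E F. n \<ge> N \<Longrightarrow> E \<in> sets borel \<Longrightarrow> F \<in> sets borel \<Longrightarrow>
     \<bar>TT n E F\<bar> \<le> D * (measure \<nu> E powr \<theta> * measure \<nu> F powr (1 - \<theta>))" using ev unfolding eventually_sequentially by blast
  obtain b where b: "\<And>j. b j \<ge> 0" "\<And>j x. x \<in> {-1..1} \<Longrightarrow> \<bar>poly (P j) x\<bar> \<le> b j" using P_bounded by blast
  define V where "V = measure \<nu> UNIV"
  have le: "measure \<nu> E \<le> measure \<nu> E powr t * V powr (1 - t)" if "E \<in> sets borel" "0 \<le> t" "t \<le> 1" for E t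
  proof -
    have "measure \<nu> E = measure \<nu> E powr t * measure \<nu> E powr (1 - t)" by (simp add: powr_add[symmetric])
    also have "\<dots> \<le> measure \<nu> E powr t * V powr (1 - t)" unfolding V_def
      using that fin\<nu>.finite_measure_mono[of E UNIV] by (intro mult_left_mono powr_mono2) auto
    finally show ?thesis .
  qed
  define V2 where "V2 = V powr (1 - \<theta>) * V powr \<theta>"
  define Z where "Z n = (\<Sum>j\<le>n. (b j)^2) * V2" for n
  have V2: "V2 \<ge> 0" by (simp add: V2_def)
  have Z0: "Z n \<ge> 0" for n using V2 by (auto simp: Z_def intro!: mult_nonneg_nonneg sum_nonneg)
  have small: "\<bar>TT n E F\<bar> \<le> Z n * (measure \<nu> E powr \<theta> * measure \<nu> F powr (1 - \<theta>))"
    if E: "E \<in> sets borel" and F: "F \<in> sets borel" for n E F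
  proof -
    have "\<bar>TT n E F\<bar> \<le> (\<Sum>j\<le>n. (b j * measure \<nu> E) * (b j * measure \<nu> F))"
      unfolding TT_def pm_def using ind_poly(2)[OF E b(2)] ind_poly(2)[OF F b(2)] b(1)
      by (intro order_trans[OF sum_abs] sum_mono) (auto simp: abs_mult intro!: mult_mono)
    also have "\<dots> = (\<Sum>j\<le>n. (b j)^2) * (measure \<nu> E * measure \<nu> F)"
      unfolding sum_distrib_right by (intro sum.cong refl) (simp add: power2_eq_square)
    also have "\<dots> \<le> (\<Sum>j\<le>n. (b j)^2) * ((measure \<nu> E powr \<theta> * V powr (1 - \<theta>)) * (measure \<nu> F powr (1 - \<theta>) * V powr \<theta>))"
      using le[OF E, of \<theta>] le[OF F, of "1 - \<theta>"] \<theta> by (intro mult_left_mono mult_mono) (auto intro: sum_nonneg)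
    also have "\<dots> = Z n * (measure \<nu> E powr \<theta> * measure \<nu> F powr (1 - \<theta>))" by (simp add: Z_def V2_def mult_ac)
    finally show ?thesis .
  qed
  define R where "R = 1 + D + (\<Sum>n<N. Z n)"
  have sZ: "(\<Sum>n<N. Z n) \<ge> 0" using Z0 by (intro sum_nonneg) auto
  have "\<bar>TT n E F\<bar> \<le> R * (measure \<nu> E powr \<theta> * measure \<nu> F powr (1 - \<theta>))"
    if E: "E \<in> sets borel" and F: "F \<in> sets borel" for n E F
  proof (cases "n < N")
    case True
    have "Z n \<le> (\<Sum>n<N. Z n)" using True Z0 by (intro member_le_sum) auto
    then have "Z n \<le> R" using D by (simp add: R_def)
    then have "Z n * (measure \<nu> E powr \<theta> * measure \<nu> F powr (1 - \<theta>)) \<le> R * (measure \<nu> E powr \<theta> * measure \<nu> F powr (1 - \<theta>))"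
      by (intro mult_right_mono) auto
    then show ?thesis using small[OF E F, of n] by linarith
  next
    case False
    have "D \<le> R" using sZ by (simp add: R_def)
    then have "D * (measure \<nu> E powr \<theta> * measure \<nu> F powr (1 - \<theta>)) \<le> R * (measure \<nu> E powr \<theta> * measure \<nu> F powr (1 - \<theta>))"
      by (intro mult_right_mono) auto
    then show ?thesis using N[OF _ E F, of n] False by linarith
  qed
  moreover have "R > 0" using D sZ by (simp add: R_def)
  ultimately show ?thesis by (intro exI[of _ R] conjI allI impI)
qed

lemma weak_type:
  assumes q: "q = \<theta> \<or> q = 1 - \<theta>"
  shows "\<exists>C>0. \<forall>E n. E \<in> sets borel \<longrightarrow>
    weak_Lp_norm \<nu> (1 / q) (partial_sum_op \<nu> P n (indicator E)) \<le> ennreal C * Lp_norm \<nu> (1 / q) (indicator E)"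
proof -
  have q01: "0 < q" "q < 1" using q \<theta> by auto
  obtain D where H: "D > 0 \<and> (\<forall>n E F. E \<in> sets borel \<longrightarrow> F \<in> sets borel \<longrightarrow> \<bar>TT n E F\<bar> \<le> D * (measure \<nu> E powr \<theta> * measure \<nu> F powr (1 - \<theta>)))"
    using TT_bound by (rule exE)
  note D = H[THEN conjunct1] and T = H[THEN conjunct2, rule_format]
  have Tq: "\<bar>TT n E F\<bar> \<le> D * (measure \<nu> E powr q * measure \<nu> F powr (1 - q))"
    if E: "E \<in> sets borel" and F: "F \<in> sets borel" for n E F
    using q
  proof
    assume "q = \<theta>"
    then show ?thesis using T[OF E F] by simp
  next
    assume "q = 1 - \<theta>"
    then show ?thesis using T[OF F E, of n] by (simp add: TT_sym[of n E F] mult.commute)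
  qed
  have "weak_Lp_norm \<nu> (1 / q) (partial_sum_op \<nu> P n (indicator E)) \<le> ennreal (2 * D) * Lp_norm \<nu> (1 / q) (indicator E)"
    if E: "E \<in> sets borel" for E n
  proof (cases "measure \<nu> E = 0")
    case True
    obtain b where b: "\<And>j x. x \<in> {-1..1} \<Longrightarrow> \<bar>poly (P j) x\<bar> \<le> b j" using P_bounded by blast
    \<comment> \<open>\<open>weak_Lp_norm_le\<close> asks for positive measure. For a null set all
      Fourier coefficients vanish, and with them the partial sum at every point.\<close>
    have "pm E j = 0" for j using ind_poly(2)[OF E b, of j] True by (simp add: pm_def)
    then have z: "partial_sum_op \<nu> P n (indicator E) = (\<lambda>_. 0)" using partial_sum_eq[OF E] by auto
    have "rearrangement \<nu> (\<lambda>_. 0) t \<le> 0" for t unfolding rearrangement_def by (intro Inf_lower) simp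
    then have "weak_Lp_norm \<nu> (1 / q) (\<lambda>_. 0) \<le> 0" unfolding weak_Lp_norm_def by (intro SUP_least) simp
    then show ?thesis unfolding z by simp
  next
    case False
    then have A: "measure \<nu> E > 0" using measure_nonneg[of \<nu> E] by linarith
    have "weak_Lp_norm \<nu> (1 / q) (partial_sum_op \<nu> P n (indicator E)) \<le> ennreal (2 * D) * ennreal (measure \<nu> E powr q)"
      by (rule weak_Lp_norm_le[OF fin\<nu>.finite_measure_axioms partial_sum_integrable[OF E] q01 A D])
         (simp add: TT_integral[OF E] Tq[OF E])
    also have "ennreal (measure \<nu> E powr q) = Lp_norm \<nu> (1 / q) (indicator E)"
      using Lp_norm_indicator[OF fin\<nu>.finite_measure_axioms, of "1 / q" E] E q01 by simp
    finally show ?thesis .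
  qed
  moreover have "2 * D > 0" using D by simp
  ultimately show ?thesis by (intro exI[of _ "2 * D"] conjI allI impI)
qed

end

theorem theorem14:
  fixes \<alpha> \<beta> p :: real and k :: nat and a M :: "nat \<Rightarrow> real" and P :: "nat \<Rightarrow> real poly"
  assumes "\<alpha> > -1/2" and "\<alpha> \<ge> \<beta>" and "\<beta> > -1"
    and "p = 4 * (\<alpha> + 1) / (2 * \<alpha> + 1) \<or> p = 4 * (\<alpha> + 1) / (2 * \<alpha> + 3)"
    and "\<forall>i<k. a i \<in> {-1..1}" and "inj_on a {..<k}" and "\<forall>i<k. M i > 0"
    and "orthonormal_polys (jacobi_nu \<alpha> \<beta> k a M) P"
  shows "\<exists>C>0. \<forall>E n. E \<in> sets borel \<longrightarrow> E \<subseteq> {-1..1} \<longrightarrow>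
           weak_Lp_norm (jacobi_nu \<alpha> \<beta> k a M) p
              (partial_sum_op (jacobi_nu \<alpha> \<beta> k a M) P n (indicator E))
           \<le> ennreal C * Lp_norm (jacobi_nu \<alpha> \<beta> k a M) p (indicator E)"
proof -
  define \<theta> where "\<theta> = (2 * \<alpha> + 1) / (4 * (\<alpha> + 1))"
  have a1: "\<alpha> + 1 > 0" "2 * \<alpha> + 1 > 0" using assms(1) by auto
  have ta: "\<theta> * (\<alpha> + 1) = \<alpha> / 2 + 1/4" using a1 by (simp add: \<theta>_def field_simps)
  have t: "0 < \<theta>" "\<theta> \<le> 1/2" using a1 by (auto simp: \<theta>_def field_simps)
  \<comment> \<open>By \<open>ta\<close> the right side equals 1/4; rearranged, this is the
    inequality required at the end point -1.\<close>
  have "(1/2 - \<theta>) * (\<beta> + 1) \<le> (1/2 - \<theta>) * (\<alpha> + 1)" using assms(2) t by (intro mult_left_mono) auto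
  moreover have "b / 2 + 1/4 \<le> u" if "1/2 * (b + 1) - u \<le> 1/2 * (c + 1) - v" "v = c / 2 + 1/4" for b c u v :: real
    using that by (simp add: field_simps)
  ultimately have tb: "\<beta> / 2 + 1/4 \<le> \<theta> * (\<beta> + 1)" using ta unfolding left_diff_distrib by blast
  interpret jacobi_masses \<alpha> \<beta> \<theta> k a M P
    by unfold_locales (use assms t ta tb in auto)
  obtain q where q: "q = \<theta> \<or> q = 1 - \<theta>" "p = 1 / q"
  proof -
    have "1 - \<theta> = (2 * \<alpha> + 3) / (4 * (\<alpha> + 1))" using a1 by (simp add: \<theta>_def field_simps)
    then have "1 / \<theta> = 4 * (\<alpha> + 1) / (2 * \<alpha> + 1)" "1 / (1 - \<theta>) = 4 * (\<alpha> + 1) / (2 * \<alpha> + 3)" by (simp_all add: \<theta>_def)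
    then show ?thesis using assms(4) that by metis
  qed
  show ?thesis using weak_type[OF q(1)] unfolding q(2) by blast
qed

end
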